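(* Let $p<20000$ be a prime. Define the following sets of primes: $R=\{2, 3, 5, 7, 11, 13, 17, 19, 23, 29, 31, 37, 41, 43, 61, 67, 71\}$, $U=\{251, 347, 587, 2459, 2819, 3299, 4547, 4787, 6659, 10667, 12227, 14281, 15299, 17027, 17681, 18059, 18481, 18947\}$, $X=\{59, 83, 107, 163, 487, 677, 727, 1187, 1459, 2663, 3779, 4259, 7523, 8837, 10883, 11699, 12659, 12899, 13043, 13183, 13523, 14243, 14387, 14723, 14867, 16547, 17939, 19379\}$. If either (i) $p\notin R\cup U\cup X$, or (ii) the generalized Riemann hypothesis (GRH) holds and $p\notin R\cup U$, then $\mathbb{Q}(C_p)$ is not stably rational over $\mathbb{Q}$.
   Context: For a field $k$ and a finite group $G$, let $G$ act on the rational function field $k(x_g\mid g\in G)$ (in indeterminates indexed by the elements of $G$) by $k$-automorphisms $h(x_g)=x_{hg}$ for all $g,h\in G$, and let $k(G)=k(x_g\mid g\in G)^G$ be the fixed field. $C_p$ denotes the cyclic group of order $p$. A field extension $K/k$ is rational if $K$ is purely transcendental over $k$, and stably rational if $K(t_1,\ldots,t_n)$ is rational over $k$ for some elements $t_1,\ldots,t_n$ algebraically independent over $K$. *)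

theory Defs
  imports "HOL-Complex_Analysis.Complex_Analysis" "HOL-Computational_Algebra.Polynomial"
begin

text \<open>Everything happens inside an ambient field 'a of characteristic 0; the prime field
  Q is the image of of_rat.\<close>

definition is_subfield :: "'a::field set \<Rightarrow> bool" where
  "is_subfield F \<longleftrightarrow> 0 \<in> F \<and> 1 \<in> F \<and>
     (\<forall>a\<in>F. \<forall>b\<in>F. a + b \<in> F \<and> a - b \<in> F \<and> a * b \<in> F) \<and>
     (\<forall>a\<in>F. inverse a \<in> F)"

text \<open>Subfield generated by S (over the prime field, which every subfield contains).\<close>
definition gen_field :: "'a::field set \<Rightarrow> 'a set" where
  "gen_field S = \<Inter>{F. is_subfield F \<and> S \<subseteq> F}"

text \<open>Algebraic independence over Q of a set S: no nontrivial polynomial relation with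
  rational coefficients among finitely many distinct elements of S.  A polynomial is a
  finite set M of exponent vectors (supported on F) with coefficients c.\<close>
definition alg_indep_Q :: "'a::field_char_0 set \<Rightarrow> bool" where
  "alg_indep_Q S \<longleftrightarrow>
     (\<forall>F M (c :: ('a \<Rightarrow> nat) \<Rightarrow> rat). finite F \<longrightarrow> F \<subseteq> S \<longrightarrow> finite M \<longrightarrow>
        (\<forall>\<alpha>\<in>M. \<forall>s. s \<notin> F \<longrightarrow> \<alpha> s = 0) \<longrightarrow>
        (\<Sum>\<alpha>\<in>M. of_rat (c \<alpha>) * (\<Prod>s\<in>F. s ^ \<alpha> s)) = 0 \<longrightarrow>
        (\<forall>\<alpha>\<in>M. c \<alpha> = 0))"

definition rational_over_Q :: "'a::field_char_0 set \<Rightarrow> bool" where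
  "rational_over_Q L \<longleftrightarrow> (\<exists>S. alg_indep_Q S \<and> gen_field S = L)"

text \<open>C_p is realised as Z/pZ = {0..<p} with addition mod p; the indeterminate x_g is x g.
  A polynomial in x_0,...,x_{p-1} with rational coefficients is given by a finite set M of
  exponent vectors and coefficients c; peval evaluates it at a family t.\<close>
definition peval :: "(nat \<Rightarrow> nat) set \<Rightarrow> ((nat \<Rightarrow> nat) \<Rightarrow> rat) \<Rightarrow> nat \<Rightarrow> (nat \<Rightarrow> 'a::field_char_0) \<Rightarrow> 'a" where
  "peval M c m t = (\<Sum>\<alpha>\<in>M. of_rat (c \<alpha>) * (\<Prod>i<m. t i ^ \<alpha> i))"

text \<open>Given algebraically independent x_0,...,x_{p-1}, Q(x) consists of the quotients
  P(x)/D(x); h in C_p acts by the Q-automorphism x_g \<mapsto> x_{h+g}, i.e.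
  P(x)/D(x) \<mapsto> P(x_{h+.})/D(x_{h+.}).  The fixed field is the set of elements of Q(x)
  invariant under all h.\<close>
definition fixed_field_Cp :: "nat \<Rightarrow> (nat \<Rightarrow> 'a::field_char_0) \<Rightarrow> 'a set" where
  "fixed_field_Cp p x = {z. \<exists>M c N d. finite M \<and> finite N \<and> peval N d p x \<noteq> 0 \<and>
      z = peval M c p x / peval N d p x \<and>
      (\<forall>h<p. peval M c p (\<lambda>g. x ((h + g) mod p)) / peval N d p (\<lambda>g. x ((h + g) mod p)) = z)}"

text \<open>Q(C_p) is stably rational over Q, realised inside the field 'a: there are n and
  elements x_0..x_{p-1}, y_1..y_n of 'a, pairwise distinct and algebraically independent
  over Q, such that K(y_1,...,y_n) is rational over Q, where K = Q(x)^{C_p}.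
  (Any field K(t_1..t_n) with t_i algebraically independent over K is K-isomorphic to
  this one.)\<close>
definition QCp_stably_rational_in :: "'a::field_char_0 itself \<Rightarrow> nat \<Rightarrow> bool" where
  "QCp_stably_rational_in _ p \<longleftrightarrow>
     (\<exists>n (x :: nat \<Rightarrow> 'a) (y :: nat \<Rightarrow> 'a).
        inj_on x {..<p} \<and> inj_on y {..<n} \<and> x ` {..<p} \<inter> y ` {..<n} = {} \<and>
        alg_indep_Q (x ` {..<p} \<union> y ` {..<n}) \<and>
        rational_over_Q (gen_field (fixed_field_Cp p x \<union> y ` {..<n})))"

definition number_field :: "complex set \<Rightarrow> bool" where
  "number_field K \<longleftrightarrow> is_subfield K \<and>
     (\<exists>B. finite B \<and> B \<subseteq> K \<and> (\<forall>z\<in>K. \<exists>c. z = (\<Sum>b\<in>B. of_rat (c b) * b)))"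

definition ring_of_integers :: "complex set \<Rightarrow> complex set" where
  "ring_of_integers K = {z \<in> K. algebraic_int z}"

definition is_ideal_in :: "complex set \<Rightarrow> complex set \<Rightarrow> bool" where
  "is_ideal_in R I \<longleftrightarrow> I \<subseteq> R \<and> 0 \<in> I \<and> (\<forall>a\<in>I. \<forall>b\<in>I. a + b \<in> I \<and> - a \<in> I) \<and>
     (\<forall>r\<in>R. \<forall>a\<in>I. r * a \<in> I)"

definition nonzero_ideals :: "complex set \<Rightarrow> complex set set" where
  "nonzero_ideals K = {I. is_ideal_in (ring_of_integers K) I \<and> I \<noteq> {0}}"

definition ideal_norm :: "complex set \<Rightarrow> complex set \<Rightarrow> nat" where
  "ideal_norm K I = card ((\<lambda>a. (+) a ` I) ` ring_of_integers K)"

text \<open>GRH: for every number field K, the (meromorphic continuation to C - {1} of the)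
  Dedekind zeta function zeta_K(s) = sum over nonzero ideals of N(I)^(-s), Re s > 1,
  has all its zeros in the critical strip 0 < Re s < 1 on the line Re s = 1/2.\<close>
definition GRH :: bool where
  "GRH \<longleftrightarrow> (\<forall>K Z. number_field K \<longrightarrow> Z holomorphic_on (- {1}) \<longrightarrow>
      (\<forall>s. 1 < Re s \<longrightarrow>
          ((\<lambda>I. 1 / (of_nat (ideal_norm K I) powr s)) has_sum Z s) (nonzero_ideals K)) \<longrightarrow>
      (\<forall>s. Z s = 0 \<longrightarrow> 0 < Re s \<longrightarrow> Re s < 1 \<longrightarrow> Re s = 1 / 2))"

definition R_set :: "nat set" where
  "R_set = {2, 3, 5, 7, 11, 13, 17, 19, 23, 29, 31, 37, 41, 43, 61, 67, 71}"

definition U_set :: "nat set" where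
  "U_set = {251, 347, 587, 2459, 2819, 3299, 4547, 4787, 6659, 10667, 12227, 14281, 15299,
            17027, 17681, 18059, 18481, 18947}"

definition X_set :: "nat set" where
  "X_set = {59, 83, 107, 163, 487, 677, 727, 1187, 1459, 2663, 3779, 4259, 7523, 8837, 10883,
            11699, 12659, 12899, 13043, 13183, 13523, 14243, 14387, 14723, 14867, 16547,
            17939, 19379}"

end

theory Submission
  imports Defs "HOL-Number_Theory.Number_Theory" "HOL-Algebra.Algebraic_Closure_Type" "Jordan_Normal_Form.Char_Poly"
begin

text \<open>
  Let \<open>n = p - 1\<close>, let \<open>g\<close> be a primitive root modulo \<open>p\<close> and \<open>w\<close> a primitive \<open>n\<close>-th root of unity.
  Over \<open>K = \<rat>(z0)\<close>, with \<open>z0\<close> a primitive \<open>p\<close>-th root of unity, the invariant field becomes the function field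
  of a torus whose character lattice is the ideal \<open>P = {f. p dvd f(g)}\<close> of \<open>\<int>[X]/(X^n - 1)\<close>, where \<open>X\<close> acts as
  the generator \<open>tau: z0 \<mapsto> z0^g\<close> of the Galois group. If the field is stably rational, then a polynomial ring
  over \<open>K\<close> with \<open>tau\<close>-fixed generators and the coordinate ring of that torus (times an affine space) have a common
  localization. By unique factorization its unit group is, modulo the units of either ring, a
  permutation module. This exhibits \<open>P\<close> as the kernel of a split surjection of permutation modules, and
  specializing \<open>X\<close> to \<open>w\<close> and taking a determinant shows that the prime ideal \<open>(p, w - g)\<close> of \<open>\<int>[w]\<close> is principal.

  Let \<open>a(w)\<close> be a generator and \<open>d = totient n\<close>. For a prime \<open>q\<close> not dividing \<open>n\<close>, the element
  \<open>a(w)^q a(w^-q) - a(w^-1)^q a(w^q)\<close> is divisible by \<open>q\<close> (Frobenius) and nonzero, while its conjugates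
  are bounded through \<open>|N a(w)| = p\<close>; hence \<open>q^d \<le> 2^d p^(q+1)\<close>. Among the primes below 20000 this leaves only
  \<open>R\<close> and 47, 53, 73, 79. If \<open>4 dvd n\<close>, a similar element gives \<open>5^d \<le> p^8\<close>, which excludes 53 and 73;
  the norm of \<open>a(w)\<close> to the quadratic subfield generated by \<open>sqrt (-23)\<close> resp. \<open>sqrt (-39)\<close> excludes 47 and 79.
\<close>

text \<open>A generator is determined only up to units, so single conjugates of a(w) may be huge or
  tiny; only the norm is known. The element used for the bound therefore has the form u - cnj u at
  every complex embedding, where |u| is a product of absolute values of conjugates of a(w), and each
  factor contributes a power of the norm p. It is nonzero because exactly one of its two terms lies
  in the prime (p, w - g). The torus comes from Lagrange resolvents z_i: over K they diagonalize the
  cyclic shift, and tau sends z_i to z_(i g). Laurent monomials in z_1, ..., z_(p-1) correspond to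
  elements f of \<int>[X]/(X^n - 1), and the invariant ones to p dvd f(g); this is the origin of P.
  Units of the common localization modulo units of one of the two rings have classes of primes as a
  basis, permuted by tau. At X = w such a lattice becomes free over \<int>[w], since orbits shorter
  than n contribute nothing, and freeness gives the splitting. The given field need not contain
  roots of unity, so all this takes place in its algebraic closure.\<close>

hide_const (open) Module.smult UnivPoly.monom UnivPoly.coeff Coset.order Polynomials.degree Polynomials.lead_coeff Divisibility.prime

section \<open>Integer polynomials at roots of unity\<close>

text \<open>Elements of \<int>[w] are carried as integer polynomials: a Galois conjugate is the
  value at another power of w, and reduction modulo the prime (p, w - t) is the value at t.\<close>

definition ipoly :: "int poly \<Rightarrow> 'a::comm_ring_1 \<Rightarrow> 'a" where
  "ipoly f x = poly (map_poly of_int f) x"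

lemma ipoly_0 [simp]: "ipoly 0 x = 0"
  and ipoly_1 [simp]: "ipoly 1 x = 1"
  and ipoly_pCons [simp]: "ipoly (pCons c f) x = of_int c + x * ipoly f x"
  by (simp_all add: ipoly_def of_int_hom.map_poly_pCons_hom)

lemma ipoly_add [simp]: "ipoly (f + g) x = ipoly f x + ipoly g x"
  by (simp add: ipoly_def of_int_poly_hom.hom_add)

lemma ipoly_smult [simp]: "ipoly (smult c f) x = of_int c * ipoly f x"
  by (induction f) (auto simp: algebra_simps)

lemma ipoly_minus [simp]: "ipoly (- f) x = - ipoly f x"
  by (simp add: ipoly_def of_int_poly_hom.hom_uminus)

lemma ipoly_diff [simp]: "ipoly (f - g) x = ipoly f x - ipoly g x"
  by (simp add: ipoly_def of_int_poly_hom.hom_minus)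

lemma ipoly_mult [simp]: "ipoly (f * g) x = ipoly f x * ipoly g x"
  by (simp add: ipoly_def of_int_poly_hom.hom_mult)

lemma ipoly_power [simp]: "ipoly (f ^ k) x = ipoly f x ^ k"
  by (induction k) auto

lemma ipoly_sum: "ipoly (\<Sum>i\<in>A. f i) x = (\<Sum>i\<in>A. ipoly (f i) x)"
  by (induction A rule: infinite_finite_induct) auto

lemma ipoly_prod: "ipoly (\<Prod>i\<in>A. f i) x = (\<Prod>i\<in>A. ipoly (f i) x)"
  by (induction A rule: infinite_finite_induct) auto

lemma ipoly_monom [simp]: "ipoly (monom c k) x = of_int c * x ^ k"
  by (simp add: ipoly_def map_poly_monom poly_monom)

lemma ipoly_pcompose: "ipoly (pcompose f g) x = ipoly f (ipoly g x)"
  by (induction f) (auto simp: pcompose_pCons)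

lemma ipoly_int [simp]: "ipoly f (x::int) = poly f x"
  by (induction f) auto

lemma ipoly_altdef:
  fixes x :: "'a::{comm_ring_1,ring_char_0}"
  shows "ipoly f x = (\<Sum>i\<le>degree f. of_int (coeff f i) * x ^ i)"
  by (simp add: ipoly_def poly_altdef degree_map_poly coeff_map_poly)

lemma poly_conj_cong: "[x = y] (mod m) \<Longrightarrow> [poly f x = poly f y] (mod (m::int))"
  by (induction f) (auto intro: cong_add cong_mult)

lemma freshman_dream:
  fixes a b :: "'a::comm_ring_1"
  assumes "prime q"
  shows "\<exists>r. (a + b) ^ q = a ^ q + b ^ q + of_nat q * r"
proof -
  have q: "q \<ge> 2" using assms by (simp add: prime_ge_2_nat)
  have "\<forall>k\<in>{1..<q}. \<exists>c. q choose k = q * c"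
    using dvd_choose_prime[of _ q] assms by (auto simp: dvd_def)
  then obtain c where c: "\<And>k. k \<in> {1..<q} \<Longrightarrow> q choose k = q * c k" by metis
  have "(a + b) ^ q = (\<Sum>k\<le>q. of_nat (q choose k) * a ^ k * b ^ (q - k))"
    by (rule binomial_ring)
  also have "{..q} = insert 0 (insert q {1..<q})" using q by auto
  also have "(\<Sum>k\<in>insert 0 (insert q {1..<q}). of_nat (q choose k) * a ^ k * b ^ (q - k)) =
     b ^ q + (a ^ q + (\<Sum>k\<in>{1..<q}. of_nat (q choose k) * a ^ k * b ^ (q - k)))"
    using q by simp
  also have "(\<Sum>k\<in>{1..<q}. of_nat (q choose k) * a ^ k * b ^ (q - k)) =
      of_nat q * (\<Sum>k\<in>{1..<q}. of_nat (c k) * a ^ k * b ^ (q - k))"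
    unfolding sum_distrib_left by (intro sum.cong) (auto simp: c algebra_simps)
  finally show ?thesis by (metis add.assoc add.commute)
qed

text \<open>Fermat's little theorem handles the constant coefficient, the freshman's dream the
  addition. The explicit h matters: differences built from such powers are later divided by q inside
  \<int>[X].\<close>

lemma frobenius_int_poly:
  fixes f :: "int poly"
  assumes "prime q"
  shows "\<exists>h. f ^ q = pcompose f (monom 1 q) + smult (int q) h"
proof (induction f)
  case 0
  then show ?case using assms by (auto intro!: exI[of _ 0] simp: prime_gt_0_nat)
next
  case (pCons c f)
  then obtain h where h: "f ^ q = pcompose f (monom 1 q) + smult (int q) h" by blast
  have q0: "q > 0" using assms prime_gt_0_nat by blast
  have "[c ^ q = c] (mod int q)"
  proof (cases "int q dvd c")
    case True
    then have "int q dvd c ^ q" using q0 by (meson dvd_power dvd_trans)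
    with True show ?thesis by (metis cong_0_iff cong_sym cong_trans)
  next
    case False
    define m where "m = nat (c mod int q)"
    have m: "[c = int m] (mod int q)" unfolding m_def using q0
      by (simp add: cong_def)
    with False have "\<not> q dvd m" by (metis cong_dvd_iff int_dvd_int_iff)
    then have "[m ^ (q - 1) = 1] (mod q)" using assms by (rule fermat_theorem[rotated])
    then have "[m ^ (q - 1) * m = 1 * m] (mod q)" by (rule cong_mult) simp
    then have "[m ^ q = m] (mod q)" using q0 by (simp add: power_eq_if mult.commute)
    then have "[int m ^ q = int m] (mod int q)" by (metis cong_int_iff of_nat_power)
    then show ?thesis using m by (meson cong_pow cong_sym cong_trans)
  qed
  then obtain e where e: "c ^ q = c + int q * e"
    by (metis add.commute cong_iff_lin cong_sym mult.commute)
  obtain r where r: "([:c:] + pCons 0 f) ^ q = [:c:] ^ q + (pCons 0 f) ^ q + of_nat q * r"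
    using freshman_dream[OF assms] by blast
  have 1: "pCons c f = [:c:] + pCons 0 f" by simp
  have 2: "pCons 0 f ^ q = monom 1 q * f ^ q"
  proof -
    have "pCons 0 f = monom 1 1 * f" by (simp add: monom_altdef)
    then show ?thesis by (simp add: power_mult_distrib monom_power)
  qed
  have 3: "[:c:] ^ q = [:c + int q * e:]" by (simp add: poly_const_pow e)
  have "pCons c f ^ q = pcompose (pCons c f) (monom 1 q) + smult (int q) ([:e:] + monom 1 q * h + r)"
    unfolding 1 r 2 3 h
    by (simp add: pcompose_pCons algebra_simps of_nat_poly smult_add_right)
  then show ?case by blast
qed

lemma poly_div_xn:
  fixes f :: "int poly"
  assumes "n > 0"
  shows "\<exists>q r. f = (monom 1 n - 1) * q + r \<and> (\<forall>i\<ge>n. coeff r i = 0)"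
proof (induction f)
  case 0
  then show ?case by (intro exI[of _ 0]) simp
next
  case (pCons c f)
  then obtain q r where f: "f = (monom 1 n - 1) * q + r" and r: "\<forall>i\<ge>n. coeff r i = 0" by blast
  \<comment> \<open>Multiplication by X moves this coefficient to position n; subtracting e (X^n -
    1) brings it back to position 0.\<close>
  define e where "e = coeff r (n - 1)"
  have 1: "pCons c f = (monom 1 n - 1) * (pCons 0 q + [:e:]) + (pCons c r - smult e (monom 1 n - 1))"
  proof -
    have "pCons 0 q = [:0,1:] * q" "pCons c r = [:c:] + [:0,1:] * r" "pCons c f = [:c:] + [:0,1:] * f"
      "smult e (monom 1 n - 1) = [:e:] * (monom 1 n - 1)" by simp_all
    then show ?thesis unfolding f by (simp only: algebra_simps)
  qed
  have "coeff (pCons c r - smult e (monom 1 n - 1)) i = 0" if "i \<ge> n" for i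
    using that r assms by (cases i) (auto simp: e_def coeff_pCons split: nat.splits)
  with 1 show ?case by blast
qed

text \<open>The vector of powers of a root of unity is an eigenvector of an integral circulant matrix.\<close>
lemma algebraic_int_ipoly_root_of_unity:
  fixes w :: "'a::field_char_0"
  assumes "n > 0" "w ^ n = 1"
  shows "algebraic_int (ipoly f w)"
proof -
  obtain q r where f: "f = (monom 1 n - 1) * q + r" and r: "\<forall>i\<ge>n. coeff r i = 0"
    using poly_div_xn[OF assms(1)] by blast
  define x where "x = ipoly f w"
  \<comment> \<open>Entry (i, j) is the coefficient of w^j in w^i f(w), which has index j - i modulo
    n; adding n - i avoids truncated subtraction.\<close>
  define c where "c i j = coeff r ((j + (n - i)) mod n)" for i j :: nat
  define A :: "int mat" where "A = mat n n (\<lambda>(i,j). c i j)"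
  define B :: "'a mat" where "B = map_mat of_int A"
  define v :: "'a vec" where "v = vec n (\<lambda>i. w ^ i)"
  have x: "x = (\<Sum>k<n. of_int (coeff r k) * w ^ k)"
  proof -
    have "x = ipoly r w" using assms by (simp add: x_def f)
    also have "\<dots> = (\<Sum>i\<le>degree r. of_int (coeff r i) * w ^ i)" by (rule ipoly_altdef)
    also have "\<dots> = (\<Sum>i<n. of_int (coeff r i) * w ^ i)"
    proof (rule sum.mono_neutral_cong)
      show "of_int (coeff r i) * w ^ i = 0" if "i \<in> {..<n} - {..degree r}" for i
        using that by (simp add: coeff_eq_0)
      show "of_int (coeff r i) * w ^ i = 0" if "i \<in> {..degree r} - {..<n}" for i
        using that r by auto
    qed auto
    finally show ?thesis .
  qed
  have wmod: "w ^ (k mod n) = w ^ k" for k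
    by (metis assms(2) div_mult_mod_eq mult.commute mult_1 power_add power_mult power_one)
  have "B *\<^sub>v v = x \<cdot>\<^sub>v v"
  proof (rule eq_vecI)
    fix i assume "i < dim_vec (x \<cdot>\<^sub>v v)"
    then have i: "i < n" by (simp add: v_def)
    have "(B *\<^sub>v v) $ i = (\<Sum>j<n. of_int (c i j) * w ^ j)"
      using i by (simp add: B_def A_def v_def scalar_prod_def atLeast0LessThan)
    also have "\<dots> = (\<Sum>k<n. of_int (coeff r k) * w ^ (k + i))"
    proof (rule sum.reindex_bij_witness[of _ "\<lambda>k. (k + i) mod n" "\<lambda>j. (j + (n - i)) mod n"])
      fix j assume j: "j \<in> {..<n}"
      have "((j + (n - i)) mod n + i) mod n = (j + (n - i) + i) mod n" by (simp add: mod_add_left_eq)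
      also have "\<dots> = j" using i j by simp
      finally show a: "((j + (n - i)) mod n + i) mod n = j" .
      show "(j + (n - i)) mod n \<in> {..<n}" using assms by simp
      have "w ^ j = w ^ ((j + (n - i)) mod n + i)" by (metis a wmod)
      then show "of_int (coeff r ((j + (n - i)) mod n)) * w ^ ((j + (n - i)) mod n + i) =
         of_int (c i j) * w ^ j" by (simp add: c_def)
    next
      fix k assume k: "k \<in> {..<n}"
      have "((k + i) mod n + (n - i)) mod n = (k + i + (n - i)) mod n" by (simp add: mod_add_left_eq)
      also have "\<dots> = k" using i k by simp
      finally show "((k + i) mod n + (n - i)) mod n = k" .
      show "(k + i) mod n \<in> {..<n}" using assms by simp
    qed
    also have "\<dots> = x * w ^ i" by (simp add: x sum_distrib_right power_add mult.assoc)
    finally show "(B *\<^sub>v v) $ i = (x \<cdot>\<^sub>v v) $ i" using i by (simp add: v_def)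
  qed (simp add: B_def A_def v_def)
  moreover have "v \<noteq> 0\<^sub>v n"
  proof
    assume "v = 0\<^sub>v n"
    then have "v $ 0 = 0" using assms by simp
    then show False using assms by (simp add: v_def)
  qed
  ultimately have "eigenvalue B x"
    unfolding eigenvalue_def eigenvector_def by (intro exI[of _ v]) (auto simp: B_def A_def v_def)
  have carA: "A \<in> carrier_mat n n" by (simp add: A_def)
  then have carB: "B \<in> carrier_mat n n" by (simp add: B_def)
  from \<open>eigenvalue B x\<close> have "poly (char_poly B) x = 0"
    using eigenvalue_root_char_poly[OF carB] by simp
  moreover have "char_poly B = map_poly of_int (char_poly A)"
    unfolding B_def using of_int_hom.char_poly_hom[OF carA] by simp
  moreover have "lead_coeff (char_poly A) = 1" using degree_monic_char_poly[OF carA] by simp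
  ultimately show ?thesis unfolding algebraic_int_altdef_ipoly x_def[symmetric] by metis
qed

lemma rat_ipoly_root_of_unity_int:
  fixes w :: "'a::field_char_0"
  assumes "n > 0" "w ^ n = 1" "ipoly f w \<in> \<rat>"
  shows "ipoly f w \<in> \<int>"
  using rational_algebraic_int_is_int algebraic_int_ipoly_root_of_unity assms by blast

section \<open>Primitive roots of unity and Galois conjugation\<close>

definition prt :: "nat \<Rightarrow> 'a::comm_ring_1 \<Rightarrow> bool" where
  "prt n w \<longleftrightarrow> n > 0 \<and> w ^ n = 1 \<and> (\<forall>d. 0 < d \<and> d < n \<longrightarrow> w ^ d \<noteq> 1)"

lemma prt_power_mod: "prt n w \<Longrightarrow> w ^ (k mod n) = w ^ k"
  unfolding prt_def by (metis div_mult_mod_eq mult.commute mult_1 power_add power_mult power_one)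

lemma prt_power_cong: "prt n w \<Longrightarrow> [i = j] (mod n) \<Longrightarrow> w ^ i = w ^ j"
  by (metis cong_def prt_power_mod)

lemma prt_power_eq_1_iff: "prt n w \<Longrightarrow> w ^ k = 1 \<longleftrightarrow> n dvd k"
  using prt_power_mod[of n w k] unfolding prt_def
  by (metis dvd_eq_mod_eq_0 mod_less_divisor neq0_conv power_0)

lemma prt_nonzero: "prt n w \<Longrightarrow> w \<noteq> (0::'a::idom)"
  unfolding prt_def by (metis power_0_left zero_neq_one neq0_conv)

lemma prt_power_eq_iff:
  assumes "prt n (w::'a::field)" shows "w ^ i = w ^ j \<longleftrightarrow> [i = j] (mod n)"
proof
  show "[i = j] (mod n) \<Longrightarrow> w ^ i = w ^ j" using prt_power_cong[OF assms] .
  assume *: "w ^ i = w ^ j"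
  have nz: "w \<noteq> 0" using assms by (rule prt_nonzero)
  have gen: "[i = j] (mod n)" if "w ^ i = w ^ j" "i \<le> j" for i j
  proof -
    have "w ^ j = w ^ i * w ^ (j - i)" using that(2) power_add[of w i "j - i"] by simp
    then have "w ^ (j - i) = 1" using that nz by simp
    then have "n dvd j - i" using prt_power_eq_1_iff[OF assms] by simp
    then show ?thesis using that by (metis cong_altdef_nat cong_sym)
  qed
  show "[i = j] (mod n)"
    using gen[of i j] gen[of j i] * by (metis cong_sym nle_le)
qed

lemma prt_power:
  assumes "prt n w" "coprime k n" shows "prt n (w ^ k)"
proof -
  have "(w ^ k) ^ d \<noteq> 1" if "0 < d" "d < n" for d
  proof
    assume "(w ^ k) ^ d = 1"
    then have "n dvd k * d" using prt_power_eq_1_iff[OF assms(1), of "k * d"] by (simp add: power_mult)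
    then have "n dvd d" using assms(2) by (simp add: coprime_commute coprime_dvd_mult_right_iff)
    then show False using that by (auto dest: dvd_imp_le)
  qed
  moreover have "(w ^ k) ^ n = 1" using assms by (metis mult.commute power_mult power_one prt_def)
  ultimately show ?thesis using assms by (simp add: prt_def)
qed

lemma prt_power_dvd:
  assumes "prt n w" "d dvd n" shows "prt (n div d) (w ^ d)"
proof -
  have n: "n > 0" using assms by (simp add: prt_def)
  then have d: "d > 0" "n div d > 0" "d * (n div d) = n" using assms(2) by (auto simp: dvd_div_eq_0_iff intro!: Nat.gr0I)
  have "(w ^ d) ^ e \<noteq> 1" if "0 < e" "e < n div d" for e
  proof
    assume "(w ^ d) ^ e = 1"
    then have "n dvd d * e" using prt_power_eq_1_iff[OF assms(1), of "d * e"] by (simp add: power_mult)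
    then have "n div d dvd e" using d by (metis dvd_mult_cancel1 nat_mult_dvd_cancel_disj not_gr0)
    then show False using that by (auto dest: dvd_imp_le)
  qed
  moreover have "(w ^ d) ^ (n div d) = 1" using assms d by (metis power_mult prt_def)
  ultimately show ?thesis using d by (simp add: prt_def)
qed

text \<open>Gauss's lemma: c divides the content of g * q, which is the content of q, so c cancels
  from the quotient.\<close>

lemma primitive_dvd_smult:
  fixes g f :: "int poly"
  assumes "content g = 1" "c \<noteq> 0" "g dvd smult c f"
  shows "g dvd f"
proof -
  obtain q where q: "smult c f = g * q" using assms(3) by (auto simp: dvd_def)
  have "c dvd content (smult c f)" by simp
  also have "\<dots> = content q" by (simp add: q content_mult assms(1))
  finally have "[:c:] dvd q" by (simp add: const_poly_dvd_iff_dvd_content)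
  then obtain q' where "q = smult c q'" by (auto simp: dvd_def)
  with q assms(2) have "f = g * q'"
    by (metis mult_smult_right smult_cancel)
  then show ?thesis by simp
qed

text \<open>g serves as the n-th cyclotomic polynomial. It is taken as a primitive polynomial of
  least degree vanishing at w: pseudo-division by it leaves remainder 0, and Gauss's lemma removes
  the multiplier. The cofactor s returns later as Psi.\<close>

lemma cyclotomic_factor:
  fixes w :: "'a::field_char_0"
  assumes "prt n w"
  obtains g s :: "int poly" where "g * s = monom 1 n - 1" "ipoly g w = 0"
    "\<And>f. ipoly f w = 0 \<Longrightarrow> g dvd f"
proof -
  let ?S = "\<lambda>f::int poly. f \<noteq> 0 \<and> ipoly f w = 0"
  have n: "n > 0" "w ^ n = 1" using assms by (auto simp: prt_def)
  have xn: "?S (monom 1 n - 1)"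
    using n by (auto simp: monom_eq_1_iff)
  define f0 where "f0 = arg_min degree ?S"
  have f0: "?S f0" and f0m: "\<And>f. ?S f \<Longrightarrow> degree f0 \<le> degree f"
    unfolding f0_def using arg_min_nat_lemma[of ?S "monom 1 n - 1" degree] xn by auto
  define g where "g = primitive_part f0"
  have g0: "g \<noteq> 0" and gd: "degree g = degree f0" and gc: "content g = 1"
    using f0 by (auto simp: g_def)
  have gw: "ipoly g w = 0"
  proof -
    have "f0 = smult (content f0) g" by (simp add: g_def)
    then have "of_int (content f0) * ipoly g w = 0" using f0 by (metis ipoly_smult)
    then show ?thesis using f0 by simp
  qed
  have dv: "g dvd f" if f: "ipoly f w = 0" for f
  proof -
    obtain q r where qr: "pseudo_divmod f g = (q, r)" by fastforce
    note pd = pseudo_divmod[OF g0 qr]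
    have "r = 0"
    proof (rule ccontr)
      assume r: "r \<noteq> 0"
      have "ipoly (smult (coeff g (degree g) ^ (Suc (degree f) - degree g)) f) w = ipoly (g * q + r) w"
        using pd(1) by simp
      then have "ipoly r w = 0" using f gw by simp
      then have "degree f0 \<le> degree r" using f0m r by blast
      then show False using pd(2) r gd by simp
    qed
    then have "g dvd smult (coeff g (degree g) ^ (Suc (degree f) - degree g)) f" using pd(1) by simp
    then show ?thesis by (rule primitive_dvd_smult[OF gc, rotated]) (use g0 in simp)
  qed
  obtain s where "monom 1 n - 1 = g * s" using dv[of "monom 1 n - 1"] xn by (auto simp: dvd_def)
  then show ?thesis using that gw dv by metis
qed

lemma ipoly_pderiv_xn: "ipoly (pderiv (monom 1 n - 1)) (x::'a::comm_ring_1) = of_nat n * x ^ (n - 1)"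
  by (simp add: pderiv_diff pderiv_monom)

text \<open>Dedekind's argument. Otherwise the cofactor s vanishes at w^q, and differentiating g s =
  X^n - 1 there makes g(w^q) a divisor of n. But g(w^q) is congruent to g(w)^q = 0 modulo q, so q
  would divide n.\<close>

lemma conj_root_prime:
  fixes w :: "'a::field_char_0"
  assumes "prt n w" "prime q" "\<not> q dvd n" "ipoly f w = 0"
  shows "ipoly f (w ^ q) = 0"
proof -
  obtain g s where gs: "g * s = monom 1 n - 1" "ipoly g w = 0" and dv: "\<And>f. ipoly f w = 0 \<Longrightarrow> g dvd f"
    using cyclotomic_factor[OF assms(1)] by blast
  have n: "n > 0" "w ^ n = 1" using assms by (auto simp: prt_def)
  have q0: "q > 0" using assms(2) prime_gt_0_nat by blast
  have "ipoly g (w ^ q) = 0"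
  proof (rule ccontr)
    assume nz: "ipoly g (w ^ q) \<noteq> 0"
    have wqn: "(w ^ q) ^ n = 1" using n by (metis mult.commute power_mult power_one)
    have "ipoly g (w ^ q) * ipoly s (w ^ q) = ipoly (monom 1 n - 1) (w ^ q)"
      by (metis gs(1) ipoly_mult)
    then have s0: "ipoly s (w ^ q) = 0" using nz wqn by simp
    have "ipoly (pderiv (g * s)) (w ^ q) = of_nat n * (w ^ q) ^ (n - 1)"
      unfolding gs(1) by (rule ipoly_pderiv_xn)
    then have 1: "ipoly g (w ^ q) * ipoly (pderiv s) (w ^ q) = of_nat n * (w ^ q) ^ (n - 1)"
      by (simp add: pderiv_mult s0)
    obtain h where h: "g ^ q = pcompose g (monom 1 q) + smult (int q) h"
      using frobenius_int_poly[OF assms(2)] by blast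
    have "ipoly (g ^ q) w = ipoly (pcompose g (monom 1 q) + smult (int q) h) w" by (simp only: h)
    then have 2: "ipoly g (w ^ q) = - (of_nat q * ipoly h w)"
      using q0 by (simp add: gs(2) ipoly_pcompose add_eq_0_iff2 power_0_left)
    \<comment> \<open>The factor w^q completes w^(q (n - 1)) to 1, so that q F(w) is the integer n
      itself.\<close>
    define F where "F = - h * pcompose (pderiv s) (monom 1 q) * monom 1 q"
    have "of_nat q * ipoly F w = ipoly g (w ^ q) * ipoly (pderiv s) (w ^ q) * w ^ q"
      by (simp add: F_def 2 ipoly_pcompose)
    also have "\<dots> = of_nat n * ((w ^ q) ^ (n - 1) * w ^ q)" by (simp add: 1)
    also have "(w ^ q) ^ (n - 1) * w ^ q = 1" using n wqn by (metis power_minus_mult)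
    finally have 3: "of_nat q * ipoly F w = of_nat n" by simp
    then have "ipoly F w = of_nat n / of_nat q" using q0 by (simp add: field_simps)
    then have "ipoly F w \<in> \<rat>" by simp
    then obtain m where m: "ipoly F w = of_int m"
      using rat_ipoly_root_of_unity_int[OF n] by (auto elim: Ints_cases)
    have "(of_int (int q * m) :: 'a) = of_int (int n)" using 3 m by simp
    then have "int q * m = int n" by (simp only: of_int_eq_iff)
    then have "int q dvd int n" by (metis dvd_triv_left)
    then show False using assms(3) by (simp only: int_dvd_int_iff)
  qed
  then show ?thesis using dv[OF assms(4)] by (auto simp: dvd_def)
qed

text \<open>An exponent coprime to n is a product of primes not dividing n. The root w varies in the
  induction because each prime q replaces it by w^q.\<close>

lemma conj_root:
  fixes w :: "'a::field_char_0"
  assumes "prt n w" "coprime j n" "ipoly f w = 0"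
  shows "ipoly f (w ^ j) = 0"
  using assms
proof (induction j arbitrary: w rule: prime_divisors_induct)
  case zero
  then have "n = 1" by simp
  with zero show ?case by (simp add: prt_def)
next
  case (unit x)
  then show ?case by simp
next
  case (factor q x)
  have "\<not> q dvd n" using factor.prems(2) factor.hyps
    by (metis coprime_common_divisor coprime_mult_left_iff dvd_refl not_prime_unit)
  then have "ipoly f (w ^ q) = 0" using conj_root_prime factor by blast
  moreover have "prt n (w ^ q)" using factor.prems by (intro prt_power) auto
  ultimately show ?case using factor.IH[of "w ^ q"] factor.prems by (simp add: power_mult)
qed

lemma conj_root_iff:
  fixes w :: "'a::field_char_0"
  assumes "prt n w" "coprime j n"
  shows "ipoly f (w ^ j) = 0 \<longleftrightarrow> ipoly f w = 0"
proof
  assume *: "ipoly f (w ^ j) = 0"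
  obtain i where i: "[j * i = 1] (mod n)" using cong_solve_coprime_nat[OF assms(2)] by auto
  then have "coprime i n" by (metis coprime_iff_invertible_nat mult.commute One_nat_def)
  have "ipoly f ((w ^ j) ^ i) = 0"
    by (rule conj_root[OF _ \<open>coprime i n\<close> *]) (use assms prt_power in blast)
  moreover have "(w ^ j) ^ i = w" using prt_power_cong[OF assms(1) i] by (simp add: power_mult)
  ultimately show "ipoly f w = 0" by simp
qed (use conj_root assms in blast)

text \<open>The sum over all n exponents is n or 0. Sorted by d = gcd k n, it splits into the traces
  for the primitive roots w^d of order n / d; those with d > 1 are rational by induction, hence so
  is the one with d = 1.\<close>

lemma trace_root_of_unity_rat:
  fixes w :: "'a::field_char_0"
  assumes "prt n w"
  shows "(\<Sum>k\<in>totatives n. w ^ (k * i)) \<in> \<rat>"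
  using assms
proof (induction n arbitrary: w rule: less_induct)
  case (less n)
  have n: "n > 0" "w ^ n = 1" using less.prems by (auto simp: prt_def)
  have all: "(\<Sum>k\<in>{0<..n}. w ^ (k * i)) \<in> \<rat>"
  proof (cases "w ^ i = 1")
    case True
    then have "w ^ (k * i) = 1" for k by (metis mult.commute power_mult power_one)
    then show ?thesis by simp
  next
    case False
    have "{0<..n} = {1..n}" by auto
    then have "(\<Sum>k\<in>{0<..n}. w ^ (k * i)) = (\<Sum>k=1..n. (w ^ i) ^ k)"
      by (simp add: power_mult[symmetric] mult.commute)
    also have "(1 - w ^ i) * \<dots> = (w ^ i) ^ 1 - (w ^ i) ^ Suc n"
      using n by (intro sum_gp_multiplied) simp
    also have "(w ^ i) ^ n = 1" using n by (metis mult.commute power_mult power_one)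
    then have "(w ^ i) ^ 1 - (w ^ i) ^ Suc n = 0" by simp
    finally show ?thesis using False by simp
  qed
  have eq: "{0<..n} = (\<Union>d\<in>{d. d dvd n}. {k\<in>{0<..n}. gcd k n = d})" by auto
  have "(\<Sum>k\<in>{0<..n}. w ^ (k * i)) = (\<Sum>d | d dvd n. \<Sum>k\<in>{k\<in>{0<..n}. gcd k n = d}. w ^ (k * i))"
    by (subst eq, rule sum.UNION_disjoint) (use n in auto)
  also have "\<dots> = (\<Sum>d | d dvd n. \<Sum>k\<in>totatives (n div d). (w ^ d) ^ (k * i))"
  proof (rule sum.cong, simp)
    fix d assume "d \<in> {d. d dvd n}"
    then have d: "d dvd n" by simp
    show "(\<Sum>k\<in>{k\<in>{0<..n}. gcd k n = d}. w ^ (k * i)) = (\<Sum>k\<in>totatives (n div d). (w ^ d) ^ (k * i))"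
      by (rule sum.reindex_bij_betw[OF bij_betw_totatives_gcd_eq[OF d n(1)], symmetric, THEN trans])
        (simp add: power_mult[symmetric] mult_ac)
  qed
  also have "\<dots> = (\<Sum>k\<in>totatives n. w ^ (k * i)) +
      (\<Sum>d\<in>{d. d dvd n} - {1}. \<Sum>k\<in>totatives (n div d). (w ^ d) ^ (k * i))"
    using n by (subst sum.remove[of _ 1]) auto
  finally have *: "(\<Sum>k\<in>totatives n. w ^ (k * i)) = (\<Sum>k\<in>{0<..n}. w ^ (k * i)) -
      (\<Sum>d\<in>{d. d dvd n} - {1}. \<Sum>k\<in>totatives (n div d). (w ^ d) ^ (k * i))" by simp
  have "(\<Sum>k\<in>totatives (n div d). (w ^ d) ^ (k * i)) \<in> \<rat>" if "d \<in> {d. d dvd n} - {1}" for d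
  proof (rule less.IH)
    show "n div d < n" using that n by (auto intro!: div_less_dividend Suc_lessI elim: dvdE)
    show "prt (n div d) (w ^ d)" using that less.prems by (intro prt_power_dvd) auto
  qed
  then have "(\<Sum>d\<in>{d. d dvd n} - {1}. \<Sum>k\<in>totatives (n div d). (w ^ d) ^ (k * i)) \<in> \<rat>"
    by (rule Rats_sum)
  then show ?case unfolding * by (intro Rats_diff all)
qed

text \<open>Galois descent without a Galois group: an element equal to all its conjugates is its
  trace divided by totient n, hence rational, and it is an algebraic integer.\<close>

lemma conj_invariant_int:
  fixes w :: "'a::field_char_0"
  assumes "prt n w" "\<And>k. coprime k n \<Longrightarrow> ipoly f (w ^ k) = ipoly f w"
  shows "ipoly f w \<in> \<int>"
proof -
  have n: "n > 0" "w ^ n = 1" using assms by (auto simp: prt_def)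
  have "of_nat (totient n) * ipoly f w = (\<Sum>k\<in>totatives n. ipoly f (w ^ k))"
    using assms(2) by (simp add: totient_def totatives_def)
  also have "\<dots> = (\<Sum>k\<in>totatives n. \<Sum>i\<le>degree f. of_int (coeff f i) * w ^ (k * i))"
    by (simp add: ipoly_altdef power_mult)
  also have "\<dots> = (\<Sum>i\<le>degree f. of_int (coeff f i) * (\<Sum>k\<in>totatives n. w ^ (k * i)))"
    unfolding sum_distrib_left by (rule sum.swap)
  also have "\<dots> \<in> \<rat>" by (intro Rats_sum Rats_mult trace_root_of_unity_rat[OF assms(1)]) auto
  finally have "of_nat (totient n) * ipoly f w / of_nat (totient n) \<in> \<rat>" by (intro Rats_divide) auto
  moreover have "totient n > 0" using n by simp
  ultimately have "ipoly f w \<in> \<rat>" by simp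
  then show ?thesis using rat_ipoly_root_of_unity_int n by blast
qed

lemma ipoly_eq_0_roots_of_unity:
  fixes w :: "'a::field_char_0"
  assumes "prt n w" "\<And>i. i < n \<Longrightarrow> ipoly f (w ^ i) = 0"
  shows "(monom 1 n - 1) dvd f"
proof -
  have n: "n > 0" "w ^ n = 1" using assms by (auto simp: prt_def)
  obtain q r where f: "f = (monom 1 n - 1) * q + r" and r: "\<forall>i\<ge>n. coeff r i = 0"
    using poly_div_xn[OF n(1)] by blast
  have rw: "ipoly r (w ^ i) = 0" if "i < n" for i
  proof -
    have "(w ^ i) ^ n = 1" using n by (metis mult.commute power_mult power_one)
    then show ?thesis using assms(2)[OF that] by (simp add: f)
  qed
  have "r = 0"
  proof (rule ccontr)
    assume nz: "r \<noteq> 0"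
    let ?R = "map_poly of_int r :: 'a poly"
    have Rnz: "?R \<noteq> 0" using nz by simp
    have "degree ?R = degree r" by (simp add: degree_map_poly)
    also have "\<dots> < n" using r nz by (meson leading_coeff_0_iff not_le)
    finally have d: "degree ?R < n" .
    have inj: "inj_on (\<lambda>i. w ^ i) {..<n}"
      using prt_power_eq_iff[OF assms(1)] by (auto simp: inj_on_def cong_def)
    have "(\<lambda>i. w ^ i) ` {..<n} \<subseteq> {x. poly ?R x = 0}" using rw by (auto simp: ipoly_def)
    then have "card ((\<lambda>i. w ^ i) ` {..<n}) \<le> card {x. poly ?R x = 0}"
      by (intro card_mono poly_roots_finite Rnz)
    also have "\<dots> \<le> degree ?R" by (rule card_poly_roots_bound[OF Rnz])
    finally show False using d card_image[OF inj] by simp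
  qed
  then show ?thesis by (simp add: f)
qed

text \<open>This makes the reduction f(w) -> f(t) modulo p well defined. Multiplied by the product H
  of all X^d - 1 with 0 < d < n, f vanishes at every n-th root of unity: at conjugates of w because
  f does, at the others because H does. So X^n - 1 divides f H. At t the left side is 0 modulo p,
  but H(t) is not, as t has order exactly n.\<close>

lemma ipoly_root_imp_dvd:
  fixes w :: "'a::field_char_0" and t :: int
  assumes w: "prt n w" and n: "n \<ge> 2" and p: "prime p"
    and t: "\<And>d. [t ^ d = 1] (mod int p) \<longleftrightarrow> n dvd d"
    and f: "ipoly f w = 0"
  shows "int p dvd poly f t"
proof -
  define H :: "int poly" where "H = (\<Prod>d\<in>{1..<n}. (monom 1 d - 1))"
  have "(monom 1 n - 1) dvd f * H"
  proof (rule ipoly_eq_0_roots_of_unity[OF w])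
    fix i assume i: "i < n"
    show "ipoly (f * H) (w ^ i) = 0"
    proof (cases "coprime i n")
      case True
      then show ?thesis using conj_root[OF w True f] by simp
    next
      case False
      define e where "e = gcd i n"
      have e: "e dvd n" "e dvd i" by (simp_all add: e_def)
      have "e \<noteq> 1" using False unfolding e_def by (metis coprime_iff_gcd_eq_1)
      moreover have "e \<noteq> 0" using n by (simp add: e_def)
      ultimately have e1: "e > 1" by simp
      define d where "d = n div e"
      have ed: "n = e * d" using e by (simp add: d_def)
      then have "d > 0" using n by (intro Nat.gr0I) auto
      then have d: "d \<in> {1..<n}" using e1 ed by simp
      have "n dvd i * d" using e(2) ed by simp
      then have "(w ^ i) ^ d = 1" using prt_power_eq_1_iff[OF w, of "i * d"] by (simp add: power_mult)
      then have "ipoly H (w ^ i) = 0" unfolding H_def ipoly_prod using d by (intro prod_zero) auto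
      then show ?thesis by simp
    qed
  qed
  then obtain K where K: "f * H = (monom 1 n - 1) * K" by (auto simp: dvd_def)
  have "poly f t * poly H t = (t ^ n - 1) * poly K t"
    using arg_cong[OF K, of "\<lambda>q. poly q t"] by (simp add: poly_monom)
  moreover have "int p dvd t ^ n - 1" using t[of n] by (simp add: cong_iff_dvd_diff)
  ultimately have "int p dvd poly f t * poly H t" by simp
  moreover have "\<not> int p dvd poly H t"
  proof
    assume "int p dvd poly H t"
    then have "int p dvd (\<Prod>d\<in>{1..<n}. t ^ d - 1)" by (simp add: H_def poly_prod poly_monom)
    then obtain d where d: "d \<in> {1..<n}" "int p dvd t ^ d - 1"
      using p by (subst (asm) prime_dvd_prod_iff) auto
    then have "n dvd d" using t[of d] by (simp add: cong_iff_dvd_diff)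
    then show False using d by (auto dest: dvd_imp_le)
  qed
  ultimately show ?thesis using p by (metis prime_dvd_mult_iff prime_nat_int_transfer)
qed

section \<open>Norms from the cyclotomic field\<close>

lemma bij_betw_totatives_mult:
  assumes "coprime k n" "n > 1"
  shows "bij_betw (\<lambda>j. j * k mod n) (totatives n) (totatives n)"
proof -
  have into: "j * k mod n \<in> totatives n" if "j \<in> totatives n" for j
  proof -
    have "coprime (j * k) n" using that assms by (simp add: in_totatives_iff)
    then have c: "coprime (j * k mod n) n" using assms by (subst coprime_mod_left_iff) auto
    then have "j * k mod n \<noteq> 0" using assms by (metis coprime_0_left_iff nat_dvd_1_iff_1 less_numeral_extra(4))
    then show ?thesis using c assms by (simp add: in_totatives_iff less_imp_le)
  qed
  have inj: "inj_on (\<lambda>j. j * k mod n) (totatives n)"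
  proof (rule inj_onI)
    fix x y assume xy: "x \<in> totatives n" "y \<in> totatives n" "x * k mod n = y * k mod n"
    then have "[x = y] (mod n)" using assms by (metis cong_def cong_mult_rcancel_nat)
    then show "x = y" using xy totatives_less[of _ n] assms by (auto simp: cong_def)
  qed
  then show ?thesis using into by (simp add: bij_betw_def endo_inj_surj image_subset_iff)
qed

lemma prod_conj_shift:
  fixes w :: "'a::field"
  assumes "prt n w" "n > 1" "coprime k n"
  shows "(\<Prod>j\<in>totatives n. F ((w ^ k) ^ j)) = (\<Prod>j\<in>totatives n. F (w ^ j))"
proof -
  have "(\<Prod>j\<in>totatives n. F (w ^ j)) = (\<Prod>j\<in>totatives n. F (w ^ (j * k mod n)))"
    by (rule prod.reindex_bij_betw[OF bij_betw_totatives_mult[OF assms(3,2)], symmetric])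
  also have "\<dots> = (\<Prod>j\<in>totatives n. F ((w ^ k) ^ j))"
    by (simp add: prt_power_mod[OF assms(1)] mult.commute[of _ k] power_mult)
  finally show ?thesis ..
qed

text \<open>The norm to \<rat>, kept as a polynomial because \<open>norm_A\<close> needs its value
  at w and also its reduction at t.\<close>

definition conj_prod :: "nat \<Rightarrow> int poly \<Rightarrow> int poly" where
  "conj_prod n f = (\<Prod>j\<in>totatives n. pcompose f (monom 1 j))"

lemma ipoly_conj_prod: "ipoly (conj_prod n f) x = (\<Prod>j\<in>totatives n. ipoly f (x ^ j))"
  by (simp add: conj_prod_def ipoly_prod ipoly_pcompose)

lemma norm_int:
  fixes w :: "'a::field_char_0"
  assumes "prt n w" "n > 1"
  shows "(\<Prod>j\<in>totatives n. ipoly f (w ^ j)) \<in> \<int>"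
proof -
  have "ipoly (conj_prod n f) w \<in> \<int>"
    by (rule conj_invariant_int[OF assms(1)]) (simp add: ipoly_conj_prod prod_conj_shift[OF assms])
  then show ?thesis by (simp add: ipoly_conj_prod)
qed

lemma norm_ge_1:
  fixes w :: complex
  assumes "prt n w" "n > 1" "ipoly f w \<noteq> 0"
  shows "1 \<le> (\<Prod>j\<in>totatives n. cmod (ipoly f (w ^ j)))"
proof -
  obtain m where m: "(\<Prod>j\<in>totatives n. ipoly f (w ^ j)) = of_int m"
    using norm_int[OF assms(1,2)] by (auto elim: Ints_cases)
  have "ipoly f (w ^ j) \<noteq> 0" if "j \<in> totatives n" for j
    using conj_root_iff[OF assms(1)] assms(3) that by (auto simp: in_totatives_iff)
  then have "(of_int m :: complex) \<noteq> 0" unfolding m[symmetric] by simp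
  then have "m \<noteq> 0" by simp
  then have "1 \<le> \<bar>m\<bar>" by simp
  then have "1 \<le> cmod (of_int m)" by (metis norm_of_int of_int_1_le_iff of_int_abs)
  then show ?thesis unfolding m[symmetric] by (simp add: prod_norm)
qed

text \<open>The prime ideal (p, w - t) is principal with generator a(w): \<open>at\<close> puts a(w)
  into it, and \<open>ab\<close> and \<open>ac\<close> say that a(w) divides both p and w -
  t.\<close>

locale principal_prime =
  fixes p n :: nat and w :: complex and t :: int and a b c :: "int poly"
  assumes p: "prime p" and n_def: "n = p - 1" and n2: "n > 2" and w: "prt n w"
    and t: "\<And>d. [t ^ d = 1] (mod int p) \<longleftrightarrow> n dvd d"
    and at: "int p dvd poly a t"
    and ab: "ipoly a w * ipoly b w = of_nat p"
    and ac: "ipoly a w * ipoly c w = w - of_int t"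
begin

lemma ipoly_root_imp_dvd_poly: "ipoly f w = 0 \<Longrightarrow> int p dvd poly f t"
  using ipoly_root_imp_dvd[OF w _ p t] n2 by simp

lemma red_power:
  assumes "ipoly f w = 0" "coprime j n" shows "int p dvd poly f (t ^ j)"
proof -
  have "ipoly (pcompose f (monom 1 j)) w = 0"
    using conj_root[OF w assms(2,1)] by (simp add: ipoly_pcompose)
  from ipoly_root_imp_dvd_poly[OF this] show ?thesis by (simp add: poly_pcompose poly_monom)
qed

lemma t_power_cong_iff: "[t ^ i = t ^ j] (mod int p) \<longleftrightarrow> [i = j] (mod n)"
proof -
  have cop: "coprime t (int p)"
  proof -
    have "[t ^ n = 1] (mod int p)" using t by simp
    moreover have "t ^ n = t * t ^ (n - 1)" using n2 by (simp flip: power_Suc)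
    ultimately show ?thesis by (metis coprime_iff_invertible_int)
  qed
  have gen: "[t ^ i = t ^ j] (mod int p) \<longleftrightarrow> [i = j] (mod n)" if "i \<le> j" for i j
  proof -
    have "[t ^ i = t ^ j] (mod int p) \<longleftrightarrow> [t ^ i * 1 = t ^ i * t ^ (j - i)] (mod int p)"
      using that by (simp flip: power_add)
    also have "\<dots> \<longleftrightarrow> [1 = t ^ (j - i)] (mod int p)"
      using cop by (intro cong_mult_lcancel) simp
    also have "\<dots> \<longleftrightarrow> n dvd j - i" using t cong_sym_eq by blast
    also have "\<dots> \<longleftrightarrow> [i = j] (mod n)" using that by (metis cong_altdef_nat cong_sym_eq)
    finally show ?thesis .
  qed
  show ?thesis using gen[of i j] gen[of j i] by (metis cong_sym_eq nle_le)
qed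

text \<open>Conjugating a c = X - t to w^j and reducing at t shows that otherwise p divides t^j - t,
  against the order of t. All later nonvanishing statements rest on this.\<close>

lemma a_nonvanish:
  assumes "coprime j n" "\<not> [j = 1] (mod n)"
  shows "\<not> int p dvd poly a (t ^ j)"
proof
  assume *: "int p dvd poly a (t ^ j)"
  have "ipoly (a * c - (monom 1 1 - [:t:])) w = 0" using ac by simp
  from red_power[OF this assms(1)]
  have "int p dvd poly a (t ^ j) * poly c (t ^ j) - (t ^ j - t)" by (simp add: poly_monom)
  then have "int p dvd t ^ j - t" using * by (metis dvd_diffD1 dvd_mult2 dvd_diff_commute dvd_diff_right_iff)
  then have "[t ^ j = t ^ 1] (mod int p)" by (simp add: cong_iff_dvd_diff)
  then show False using assms(2) t_power_cong_iff by blast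
qed

abbreviation "A j \<equiv> ipoly a (w ^ j)"

text \<open>Distinct conjugates of the prime are coprime. Raising w^i = t to the inverse i' of i
  modulo n shows that A i divides w - t^i' as well as p; likewise for j. The difference t^i' - t^j'
  is prime to p.\<close>

lemma A_bezout:
  assumes i: "coprime i n" and j: "coprime j n" and ij: "\<not> [i = j] (mod n)"
  shows "\<exists>x y. A i * ipoly x w + A j * ipoly y w = 1"
proof -
  have dv: "\<exists>x. A i * ipoly x w = of_nat p" if "coprime i n" for i
  proof -
    have "ipoly (a * b - [:int p:]) w = 0" using ab by simp
    from conj_root[OF w that this] show ?thesis
      by (intro exI[of _ "pcompose b (monom 1 i)"]) (simp add: ipoly_pcompose)
  qed
  have lin: "\<exists>x. A i * ipoly x w = w - of_int t ^ i'" if i: "coprime i n" "[i * i' = 1] (mod n)" for i i'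
  proof -
    have "ipoly (a * c - (monom 1 1 - [:t:])) w = 0" using ac by simp
    from conj_root[OF w that(1) this] have 1: "A i * ipoly c (w ^ i) = w ^ i - of_int t" by simp
    have wi: "(w ^ i) ^ i' = w" using prt_power_cong[OF w i(2)] by (simp add: power_mult)
    \<comment> \<open>The cofactor of w^i - t in (w^i)^i' - t^i'.\<close>
    define S :: "int poly" where "S = (\<Sum>k<i'. [:t:] ^ (i' - Suc k) * monom 1 (i * k))"
    have "(w ^ i - of_int t) * ipoly S w = (w ^ i) ^ i' - of_int t ^ i'"
      unfolding S_def by (subst power_diff_sumr2) (simp add: ipoly_sum power_mult[symmetric] mult.commute)
    then have "A i * ipoly (pcompose c (monom 1 i) * S) w = w - of_int t ^ i'"
      by (simp add: ipoly_pcompose wi mult.assoc[symmetric] 1)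
    then show ?thesis by blast
  qed
  obtain i' where i': "[i * i' = 1] (mod n)" using cong_solve_coprime_nat[OF i] by auto
  obtain j' where j': "[j * j' = 1] (mod n)" using cong_solve_coprime_nat[OF j] by auto
  have "\<not> [i' = j'] (mod n)"
  proof
    assume "[i' = j'] (mod n)"
    then have "[i * j' = j * j'] (mod n)" using i' j'
      by (meson cong_scalar_left cong_sym cong_trans)
    moreover have "coprime j' n" using j' by (metis coprime_iff_invertible_nat mult.commute One_nat_def)
    ultimately show False using ij by (simp add: cong_mult_rcancel_nat)
  qed
  then have "\<not> int p dvd t ^ i' - t ^ j'"
    using t_power_cong_iff by (simp add: cong_iff_dvd_diff)
  then have "coprime (int p) (t ^ i' - t ^ j')"
    using p by (simp add: prime_imp_coprime)
  then obtain u v where uv: "u * int p + v * (t ^ i' - t ^ j') = 1"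
    by (metis bezout_int coprime_imp_gcd_eq_1)
  obtain x1 where x1: "A i * ipoly x1 w = of_nat p" using dv[OF i] by blast
  obtain x2 where x2: "A i * ipoly x2 w = w - of_int t ^ i'" using lin[OF i i'] by blast
  obtain y2 where y2: "A j * ipoly y2 w = w - of_int t ^ j'" using lin[OF j j'] by blast
  have "A i * ipoly (smult u x1 - smult v x2) w + A j * ipoly (smult v y2) w =
      of_int u * (A i * ipoly x1 w) - of_int v * (A i * ipoly x2 w) + of_int v * (A j * ipoly y2 w)"
    by (simp add: algebra_simps)
  also have "\<dots> = of_int (u * int p + v * (t ^ i' - t ^ j'))"
    unfolding x1 x2 y2 by (simp add: algebra_simps)
  finally show ?thesis using uv by (metis of_int_1)
qed

lemma prod_A_dvd:
  assumes "finite V" "V \<subseteq> totatives n"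
  shows "\<exists>x. (\<Prod>j\<in>V. A j) * ipoly x w = of_nat p"
  using assms
proof (induction V rule: finite_induct)
  case empty
  then show ?case by (intro exI[of _ "[:int p:]"]) simp
next
  case (insert i V)
  then obtain x where x: "(\<Prod>j\<in>V. A j) * ipoly x w = of_nat p" by auto
  have i: "coprime i n" "i \<in> totatives n" using insert by (auto simp: in_totatives_iff)
  have "\<exists>u v. A i * ipoly u w + (\<Prod>j\<in>W. A j) * ipoly v w = 1" if "W \<subseteq> V" for W
    using finite_subset[OF that insert(1)] that
  proof (induction W rule: finite_induct)
    case empty
    show ?case by (intro exI[of _ 0] exI[of _ 1]) simp
  next
    case (insert j W)
    then obtain u v where uv: "A i * ipoly u w + (\<Prod>j\<in>W. A j) * ipoly v w = 1" by auto
    have j: "j \<in> totatives n" "j \<noteq> i" using insert \<open>insert i V \<subseteq> totatives n\<close> \<open>i \<notin> V\<close> by auto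
    have "\<not> [i = j] (mod n)" using i j totatives_less[of _ n] n2 by (auto simp: cong_def)
    then obtain u' v' where uv': "A i * ipoly u' w + A j * ipoly v' w = 1"
      using A_bezout[of i j] i j by (auto simp: in_totatives_iff)
    \<comment> \<open>The product of the two Bezout relations, using 1 - (1 - A i u) (1 - A i u') =
      A i (u + u' - A i u u').\<close>
    have "A i * ipoly (u + u' * (1 - [:0:]) - u * pcompose a (monom 1 i) * u') w
          + (\<Prod>j\<in>insert j W. A j) * ipoly (v * v') w =
        A i * (ipoly u w + ipoly u' w - ipoly u w * A i * ipoly u' w) +
        ((\<Prod>j\<in>W. A j) * ipoly v w) * (A j * ipoly v' w)"
      using insert by (simp add: ipoly_pcompose)
    also have "(\<Prod>j\<in>W. A j) * ipoly v w = 1 - A i * ipoly u w" using uv by (simp add: algebra_simps)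
    also have "A j * ipoly v' w = 1 - A i * ipoly u' w" using uv' by (simp add: algebra_simps)
    finally have "A i * ipoly (u + u' * (1 - [:0:]) - u * pcompose a (monom 1 i) * u') w
          + (\<Prod>j\<in>insert j W. A j) * ipoly (v * v') w = 1" by (simp add: algebra_simps)
    then show ?case by blast
  qed
  then obtain u v where uv: "A i * ipoly u w + (\<Prod>j\<in>V. A j) * ipoly v w = 1" by blast
  obtain y where y: "A i * ipoly y w = of_nat p"
  proof -
    have "ipoly (a * b - [:int p:]) w = 0" using ab by simp
    from conj_root[OF w i(1) this] show ?thesis
      by (intro that[of "pcompose b (monom 1 i)"]) (simp add: ipoly_pcompose)
  qed
  \<comment> \<open>This is p times the Bezout relation: x supplies p from the product over V, and y
    supplies p from A i.\<close>
  have "(\<Prod>j\<in>insert i V. A j) * ipoly (u * x + v * y) w =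
     (A i * ipoly u w) * ((\<Prod>j\<in>V. A j) * ipoly x w) + ((\<Prod>j\<in>V. A j) * ipoly v w) * (A i * ipoly y w)"
    using insert by (simp add: algebra_simps)
  also have "\<dots> = of_nat p * (A i * ipoly u w + (\<Prod>j\<in>V. A j) * ipoly v w)"
    unfolding x y by (simp add: algebra_simps)
  also have "\<dots> = of_nat p" by (simp only: uv mult_1_right)
  finally show ?case by blast
qed

text \<open>The norm N is an integer dividing p, since the cofactor from \<open>prod_A_dvd\<close>
  is a rational algebraic integer. Conversely p divides N, because reduction at t kills the factor
  with j = 1. So N is p up to sign.\<close>

lemma norm_A: "(\<Prod>j\<in>totatives n. cmod (A j)) = real p"
proof -
  have n1: "n > 1" using n2 by simp
  obtain N where N: "(\<Prod>j\<in>totatives n. A j) = of_int N"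
    using norm_int[OF w n1] by (auto elim: Ints_cases)
  obtain x where x: "(\<Prod>j\<in>totatives n. A j) * ipoly x w = of_nat p" using prod_A_dvd[of "totatives n"] by auto
  have "(of_int N :: complex) \<noteq> 0" using x N p by (metis mult_zero_left not_prime_0 of_nat_eq_0_iff)
  then have N0: "N \<noteq> 0" by simp
  have "ipoly x w = of_nat p / of_int N" using x N N0 by (simp add: field_simps)
  then have "ipoly x w \<in> \<rat>" by simp
  then obtain m where m: "ipoly x w = of_int m"
    using rat_ipoly_root_of_unity_int[of n w x] w by (auto simp: prt_def elim: Ints_cases)
  have "(of_int (N * m) :: complex) = of_int (int p)" using x N m by simp
  then have Nm: "N * m = int p" by (simp only: of_int_eq_iff)
  have "int p dvd poly (conj_prod n a - [:N:]) t"
    by (rule ipoly_root_imp_dvd_poly) (simp add: ipoly_conj_prod N)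
  then have "int p dvd (\<Prod>j\<in>totatives n. poly a (t ^ j)) - N"
    by (simp add: conj_prod_def poly_prod poly_pcompose poly_monom)
  moreover have "int p dvd (\<Prod>j\<in>totatives n. poly a (t ^ j))"
  proof -
    have "poly a (t ^ 1) dvd (\<Prod>j\<in>totatives n. poly a (t ^ j))"
      using n2 by (intro dvd_prodI) (auto simp: in_totatives_iff)
    then show ?thesis using at by (metis dvd_trans power_one_right)
  qed
  ultimately have "int p dvd N" using dvd_diff_right_iff by blast
  then obtain r where r: "N = int p * r" by (auto simp: dvd_def)
  then have "int p * (r * m) = int p * 1" using Nm by (simp add: mult.assoc)
  then have "r * m = 1" using p by (simp add: prime_gt_0_nat)
  then have "\<bar>r\<bar> = 1" using zmult_eq_1_iff[of r m] by auto
  then have "\<bar>N\<bar> = int p" by (simp add: r abs_mult)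
  then have "cmod (of_int N) = real p" by (metis norm_of_int of_int_abs of_int_of_nat_eq)
  then show ?thesis unfolding N[symmetric] by (simp add: prod_norm)
qed

end

lemma ipoly_cnj: "ipoly f (cnj x) = cnj (ipoly f x)"
  by (induction f) auto

section \<open>Height bounds\<close>

lemma pcompose_power: "pcompose (f ^ k) g = pcompose f g ^ k"
  by (induction k) (auto simp: pcompose_mult pcompose_1)

lemma prt_cnj:
  assumes "prt n (w::complex)" shows "w ^ (n - 1) = cnj w"
proof -
  have n: "n > 0" "w ^ n = 1" using assms by (auto simp: prt_def)
  then have "cmod w ^ n = 1" by (metis norm_one norm_power)
  then have "cmod w = 1" using n(1) by (metis norm_ge_zero power_eq_imp_eq_base power_one zero_le_one)
  then have "w * cnj w = 1" by (simp add: complex_norm_square[symmetric])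
  moreover have "w * w ^ (n - 1) = 1" using n by (metis mult.commute power_minus_mult)
  ultimately show ?thesis using prt_nonzero[OF assms] by (metis mult_cancel_left)
qed

context principal_prime
begin

lemma n1: "n > 1" using n2 by simp

lemma A_cnj: "ipoly a ((w ^ (n - 1)) ^ j) = cnj (A j)"
  by (simp only: prt_cnj[OF w] ipoly_cnj[symmetric] complex_cnj_power)

lemma prod_A_mult: "coprime k n \<Longrightarrow> (\<Prod>j\<in>totatives n. cmod (ipoly a ((w ^ k) ^ j))) = real p"
  using prod_conj_shift[OF w n1, of k "\<lambda>x. cmod (ipoly a x)"] norm_A by simp

lemma coprime_n1: "coprime (n - 1) n"
  by (rule coprime_diff_one_left_nat) (use n1 in simp)

lemma not_cong_n1: "\<not> [n - 1 = 1] (mod n)"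
  using n2 by (simp add: cong_def)

lemma coprime_prime_p: "coprime k n \<Longrightarrow> \<not> [k = 1] (mod n) \<Longrightarrow> \<not> int p dvd poly (pcompose a (monom 1 k)) t"
  using a_nonvanish by (simp add: poly_pcompose poly_monom)

text \<open>At each embedding the two terms of D are complex conjugates, so only |A j| and its
  conjugate under q enter the estimate. Modulo the prime above p the first term of D vanishes, while
  the second does not by \<open>a_nonvanish\<close> for the exponents n - 1 and q; the condition q <
  n ensures that q is not 1 modulo n.\<close>

theorem height_bound:
  assumes q: "prime q" "\<not> q dvd n" "q < n"
  shows "real q ^ totient n \<le> 2 ^ totient n * real p ^ (q + 1)"
proof -
  have q1: "q > 1" using q(1) prime_gt_1_nat by blast
  have cq: "coprime q n" using q by (simp add: prime_imp_coprime)
  have qn: "\<not> [q = 1] (mod n)" using q1 q(3) n1 by (simp add: cong_def)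
  define ab where "ab = pcompose a (monom 1 (n - 1))"
  define aq where "aq = pcompose a (monom 1 q)"
  define abq where "abq = pcompose aq (monom 1 (n - 1))"
  define D where "D = a ^ q * abq - ab ^ q * aq"
  obtain h where h: "a ^ q = aq + smult (int q) h"
    using frobenius_int_poly[OF q(1)] unfolding aq_def by blast
  define hb where "hb = pcompose h (monom 1 (n - 1))"
  have hb: "ab ^ q = abq + smult (int q) hb"
  proof -
    have "pcompose (a ^ q) (monom 1 (n - 1)) = pcompose (aq + smult (int q) h) (monom 1 (n - 1))"
      by (simp only: h)
    then show ?thesis by (simp add: ab_def abq_def hb_def pcompose_power pcompose_add pcompose_smult)
  qed
  \<comment> \<open>The product aq * abq cancels in D after expanding both q-th powers; what remains
    is q times E.\<close>
  define E where "E = h * abq - hb * aq"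
  have DE: "D = smult (int q) E"
    unfolding D_def E_def h hb by (simp add: algebra_simps smult_diff_right)
  have "\<not> int p dvd poly D t"
  proof
    assume "int p dvd poly D t"
    moreover have "int p dvd poly (a ^ q * abq) t" using dvd_trans[OF at dvd_power[of q "poly a t"]] q1 by simp
    ultimately have "int p dvd poly ab t ^ q * poly aq t"
      unfolding D_def by (simp add: dvd_diff_right_iff)
    then have "int p dvd poly ab t \<or> int p dvd poly aq t"
      using p by (metis prime_dvd_mult_iff prime_dvd_power prime_nat_int_transfer)
    then show False
      using coprime_prime_p[OF coprime_n1 not_cong_n1] coprime_prime_p[OF cq qn] by (auto simp: ab_def aq_def)
  qed
  then have "ipoly D w \<noteq> 0" using ipoly_root_imp_dvd_poly by blast
  then have "ipoly E w \<noteq> 0" by (auto simp: DE)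
  then have "1 \<le> (\<Prod>j\<in>totatives n. cmod (ipoly E (w ^ j)))" by (rule norm_ge_1[OF w n1])
  then have "real q ^ totient n * 1 \<le> real q ^ totient n * (\<Prod>j\<in>totatives n. cmod (ipoly E (w ^ j)))"
    by (intro mult_left_mono) auto
  also have "\<dots> = (\<Prod>j\<in>totatives n. cmod (ipoly D (w ^ j)))"
    by (simp add: DE norm_mult prod.distrib totient_def)
  also have "\<dots> \<le> (\<Prod>j\<in>totatives n. 2 * (cmod (A j) ^ q * cmod (ipoly a ((w ^ q) ^ j))))"
  proof (rule prod_mono, intro conjI)
    fix j
    have 1: "ipoly ab (w ^ j) = cnj (A j)"
      using A_cnj[of j] by (simp add: ab_def ipoly_pcompose power_mult[symmetric] mult.commute)
    have 2: "ipoly aq (w ^ j) = ipoly a ((w ^ q) ^ j)"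
      by (simp add: aq_def ipoly_pcompose power_mult[symmetric] mult.commute)
    have 3: "ipoly abq (w ^ j) = cnj (ipoly a ((w ^ q) ^ j))"
    proof -
      have "ipoly abq (w ^ j) = ipoly aq ((w ^ (n - 1)) ^ j)"
        by (simp add: abq_def ipoly_pcompose power_mult[symmetric] mult.commute)
      also have "\<dots> = cnj (ipoly aq (w ^ j))" by (simp only: prt_cnj[OF w] ipoly_cnj[symmetric] complex_cnj_power)
      finally show ?thesis by (simp add: 2)
    qed
    have "cmod (ipoly D (w ^ j)) \<le> cmod (A j ^ q * cnj (ipoly a ((w ^ q) ^ j))) + cmod (cnj (A j) ^ q * ipoly a ((w ^ q) ^ j))"
      unfolding D_def by (simp only: ipoly_diff ipoly_mult ipoly_power 1 2 3) (rule norm_triangle_ineq4)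
    then show "cmod (ipoly D (w ^ j)) \<le> 2 * (cmod (A j) ^ q * cmod (ipoly a ((w ^ q) ^ j)))"
      by (simp add: norm_mult norm_power)
  qed simp
  also have "\<dots> = 2 ^ totient n * ((\<Prod>j\<in>totatives n. cmod (A j)) ^ q * (\<Prod>j\<in>totatives n. cmod (ipoly a ((w ^ q) ^ j))))"
    by (simp add: prod.distrib totient_def prod_power_distrib)
  also have "\<dots> = 2 ^ totient n * real p ^ (q + 1)"
    by (simp add: norm_A prod_A_mult[OF cq])
  finally show ?thesis by simp
qed

end

section \<open>Tools for the primes 47, 53, 73 and 79\<close>

lemma prime_13: "prime (13::int)" and prime_23: "prime (23::int)"
  by simp_all

lemma sq_between: "(k::int) ^ 2 < T ^ 2 \<Longrightarrow> T ^ 2 < (k + 1) ^ 2 \<Longrightarrow> k \<ge> 0 \<Longrightarrow> False"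
  by (smt (verit) power2_abs power_less_imp_less_base abs_ge_zero)

lemma sq_cases:
  fixes k :: int
  assumes "k ^ 2 < 9" shows "k ^ 2 \<in> {0, 1, 4}"
proof -
  have "\<bar>k\<bar> < 3" using assms power_less_imp_less_base[of "\<bar>k\<bar>" 2 3] by simp
  then have "k \<in> {-2, -1, 0, 1, 2}" by auto
  then show ?thesis by auto
qed

text \<open>188 = 4 * 47: no integer of \<rat>(sqrt (-23)) has norm 47.\<close>

lemma quad_23: "23 * k ^ 2 + T ^ 2 = (188::int) \<Longrightarrow> False"
proof -
  assume *: "23 * k ^ 2 + T ^ 2 = 188"
  moreover have "T ^ 2 \<ge> 0" by simp
  ultimately have "k ^ 2 \<in> {0, 1, 4}" by (intro sq_cases) linarith
  then have "T ^ 2 = 188 \<or> T ^ 2 = 165 \<or> T ^ 2 = 96" using * by auto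
  then show False using sq_between[of 13 T] sq_between[of 12 T] sq_between[of 9 T] by auto
qed

text \<open>316 = 4 * 79: no integer of \<rat>(sqrt (-39)) has norm 79.\<close>

lemma quad_39: "39 * k ^ 2 + T ^ 2 = (316::int) \<Longrightarrow> False"
proof -
  assume *: "39 * k ^ 2 + T ^ 2 = 316"
  moreover have "T ^ 2 \<ge> 0" by simp
  ultimately have "k ^ 2 \<in> {0, 1, 4}" by (intro sq_cases) linarith
  then have "T ^ 2 = 316 \<or> T ^ 2 = 277 \<or> T ^ 2 = 160" using * by auto
  then show False using sq_between[of 17 T] sq_between[of 16 T] sq_between[of 12 T] by auto
qed

lemma pcompose_neg_cong: "\<exists>h. pcompose a [:0, - 1:] = a + smult 2 (h :: int poly)"
proof (induction a)
  case 0
  show ?case by (intro exI[of _ 0]) simp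
next
  case (pCons c a)
  then obtain h where h: "pcompose a [:0, - 1:] = a + smult 2 h" by blast
  have "pcompose (pCons c a) [:0, - 1:] = pCons c a + smult 2 (- pCons 0 a - pCons 0 h)"
  proof -
    have "pcompose (pCons c a) [:0, - 1:] = [:c:] + [:0, - 1:] * (a + smult 2 h)"
      by (simp add: pcompose_pCons h)
    also have "\<dots> = [:c:] - (pCons 0 a + smult 2 (pCons 0 h))" by (simp add: smult_add_right)
    also have "\<dots> = pCons c a + smult 2 (- pCons 0 a - pCons 0 h)"
    proof -
      have "smult 2 (pCons 0 a) = pCons 0 a + pCons 0 a" for a :: "int poly" using smult_add_left[of 1 1 "pCons 0 a"] by simp
      moreover have "pCons c a = [:c:] + pCons 0 a" by simp
      ultimately show ?thesis by (simp only: smult_diff_right smult_minus_right)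
    qed
    finally show ?thesis .
  qed
  then show ?case by blast
qed

text \<open>AM-GM for four copies of z = x y and one of (x - y)^2 = 5 c - 4 z, whose mean is c = (x
  + y)^2 / 5.\<close>

lemma am_gm_five:
  fixes x y :: real
  assumes "x \<ge> 0" "y \<ge> 0"
  shows "3125 * ((x * y) ^ 4 * (x - y)\<^sup>2) \<le> (x + y) ^ 10"
proof -
  define c where "c = (x + y)\<^sup>2 / 5"
  define z where "z = x * y"
  have "c \<ge> 0" "z \<ge> 0" using assms by (auto simp: c_def z_def)
  \<comment> \<open>The explicit factorization of c^5 - 5 c z^4 + 4 z^5, which has a double root at
    z = c.\<close>
  then have "0 \<le> (c - z)\<^sup>2 * (c ^ 3 + 2 * c\<^sup>2 * z + 3 * c * z\<^sup>2 + 4 * z ^ 3)" by simp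
  also have "\<dots> = c ^ 5 - z ^ 4 * (5 * c - 4 * z)" by (simp add: power2_eq_square eval_nat_numeral algebra_simps)
  also have "5 * c - 4 * z = (x - y)\<^sup>2" by (simp add: c_def z_def power2_eq_square algebra_simps)
  finally have "z ^ 4 * (x - y)\<^sup>2 \<le> c ^ 5" by simp
  moreover have "3125 * c ^ 5 = (x + y) ^ 10" by (simp add: c_def power_divide flip: power_mult)
  ultimately show ?thesis by (simp add: z_def)
qed

context principal_prime
begin

text \<open>As 4 divides n, -w is the conjugate w^m with m = n / 2 + 1. Put u = a(w) cnj (a(-w)).
  The congruence a(-X) = a(X) modulo 2 makes Re u, i Im u and Re (u^2) algebraic integers; they are
  nonzero because u lies in the prime above p and cnj u does not. A suitable product of them is
  small against a power of |u|, uniformly in u.\<close>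

theorem height_bound_4:
  assumes n4: "4 dvd n"
  shows "5 ^ totient n \<le> p ^ 8"
proof -
  define m where "m = n div 2 + 1"
  have m: "n = 2 * (m - 1)" "even (m - 1)" using n4 by (auto simp: m_def elim!: dvdE)
  have cm: "coprime m n"
  proof -
    have "coprime m (m - 1)" using m n2 by (metis coprime_commute coprime_diff_one_left_nat m_def zero_less_Suc Suc_eq_plus1)
    moreover have "coprime m 2" using m n2 by (simp add: m_def)
    ultimately show ?thesis by (subst m(1)) (simp add: coprime_mult_right_iff)
  qed
  have mn: "\<not> [m = 1] (mod n)" using n2 m unfolding m_def by (simp add: cong_def)
  have wm: "w ^ m = - w"
  proof -
    have "(w ^ (m - 1)) ^ 2 = 1" using m(1) w by (metis mult.commute power_mult prt_def)
    moreover have "w ^ (m - 1) \<noteq> 1"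
      using prt_power_eq_1_iff[OF w, of "m - 1"] n2 m(1) by (auto dest!: dvd_imp_le)
    ultimately have "w ^ (m - 1) = - 1" by (metis power2_eq_1_iff)
    moreover have "w ^ m = w * w ^ (m - 1)" by (simp add: m_def)
    ultimately show ?thesis by simp
  qed
  have tm: "[t ^ m = - t] (mod int p)"
  proof -
    have "ipoly (monom 1 m + monom 1 1) w = 0" by (simp add: wm)
    from ipoly_root_imp_dvd_poly[OF this] show ?thesis by (simp add: poly_monom cong_iff_dvd_diff)
  qed
  define ab where "ab = pcompose a (monom 1 (n - 1))"
  define s where "s = pcompose a [:0, - 1:]"
  define sb where "sb = pcompose s (monom 1 (n - 1))"
  obtain h where h: "s = a + smult 2 h" using pcompose_neg_cong unfolding s_def by blast
  define hb where "hb = pcompose h (monom 1 (n - 1))"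
  have hb: "sb = ab + smult 2 hb"
    by (simp add: sb_def h hb_def ab_def pcompose_add pcompose_smult)
  \<comment> \<open>At w, h1, h2 and h3 are (u - cnj u) / 2, (u + cnj u) / 2 and (u^2 + (cnj u)^2) /
    2, with the division by 2 carried out in \<int>[X].\<close>
  define h1 where "h1 = a * hb - ab * h"
  define h2 where "h2 = h1 + ab * s"
  define h3 where "h3 = smult 2 (h1 ^ 2) + a * sb * (ab * s)"
  have s1: "a * sb - ab * s = smult 2 h1" unfolding h1_def hb h by (simp add: algebra_simps smult_diff_right)
  have s2: "a * sb + ab * s = smult 2 h2"
  proof -
    have "a * sb + ab * s = (a * sb - ab * s) + smult 2 (ab * s)" by (simp flip: mult_2 add: numeral_poly)
    then show ?thesis unfolding s1 h2_def by (simp add: smult_add_right)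
  qed
  have ns: "\<not> int p dvd poly s t"
  proof
    assume "int p dvd poly s t"
    then have "int p dvd poly a (- t)" by (simp add: s_def poly_pcompose)
    moreover have "[poly a (t ^ m) = poly a (- t)] (mod int p)" by (rule poly_conj_cong[OF tm])
    ultimately have "int p dvd poly a (t ^ m)" by (simp add: cong_dvd_iff)
    then show False using a_nonvanish[OF cm mn] by simp
  qed
  have nab: "\<not> int p dvd poly ab t"
    using coprime_prime_p[OF coprime_n1 not_cong_n1] by (simp add: ab_def)
  have nv: "\<not> int p dvd poly (ab * s) t"
    using ns nab p by (simp add: prime_dvd_mult_iff)
  have pu: "int p dvd poly (a * sb) t" using at by simp
  have N1: "ipoly h1 w \<noteq> 0"
  proof
    assume "ipoly h1 w = 0"
    then have "ipoly (a * sb - ab * s) w = 0" unfolding s1 by simp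
    from ipoly_root_imp_dvd_poly[OF this] show False using nv pu by (simp add: dvd_diff_right_iff)
  qed
  have N2: "ipoly h2 w \<noteq> 0"
  proof
    assume "ipoly h2 w = 0"
    then have "ipoly (a * sb + ab * s) w = 0" unfolding s2 by simp
    from ipoly_root_imp_dvd_poly[OF this] show False using nv pu by (simp add: dvd_add_right_iff)
  qed
  have s3: "(a * sb) ^ 2 + (ab * s) ^ 2 = smult 2 h3"
  proof -
    have "(a * sb) ^ 2 + (ab * s) ^ 2 = (a * sb - ab * s) ^ 2 + 2 * (a * sb * (ab * s))"
      by (simp add: power2_eq_square algebra_simps)
    also have "\<dots> = smult 2 h3" unfolding s1 h3_def
      by (simp add: smult_add_right power2_eq_square numeral_poly)
    finally show ?thesis .
  qed
  have N3: "ipoly h3 w \<noteq> 0"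
  proof
    assume "ipoly h3 w = 0"
    then have "ipoly ((a * sb) ^ 2 + (ab * s) ^ 2) w = 0" unfolding s3 by simp
    from ipoly_root_imp_dvd_poly[OF this] have "int p dvd poly (a * sb) t ^ 2 + poly (ab * s) t ^ 2" by simp
    then have "int p dvd poly (ab * s) t ^ 2" using pu by (simp add: dvd_add_right_iff power2_eq_square)
    then show False using nv p by (metis prime_dvd_power prime_nat_int_transfer)
  qed
  \<comment> \<open>The exponents fit \<open>am_gm_five\<close>: with x = (Im u)^2 and y = (Re u)^2,
    |F| is (x y)^4 (x - y)^2, at most |u|^20 / 5^5. The product of |u| over all conjugates is p^2,
    which yields 5^(5 d) \<le> p^40 for d = totient n.\<close>
  define F where "F = h1 ^ 8 * h2 ^ 8 * h3 ^ 2"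
  have "ipoly F w \<noteq> 0" using N1 N2 N3 by (simp add: F_def)
  then have "1 \<le> (\<Prod>j\<in>totatives n. cmod (ipoly F (w ^ j)))" by (rule norm_ge_1[OF w n1])
  also have "\<dots> \<le> (\<Prod>j\<in>totatives n. (cmod (A j) * cmod (ipoly a ((w ^ m) ^ j))) ^ 20 / 5 ^ 5)"
  proof (rule prod_mono, intro conjI)
    fix j assume j: "j \<in> totatives n"
    then have "coprime j 4" using n4 by (meson coprime_divisors dvd_refl in_totatives_iff)
    then have "odd j" using coprime_common_divisor[of j 4 2] by auto
    then have wj: "(w ^ m) ^ j = - (w ^ j)" by (simp add: wm)
    define u where "u = A j * cnj (ipoly a (- (w ^ j)))"
    have cn: "(w ^ j) ^ (n - 1) = cnj (w ^ j)" using prt_cnj[OF w] by (metis complex_cnj_power mult.commute power_mult)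
    have u1: "ipoly (a * sb) (w ^ j) = u"
      by (simp add: u_def sb_def s_def ipoly_pcompose cn[unfolded One_nat_def] ipoly_cnj[symmetric])
    have u2: "ipoly (ab * s) (w ^ j) = cnj u"
      by (simp add: u_def ab_def s_def ipoly_pcompose cn[unfolded One_nat_def] ipoly_cnj[symmetric])
    have "2 * ipoly h1 (w ^ j) = u - cnj u"
      using arg_cong[OF s1, of "\<lambda>f. ipoly f (w ^ j)"] by (simp only: ipoly_diff u1 u2 ipoly_smult) simp
    then have "2 * ipoly h1 (w ^ j) = 2 * (\<i> * complex_of_real (Im u))" by (simp add: complex_diff_cnj mult_ac)
    then have g1: "cmod (ipoly h1 (w ^ j)) = \<bar>Im u\<bar>" by (simp add: norm_mult)
    have "2 * ipoly h2 (w ^ j) = u + cnj u"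
      using arg_cong[OF s2, of "\<lambda>f. ipoly f (w ^ j)"] by (simp only: ipoly_add u1 u2 ipoly_smult) simp
    then have "2 * ipoly h2 (w ^ j) = 2 * complex_of_real (Re u)" by (simp add: complex_add_cnj)
    then have g2: "cmod (ipoly h2 (w ^ j)) = \<bar>Re u\<bar>" by simp
    have "2 * ipoly h3 (w ^ j) = u ^ 2 + cnj u ^ 2"
      using arg_cong[OF s3, of "\<lambda>f. ipoly f (w ^ j)"] by (simp only: ipoly_add ipoly_power u1 u2 ipoly_smult) simp
    then have "2 * ipoly h3 (w ^ j) = 2 * complex_of_real (Re (u\<^sup>2))"
      using complex_add_cnj[of "u\<^sup>2"] by simp
    then have "ipoly h3 (w ^ j) = complex_of_real (Re (u\<^sup>2))" by (simp only: mult_cancel_left) simp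
    then have "cmod (ipoly h3 (w ^ j)) = \<bar>Re (u\<^sup>2)\<bar>" by (simp only: norm_of_real)
    then have g3: "cmod (ipoly h3 (w ^ j)) = \<bar>(Re u)\<^sup>2 - (Im u)\<^sup>2\<bar>" by (simp only: Re_power2)
    have "cmod (ipoly F (w ^ j)) = ((Im u)\<^sup>2 * (Re u)\<^sup>2) ^ 4 * ((Im u)\<^sup>2 - (Re u)\<^sup>2)\<^sup>2"
      by (simp add: F_def norm_mult norm_power g1 g2 g3 power_mult_distrib power2_commute flip: power_mult)
    also have "3125 * \<dots> \<le> ((Im u)\<^sup>2 + (Re u)\<^sup>2) ^ 10" by (rule am_gm_five) auto
    also have "(Im u)\<^sup>2 + (Re u)\<^sup>2 = cmod u ^ 2" by (simp add: cmod_power2)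
    finally have "cmod (ipoly F (w ^ j)) \<le> cmod u ^ 20 / 5 ^ 5" by (simp flip: power_mult)
    then show "cmod (ipoly F (w ^ j)) \<le> (cmod (A j) * cmod (ipoly a ((w ^ m) ^ j))) ^ 20 / 5 ^ 5"
      by (simp add: wj u_def norm_mult)
  qed simp
  also have "\<dots> = ((\<Prod>j\<in>totatives n. cmod (A j)) * (\<Prod>j\<in>totatives n. cmod (ipoly a ((w ^ m) ^ j)))) ^ 20 / (5 ^ 5) ^ totient n"
    by (simp add: prod.distrib prod_dividef totient_def flip: prod_power_distrib)
  also have "((5::real) ^ 5) ^ totient n = (5 ^ totient n) ^ 5"
    by (simp only: power_mult[symmetric] mult.commute)
  also have "((\<Prod>j\<in>totatives n. cmod (A j)) * (\<Prod>j\<in>totatives n. cmod (ipoly a ((w ^ m) ^ j)))) ^ 20 / (5 ^ totient n) ^ 5 = (real p ^ 8) ^ 5 / (5 ^ totient n) ^ 5"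
    unfolding norm_A prod_A_mult[OF cm]
    by (simp add: mult.commute power_mult_distrib flip: power_mult power_add)
  finally have "(5 ^ totient n) ^ 5 \<le> (real p ^ 8) ^ 5" by (simp add: field_simps)
  then have "(5::real) ^ totient n \<le> real p ^ 8" by (rule power_le_imp_le_base[of _ 4, simplified]) simp
  then have "real (5 ^ totient n) \<le> real (p ^ 8)" by simp
  then show ?thesis by (simp only: of_nat_le_iff)
qed

text \<open>The norm of \<open>a(w)\<close> to the subfield \<open>\<rat>(sqrt (- D))\<close> has norm \<open>p\<close>; \<open>T\<close> is its trace.\<close>
theorem quadratic_subfield:
  assumes g: "ipoly g w ^ 2 = - of_nat D" and D: "D > 0"
  shows "\<exists>T m :: int. m ^ 2 = int D * (4 * int p - T ^ 2)"
proof -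
  define G where "G = ipoly g w"
  have G0: "G \<noteq> 0" using g D by (auto simp: G_def)
  have pm: "ipoly g (w ^ k) = G \<or> ipoly g (w ^ k) = - G" if "coprime k n" for k
  proof -
    have "ipoly (g ^ 2 + [:int D:]) w = 0" using g by simp
    from conj_root[OF w that this] have "ipoly g (w ^ k) ^ 2 = G ^ 2" using g
      by (simp add: G_def add_eq_0_iff)
    then show ?thesis by (simp add: power2_eq_iff)
  qed
  \<comment> \<open>The quadratic character of the subfield: whether conjugation by k fixes or
    negates the square root G of -D.\<close>
  define chi :: "nat \<Rightarrow> bool" where "chi k \<longleftrightarrow> ipoly g (w ^ k) = G" for k
  have gchi: "ipoly g (w ^ k) = (if chi k then G else - G)" if "coprime k n" for k
    using pm[OF that] by (auto simp: chi_def)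
  have chi_mult: "chi (k * j) \<longleftrightarrow> (chi k \<longleftrightarrow> chi j)" if k: "coprime k n" and j: "coprime j n" for j k
  proof -
    define e :: int where "e = (if chi k then 1 else - 1)"
    \<comment> \<open>The relation g(w^k) = e g(w) may itself be conjugated by j, which makes chi
      multiplicative.\<close>
    have "ipoly (pcompose g (monom 1 k) - smult e g) w = 0"
      using gchi[OF k] by (simp add: ipoly_pcompose e_def G_def)
    from conj_root[OF w j this] have "ipoly g ((w ^ j) ^ k) = of_int e * ipoly g (w ^ j)"
      by (simp add: ipoly_pcompose)
    moreover have "(w ^ j) ^ k = w ^ (k * j)" by (simp add: power_mult[symmetric] mult.commute)
    ultimately show ?thesis using gchi[OF j] gchi[of "k * j"] k j G0
      by (auto simp: e_def split: if_splits)
  qed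
  have chi_mod: "chi (k mod n) = chi k" for k by (simp add: chi_def prt_power_mod[OF w])
  \<comment> \<open>Complex conjugation negates G, because the square of a real number is not
    negative.\<close>
  have chi_n1: "\<not> chi (n - 1)"
  proof
    assume "chi (n - 1)"
    then have "cnj G = G" using prt_cnj[OF w] by (simp add: chi_def G_def ipoly_cnj)
    then have "Im G = 0" by (metis Reals_cnj_iff complex_is_Real_iff)
    then have "G = complex_of_real (Re G)" by (simp add: complex_eq_iff)
    then have "complex_of_real ((Re G) ^ 2) = complex_of_real (- real D)" using g
      by (metis G_def of_real_minus of_real_of_nat_eq of_real_power)
    then have "(Re G)\<^sup>2 = - real D" by (simp only: of_real_eq_iff)
    moreover have "(Re G)\<^sup>2 \<ge> 0" by simp
    ultimately show False using D by linarith
  qed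
  \<comment> \<open>Products over the kernel of chi and over its complement: at w they are the norm
    of a(w) to the quadratic subfield and the conjugate of that norm.\<close>
  define G1 where "G1 = (\<Prod>j\<in>{j\<in>totatives n. chi j}. pcompose a (monom 1 j))"
  define G2 where "G2 = (\<Prod>j\<in>{j\<in>totatives n. \<not> chi j}. pcompose a (monom 1 j))"
  have bij: "bij_betw (\<lambda>j. j * k mod n) {j\<in>totatives n. chi j = e} {j\<in>totatives n. chi j = (e = chi k)}"
    if k: "coprime k n" for k e
  proof -
    note B = bij_betw_totatives_mult[OF k n1]
    have c: "chi (j * k mod n) = (chi j = chi k)" if "j \<in> totatives n" for j
      using chi_mult[of j k] that k by (auto simp: chi_mod in_totatives_iff)
    have "(\<lambda>j. j * k mod n) ` {j\<in>totatives n. chi j = e} = {j\<in>totatives n. chi j = (e = chi k)}"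
    proof (intro equalityI subsetI)
      fix y assume "y \<in> (\<lambda>j. j * k mod n) ` {j\<in>totatives n. chi j = e}"
      then show "y \<in> {j\<in>totatives n. chi j = (e = chi k)}" using bij_betwE[OF B] c by auto
    next
      fix y assume y: "y \<in> {j\<in>totatives n. chi j = (e = chi k)}"
      then obtain j where j: "j \<in> totatives n" "y = j * k mod n"
        using B unfolding bij_betw_def by (metis (no_types, lifting) imageE mem_Collect_eq)
      then have "chi j = e" using c y by auto
      then show "y \<in> (\<lambda>j. j * k mod n) ` {j\<in>totatives n. chi j = e}" using j by auto
    qed
    moreover have "inj_on (\<lambda>j. j * k mod n) {j\<in>totatives n. chi j = e}"
      using B by (auto simp: bij_betw_def intro: inj_on_subset)
    ultimately show ?thesis by (simp add: bij_betw_def)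
  qed
  have sh: "(\<Prod>j\<in>{j\<in>totatives n. chi j = e}. ipoly a ((w ^ k) ^ j)) = (\<Prod>j\<in>{j\<in>totatives n. chi j = (e = chi k)}. A j)"
    if k: "coprime k n" for k e
  proof -
    have "(\<Prod>j\<in>{j\<in>totatives n. chi j = (e = chi k)}. A j) = (\<Prod>j\<in>{j\<in>totatives n. chi j = e}. A (j * k mod n))"
      by (rule prod.reindex_bij_betw[OF bij[OF k], symmetric])
    then show ?thesis by (simp add: prt_power_mod[OF w] mult.commute[of _ k] power_mult)
  qed
  have g1: "ipoly G1 x = (\<Prod>j\<in>{j\<in>totatives n. chi j = True}. ipoly a (x ^ j))" for x :: complex
    by (simp add: G1_def ipoly_prod ipoly_pcompose)
  have g2: "ipoly G2 x = (\<Prod>j\<in>{j\<in>totatives n. chi j = False}. ipoly a (x ^ j))" for x :: complex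
    by (simp add: G2_def ipoly_prod ipoly_pcompose)
  have k1: "ipoly G1 (w ^ k) = (if chi k then ipoly G1 w else ipoly G2 w)" if "coprime k n" for k
    unfolding g1 g2 using sh[OF that, of True] by auto
  have k2: "ipoly G2 (w ^ k) = (if chi k then ipoly G2 w else ipoly G1 w)" if "coprime k n" for k
    unfolding g1 g2 using sh[OF that, of False] by auto
  have "ipoly (G1 + G2) w \<in> \<int>"
    by (rule conj_invariant_int[OF w]) (simp add: k1 k2)
  then obtain T where T: "ipoly G1 w + ipoly G2 w = of_int T" by (auto elim: Ints_cases)
  have "ipoly ((G1 - G2) * g) w \<in> \<int>"
    by (rule conj_invariant_int[OF w]) (simp add: k1 k2 gchi G_def[symmetric] algebra_simps)
  then obtain m where m: "(ipoly G1 w - ipoly G2 w) * G = of_int m" by (auto simp: G_def elim: Ints_cases)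
  have cn: "ipoly G2 w = cnj (ipoly G1 w)"
    using k1[OF coprime_n1] chi_n1 prt_cnj[OF w] by (simp add: ipoly_cnj)
  have "totatives n = {j\<in>totatives n. chi j = True} \<union> {j\<in>totatives n. chi j = False}" by auto
  then have "ipoly G1 w * ipoly G2 w = (\<Prod>j\<in>totatives n. A j)"
    unfolding g1 g2 by (subst prod.union_disjoint[symmetric]) auto
  then have "cmod (ipoly G1 w) ^ 2 = real p"
    using norm_A cn by (metis complex_mod_cnj norm_mult power2_eq_square prod_norm)
  then have pr: "ipoly G1 w * ipoly G2 w = of_nat p"
    unfolding cn complex_norm_square[symmetric] by (metis of_real_of_nat_eq of_real_power)
  \<comment> \<open>(G1 - G2)^2 = T^2 - 4 p at w, and G^2 = -D.\<close>
  have "(of_int (m ^ 2) :: complex) = ((ipoly G1 w + ipoly G2 w) ^ 2 - 4 * (ipoly G1 w * ipoly G2 w)) * G ^ 2"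
    unfolding of_int_power m[symmetric] by (simp add: power2_eq_square algebra_simps)
  also have "\<dots> = of_int (int D * (4 * int p - T ^ 2))"
    unfolding T pr using g by (simp add: G_def algebra_simps)
  finally have "m ^ 2 = int D * (4 * int p - T ^ 2)" by (simp only: of_int_eq_iff)
  then show ?thesis by blast
qed

lemma sum_root_of_unity:
  assumes "k * l = n" "l > 1" shows "(\<Sum>i<l. (w ^ k) ^ i) = 0"
proof -
  have "prt l (w ^ k)" using prt_power_dvd[OF w, of k] assms n2 by (metis dvd_triv_left nonzero_mult_div_cancel_left mult_0 not_less_zero)
  then have "(w ^ k) ^ l = 1" "w ^ k \<noteq> 1" using assms(2) unfolding prt_def by (auto dest!: spec[of _ 1])
  then show ?thesis by (simp add: geometric_sum)
qed

lemma p_not_47: "p \<noteq> 47"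
proof
  assume p47: "p = 47"
  \<comment> \<open>n = 46, so u is a primitive 23rd root of unity.\<close>
  define u where "u = w ^ 2"
  txt \<open>\<open>g(u)\<close> is the quadratic Gauss sum modulo 23.\<close>
  define g :: "int poly" where "g = [:0, 1, 1, 1, 1, -1, 1, -1, 1, 1, -1, -1, 1, 1, -1, -1, 1, -1, 1, -1, -1, -1, -1:]"
  \<comment> \<open>The quotient of g^2 + 23 by 1 + X + ... + X^22.\<close>
  define K :: "int poly" where "K = [:23, -23, 1, 1, 1, 1, -3, 1, -3, 1, 5, -7, 5, -7, 5, 1, -3, 1, -3, 1, 1, 1, 1:]"
  have id: "g ^ 2 + 23 = [:1, 1, 1, 1, 1, 1, 1, 1, 1, 1, 1, 1, 1, 1, 1, 1, 1, 1, 1, 1, 1, 1, 1:] * K" unfolding g_def K_def by code_simp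
  have "ipoly [:1, 1, 1, 1, 1, 1, 1, 1, 1, 1, 1, 1, 1, 1, 1, 1, 1, 1, 1, 1, 1, 1, 1:] u = (\<Sum>i<23. u ^ i)" by (simp add: eval_nat_numeral algebra_simps)
  also have "\<dots> = 0" using sum_root_of_unity[of 2 23] by (simp add: u_def n_def p47)
  finally have "ipoly (g ^ 2 + 23) u = 0" unfolding id ipoly_mult by (simp only: mult_zero_left)
  then have "ipoly g u ^ 2 + 23 = 0" by (simp add: numeral_poly)
  then have "ipoly g u ^ 2 = - 23" by (simp only: eq_neg_iff_add_eq_0)
  then have "ipoly (pcompose g (monom 1 2)) w ^ 2 = - of_nat 23" by (simp add: ipoly_pcompose u_def)
  from quadratic_subfield[OF this] obtain T m :: int where Tm: "m ^ 2 = 23 * (188 - T ^ 2)"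
    by (auto simp: p47)
  have "23 dvd m"
    using Tm by (metis dvd_triv_left prime_dvd_power prime_23)
  then obtain k where k: "m = 23 * k" by (auto simp: dvd_def)
  with Tm have "23 * k ^ 2 + T ^ 2 = 188" by (simp add: power2_eq_square)
  then show False by (rule quad_23)
qed

lemma p_not_79: "p \<noteq> 79"
proof
  assume p79: "p = 79"
  \<comment> \<open>n = 78, so u is a primitive 13th root of unity and v a primitive cube root of
    unity.\<close>
  define u where "u = w ^ 6"
  define v where "v = w ^ 26"
  \<comment> \<open>The Gauss sum modulo 13, whose square at u is 13. Times 1 + 2 v, a square root
    of -3, it is a square root of -39.\<close>
  define g :: "int poly" where "g = [:0, 1, -1, 1, 1, -1, -1, -1, -1, 1, 1, -1, 1:]"
  define K :: "int poly" where "K = [:-13, 13, 1, -3, 5, -3, -3, 5, -3, -3, 5, -3, 1:]"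
  have id: "g ^ 2 - 13 = [:1, 1, 1, 1, 1, 1, 1, 1, 1, 1, 1, 1, 1:] * K" unfolding g_def K_def by code_simp
  have "ipoly [:1, 1, 1, 1, 1, 1, 1, 1, 1, 1, 1, 1, 1:] u = (\<Sum>i<13. u ^ i)" by (simp add: eval_nat_numeral algebra_simps)
  also have "\<dots> = 0" using sum_root_of_unity[of 6 13] by (simp add: u_def n_def p79)
  finally have "ipoly (g ^ 2 - 13) u = 0" unfolding id ipoly_mult by (simp only: mult_zero_left)
  then have 1: "ipoly g u ^ 2 = 13" by (simp add: numeral_poly)
  have "(\<Sum>i<3. v ^ i) = 0" using sum_root_of_unity[of 26 3] by (simp add: v_def n_def p79)
  then have "1 + v + v ^ 2 = 0" by (simp add: eval_nat_numeral)
  moreover have "(1 + 2 * v) ^ 2 = 4 * (1 + v + v ^ 2) - 3" by (simp add: power2_eq_square algebra_simps)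
  ultimately have 2: "(1 + 2 * v) ^ 2 = - 3" by simp
  have "ipoly ((1 + smult 2 (monom 1 26)) * pcompose g (monom 1 6)) w ^ 2 = ((1 + 2 * v) * ipoly g u) ^ 2"
    by (simp add: ipoly_pcompose u_def v_def)
  also have "\<dots> = - of_nat 39" unfolding power_mult_distrib 1 2 by simp
  finally obtain T m :: int where Tm: "m ^ 2 = 39 * (316 - T ^ 2)"
    using quadratic_subfield by (fastforce simp: p79)
  have "3 dvd m ^ 2" "13 dvd m ^ 2" unfolding Tm by (simp_all add: dvd_mult2)
  then have "3 dvd m" "13 dvd m"
    using prime_dvd_power[of "3::int" m 2] prime_dvd_power[of "13::int" m 2] by (simp_all add: prime_13)
  then have "3 * 13 dvd m" by presburger
  then obtain k where k: "m = 39 * k" by (auto simp: dvd_def)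
  with Tm have "39 * k ^ 2 + T ^ 2 = 316" by (simp add: power2_eq_square)
  then show False by (rule quad_39)
qed

end

text \<open>The extremal set is {2, ..., k + 1}, for which the first product telescopes. Removing
  the maximum, which is at least k + 1, gives the induction.\<close>

lemma card_distinct_bounds:
  assumes "finite F" "\<forall>q\<in>F. q \<ge> (2::nat)"
  shows "(\<Prod>q\<in>F. 1 - 1 / real q) \<ge> 1 / (real (card F) + 1) \<and> \<Prod>F \<ge> fact (card F + 1)"
  using assms
proof (induction "card F" arbitrary: F)
  case 0
  then show ?case by simp
next
  case (Suc k)
  define m where "m = Max F"
  have F: "F \<noteq> {}" using Suc by auto
  then have m: "m \<in> F" using Suc by (simp add: m_def)
  define F' where "F' = F - {m}"
  have k: "card F' = k" "finite F'" "\<forall>q\<in>F'. q \<ge> 2" using Suc m by (auto simp: F'_def)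
  have IH: "(\<Prod>q\<in>F'. 1 - 1 / real q) \<ge> 1 / (real k + 1)" "\<Prod>F' \<ge> fact (k + 1)"
    using Suc.hyps(1)[of F'] k by auto
  have "F \<subseteq> {2..m}" using Suc by (auto simp: m_def)
  then have "card F \<le> m - 1" using card_mono[of "{2..m}" F] by simp
  then have mk: "m \<ge> k + 2" using Suc by linarith
  have "(\<Prod>q\<in>F. 1 - 1 / real q) = (1 - 1 / real m) * (\<Prod>q\<in>F'. 1 - 1 / real q)"
    unfolding F'_def using m Suc by (subst prod.remove[of _ m]) auto
  also have "\<dots> \<ge> (1 - 1 / real (k + 2)) * (1 / (real k + 1))"
    using mk by (intro mult_mono IH diff_left_mono frac_le) auto
  also have "(1 - 1 / real (k + 2)) * (1 / (real k + 1)) = 1 / (real (card F) + 1)"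
    using Suc(2)[symmetric] by (simp add: field_simps)
  finally have 1: "(\<Prod>q\<in>F. 1 - 1 / real q) \<ge> 1 / (real (card F) + 1)" .
  have "\<Prod>F = m * \<Prod>F'" unfolding F'_def using m Suc by (subst prod.remove[of _ m]) auto
  also have "\<dots> \<ge> (k + 2) * fact (k + 1)" using mk IH(2) by (intro mult_mono) auto
  also have "(k + 2) * fact (k + 1) = (fact (card F + 1) :: nat)" using Suc(2)[symmetric] by (simp add: algebra_simps)
  finally show ?case using 1 by blast
qed

section \<open>Values and a lower bound of the totient function\<close>

lemma totient_mult_eq: "n = a * b \<Longrightarrow> coprime a b \<Longrightarrow> totient a = x \<Longrightarrow> totient b = y \<Longrightarrow> totient n = x * (y::nat)"
  by (simp add: totient_mult_coprime)

lemma totient_prime_power_eq: "n = q ^ Suc k \<Longrightarrow> prime q \<Longrightarrow> totient n = q ^ k * (q - 1)"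
  by (simp only: totient_prime_power_Suc)

lemma totient_4: "totient 4 = 2"
  using totient_prime_power_eq[of 4 2 1] by simp

lemma totient_13: "totient 13 = 12"
  using totient_prime_power_eq[of 13 13 0] by simp

lemma totient_52: "totient 52 = 24"
  by (rule totient_mult_eq[of 52 4 13, OF _ _ totient_4 totient_13, THEN trans]; (subst coprime_iff_gcd_eq_1)?; simp add: gcd_non_0_nat)

lemma totient_8: "totient 8 = 4"
  using totient_prime_power_eq[of 8 2 2] by simp

lemma totient_9: "totient 9 = 6"
  using totient_prime_power_eq[of 9 3 1] by simp

lemma totient_72: "totient 72 = 24"
  by (rule totient_mult_eq[of 72 8 9, OF _ _ totient_8 totient_9, THEN trans]; (subst coprime_iff_gcd_eq_1)?; simp add: gcd_non_0_nat)

lemma totient_2: "totient 2 = 1"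
  using totient_prime_power_eq[of 2 2 0] by simp

lemma totient_29: "totient 29 = 28"
  using totient_prime_power_eq[of 29 29 0] by simp

lemma totient_58: "totient 58 = 28"
  by (rule totient_mult_eq[of 58 2 29, OF _ _ totient_2 totient_29, THEN trans]; (subst coprime_iff_gcd_eq_1)?; simp add: gcd_non_0_nat)

lemma totient_41: "totient 41 = 40"
  using totient_prime_power_eq[of 41 41 0] by simp

lemma totient_82: "totient 82 = 40"
  by (rule totient_mult_eq[of 82 2 41, OF _ _ totient_2 totient_41, THEN trans]; (subst coprime_iff_gcd_eq_1)?; simp add: gcd_non_0_nat)

lemma totient_11: "totient 11 = 10"
  using totient_prime_power_eq[of 11 11 0] by simp

lemma totient_88: "totient 88 = 40"
  by (rule totient_mult_eq[of 88 8 11, OF _ _ totient_8 totient_11, THEN trans]; (subst coprime_iff_gcd_eq_1)?; simp add: gcd_non_0_nat)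

lemma totient_32: "totient 32 = 16"
  using totient_prime_power_eq[of 32 2 4] by simp

lemma totient_3: "totient 3 = 2"
  using totient_prime_power_eq[of 3 3 0] by simp

lemma totient_96: "totient 96 = 32"
  by (rule totient_mult_eq[of 96 32 3, OF _ _ totient_32 totient_3, THEN trans]; (subst coprime_iff_gcd_eq_1)?; simp add: gcd_non_0_nat)

lemma totient_25: "totient 25 = 20"
  using totient_prime_power_eq[of 25 5 1] by simp

lemma totient_100: "totient 100 = 40"
  by (rule totient_mult_eq[of 100 4 25, OF _ _ totient_4 totient_25, THEN trans]; (subst coprime_iff_gcd_eq_1)?; simp add: gcd_non_0_nat)

lemma totient_17: "totient 17 = 16"
  using totient_prime_power_eq[of 17 17 0] by simp

lemma totient_51: "totient 51 = 32"
  by (rule totient_mult_eq[of 51 3 17, OF _ _ totient_3 totient_17, THEN trans]; (subst coprime_iff_gcd_eq_1)?; simp add: gcd_non_0_nat)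

lemma totient_102: "totient 102 = 32"
  by (rule totient_mult_eq[of 102 2 51, OF _ _ totient_2 totient_51, THEN trans]; (subst coprime_iff_gcd_eq_1)?; simp add: gcd_non_0_nat)

lemma totient_53: "totient 53 = 52"
  using totient_prime_power_eq[of 53 53 0] by simp

lemma totient_106: "totient 106 = 52"
  by (rule totient_mult_eq[of 106 2 53, OF _ _ totient_2 totient_53, THEN trans]; (subst coprime_iff_gcd_eq_1)?; simp add: gcd_non_0_nat)

lemma totient_27: "totient 27 = 18"
  using totient_prime_power_eq[of 27 3 2] by simp

lemma totient_108: "totient 108 = 36"
  by (rule totient_mult_eq[of 108 4 27, OF _ _ totient_4 totient_27, THEN trans]; (subst coprime_iff_gcd_eq_1)?; simp add: gcd_non_0_nat)

lemma totient_16: "totient 16 = 8"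
  using totient_prime_power_eq[of 16 2 3] by simp

lemma totient_7: "totient 7 = 6"
  using totient_prime_power_eq[of 7 7 0] by simp

lemma totient_112: "totient 112 = 48"
  by (rule totient_mult_eq[of 112 16 7, OF _ _ totient_16 totient_7, THEN trans]; (subst coprime_iff_gcd_eq_1)?; simp add: gcd_non_0_nat)

lemma totient_63: "totient 63 = 36"
  by (rule totient_mult_eq[of 63 9 7, OF _ _ totient_9 totient_7, THEN trans]; (subst coprime_iff_gcd_eq_1)?; simp add: gcd_non_0_nat)

lemma totient_126: "totient 126 = 36"
  by (rule totient_mult_eq[of 126 2 63, OF _ _ totient_2 totient_63, THEN trans]; (subst coprime_iff_gcd_eq_1)?; simp add: gcd_non_0_nat)

lemma totient_5: "totient 5 = 4"
  using totient_prime_power_eq[of 5 5 0] by simp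

lemma totient_65: "totient 65 = 48"
  by (rule totient_mult_eq[of 65 5 13, OF _ _ totient_5 totient_13, THEN trans]; (subst coprime_iff_gcd_eq_1)?; simp add: gcd_non_0_nat)

lemma totient_130: "totient 130 = 48"
  by (rule totient_mult_eq[of 130 2 65, OF _ _ totient_2 totient_65, THEN trans]; (subst coprime_iff_gcd_eq_1)?; simp add: gcd_non_0_nat)

lemma totient_136: "totient 136 = 64"
  by (rule totient_mult_eq[of 136 8 17, OF _ _ totient_8 totient_17, THEN trans]; (subst coprime_iff_gcd_eq_1)?; simp add: gcd_non_0_nat)

lemma totient_23: "totient 23 = 22"
  using totient_prime_power_eq[of 23 23 0] by simp

lemma totient_69: "totient 69 = 44"
  by (rule totient_mult_eq[of 69 3 23, OF _ _ totient_3 totient_23, THEN trans]; (subst coprime_iff_gcd_eq_1)?; simp add: gcd_non_0_nat)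

lemma totient_138: "totient 138 = 44"
  by (rule totient_mult_eq[of 138 2 69, OF _ _ totient_2 totient_69, THEN trans]; (subst coprime_iff_gcd_eq_1)?; simp add: gcd_non_0_nat)

lemma totient_37: "totient 37 = 36"
  using totient_prime_power_eq[of 37 37 0] by simp

lemma totient_148: "totient 148 = 72"
  by (rule totient_mult_eq[of 148 4 37, OF _ _ totient_4 totient_37, THEN trans]; (subst coprime_iff_gcd_eq_1)?; simp add: gcd_non_0_nat)

lemma totient_75: "totient 75 = 40"
  by (rule totient_mult_eq[of 75 3 25, OF _ _ totient_3 totient_25, THEN trans]; (subst coprime_iff_gcd_eq_1)?; simp add: gcd_non_0_nat)

lemma totient_150: "totient 150 = 40"
  by (rule totient_mult_eq[of 150 2 75, OF _ _ totient_2 totient_75, THEN trans]; (subst coprime_iff_gcd_eq_1)?; simp add: gcd_non_0_nat)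

lemma totient_39: "totient 39 = 24"
  by (rule totient_mult_eq[of 39 3 13, OF _ _ totient_3 totient_13, THEN trans]; (subst coprime_iff_gcd_eq_1)?; simp add: gcd_non_0_nat)

lemma totient_156: "totient 156 = 48"
  by (rule totient_mult_eq[of 156 4 39, OF _ _ totient_4 totient_39, THEN trans]; (subst coprime_iff_gcd_eq_1)?; simp add: gcd_non_0_nat)

lemma totient_81: "totient 81 = 54"
  using totient_prime_power_eq[of 81 3 3] by simp

lemma totient_162: "totient 162 = 54"
  by (rule totient_mult_eq[of 162 2 81, OF _ _ totient_2 totient_81, THEN trans]; (subst coprime_iff_gcd_eq_1)?; simp add: gcd_non_0_nat)

lemma totient_83: "totient 83 = 82"
  using totient_prime_power_eq[of 83 83 0] by simp

lemma totient_166: "totient 166 = 82"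
  by (rule totient_mult_eq[of 166 2 83, OF _ _ totient_2 totient_83, THEN trans]; (subst coprime_iff_gcd_eq_1)?; simp add: gcd_non_0_nat)

lemma totient_43: "totient 43 = 42"
  using totient_prime_power_eq[of 43 43 0] by simp

lemma totient_172: "totient 172 = 84"
  by (rule totient_mult_eq[of 172 4 43, OF _ _ totient_4 totient_43, THEN trans]; (subst coprime_iff_gcd_eq_1)?; simp add: gcd_non_0_nat)

lemma totient_89: "totient 89 = 88"
  using totient_prime_power_eq[of 89 89 0] by simp

lemma totient_178: "totient 178 = 88"
  by (rule totient_mult_eq[of 178 2 89, OF _ _ totient_2 totient_89, THEN trans]; (subst coprime_iff_gcd_eq_1)?; simp add: gcd_non_0_nat)

lemma totient_45: "totient 45 = 24"
  by (rule totient_mult_eq[of 45 9 5, OF _ _ totient_9 totient_5, THEN trans]; (subst coprime_iff_gcd_eq_1)?; simp add: gcd_non_0_nat)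

lemma totient_180: "totient 180 = 48"
  by (rule totient_mult_eq[of 180 4 45, OF _ _ totient_4 totient_45, THEN trans]; (subst coprime_iff_gcd_eq_1)?; simp add: gcd_non_0_nat)

lemma totient_19: "totient 19 = 18"
  using totient_prime_power_eq[of 19 19 0] by simp

lemma totient_95: "totient 95 = 72"
  by (rule totient_mult_eq[of 95 5 19, OF _ _ totient_5 totient_19, THEN trans]; (subst coprime_iff_gcd_eq_1)?; simp add: gcd_non_0_nat)

lemma totient_190: "totient 190 = 72"
  by (rule totient_mult_eq[of 190 2 95, OF _ _ totient_2 totient_95, THEN trans]; (subst coprime_iff_gcd_eq_1)?; simp add: gcd_non_0_nat)

lemma totient_64: "totient 64 = 32"
  using totient_prime_power_eq[of 64 2 5] by simp

lemma totient_192: "totient 192 = 64"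
  by (rule totient_mult_eq[of 192 64 3, OF _ _ totient_64 totient_3, THEN trans]; (subst coprime_iff_gcd_eq_1)?; simp add: gcd_non_0_nat)

lemma totient_49: "totient 49 = 42"
  using totient_prime_power_eq[of 49 7 1] by simp

lemma totient_196: "totient 196 = 84"
  by (rule totient_mult_eq[of 196 4 49, OF _ _ totient_4 totient_49, THEN trans]; (subst coprime_iff_gcd_eq_1)?; simp add: gcd_non_0_nat)

lemma totient_99: "totient 99 = 60"
  by (rule totient_mult_eq[of 99 9 11, OF _ _ totient_9 totient_11, THEN trans]; (subst coprime_iff_gcd_eq_1)?; simp add: gcd_non_0_nat)

lemma totient_198: "totient 198 = 60"
  by (rule totient_mult_eq[of 198 2 99, OF _ _ totient_2 totient_99, THEN trans]; (subst coprime_iff_gcd_eq_1)?; simp add: gcd_non_0_nat)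

text \<open>The distinct prime factors of n multiply to at most n < (k + 1)!, so there are fewer
  than k of them, and the product of the factors 1 - 1 / q is at least 1 / k.\<close>

lemma totient_ge':
  assumes "n < fact (k + 1)" "n > 0" shows "k * totient n \<ge> n"
proof -
  define F where "F = prime_factors n"
  have F: "finite F" "\<forall>q\<in>F. q \<ge> 2" by (auto simp: F_def intro!: prime_ge_2_nat)
  note B = card_distinct_bounds[OF F]
  have "\<Prod>F dvd n"
  proof -
    have "\<Prod>F dvd (\<Prod>q\<in>F. q ^ multiplicity q n)"
      using F assms by (intro prod_dvd_prod) (auto simp: F_def prime_factors_multiplicity intro!: dvd_power)
    also have "\<dots> = n" using assms by (simp add: F_def prime_factorization_nat[symmetric])
    finally show ?thesis .
  qed
  then have "\<Prod>F \<le> n" using assms by (simp add: dvd_imp_le)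
  then have "fact (card F + 1) < (fact (k + 1) :: nat)" using B assms by linarith
  then have c: "card F + 1 < k + 1" by (meson fact_mono_nat not_le)
  then have "1 / real k \<le> 1 / (real (card F) + 1)" by (intro divide_left_mono) auto
  also have "\<dots> \<le> (\<Prod>q\<in>F. 1 - 1 / real q)" using B by blast
  finally have "real n * (1 / real k) \<le> real n * (\<Prod>q\<in>F. 1 - 1 / real q)" by (intro mult_left_mono) auto
  also have "\<dots> = real (totient n)" by (simp add: totient_formula2 F_def)
  finally have "real n \<le> real k * real (totient n)" using c by (simp add: field_simps)
  then show ?thesis by (metis of_nat_le_iff of_nat_mult)
qed

text \<open>(q / 2)^d / p^(q + 1) does not decrease in d and decreases in p, so a single numerical
  check covers a whole range.\<close>

lemma large_height:
  fixes q d d0 p p0 :: nat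
  assumes "2 ^ d0 * p0 ^ (q + 1) < q ^ d0" "d0 \<le> d" "p \<le> p0" "2 \<le> q"
  shows "\<not> real q ^ d \<le> 2 ^ d * real p ^ (q + 1)"
proof
  assume "real q ^ d \<le> 2 ^ d * real p ^ (q + 1)"
  then have "real (q ^ d) \<le> real (2 ^ d * p ^ (q + 1))" by simp
  then have "q ^ d \<le> 2 ^ d * p ^ (q + 1)" by (simp only: of_nat_le_iff)
  also have "\<dots> \<le> 2 ^ d * p0 ^ (q + 1)" using assms by (intro mult_left_mono power_mono) auto
  also have "\<dots> = 2 ^ (d - d0) * (2 ^ d0 * p0 ^ (q + 1))" using assms(2) by (simp flip: power_add)
  also have "\<dots> < 2 ^ (d - d0) * q ^ d0" using assms(1) by simp
  also have "\<dots> \<le> q ^ (d - d0) * q ^ d0" using assms(4) by (intro mult_right_mono power_mono) auto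
  also have "\<dots> = q ^ d" using assms(2) by (simp flip: power_add)
  finally show False by simp
qed

text \<open>Sieving by the primes up to 13 suffices, as 206 < 17^2.\<close>

lemma primes_below_206:
  assumes "prime (p::nat)" "p < 206" "p \<notin> {2, 3, 5, 7, 11, 13, 17, 19, 23, 29, 31, 37, 41, 43, 61, 67, 71, 47, 53, 73, 79}"
  shows "p \<in> {59, 83, 89, 97, 101, 103, 107, 109, 113, 127, 131, 137, 139, 149, 151, 157, 163, 167, 173, 179, 181, 191, 193, 197, 199}"
proof -
  define Q where "Q p \<longleftrightarrow> p mod 2 = 0 \<or> p mod 3 = 0 \<or> p mod 5 = 0 \<or> p mod 7 = 0 \<or> p mod 11 = 0 \<or> p mod 13 = 0 \<or>
     List.member [2, 3, 5, 7, 11, 13, 17, 19, 23, 29, 31, 37, 41, 43, 61, 67, 71, 47, 53, 73, 79, 59, 83, 89, 97, 101, 103, 107, 109, 113, 127, 131, 137, 139, 149, 151, 157, 163, 167, 173, 179, 181, 191, 193, 197, 199] p" for p :: nat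
  have "list_all Q [2..<206]" unfolding Q_def by code_simp
  moreover have "p \<in> set [2..<206]"
    unfolding set_upt atLeastLessThan_iff using assms(2) prime_ge_2_nat[OF assms(1)] by (intro conjI)
  ultimately have "Q p" unfolding list_all_iff by (rule bspec)
  then have *: "p mod 2 = 0 \<or> p mod 3 = 0 \<or> p mod 5 = 0 \<or> p mod 7 = 0 \<or> p mod 11 = 0 \<or> p mod 13 = 0 \<or>
     p \<in> set [2, 3, 5, 7, 11, 13, 17, 19, 23, 29, 31, 37, 41, 43, 61, 67, 71, 47, 53, 73, 79, 59, 83, 89, 97, 101, 103, 107, 109, 113, 127, 131, 137, 139, 149, 151, 157, 163, 167, 173, 179, 181, 191, 193, 197, 199]"
    unfolding Q_def List.member_iff .
  have d: "p = q" if "p mod q = 0" "prime q" for q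
    using that assms(1) by (metis primes_dvd_imp_eq mod_eq_0_iff_dvd)
  have "p \<in> set [2, 3, 5, 7, 11, 13, 17, 19, 23, 29, 31, 37, 41, 43, 61, 67, 71, 47, 53, 73, 79, 59, 83, 89, 97, 101, 103, 107, 109, 113, 127, 131, 137, 139, 149, 151, 157, 163, 167, 173, 179, 181, 191, 193, 197, 199]"
    using * d[of 2] d[of 3] d[of 5] d[of 7] d[of 11] d[of 13] by auto
  then show ?thesis using assms(3) by auto
qed

section \<open>Elimination of the remaining primes below 20000\<close>

context principal_prime
begin

text \<open>Otherwise 2 * 5 * 7 * 11 * 13 = 10010 divides n < 20000, so p = 10011, a multiple of
  3.\<close>

lemma exists_small_prime_nondivisor:
  assumes "p < 20000"
  shows "\<exists>q\<in>{5, 7, 11, 13}. \<not> q dvd n"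
proof (rule ccontr)
  assume "\<not> ?thesis"
  then have "5 dvd n" "7 dvd n" "11 dvd n" "13 dvd n" by auto
  moreover have "2 dvd n"
    using p n2 prime_odd_nat[of p] by (simp add: n_def)
  ultimately have "lcm 2 (lcm 5 (lcm 7 (lcm 11 13))) dvd n" by (intro lcm_least)
  then have "10010 dvd n" by (simp add: lcm_nat_def gcd_non_0_nat)
  then obtain k where k: "n = 10010 * k" by (auto simp: dvd_def)
  then have "k = 1" using assms n2 by (simp add: n_def)
  then have "p = 10011" using k n2 by (simp add: n_def)
  then have "3 dvd p" by presburger
  then have "3 = p" using p by (intro primes_dvd_imp_eq) auto
  then show False using \<open>p = 10011\<close> by linarith
qed

lemma not_large:
  assumes "p < 20000" shows "p < 206"
proof (rule ccontr)
  assume large: "\<not> p < 206"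
  obtain q where q: "q \<in> {5, 7, 11, 13}" "\<not> q dvd n"
    using exists_small_prime_nondivisor[OF assms] by blast
  have "q < n" using q(1) large by (auto simp: n_def)
  moreover have "prime q" using q(1) by auto
  ultimately have *: "real q ^ totient n \<le> 2 ^ totient n * real p ^ (q + 1)" using height_bound q by blast
  have n0: "n > 0" using n2 by simp
  \<comment> \<open>As 20000 < 8! and 526 < 6!, totient n is at least n / 7 and n / 5 respectively.
    The cut points yield totient n at least 75, 48 and 41, enough for all four q; q = 13 is the
    tight case.\<close>
  consider "p \<ge> 526" | "240 < p" "p < 526" | "p \<le> 240" by linarith
  then show False
  proof cases
    case 1
    have "7 * totient n \<ge> n" using totient_ge'[of n 7] assms n0 by (simp add: n_def fact_numeral)
    then have "totient n \<ge> 75" using 1 by (simp add: n_def)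
    then show False using * large_height[of 75 20000 q "totient n" p] assms q(1) by auto
  next
    case 2
    have "5 * totient n \<ge> n" using totient_ge'[of n 5] 2 n0 by (simp add: n_def fact_numeral)
    then have "totient n \<ge> 48" using 2 by (simp add: n_def)
    then show False using * large_height[of 48 526 q "totient n" p] 2 q(1) by auto
  next
    case 3
    have "5 * totient n \<ge> n" using totient_ge'[of n 5] 3 n0 by (simp add: n_def fact_numeral)
    then have "totient n \<ge> 41" using large by (simp add: n_def)
    then show False using * large_height[of 41 240 q "totient n" p] 3 q(1) by auto
  qed
qed

theorem principal_prime_cases:
  assumes "p < 20000"
  shows "p \<in> {2, 3, 5, 7, 11, 13, 17, 19, 23, 29, 31, 37, 41, 43, 61, 67, 71}"
proof (rule ccontr)
  assume R: "p \<notin> {2, 3, 5, 7, 11, 13, 17, 19, 23, 29, 31, 37, 41, 43, 61, 67, 71}"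
  \<comment> \<open>totient 52 = totient 72 = 24, and 5^24 = 125^8 exceeds both 53^8 and
    73^8.\<close>
  have "p \<noteq> 53" using height_bound_4 totient_52 by (auto simp: n_def)
  moreover have "p \<noteq> 73" using height_bound_4 totient_72 by (auto simp: n_def)
  moreover note p_not_47 p_not_79
  ultimately have "p \<in> {59, 83, 89, 97, 101, 103, 107, 109, 113, 127, 131, 137, 139, 149, 151, 157, 163, 167, 173, 179, 181, 191, 193, 197, 199}"
    using primes_below_206[OF p not_large[OF assms]] R by blast
  \<comment> \<open>Each p is excluded by \<open>height_bound\<close> with q = 5, or with q = 7 when
    5 divides p - 1.\<close>
  then consider "p = 59" | "p = 83" | "p = 89" | "p = 97" | "p = 101" | "p = 103" | "p = 107" | "p = 109" | "p = 113" | "p = 127" | "p = 131" | "p = 137" | "p = 139" | "p = 149" | "p = 151" | "p = 157" | "p = 163" | "p = 167" | "p = 173" | "p = 179" | "p = 181" | "p = 191" | "p = 193" | "p = 197" | "p = 199" by blast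
  then show False
  proof cases
    case 1
    then show False using height_bound[of 5] large_height[of "totient n" p 5 "totient n" p]
      by (simp add: n_def totient_58)
  next
    case 2
    then show False using height_bound[of 5] large_height[of "totient n" p 5 "totient n" p]
      by (simp add: n_def totient_82)
  next
    case 3
    then show False using height_bound[of 5] large_height[of "totient n" p 5 "totient n" p]
      by (simp add: n_def totient_88)
  next
    case 4
    then show False using height_bound[of 5] large_height[of "totient n" p 5 "totient n" p]
      by (simp add: n_def totient_96)
  next
    case 5
    then show False using height_bound[of 7] large_height[of "totient n" p 7 "totient n" p]
      by (simp add: n_def totient_100)
  next
    case 6
    then show False using height_bound[of 5] large_height[of "totient n" p 5 "totient n" p]
      by (simp add: n_def totient_102)
  next
    case 7
    then show False using height_bound[of 5] large_height[of "totient n" p 5 "totient n" p]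
      by (simp add: n_def totient_106)
  next
    case 8
    then show False using height_bound[of 5] large_height[of "totient n" p 5 "totient n" p]
      by (simp add: n_def totient_108)
  next
    case 9
    then show False using height_bound[of 5] large_height[of "totient n" p 5 "totient n" p]
      by (simp add: n_def totient_112)
  next
    case 10
    then show False using height_bound[of 5] large_height[of "totient n" p 5 "totient n" p]
      by (simp add: n_def totient_126)
  next
    case 11
    then show False using height_bound[of 7] large_height[of "totient n" p 7 "totient n" p]
      by (simp add: n_def totient_130)
  next
    case 12
    then show False using height_bound[of 5] large_height[of "totient n" p 5 "totient n" p]
      by (simp add: n_def totient_136)
  next
    case 13
    then show False using height_bound[of 5] large_height[of "totient n" p 5 "totient n" p]
      by (simp add: n_def totient_138)
  next
    case 14
    then show False using height_bound[of 5] large_height[of "totient n" p 5 "totient n" p]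
      by (simp add: n_def totient_148)
  next
    case 15
    then show False using height_bound[of 7] large_height[of "totient n" p 7 "totient n" p]
      by (simp add: n_def totient_150)
  next
    case 16
    then show False using height_bound[of 5] large_height[of "totient n" p 5 "totient n" p]
      by (simp add: n_def totient_156)
  next
    case 17
    then show False using height_bound[of 5] large_height[of "totient n" p 5 "totient n" p]
      by (simp add: n_def totient_162)
  next
    case 18
    then show False using height_bound[of 5] large_height[of "totient n" p 5 "totient n" p]
      by (simp add: n_def totient_166)
  next
    case 19
    then show False using height_bound[of 5] large_height[of "totient n" p 5 "totient n" p]
      by (simp add: n_def totient_172)
  next
    case 20
    then show False using height_bound[of 5] large_height[of "totient n" p 5 "totient n" p]
      by (simp add: n_def totient_178)
  next
    case 21
    then show False using height_bound[of 7] large_height[of "totient n" p 7 "totient n" p]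
      by (simp add: n_def totient_180)
  next
    case 22
    then show False using height_bound[of 7] large_height[of "totient n" p 7 "totient n" p]
      by (simp add: n_def totient_190)
  next
    case 23
    then show False using height_bound[of 5] large_height[of "totient n" p 5 "totient n" p]
      by (simp add: n_def totient_192)
  next
    case 24
    then show False using height_bound[of 5] large_height[of "totient n" p 5 "totient n" p]
      by (simp add: n_def totient_196)
  next
    case 25
    then show False using height_bound[of 5] large_height[of "totient n" p 5 "totient n" p]
      by (simp add: n_def totient_198)
  qed
qed

end

section \<open>Polynomial functions and algebraic independence\<close>

text \<open>Polynomials in N variables are carried as functions. Over an infinite domain this loses
  nothing, and substitution becomes composition.\<close>

inductive_set polyf :: "'b::comm_ring_1 set \<Rightarrow> nat \<Rightarrow> ((nat \<Rightarrow> 'b) \<Rightarrow> 'b) set" for K N where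
  const: "c \<in> K \<Longrightarrow> (\<lambda>_. c) \<in> polyf K N"
| proj: "i < N \<Longrightarrow> (\<lambda>t. t i) \<in> polyf K N"
| add: "f \<in> polyf K N \<Longrightarrow> g \<in> polyf K N \<Longrightarrow> (\<lambda>t. f t + g t) \<in> polyf K N"
| mult: "f \<in> polyf K N \<Longrightarrow> g \<in> polyf K N \<Longrightarrow> (\<lambda>t. f t * g t) \<in> polyf K N"

text \<open>A relation at v must be the zero function. With K = \<int> this is independence over
  \<rat>, denominators being cleared.\<close>

definition alg_ind :: "'b::comm_ring_1 set \<Rightarrow> nat \<Rightarrow> (nat \<Rightarrow> 'b) \<Rightarrow> bool" where
  "alg_ind K N v \<longleftrightarrow> (\<forall>f\<in>polyf K N. f v = 0 \<longrightarrow> (\<forall>t. f t = 0))"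

lemma polyf_mono:
  assumes "f \<in> polyf K M" "K \<subseteq> K'" "M \<le> N" shows "f \<in> polyf K' N"
  using assms(1) by induction (use assms(2,3) in \<open>auto intro: polyf.intros\<close>)

lemma polyf_cong:
  assumes "f \<in> polyf K N" "\<And>i. i < N \<Longrightarrow> s i = t i" shows "f s = f t"
  using assms(1) by induction (use assms(2) in auto)

lemma polyf_sum:
  assumes "0 \<in> K" "\<And>i. i \<in> I \<Longrightarrow> f i \<in> polyf K N"
  shows "(\<lambda>t. \<Sum>i\<in>I. f i t) \<in> polyf K N"
  using assms(2)
  by (induction I rule: infinite_finite_induct) (auto intro: polyf.intros assms(1))

lemma polyf_prod:
  assumes "1 \<in> K" "\<And>i. i \<in> I \<Longrightarrow> f i \<in> polyf K N"
  shows "(\<lambda>t. \<Prod>i\<in>I. f i t) \<in> polyf K N"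
  using assms(2)
  by (induction I rule: infinite_finite_induct) (auto intro: polyf.intros assms(1))

lemma polyf_power:
  assumes "1 \<in> K" "f \<in> polyf K N" shows "(\<lambda>t. f t ^ k) \<in> polyf K N"
  by (induction k) (auto intro: polyf.intros assms)

lemma polyf_subst:
  assumes "f \<in> polyf K M" "\<And>i. i < M \<Longrightarrow> phi i \<in> polyf K N"
  shows "(\<lambda>t. f (\<lambda>i. phi i t)) \<in> polyf K N"
  using assms(1) by induction (use assms(2) in \<open>auto intro: polyf.intros\<close>)

lemma polyf_line:
  fixes a b :: "nat \<Rightarrow> 'b::comm_ring_1"
  assumes "f \<in> polyf K N"
  shows "\<exists>P. \<forall>s. f (\<lambda>i. a i + s * b i) = poly P s"
  using assms
proof induction
  case (const c)
  show ?case by (intro exI[of _ "[:c:]"]) simp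
next
  case (proj i)
  show ?case by (intro exI[of _ "[:a i, b i:]"]) simp
next
  case (add f g)
  then obtain P Q where "\<forall>s. f (\<lambda>i. a i + s * b i) = poly P s" "\<forall>s. g (\<lambda>i. a i + s * b i) = poly Q s" by blast
  then show ?case by (intro exI[of _ "P + Q"]) simp
next
  case (mult f g)
  then obtain P Q where "\<forall>s. f (\<lambda>i. a i + s * b i) = poly P s" "\<forall>s. g (\<lambda>i. a i + s * b i) = poly Q s" by blast
  then show ?case by (intro exI[of _ "P * Q"]) simp
qed

lemma polyf_coord:
  fixes t :: "nat \<Rightarrow> 'b::comm_ring_1"
  assumes "f \<in> polyf K N"
  shows "\<exists>P. \<forall>s. f (t(j := s)) = poly P s"
proof -
  obtain P where P: "\<forall>s. f (\<lambda>i. (t(j := 0)) i + s * (if i = j then 1 else 0)) = poly P s"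
    using polyf_line[OF assms] by metis
  have "(\<lambda>i. (t(j := 0)) i + s * (if i = j then 1 else 0)) = t(j := s)" for s by auto
  then show ?thesis using P by metis
qed

lemma poly_zero_infinite:
  fixes P :: "'b::idom poly"
  assumes "infinite Z" "\<And>z. z \<in> Z \<Longrightarrow> poly P z = 0"
  shows "P = 0"
proof (rule ccontr)
  assume "P \<noteq> 0"
  then have "finite {x. poly P x = 0}" by (rule poly_roots_finite)
  then show False using assms by (meson finite_subset mem_Collect_eq subsetI)
qed

text \<open>The coordinates 0, ..., j - 1 are released from Z one at a time: in each of them f is a
  univariate polynomial with infinitely many zeros.\<close>

lemma polyf_zero_grid:
  fixes f :: "(nat \<Rightarrow> 'b::idom) \<Rightarrow> 'b"
  assumes f: "f \<in> polyf K N" and Z: "infinite Z"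
    and z: "\<And>t. (\<And>i. i < N \<Longrightarrow> t i \<in> Z) \<Longrightarrow> f t = 0"
  shows "f t = 0"
proof -
  have "\<forall>t. (\<forall>i. j \<le> i \<and> i < N \<longrightarrow> t i \<in> Z) \<longrightarrow> f t = 0" if "j \<le> N" for j
    using that
  proof (induction j)
    case 0
    then show ?case using z by auto
  next
    case (Suc j)
    show ?case
    proof (intro allI impI)
      fix t assume t: "\<forall>i. Suc j \<le> i \<and> i < N \<longrightarrow> t i \<in> Z"
      obtain P where P: "\<forall>s. f (t(j := s)) = poly P s" using polyf_coord[OF f] by blast
      have "poly P s = 0" if "s \<in> Z" for s
      proof -
        have "\<forall>i. j \<le> i \<and> i < N \<longrightarrow> (t(j := s)) i \<in> Z" using t that by auto
        then show ?thesis using Suc P by (metis Suc_leD)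
      qed
      then have "P = 0" by (rule poly_zero_infinite[OF Z])
      then show "f t = 0" using P by (metis fun_upd_triv poly_0)
    qed
  qed
  from this[of N] show ?thesis by (meson not_le order_refl)
qed

text \<open>Join a point where f is nonzero to one where g is nonzero. On that line both restrict to
  nonzero univariate polynomials, yet their product is 0 at infinitely many points.\<close>

lemma polyf_domain:
  fixes f g :: "(nat \<Rightarrow> 'b::{idom,ring_char_0}) \<Rightarrow> 'b"
  assumes "f \<in> polyf K N" "g \<in> polyf K N" "\<And>t. f t * g t = 0"
  shows "(\<forall>t. f t = 0) \<or> (\<forall>t. g t = 0)"
proof (rule ccontr)
  assume "\<not> ?thesis"
  then obtain x y where xy: "f x \<noteq> 0" "g y \<noteq> 0" by blast
  let ?l = "\<lambda>s i. x i + s * (y i - x i)"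
  obtain P where P: "\<forall>s. f (?l s) = poly P s" using polyf_line[OF assms(1), of x "\<lambda>i. y i - x i"] by blast
  obtain Q where Q: "\<forall>s. g (?l s) = poly Q s" using polyf_line[OF assms(2), of x "\<lambda>i. y i - x i"] by blast
  have "P * Q = 0" by (rule poly_zero_infinite[OF infinite_UNIV_char_0]) (metis P Q assms(3) poly_mult)
  then have "P = 0 \<or> Q = 0" by simp
  moreover have "poly P 0 = f x" using P[rule_format, of 0] by simp
  moreover have "poly Q 1 = g y" using Q[rule_format, of 1] by simp
  ultimately show False using xy by auto
qed

lemma polyf_domain_prod:
  fixes f :: "'i \<Rightarrow> (nat \<Rightarrow> 'b::{idom,ring_char_0}) \<Rightarrow> 'b"
  assumes "finite I" "1 \<in> K" "\<And>i. i \<in> I \<Longrightarrow> f i \<in> polyf K N" "\<And>t. (\<Prod>i\<in>I. f i t) = 0"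
  shows "\<exists>i\<in>I. \<forall>t. f i t = 0"
  using assms(1,3,4)
proof (induction I rule: finite_induct)
  case (insert i I)
  have "(\<forall>t. f i t = 0) \<or> (\<forall>t. (\<Prod>i\<in>I. f i t) = 0)"
    by (rule polyf_domain[of _ K N]) (use insert in \<open>auto intro!: polyf_prod assms(2)\<close>)
  then show ?case using insert by auto
qed simp

lemma polyf_split:
  assumes "f \<in> polyf K (Suc N)" "0 \<in> K" "1 \<in> K"
  shows "\<exists>d g. (\<forall>l. g l \<in> polyf K N) \<and> (\<forall>t x. f (t(N := x)) = (\<Sum>l<d. g l t * x ^ l))"
  using assms(1)
proof induction
  case (const c)
  show ?case
    by (rule exI[of _ 1], rule exI[of _ "\<lambda>_ _. c"]) (use const in \<open>auto intro: polyf.intros\<close>)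
next
  case (proj i)
  show ?case
  proof (cases "i = N")
    case True
    show ?thesis
      by (rule exI[of _ 2], rule exI[of _ "\<lambda>l t. if l = 1 then 1 else 0"])
        (use True assms(2,3) in \<open>auto simp: eval_nat_numeral intro: polyf.const\<close>)
  next
    case False
    then have "i < N" using proj by simp
    then show ?thesis
      by (intro exI[of _ 1] exI[of _ "\<lambda>l t. t i"]) (auto intro: polyf.intros)
  qed
next
  case (add f g)
  then obtain d a e b where a: "\<forall>l. a l \<in> polyf K N" "\<forall>t x. f (t(N := x)) = (\<Sum>l<d. a l t * x ^ l)"
    and b: "\<forall>l. b l \<in> polyf K N" "\<forall>t x. g (t(N := x)) = (\<Sum>l<e. b l t * x ^ l)" by blast
  define a' where "a' l = (if l < d then a l else (\<lambda>_. 0))" for l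
  define b' where "b' l = (if l < e then b l else (\<lambda>_. 0))" for l
  have a': "f (t(N := x)) = (\<Sum>l<d+e. a' l t * x ^ l)" for t x
    unfolding a(2)[rule_format] a'_def by (rule sum.mono_neutral_cong_left) auto
  have b': "g (t(N := x)) = (\<Sum>l<d+e. b' l t * x ^ l)" for t x
    unfolding b(2)[rule_format] b'_def by (rule sum.mono_neutral_cong_left) auto
  have "a' l \<in> polyf K N" "b' l \<in> polyf K N" for l
    using a(1) b(1) polyf.const[OF assms(2)] by (auto simp: a'_def b'_def)
  then have "(\<lambda>t. a' l t + b' l t) \<in> polyf K N" for l by (intro polyf.add)
  moreover have "f (t(N := x)) + g (t(N := x)) = (\<Sum>l<d+e. (a' l t + b' l t) * x ^ l)" for t x
    unfolding a' b' by (simp add: sum.distrib distrib_right)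
  ultimately show ?case by (intro exI[of _ "d + e"] exI[of _ "\<lambda>l t. a' l t + b' l t"] conjI allI)
next
  case (mult f g)
  then obtain d a e b where a: "\<forall>l. a l \<in> polyf K N" "\<forall>t x. f (t(N := x)) = (\<Sum>l<d. a l t * x ^ l)"
    and b: "\<forall>l. b l \<in> polyf K N" "\<forall>t x. g (t(N := x)) = (\<Sum>l<e. b l t * x ^ l)" by blast
  define c where "c k t = (\<Sum>(i,j)\<in>{(i,j). i < d \<and> j < e \<and> i + j = k}. a i t * b j t)" for k t
  have fin: "finite {(i,j). i < d \<and> j < e \<and> i + j = k}" for k
    by (rule finite_subset[of _ "{..<d} \<times> {..<e}"]) auto
  have "f (t(N := x)) * g (t(N := x)) = (\<Sum>k<d+e. c k t * x ^ k)" for t x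
  proof -
    have "f (t(N := x)) * g (t(N := x)) = (\<Sum>(i,j)\<in>{..<d} \<times> {..<e}. a i t * b j t * x ^ (i + j))"
      unfolding a(2)[rule_format] b(2)[rule_format] sum_product sum.cartesian_product
      by (intro sum.cong) (auto simp: power_add algebra_simps)
    also have "\<dots> = (\<Sum>k<d+e. \<Sum>(i,j)\<in>{ij\<in>{..<d} \<times> {..<e}. fst ij + snd ij = k}. a i t * b j t * x ^ (i + j))"
      by (rule sum.group[symmetric]) auto
    also have "\<dots> = (\<Sum>k<d+e. c k t * x ^ k)"
      unfolding c_def sum_distrib_right by (intro sum.cong) auto
    finally show ?thesis .
  qed
  moreover have "c k \<in> polyf K N" for k
    unfolding c_def case_prod_unfold using a(1) b(1) assms(2) by (intro polyf_sum polyf.mult) auto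
  ultimately show ?case by blast
qed

text \<open>The ring K[v_0, ..., v_(N-1)] inside the ambient ring.\<close>

definition PR :: "'b::comm_ring_1 set \<Rightarrow> nat \<Rightarrow> (nat \<Rightarrow> 'b) \<Rightarrow> 'b set" where
  "PR K N v = {f v | f. f \<in> polyf K N}"

lemma alg_indD: "alg_ind K N v \<Longrightarrow> f \<in> polyf K N \<Longrightarrow> f v = 0 \<Longrightarrow> f t = 0"
  by (auto simp: alg_ind_def)

lemma alg_ind_less: "alg_ind K N v \<Longrightarrow> M \<le> N \<Longrightarrow> alg_ind K M v"
  unfolding alg_ind_def by (meson order_refl polyf_mono)

text \<open>This makes \<open>PR\<close> an iterated univariate polynomial ring, to which Gauss's
  theorem can be applied step by step.\<close>

lemma alg_ind_transcendental:
  fixes v :: "nat \<Rightarrow> 'b::{idom,ring_char_0}"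
  assumes ind: "alg_ind K (Suc N) v" and K: "0 \<in> K" "1 \<in> K"
    and P: "\<And>i. coeff P i \<in> PR K N v" and 0: "poly P (v N) = 0"
  shows "P = 0"
proof -
  have "\<forall>i. \<exists>f. f \<in> polyf K N \<and> coeff P i = f v" using P unfolding PR_def by blast
  then obtain f where f: "\<And>i. f i \<in> polyf K N" "\<And>i. coeff P i = f i v" by metis
  define F where "F t = (\<Sum>i\<le>degree P. f i t * t N ^ i)" for t
  have "F \<in> polyf K (Suc N)" unfolding F_def
    by (intro polyf_sum polyf.mult polyf_power K polyf.proj polyf_mono[OF f(1)]) auto
  moreover have "F v = 0" using 0 by (simp add: F_def f(2)[symmetric] poly_altdef)
  ultimately have F0: "F t = 0" for t using ind by (auto simp: alg_ind_def)
  have "(\<Sum>i\<le>degree P. monom (f i v) i) = 0"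
  proof (rule poly_zero_infinite[OF infinite_UNIV_char_0])
    fix s
    have "F (v(N := s)) = (\<Sum>i\<le>degree P. f i v * s ^ i)"
      unfolding F_def by (intro sum.cong) (auto intro!: arg_cong2[of _ _ _ _ "(*)"] polyf_cong[OF f(1)])
    then show "poly (\<Sum>i\<le>degree P. monom (f i v) i) s = 0" by (simp add: F0 poly_sum poly_monom)
  qed
  then show "P = 0" by (simp add: f(2)[symmetric] poly_as_sum_of_monoms)
qed

text \<open>Specializing the other variables to integers turns a relation involving a root of unity
  into an integer polynomial, to which \<open>conj_root\<close> applies.\<close>

lemma polyf_int_point:
  fixes v :: "nat \<Rightarrow> 'b::comm_ring_1"
  assumes "f \<in> polyf \<int> (Suc N)" "\<And>i. i < N \<Longrightarrow> v i \<in> \<int>"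
  shows "\<exists>F. \<forall>x. f (v(N := x)) = ipoly F x"
  using assms(1)
proof induction
  case (const c)
  then obtain m where "c = of_int m" by (auto elim: Ints_cases)
  then show ?case by (intro exI[of _ "[:m:]"]) simp
next
  case (proj i)
  show ?case
  proof (cases "i = N")
    case True
    then show ?thesis by (intro exI[of _ "[:0,1:]"]) simp
  next
    case False
    then obtain m where "v i = of_int m" using assms(2)[of i] proj by (auto elim: Ints_cases)
    then show ?thesis using False by (intro exI[of _ "[:m:]"]) simp
  qed
next
  case (add f g)
  then show ?case by (metis ipoly_add)
next
  case (mult f g)
  then show ?case by (metis ipoly_mult)
qed

section \<open>Independence over \<rat>(z), for z a root of unity\<close>

definition QF :: "'b::field_char_0 \<Rightarrow> 'b set" where
  "QF z = {ipoly r z / ipoly s z | r s. ipoly s z \<noteq> 0}"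

lemma QF_ipoly: "ipoly r z \<in> QF z"
  unfolding QF_def using ipoly_1[of z] by (metis (mono_tags, lifting) CollectI div_by_1 zero_neq_one)

lemma QF_of_int: "of_int c \<in> QF z"
  using QF_ipoly[of "[:c:]" z] by simp

lemma QF_0: "0 \<in> QF z" and QF_1: "1 \<in> QF z"
  using QF_of_int[of 0 z] QF_of_int[of 1 z] by auto

lemma QF_mult: "x \<in> QF z \<Longrightarrow> y \<in> QF z \<Longrightarrow> x * y \<in> QF z"
  unfolding QF_def by clarsimp (metis ipoly_mult mult_eq_0_iff)

lemma QF_add: "x \<in> QF z \<Longrightarrow> y \<in> QF z \<Longrightarrow> x + y \<in> QF z"
proof -
  assume "x \<in> QF z" "y \<in> QF z"
  then obtain r s r' s' where *: "x = ipoly r z / ipoly s z" "ipoly s z \<noteq> 0"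
    "y = ipoly r' z / ipoly s' z" "ipoly s' z \<noteq> 0" by (auto simp: QF_def)
  then have "x + y = ipoly (r * s' + r' * s) z / ipoly (s * s') z"
    unfolding *(1,3) add_frac_eq[OF *(2,4)] by simp
  moreover have "ipoly (s * s') z \<noteq> 0" using * by simp
  ultimately show ?thesis unfolding QF_def by blast
qed

lemma QF_inverse: "x \<in> QF z \<Longrightarrow> inverse x \<in> QF z"
proof -
  assume "x \<in> QF z"
  then obtain r s where *: "x = ipoly r z / ipoly s z" "ipoly s z \<noteq> 0" by (auto simp: QF_def)
  show ?thesis
  proof (cases "ipoly r z = 0")
    case True
    then show ?thesis using * QF_0 by simp
  next
    case False
    moreover have "inverse x = ipoly s z / ipoly r z" using * by simp
    ultimately show ?thesis unfolding QF_def by blast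
  qed
qed

lemma QF_minus: "x \<in> QF z \<Longrightarrow> - x \<in> QF z"
  using QF_mult[OF QF_of_int[of "-1"], of x] by simp

lemma QF_subfield: "is_subfield (QF z)"
  unfolding is_subfield_def
  using QF_0 QF_1 QF_add QF_mult QF_inverse QF_minus
  by (metis add_uminus_conv_diff)

lemma Ints_subset_QF: "\<int> \<subseteq> QF z" by (auto elim!: Ints_cases intro: QF_of_int)

lemma polyf_ipoly: "f \<in> polyf \<int> N \<Longrightarrow> (\<lambda>t. ipoly r (f t)) \<in> polyf \<int> N"
  by (induction r) (auto intro!: polyf.intros)

text \<open>Denominators are cleared and z becomes the extra variable of index N, so that
  conjugation is a change of that variable.\<close>

lemma QF_lift:
  fixes z :: "'b::field_char_0"
  assumes "f \<in> polyf (QF z) N"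
  shows "\<exists>F s. F \<in> polyf \<int> (Suc N) \<and> ipoly s z \<noteq> 0 \<and> (\<forall>t. ipoly s z * f t = F (t(N := z)))"
  using assms
proof induction
  have ip: "(\<lambda>t. ipoly r (t N)) \<in> polyf \<int> (Suc N)" for r :: "int poly"
    by (intro polyf_ipoly polyf.proj) simp
  {
    case (const c)
    then obtain r s where *: "c = ipoly r z / ipoly s z" "ipoly s z \<noteq> 0" by (auto simp: QF_def)
    then show ?case
      by (intro exI[of _ "\<lambda>t. ipoly r (t N)"] exI[of _ s]) (auto intro: ip)
  next
    case (proj i)
    then show ?case by (intro exI[of _ "\<lambda>t. t i"] exI[of _ 1]) (auto intro: polyf.intros)
  next
    case (add f g)
    then obtain F r G s where FG: "F \<in> polyf \<int> (Suc N)" "ipoly r z \<noteq> 0" "\<forall>t. ipoly r z * f t = F (t(N := z))"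
      "G \<in> polyf \<int> (Suc N)" "ipoly s z \<noteq> 0" "\<forall>t. ipoly s z * g t = G (t(N := z))" by blast
    let ?H = "\<lambda>t. ipoly s (t N) * F t + ipoly r (t N) * G t"
    have "ipoly (r * s) z * (f t + g t) = ?H (t(N := z))" for t
      using FG(3,6)[rule_format, of t, symmetric] by (simp add: algebra_simps)
    moreover have "?H \<in> polyf \<int> (Suc N)" using FG by (intro polyf.intros ip)
    moreover have "ipoly (r * s) z \<noteq> 0" using FG by simp
    ultimately show ?case by blast
  next
    case (mult f g)
    then obtain F r G s where FG: "F \<in> polyf \<int> (Suc N)" "ipoly r z \<noteq> 0" "\<forall>t. ipoly r z * f t = F (t(N := z))"
      "G \<in> polyf \<int> (Suc N)" "ipoly s z \<noteq> 0" "\<forall>t. ipoly s z * g t = G (t(N := z))" by blast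
    let ?H = "\<lambda>t. F t * G t"
    have "ipoly (r * s) z * (f t * g t) = ?H (t(N := z))" for t
      using FG(3,6)[rule_format, of t, symmetric] by (simp add: algebra_simps)
    moreover have "?H \<in> polyf \<int> (Suc N)" using FG by (intro polyf.intros)
    moreover have "ipoly (r * s) z \<noteq> 0" using FG by simp
    ultimately show ?case by blast
  }
qed

lemma polyf_fix_last:
  assumes "F \<in> polyf \<int> (Suc N)" "z \<in> K" "\<int> \<subseteq> K"
  shows "(\<lambda>t. F (t(N := z))) \<in> polyf K N"
proof -
  have "(\<lambda>t. F (\<lambda>i. (if i = N then (\<lambda>_. z) else (\<lambda>t. t i)) t)) \<in> polyf K N"
  proof (rule polyf_subst[OF polyf_mono[OF assms(1,3) order_refl]])
    fix i assume "i < Suc N"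
    then show "(if i = N then (\<lambda>_. z) else (\<lambda>t. t i)) \<in> polyf K N"
      using polyf.const[OF assms(2)] by (cases "i = N") (auto intro: polyf.proj)
  qed
  moreover have "(\<lambda>i. (if i = N then (\<lambda>_. z) else (\<lambda>t. t i)) t) = t(N := z)" for t by auto
  ultimately show ?thesis by simp
qed

lemma trace_root_of_unity_int:
  fixes z :: "'b::field_char_0"
  assumes "prt n z" shows "(\<Sum>k\<in>totatives n. z ^ (k * l)) \<in> \<int>"
proof -
  have "(\<Sum>k\<in>totatives n. z ^ (k * l)) = ipoly (\<Sum>k\<in>totatives n. monom 1 (k * l)) z"
    by (simp add: ipoly_sum)
  moreover have "n > 0" "z ^ n = 1" using assms by (auto simp: prt_def)
  ultimately show ?thesis
    using trace_root_of_unity_rat[OF assms, of l] rat_ipoly_root_of_unity_int[of n z] by simp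
qed

lemma infinite_Ints: "infinite (\<int> :: 'b::ring_char_0 set)"
proof -
  have "inj (of_int :: int \<Rightarrow> 'b)" by (simp add: inj_def)
  then have "infinite (range (of_int :: int \<Rightarrow> 'b))" using infinite_UNIV_int by (metis finite_imageD)
  then show ?thesis by (simp add: Ints_def)
qed

lemma infinite_Ints_nonzero: "infinite (\<int> - {0} :: 'b::ring_char_0 set)"
  using infinite_Ints by simp

text \<open>Expanded in the last variable, the sum over the conjugates involves z only through
  traces of powers of z, which are integers.\<close>

lemma polyf_trace:
  fixes z :: "'b::field_char_0"
  assumes z: "prt n z" and F: "F \<in> polyf \<int> (Suc N)"
  shows "(\<lambda>t. \<Sum>k\<in>totatives n. F (t(N := z ^ k))) \<in> polyf \<int> N"
proof -
  obtain d g where g: "\<forall>l. g l \<in> polyf \<int> N" "\<forall>t x. F (t(N := x)) = (\<Sum>l<d. g l t * x ^ l)"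
    using polyf_split[OF F] by auto
  have "(\<Sum>k\<in>totatives n. F (t(N := z ^ k))) = (\<Sum>l<d. g l t * (\<Sum>k\<in>totatives n. z ^ (k * l)))" for t
    unfolding g(2)[rule_format] sum_distrib_left by (subst sum.swap) (simp add: power_mult)
  then show ?thesis using g(1) trace_root_of_unity_int[OF z]
    by (simp only:) (intro polyf_sum polyf.mult polyf.const, auto)
qed

text \<open>Vanishing can be tested at integer points, and there it is a statement about an integer
  polynomial at conjugate roots of unity.\<close>

lemma polyf_conj_zero:
  fixes z :: "'b::field_char_0"
  assumes z: "prt n z" and F: "F \<in> polyf \<int> (Suc N)" and j: "coprime j n" and i: "coprime i n"
    and 0: "\<And>t. F (t(N := z ^ i)) = 0"
  shows "F (t(N := z ^ j)) = 0"
proof (rule polyf_zero_grid[where f = "\<lambda>t. F (t(N := z ^ j))" and t = t and Z = \<int>])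
  show "infinite (\<int> :: 'b set)" by (rule infinite_Ints)
  show "(\<lambda>t. F (t(N := z ^ j))) \<in> polyf (QF z) N"
    using F Ints_subset_QF[of z] QF_ipoly[of "monom 1 j" z] by (intro polyf_fix_last) auto
  fix t :: "nat \<Rightarrow> 'b" assume "\<And>i. i < N \<Longrightarrow> t i \<in> \<int>"
  then obtain G where G: "\<forall>x. F (t(N := x)) = ipoly G x" using polyf_int_point[OF F] by blast
  then have "ipoly G (z ^ i) = 0" using 0 by metis
  then have "ipoly G z = 0" using conj_root_iff[OF z i] by simp
  then show "F (t(N := z ^ j)) = 0" using conj_root_iff[OF z j] G by simp
qed

text \<open>The norm of a relation over \<rat>(z) is, up to a factor, a relation over \<int>, hence
  identically zero. Then one conjugate factor is identically zero, and so is the original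
  relation.\<close>

lemma alg_ind_QF:
  fixes z :: "'b::field_char_0"
  assumes z: "prt n z" "n > 1" and v: "alg_ind \<int> N v"
  shows "alg_ind (QF z) N v"
  unfolding alg_ind_def
proof (intro ballI impI allI)
  fix f t assume f: "f \<in> polyf (QF z) N" and fv: "f v = 0"
  obtain F s where F: "F \<in> polyf \<int> (Suc N)" and s: "ipoly s z \<noteq> 0" and Fs: "\<forall>t. ipoly s z * f t = F (t(N := z))"
    using QF_lift[OF f] by blast
  define H where "H t = (\<Prod>j\<in>totatives n. F (t(N := t N ^ j)))" for t
  have H: "H \<in> polyf \<int> (Suc N)" unfolding H_def
  proof (intro polyf_prod)
    fix j
    have "(\<lambda>t. F (\<lambda>i. (if i = N then (\<lambda>t. t N ^ j) else (\<lambda>t. t i)) t)) \<in> polyf \<int> (Suc N)"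
    proof (rule polyf_subst[OF F])
      fix i assume "i < Suc N"
      then show "(if i = N then (\<lambda>t. t N ^ j) else (\<lambda>t. t i)) \<in> polyf \<int> (Suc N)"
        using polyf_power[OF _ polyf.proj[of N "Suc N" \<int>], of j] by (cases "i = N") (auto intro: polyf.proj)
    qed
    moreover have "(\<lambda>i. (if i = N then (\<lambda>t. t N ^ j) else (\<lambda>t. t i)) t) = t(N := t N ^ j)" for t :: "nat \<Rightarrow> 'b" by auto
    ultimately show "(\<lambda>t. F (t(N := t N ^ j))) \<in> polyf \<int> (Suc N)" by simp
  qed simp
  have Hk: "H (t(N := z ^ k)) = (\<Prod>j\<in>totatives n. F (t(N := z ^ j)))" if "coprime k n" for k t
    unfolding H_def using prod_conj_shift[OF z that, of "\<lambda>x. F (t(N := x))"] by simp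
  \<comment> \<open>Conjugation permutes the factors of H, so its trace is totient n times the norm.
    By \<open>polyf_trace\<close> this is a polynomial function with integer coefficients.\<close>
  have tr: "(\<Sum>k\<in>totatives n. H (t(N := z ^ k))) = of_nat (totient n) * (\<Prod>j\<in>totatives n. F (t(N := z ^ j)))" for t
    using Hk by (simp add: totient_def in_totatives_iff)
  have one: "1 \<in> totatives n" using z(2) by simp
  have "(\<Prod>j\<in>totatives n. F (v(N := z ^ j))) = 0"
  proof (rule prod_zero)
    have "F (v(N := z ^ 1)) = 0" using Fs[rule_format, of v] fv by simp
    then show "\<exists>j\<in>totatives n. F (v(N := z ^ j)) = 0" using one by blast
  qed simp
  then have "(\<Sum>k\<in>totatives n. H (v(N := z ^ k))) = 0" unfolding tr by simp
  then have "(\<Sum>k\<in>totatives n. H (t(N := z ^ k))) = 0" for t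
    by (rule alg_indD[OF v polyf_trace[OF z(1) H]])
  then have P0: "(\<Prod>j\<in>totatives n. F (t(N := z ^ j))) = 0" for t
    unfolding tr using z(2) by simp
  have "\<exists>j\<in>totatives n. \<forall>t. F (t(N := z ^ j)) = 0"
  proof (rule polyf_domain_prod[of _ "QF z" _ N])
    fix j
    show "(\<lambda>t. F (t(N := z ^ j))) \<in> polyf (QF z) N"
      using F Ints_subset_QF[of z] QF_ipoly[of "monom 1 j" z] by (intro polyf_fix_last) auto
  qed (use P0 QF_1 in auto)
  then obtain j where j: "coprime j n" "\<And>t. F (t(N := z ^ j)) = 0" by (auto simp: in_totatives_iff)
  have "F (t(N := z ^ 1)) = 0" by (rule polyf_conj_zero[OF z(1) F _ j(1) j(2)]) simp
  then show "f t = 0" using Fs s by (metis mult_eq_0_iff power_one_right)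
qed

section \<open>Domains with prime factorization\<close>

definition subrng :: "'a::comm_ring_1 set \<Rightarrow> bool" where
  "subrng D \<longleftrightarrow> 0 \<in> D \<and> 1 \<in> D \<and> (\<forall>x\<in>D. \<forall>y\<in>D. x + y \<in> D \<and> x - y \<in> D \<and> x * y \<in> D)"

definition ddvd :: "'a::comm_ring_1 set \<Rightarrow> 'a \<Rightarrow> 'a \<Rightarrow> bool" where
  "ddvd D x y \<longleftrightarrow> (\<exists>z\<in>D. y = x * z)"

definition unts :: "'a::comm_ring_1 set \<Rightarrow> 'a set" where
  "unts D = {x\<in>D. \<exists>y\<in>D. x * y = 1}"

definition primel :: "'a::comm_ring_1 set \<Rightarrow> 'a \<Rightarrow> bool" where
  "primel D q \<longleftrightarrow> q \<in> D \<and> q \<noteq> 0 \<and> q \<notin> unts D \<and>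
     (\<forall>x\<in>D. \<forall>y\<in>D. ddvd D q (x * y) \<longrightarrow> ddvd D q x \<or> ddvd D q y)"

text \<open>Factorial domains, as subsets of an ambient ring. A factorization into prime elements is
  unique automatically, so there is no clause for uniqueness.\<close>

definition PFD :: "'a::comm_ring_1 set \<Rightarrow> bool" where
  "PFD D \<longleftrightarrow> subrng D \<and>
     (\<forall>x\<in>D. x \<noteq> 0 \<longrightarrow> (\<exists>u\<in>unts D. \<exists>qs. (\<forall>q\<in>set qs. primel D q) \<and> x = u * prod_list qs))"

lemma subrngD:
  assumes "subrng D"
  shows "0 \<in> D" "1 \<in> D" "x \<in> D \<Longrightarrow> y \<in> D \<Longrightarrow> x + y \<in> D" "x \<in> D \<Longrightarrow> y \<in> D \<Longrightarrow> x - y \<in> D"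
    "x \<in> D \<Longrightarrow> y \<in> D \<Longrightarrow> x * y \<in> D"
  using assms by (auto simp: subrng_def)

lemma subrng_uminus: "subrng D \<Longrightarrow> x \<in> D \<Longrightarrow> - x \<in> D"
  unfolding subrng_def by (metis diff_0)

lemma subrng_sum: "subrng D \<Longrightarrow> (\<And>i. i \<in> I \<Longrightarrow> f i \<in> D) \<Longrightarrow> (\<Sum>i\<in>I. f i) \<in> D"
  by (induction I rule: infinite_finite_induct) (auto simp: subrng_def)

lemma subrng_prod: "subrng D \<Longrightarrow> (\<And>i. i \<in> I \<Longrightarrow> f i \<in> D) \<Longrightarrow> (\<Prod>i\<in>I. f i) \<in> D"
  by (induction I rule: infinite_finite_induct) (auto simp: subrng_def)

lemma subrng_power: "subrng D \<Longrightarrow> x \<in> D \<Longrightarrow> x ^ k \<in> D"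
  by (induction k) (auto simp: subrng_def)

lemma subrng_prod_list: "subrng D \<Longrightarrow> set xs \<subseteq> D \<Longrightarrow> prod_list xs \<in> D"
  by (induction xs) (auto simp: subrng_def)

lemma unts_mult: "subrng D \<Longrightarrow> x \<in> unts D \<Longrightarrow> y \<in> unts D \<Longrightarrow> x * y \<in> unts D"
proof -
  assume D: "subrng D" and "x \<in> unts D" "y \<in> unts D"
  then obtain a b where ab: "a \<in> D" "b \<in> D" "x * a = 1" "y * b = 1" "x \<in> D" "y \<in> D" by (auto simp: unts_def)
  have "x * y * (a * b) = (x * a) * (y * b)" by (simp add: algebra_simps)
  then have "x * y * (a * b) = 1" by (simp add: ab)
  then show ?thesis using ab D by (auto simp: unts_def subrng_def)
qed

lemma unts_1: "subrng D \<Longrightarrow> 1 \<in> unts D" by (auto simp: unts_def subrng_def)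

lemma unts_factor: "subrng D \<Longrightarrow> x \<in> D \<Longrightarrow> y \<in> D \<Longrightarrow> x * y \<in> unts D \<Longrightarrow> x \<in> unts D"
  unfolding unts_def by (auto simp: mult.assoc) (metis subrngD(5))

lemma ddvd_refl: "subrng D \<Longrightarrow> ddvd D x x"
  unfolding ddvd_def using subrngD(2) by (intro bexI[of _ 1]) auto

lemma ddvd_trans: "subrng D \<Longrightarrow> ddvd D x y \<Longrightarrow> ddvd D y z \<Longrightarrow> ddvd D x z"
  unfolding ddvd_def using subrngD(5) by (metis mult.assoc)

lemma ddvd_mult: "subrng D \<Longrightarrow> y \<in> D \<Longrightarrow> ddvd D x z \<Longrightarrow> ddvd D x (z * y)"
  unfolding ddvd_def using subrngD(5) by (metis mult.assoc)

lemma ddvd_add: "subrng D \<Longrightarrow> ddvd D x y \<Longrightarrow> ddvd D x z \<Longrightarrow> ddvd D x (y + z)"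
  unfolding ddvd_def using subrngD(3) by (metis distrib_left)

lemma ddvd_diff: "subrng D \<Longrightarrow> ddvd D x y \<Longrightarrow> ddvd D x z \<Longrightarrow> ddvd D x (y - z)"
  unfolding ddvd_def using subrngD(4) by (metis right_diff_distrib)

lemma ddvd_0: "subrng D \<Longrightarrow> ddvd D x 0"
  unfolding ddvd_def using subrngD(1) by (intro bexI[of _ 0]) auto

lemma ddvd_sum: "subrng D \<Longrightarrow> (\<And>i. i \<in> I \<Longrightarrow> ddvd D x (f i)) \<Longrightarrow> ddvd D x (\<Sum>i\<in>I. f i)"
  by (induction I rule: infinite_finite_induct) (auto intro: ddvd_0 ddvd_add)

lemma primelD:
  assumes "primel D q" shows "q \<in> D" "q \<noteq> 0" "q \<notin> unts D"
    "x \<in> D \<Longrightarrow> y \<in> D \<Longrightarrow> ddvd D q (x * y) \<Longrightarrow> ddvd D q x \<or> ddvd D q y"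
  using assms by (auto simp: primel_def)

lemma not_ddvd_unit:
  assumes "subrng D" "primel D q" "u \<in> unts D" shows "\<not> ddvd D q u"
proof
  assume "ddvd D q u"
  then obtain z where "z \<in> D" "u = q * z" by (auto simp: ddvd_def)
  then show False using unts_factor[OF assms(1), of q z] primelD[OF assms(2)] assms(3) by auto
qed

lemma primel_ddvd_prod_list:
  assumes "subrng D" "primel D q" "set xs \<subseteq> D" "ddvd D q (prod_list xs)"
  shows "\<exists>x\<in>set xs. ddvd D q x"
  using assms(3,4)
proof (induction xs)
  case Nil
  then show ?case using not_ddvd_unit[OF assms(1,2) unts_1[OF assms(1)]] by simp
next
  case (Cons x xs)
  then have "ddvd D q x \<or> ddvd D q (prod_list xs)"
    using primelD(4)[OF assms(2), of x "prod_list xs"] subrng_prod_list[OF assms(1), of xs] by simp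
  then show ?case using Cons by auto
qed

lemma primel_assoc:
  fixes D :: "'a::idom set"
  assumes "subrng D" "primel D q" "primel D r" "ddvd D q r"
  obtains w where "w \<in> unts D" "r = q * w"
proof -
  obtain w where w: "w \<in> D" "r = q * w" using assms(4) by (auto simp: ddvd_def)
  have "ddvd D r q \<or> ddvd D r w"
    using primelD(4)[OF assms(3), of q w] w primelD(1)[OF assms(2)] ddvd_refl[OF assms(1), of r] by simp
  then have "w \<in> unts D"
  proof
    assume "ddvd D r q"
    then obtain y where y: "y \<in> D" "q = r * y" by (auto simp: ddvd_def)
    then have "q * 1 = q * (w * y)" using w by (simp add: mult.assoc)
    then have "w * y = 1" using primelD(2)[OF assms(2)] by (metis mult_left_cancel)
    then show ?thesis using w y by (auto simp: unts_def)
  next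
    assume "ddvd D r w"
    then obtain y where y: "y \<in> D" "w = r * y" by (auto simp: ddvd_def)
    then have "w * 1 = w * (q * y)" using w by (simp add: algebra_simps)
    moreover have "w \<noteq> 0" using w primelD(2)[OF assms(3)] by auto
    ultimately have "q * y = 1" by (metis mult_left_cancel)
    then have "q \<in> unts D" using y primelD(1)[OF assms(2)] by (auto simp: unts_def)
    then show ?thesis using primelD(3)[OF assms(2)] by simp
  qed
  then show ?thesis using that w by blast
qed

lemma primel_assoc_sym:
  fixes D :: "'a::idom set"
  assumes "subrng D" "primel D q" "primel D r" "ddvd D q r" shows "ddvd D r q"
proof -
  obtain w where w: "w \<in> unts D" "r = q * w" using primel_assoc[OF assms] .
  then obtain y where "y \<in> D" "w * y = 1" by (auto simp: unts_def)
  then have "q = r * y" using w by (simp add: mult.assoc)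
  then show ?thesis using \<open>y \<in> D\<close> by (auto simp: ddvd_def)
qed

section \<open>Gauss's theorem on polynomials over a factorial domain\<close>

definition DX :: "'a::comm_ring_1 set \<Rightarrow> 'a poly set" where
  "DX D = {P. \<forall>i. coeff P i \<in> D}"

lemma DX_coeff: "P \<in> DX D \<Longrightarrow> coeff P i \<in> D" by (simp add: DX_def)

lemma DX_subrng: assumes "subrng D" shows "subrng (DX D)"
  unfolding subrng_def DX_def using subrngD[OF assms]
  by (auto simp: coeff_mult coeff_1 intro!: subrng_sum[OF assms])

lemma DX_const: "subrng D \<Longrightarrow> c \<in> D \<Longrightarrow> [:c:] \<in> DX D"
  by (auto simp: DX_def coeff_pCons subrng_def split: nat.splits)

lemma DX_const_iff: "subrng D \<Longrightarrow> [:c:] \<in> DX D \<longleftrightarrow> c \<in> D"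
  using DX_const[of D c] by (auto simp: DX_def dest: spec[of _ 0])

lemma DX_monom: "subrng D \<Longrightarrow> c \<in> D \<Longrightarrow> monom c k \<in> DX D"
  by (auto simp: DX_def subrng_def)

lemma ddvd_DX_const:
  fixes D :: "'a::idom set"
  assumes "subrng D"
  shows "ddvd (DX D) [:q:] P \<longleftrightarrow> (\<forall>i. ddvd D q (coeff P i))"
proof
  assume "ddvd (DX D) [:q:] P"
  then show "\<forall>i. ddvd D q (coeff P i)" by (auto simp: ddvd_def DX_def)
next
  assume "\<forall>i. ddvd D q (coeff P i)"
  then have "\<forall>i. \<exists>z. z \<in> D \<and> coeff P i = q * z" by (auto simp: ddvd_def)
  then obtain z where z: "\<And>i. z i \<in> D" "\<And>i. coeff P i = q * z i" by metis
  define Q where "Q = (\<Sum>i\<le>degree P. monom (z i) i)"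
  have "Q \<in> DX D" unfolding Q_def by (intro subrng_sum DX_subrng DX_monom assms z)
  moreover have "P = [:q:] * Q"
  proof -
    have "P = (\<Sum>i\<le>degree P. monom (coeff P i) i)" by (simp add: poly_as_sum_of_monoms)
    also have "\<dots> = [:q:] * Q" unfolding Q_def sum_distrib_left by (simp add: z(2) smult_monom)
    finally show ?thesis .
  qed
  ultimately show "ddvd (DX D) [:q:] P" by (auto simp: ddvd_def)
qed

lemma unts_DX:
  fixes D :: "'a::idom set"
  assumes "subrng D" shows "unts (DX D) = (\<lambda>c. [:c:]) ` unts D"
proof (intro equalityI subsetI)
  fix P assume "P \<in> unts (DX D)"
  then obtain Q where Q: "P \<in> DX D" "Q \<in> DX D" "P * Q = 1" by (auto simp: unts_def)
  then have "P dvd 1" "Q dvd 1" by (metis dvd_triv_left, metis dvd_triv_right)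
  then obtain c d where cd: "P = [:c:]" "Q = [:d:]" by (auto simp: is_unit_poly_iff)
  then have "c * d = 1" using Q(3) by (simp add: one_pCons mult.commute)
  then show "P \<in> (\<lambda>c. [:c:]) ` unts D" using cd Q DX_const_iff[OF assms] by (auto simp: unts_def)
next
  fix P assume "P \<in> (\<lambda>c. [:c:]) ` unts D"
  then obtain c d where cd: "P = [:c:]" "c \<in> D" "d \<in> D" "c * d = 1" by (auto simp: unts_def)
  then have "P * [:d:] = 1" by (simp add: one_pCons mult.commute)
  then show "P \<in> unts (DX D)" using cd DX_const[OF assms] unfolding unts_def by blast
qed

text \<open>Let i and j be the first indices at which q fails to divide the coefficients of P and Q.
  In the coefficient of P * Q at i + j every other term is divisible by q.\<close>

lemma primel_const:
  fixes D :: "'a::idom set"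
  assumes D: "subrng D" and q: "primel D q"
  shows "primel (DX D) [:q:]"
  unfolding primel_def
proof (intro conjI ballI impI)
  show "[:q:] \<in> DX D" using DX_const[OF D] primelD[OF q] by blast
  show "[:q:] \<noteq> 0" using primelD[OF q] by simp
  show "[:q:] \<notin> unts (DX D)" using primelD(3)[OF q] by (auto simp: unts_DX[OF D])
  fix P Q assume PQ: "P \<in> DX D" "Q \<in> DX D" "ddvd (DX D) [:q:] (P * Q)"
  show "ddvd (DX D) [:q:] P \<or> ddvd (DX D) [:q:] Q"
  proof (rule ccontr)
    assume "\<not> ?thesis"
    then have ex: "\<exists>i. \<not> ddvd D q (coeff P i)" "\<exists>i. \<not> ddvd D q (coeff Q i)"
      by (auto simp: ddvd_DX_const[OF D])
    define i where "i = (LEAST i. \<not> ddvd D q (coeff P i))"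
    define j where "j = (LEAST i. \<not> ddvd D q (coeff Q i))"
    have i: "\<not> ddvd D q (coeff P i)" "\<And>k. k < i \<Longrightarrow> ddvd D q (coeff P k)"
      using LeastI_ex[OF ex(1)] unfolding i_def by (assumption, metis not_less_Least)
    have j: "\<not> ddvd D q (coeff Q j)" "\<And>k. k < j \<Longrightarrow> ddvd D q (coeff Q k)"
      using LeastI_ex[OF ex(2)] unfolding j_def by (assumption, metis not_less_Least)
    have "coeff (P * Q) (i + j) = coeff P i * coeff Q j + (\<Sum>k\<in>{..i+j} - {i}. coeff P k * coeff Q (i + j - k))"
      by (simp add: coeff_mult sum.remove[of _ i])
    then have "coeff P i * coeff Q j = coeff (P * Q) (i + j) - (\<Sum>k\<in>{..i+j} - {i}. coeff P k * coeff Q (i + j - k))"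
      by simp
    also have "ddvd D q \<dots>"
    proof (intro ddvd_diff[OF D] ddvd_sum[OF D])
      show "ddvd D q (coeff (P * Q) (i + j))" using PQ(3) by (simp add: ddvd_DX_const[OF D])
      fix k assume k: "k \<in> {..i+j} - {i}"
      show "ddvd D q (coeff P k * coeff Q (i + j - k))"
      proof (cases "k < i")
        case True
        then show ?thesis using i(2) by (intro ddvd_mult[OF D DX_coeff[OF PQ(2)]])
      next
        case False
        then have "i + j - k < j" using k by auto
        then show ?thesis using ddvd_mult[OF D DX_coeff[OF PQ(1)] j(2)] by (metis mult.commute)
      qed
    qed
    finally have "ddvd D q (coeff P i * coeff Q j)" .
    then show False using primelD(4)[OF q, of "coeff P i" "coeff Q j"] i(1) j(1) DX_coeff[OF PQ(1)] DX_coeff[OF PQ(2)] by blast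
  qed
qed

lemma primel_X:
  fixes D :: "'a::idom set"
  assumes D: "subrng D" shows "primel (DX D) [:0, 1:]"
  unfolding primel_def
proof (intro conjI ballI impI)
  show "[:0, 1:] \<in> DX D" using subrngD(1,2)[OF D] by (auto simp: DX_def coeff_pCons split: nat.splits)
  show "[:0, 1:] \<noteq> (0 :: 'a poly)" by simp
  show "[:0, 1:] \<notin> unts (DX D)" by (auto simp: unts_DX[OF D])
  have dv: "ddvd (DX D) [:0, 1:] P \<longleftrightarrow> coeff P 0 = 0" if "P \<in> DX D" for P
  proof
    assume "coeff P 0 = 0"
    then obtain Q where Q: "P = pCons 0 Q" by (cases P) auto
    then have "P = [:0,1:] * Q" by simp
    moreover have "Q \<in> DX D" unfolding DX_def
    proof safe
      fix i show "coeff Q i \<in> D" using DX_coeff[OF that, of "Suc i"] by (simp add: Q)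
    qed
    ultimately show "ddvd (DX D) [:0, 1:] P" by (auto simp: ddvd_def)
  qed (auto simp: ddvd_def coeff_mult)
  fix P Q assume PQ: "P \<in> DX D" "Q \<in> DX D" "ddvd (DX D) [:0, 1:] (P * Q)"
  then show "ddvd (DX D) [:0, 1:] P \<or> ddvd (DX D) [:0, 1:] Q"
    using subrngD(5)[OF DX_subrng[OF D]] by (auto simp: dv coeff_mult)
qed

definition primitv :: "'a::comm_ring_1 set \<Rightarrow> 'a poly \<Rightarrow> bool" where
  "primitv D P \<longleftrightarrow> (\<forall>q. primel D q \<longrightarrow> \<not> ddvd (DX D) [:q:] P)"

lemma PFD_subrng: "PFD D \<Longrightarrow> subrng D" by (simp add: PFD_def)

lemma PFD_factor:
  assumes "PFD D" "x \<in> D" "x \<noteq> 0"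
  obtains u qs where "u \<in> unts D" "\<forall>q\<in>set qs. primel D q" "x = u * prod_list qs"
  using assms unfolding PFD_def by blast

lemma PFD_unit_or_prime:
  assumes "PFD D" "x \<in> D" "x \<noteq> 0" "x \<notin> unts D"
  obtains q where "primel D q" "ddvd D q x"
proof -
  obtain u qs where x: "u \<in> unts D" "\<forall>q\<in>set qs. primel D q" "x = u * prod_list qs"
    using PFD_factor[OF assms(1-3)] .
  note D = PFD_subrng[OF assms(1)]
  have "qs \<noteq> []" using x assms(4) by auto
  then obtain q rs where qs: "qs = q # rs" by (cases qs) auto
  have "prod_list rs \<in> D" using x qs by (intro subrng_prod_list[OF D]) (auto dest: primelD)
  then have "u * prod_list rs \<in> D" using x by (intro subrngD(5)[OF D]) (auto simp: unts_def)
  moreover have "x = q * (u * prod_list rs)" by (simp add: x qs algebra_simps)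
  ultimately have "ddvd D q x" by (auto simp: ddvd_def)
  then show ?thesis using that x qs by auto
qed

text \<open>The prime factors of c are removed one at a time: each divides P * R but not the
  primitive P, hence divides R.\<close>

lemma cancel_const:
  fixes D :: "'a::idom set"
  assumes D: "PFD D" and c: "c \<in> D" "c \<noteq> 0" and P: "P \<in> DX D" "primitv D P"
    and Q: "Q \<in> DX D" and R: "R \<in> DX D" and eq: "[:c:] * Q = P * R"
  obtains R' where "R' \<in> DX D" "R = [:c:] * R'" "Q = P * R'"
proof -
  note Ds = PFD_subrng[OF D]
  note DXs = DX_subrng[OF Ds]
  obtain u qs where x: "u \<in> unts D" "\<forall>q\<in>set qs. primel D q" "c = u * prod_list qs"
    using PFD_factor[OF D c] .
  have "\<exists>R'\<in>DX D. R = [:prod_list qs:] * R'"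
    if "[:prod_list qs:] * Q = P * R" "R \<in> DX D" "Q \<in> DX D" "\<forall>q\<in>set qs. primel D q" for Q R
    using that
  proof (induction qs arbitrary: Q R)
    case Nil
    then show ?case by (auto simp: one_pCons[symmetric])
  next
    case (Cons q qs)
    have q: "primel D q" and qs: "prod_list qs \<in> D" using Cons.prems subrng_prod_list[OF Ds, of qs]
      by (auto dest: primelD)
    have "P * R = [:q:] * ([:prod_list qs:] * Q)" using Cons.prems(1) by (simp add: mult.commute)
    then have "ddvd (DX D) [:q:] (P * R)"
      using subrngD(5)[OF DXs DX_const[OF Ds qs] Cons.prems(3)] unfolding ddvd_def by blast
    then have "ddvd (DX D) [:q:] R"
      using primelD(4)[OF primel_const[OF Ds q] P(1) Cons.prems(2)] P(2) q by (auto simp: primitv_def)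
    then obtain R1 where R1: "R1 \<in> DX D" "R = [:q:] * R1" by (auto simp: ddvd_def)
    have "[:q:] * ([:prod_list qs:] * Q) = [:q:] * (P * R1)"
      using Cons.prems(1) R1 by (simp add: mult.commute)
    then have "[:prod_list qs:] * Q = P * R1" using primelD(2)[OF q] by (metis mult_left_cancel pCons_eq_0_iff)
    then obtain R' where "R' \<in> DX D" "R1 = [:prod_list qs:] * R'" using Cons.IH[of Q R1] R1 Cons.prems by auto
    then show ?case using R1 by (auto simp: mult.commute)
  qed
  moreover have "[:prod_list qs:] * ([:u:] * Q) = P * R" using eq x by (simp add: mult.commute)
  moreover have uD: "u \<in> D" using x by (simp add: unts_def)
  moreover have "[:u:] * Q \<in> DX D" by (intro subrngD(5)[OF DXs] DX_const[OF Ds] uD Q)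
  ultimately obtain R1 where R1: "R1 \<in> DX D" "R = [:prod_list qs:] * R1" using R x by blast
  obtain u' where u': "u' \<in> D" "u * u' = 1" using x by (auto simp: unts_def)
  define R' where "R' = [:u':] * R1"
  have R'D: "R' \<in> DX D" unfolding R'_def by (intro subrngD(5)[OF DXs] DX_const[OF Ds] u' R1)
  have RR: "R = [:c:] * R'"
  proof -
    have "[:c:] * R' = smult (u * u') ([:prod_list qs:] * R1)" by (simp add: R'_def x mult_ac)
    then show ?thesis using R1 u' by simp
  qed
  have "[:c:] * Q = [:c:] * (P * R')" using eq RR by (simp add: mult.left_commute)
  then have "Q = P * R'" using c by (metis mult_left_cancel pCons_eq_0_iff)
  then show ?thesis using that R'D RR by blast
qed

text \<open>Common prime factors of the coefficients are split off one at a time. This ends because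
  each removes one prime factor of the leading coefficient.\<close>

lemma content_extract:
  fixes D :: "'a::idom set"
  assumes D: "PFD D" and F: "F \<in> DX D" "F \<noteq> 0"
  obtains e F' where "e \<in> D" "e \<noteq> 0" "F' \<in> DX D" "primitv D F'" "F = [:e:] * F'"
proof -
  note Ds = PFD_subrng[OF D]
  have "\<exists>e F'. e \<in> D \<and> e \<noteq> 0 \<and> F' \<in> DX D \<and> primitv D F' \<and> F = [:e:] * F'"
    if "lead_coeff F = u * prod_list qs" "u \<in> unts D" "\<forall>q\<in>set qs. primel D q" "F \<in> DX D" "F \<noteq> 0" for F u qs
    using that
  proof (induction "length qs" arbitrary: F u qs)
    case 0
    have "primitv D F" unfolding primitv_def
    proof (intro allI impI notI)
      fix q assume q: "primel D q" "ddvd (DX D) [:q:] F"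
      then have "ddvd D q (lead_coeff F)" by (simp add: ddvd_DX_const[OF Ds])
      then show False using not_ddvd_unit[OF Ds q(1)] 0 by simp
    qed
    then show ?case using 0 subrngD(2)[OF Ds] by (intro exI[of _ 1] exI[of _ F]) (auto simp: one_pCons[symmetric])
  next
    case (Suc m)
    show ?case
    proof (cases "primitv D F")
      case True
      then show ?thesis using Suc subrngD(2)[OF Ds] by (intro exI[of _ 1] exI[of _ F]) (auto simp: one_pCons[symmetric])
    next
      case False
      then obtain q where q: "primel D q" "ddvd (DX D) [:q:] F" by (auto simp: primitv_def)
      then obtain F1 where F1: "F1 \<in> DX D" "F = [:q:] * F1" by (auto simp: ddvd_def)
      have q0: "q \<noteq> 0" "q \<in> D" using primelD[OF q(1)] by auto
      have lc: "lead_coeff F = q * lead_coeff F1" using F1 q0 by simp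
      have "ddvd D q (u * prod_list qs)" using q(2) Suc.prems(1) by (metis ddvd_DX_const[OF Ds])
      moreover have pl: "prod_list qs \<in> D" "u \<in> D" using Suc.prems subrng_prod_list[OF Ds, of qs]
        by (auto dest: primelD simp: unts_def)
      ultimately have "ddvd D q (prod_list qs)"
        using primelD(4)[OF q(1), of u "prod_list qs"] not_ddvd_unit[OF Ds q(1)] Suc.prems(2) by blast
      then obtain r where r: "r \<in> set qs" "ddvd D q r"
        using primel_ddvd_prod_list[OF Ds q(1), of qs] Suc.prems(3) by (auto dest: primelD)
      then obtain w where w: "w \<in> unts D" "r = q * w" using primel_assoc[OF Ds q(1)] Suc.prems(3) by metis
      have "prod_list qs = r * prod_list (remove1 r qs)"
        using r(1) by (induction qs) (auto simp: algebra_simps)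
      then have "q * lead_coeff F1 = q * (u * w * prod_list (remove1 r qs))"
        using lc Suc.prems(1) w by (auto simp: algebra_simps)
      then have "lead_coeff F1 = u * w * prod_list (remove1 r qs)" using q0 by (metis mult_left_cancel)
      moreover have "m = length (remove1 r qs)" using Suc.hyps(2) r(1) by (simp add: length_remove1)
      moreover have "\<forall>q\<in>set (remove1 r qs). primel D q" using Suc.prems(3) set_remove1_subset[of r qs] by blast
      moreover have "F1 \<noteq> 0" using F1 Suc.prems by auto
      ultimately obtain e F' where e: "e \<in> D" "e \<noteq> 0" "F' \<in> DX D" "primitv D F'" "F1 = [:e:] * F'"
        using Suc.hyps(1)[of "remove1 r qs" F1 "u * w"] F1(1) unts_mult[OF Ds Suc.prems(2) w(1)] by blast
      have "F = [:q * e:] * F'" using F1 e by (simp add: mult_ac)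
      moreover have "q * e \<in> D" "q * e \<noteq> 0" using q0 e subrngD(5)[OF Ds] by auto
      ultimately show ?thesis using e by blast
    qed
  qed
  moreover obtain u qs where "u \<in> unts D" "\<forall>q\<in>set qs. primel D q" "lead_coeff F = u * prod_list qs"
    using PFD_factor[OF D, of "lead_coeff F"] F DX_coeff by (metis leading_coeff_0_iff)
  ultimately show ?thesis using that F by blast
qed

lemma pseudo_division:
  fixes D :: "'a::idom set"
  assumes D: "subrng D" and H: "H \<in> DX D" "H \<noteq> 0" and F: "F \<in> DX D"
  shows "\<exists>c Q R. c \<in> D \<and> c \<noteq> 0 \<and> Q \<in> DX D \<and> R \<in> DX D \<and> [:c:] * F = Q * H + R \<and> (R = 0 \<or> degree R < degree H)"
  using F
proof (induction "degree F" arbitrary: F rule: less_induct)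
  case less
  note DXs = DX_subrng[OF D]
  show ?case
  proof (cases "F = 0 \<or> degree F < degree H")
    case True
    then show ?thesis using less.prems subrngD[OF D] subrngD(1)[OF DXs]
      by (intro exI[of _ 1] exI[of _ 0] exI[of _ F]) (auto simp: one_pCons[symmetric])
  next
    case False
    define l where "l = lead_coeff H"
    define k where "k = degree F - degree H"
    define G where "G = [:l:] * F - monom (lead_coeff F) k * H"
    have l: "l \<in> D" "l \<noteq> 0" using H by (auto simp: l_def DX_coeff)
    have mon: "monom (lead_coeff F) k \<in> DX D" using less.prems by (intro DX_monom[OF D] DX_coeff)
    have G: "G \<in> DX D" unfolding G_def
      by (intro subrngD(4)[OF DXs] subrngD(5)[OF DXs] DX_const[OF D] l less.prems mon H)
    show ?thesis
    proof (cases "degree F = 0")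
      case True
      then have "degree H = 0" using False by simp
      then obtain h where h: "H = [:h:]" by (metis degree_eq_zeroE)
      obtain f where f: "F = [:f:]" using True by (metis degree_eq_zeroE)
      have "h \<in> D" "h \<noteq> 0" using H h DX_const_iff[OF D] by auto
      then show ?thesis using less.prems subrngD(1)[OF DXs]
        by (intro exI[of _ h] exI[of _ F] exI[of _ 0]) (auto simp: h f mult.commute)
    next
      case nz: False
      have "degree G < degree F \<or> G = 0"
      proof -
        have d1: "degree ([:l:] * F) \<le> degree F" by simp
        have d2: "degree (monom (lead_coeff F) k * H) \<le> degree F"
          using False H by (intro order_trans[OF degree_mult_le] order_trans[OF add_right_mono[OF degree_monom_le]]) (simp add: k_def)
        have "degree G \<le> degree F" unfolding G_def by (intro degree_diff_le d1 d2)
        moreover have "coeff G (degree F) = 0"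
        proof -
          have "coeff (monom (lead_coeff F) k * H) (degree F) = lead_coeff F * l"
            using False by (subst coeff_monom_mult) (simp add: k_def l_def)
          then show ?thesis by (simp add: G_def)
        qed
        ultimately show ?thesis by (metis le_neq_implies_less leading_coeff_0_iff)
      qed
      then have "degree G < degree F" using nz by auto
      from less.hyps[OF this G] obtain c Q R where cQR: "c \<in> D" "c \<noteq> 0" "Q \<in> DX D" "R \<in> DX D"
        "[:c:] * G = Q * H + R" "R = 0 \<or> degree R < degree H" by blast
      have "[:c * l:] * F = [:c:] * G + [:c:] * (monom (lead_coeff F) k * H)"
        by (simp add: G_def algebra_simps smult_diff_right)
      also have "\<dots> = (Q + [:c:] * monom (lead_coeff F) k) * H + R" unfolding cQR(5) by (simp add: algebra_simps)
      finally have "[:c * l:] * F = (Q + [:c:] * monom (lead_coeff F) k) * H + R" .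
      moreover have "Q + [:c:] * monom (lead_coeff F) k \<in> DX D"
        by (intro subrngD(3)[OF DXs] subrngD(5)[OF DXs] DX_const[OF D] cQR mon)
      moreover have "c * l \<in> D" "c * l \<noteq> 0" using cQR l subrngD(5)[OF D] by auto
      ultimately show ?thesis using cQR by blast
    qed
  qed
qed

text \<open>The primitive part h' of a smallest element of the ideal (P, f) divides P and f. By
  irreducibility it is P up to a unit, and then P divides f, or it is constant. In that case a
  constant d lies in (P, f), so P divides d g and, being primitive, g.\<close>

lemma irreducible_imp_primel:
  fixes D :: "'a::idom set"
  assumes D: "PFD D" and P: "P \<in> DX D" "primitv D P" "degree P > 0"
    and irr: "\<And>G H. G \<in> DX D \<Longrightarrow> H \<in> DX D \<Longrightarrow> P = G * H \<Longrightarrow> degree G = 0 \<or> degree H = 0"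
  shows "primel (DX D) P"
  unfolding primel_def
proof (intro conjI ballI impI)
  note Ds = PFD_subrng[OF D]
  note DXs = DX_subrng[OF Ds]
  show "P \<in> DX D" by fact
  show P0: "P \<noteq> 0" using P(3) by auto
  show "P \<notin> unts (DX D)" using P(3) by (auto simp: unts_DX[OF Ds])
  fix f g assume fg: "f \<in> DX D" "g \<in> DX D" "ddvd (DX D) P (f * g)"
  define I where "I h \<longleftrightarrow> h \<noteq> 0 \<and> (\<exists>u\<in>DX D. \<exists>v\<in>DX D. h = u * P + v * f)" for h
  have IP: "I P" unfolding I_def using P0 subrngD(1,2)[OF DXs]
    by (intro conjI bexI[of _ 1] bexI[of _ 0]) auto
  define h where "h = arg_min degree I"
  have h: "I h" "\<And>k. I k \<Longrightarrow> degree h \<le> degree k"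
    using arg_min_nat_lemma[of I P degree, OF IP] by (auto simp: h_def)
  then obtain u v where uv: "u \<in> DX D" "v \<in> DX D" "h = u * P + v * f" "h \<noteq> 0" by (auto simp: I_def)
  have hD: "h \<in> DX D" unfolding uv(3) by (intro subrngD(3)[OF DXs] subrngD(5)[OF DXs] uv P fg)
  obtain e h' where e: "e \<in> D" "e \<noteq> 0" "h' \<in> DX D" "primitv D h'" "h = [:e:] * h'"
    using content_extract[OF D hD uv(4)] .
  have dv: "\<exists>R\<in>DX D. F = h' * R" if F: "F \<in> DX D" "\<exists>a\<in>DX D. \<exists>b\<in>DX D. F = a * P + b * f" for F
  proof -
    obtain a b where ab: "a \<in> DX D" "b \<in> DX D" "F = a * P + b * f" using F by blast
    obtain c Q R where cQR: "c \<in> D" "c \<noteq> 0" "Q \<in> DX D" "R \<in> DX D" "[:c:] * F = Q * h + R"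
      "R = 0 \<or> degree R < degree h" using pseudo_division[OF Ds hD uv(4) F(1)] by blast
    have "R = ([:c:] * a - Q * u) * P + ([:c:] * b - Q * v) * f"
    proof -
      have "R = [:c:] * F - Q * h" using cQR by simp
      then show ?thesis unfolding ab(3) uv(3) by (simp add: algebra_simps smult_add_right)
    qed
    moreover have "[:c:] * a - Q * u \<in> DX D" "[:c:] * b - Q * v \<in> DX D"
      by (intro subrngD(4)[OF DXs] subrngD(5)[OF DXs] DX_const[OF Ds] cQR ab uv)+
    ultimately have "R \<noteq> 0 \<Longrightarrow> I R" unfolding I_def by blast
    then have "R = 0" using h(2)[of R] cQR(6) by fastforce
    then have "[:c:] * F = h' * (Q * [:e:])" using cQR(5) e(5) by (simp add: mult_ac)
    moreover have "Q * [:e:] \<in> DX D" by (intro subrngD(5)[OF DXs] DX_const[OF Ds] cQR e)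
    ultimately show ?thesis using cancel_const[OF D cQR(1,2) e(3,4) F(1)] by metis
  qed
  have "\<exists>R\<in>DX D. P = h' * R"
    by (rule dv[OF P(1)]) (use IP in \<open>auto simp: I_def\<close>)
  then obtain R where R: "R \<in> DX D" "P = h' * R" by blast
  from irr[OF e(3) R] show "ddvd (DX D) P f \<or> ddvd (DX D) P g"
  proof
    assume "degree R = 0"
    then obtain r where r: "R = [:r:]" by (metis degree_eq_zeroE)
    have rD: "r \<in> D" "r \<noteq> 0" using R r P0 DX_const_iff[OF Ds] by auto
    have "r \<in> unts D"
    proof (rule ccontr)
      assume "r \<notin> unts D"
      then obtain q where q: "primel D q" "ddvd D q r" using PFD_unit_or_prime[OF D rD] by blast
      then have "\<forall>i. ddvd D q (coeff P i)" unfolding R(2) r using ddvd_mult[OF Ds DX_coeff[OF e(3)]]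
        by (auto simp: mult.commute)
      then show False using P(2) q by (auto simp: primitv_def ddvd_DX_const[OF Ds])
    qed
    then obtain r' where r': "r' \<in> D" "r * r' = 1" by (auto simp: unts_def)
    have "\<exists>R\<in>DX D. f = h' * R"
    proof (rule dv[OF fg(1)])
      have "f = 0 * P + 1 * f" by simp
      then show "\<exists>a\<in>DX D. \<exists>b\<in>DX D. f = a * P + b * f" using subrngD(1,2)[OF DXs] by blast
    qed
    then obtain R2 where R2: "R2 \<in> DX D" "f = h' * R2" by blast
    have "f = smult (r * r') (h' * R2)" using R2 r' by simp
    also have "\<dots> = P * ([:r':] * R2)" unfolding R(2) r by (simp add: mult_ac)
    finally have "f = P * ([:r':] * R2)" .
    moreover have "[:r':] * R2 \<in> DX D" by (intro subrngD(5)[OF DXs] DX_const[OF Ds] r' R2)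
    ultimately show ?thesis unfolding ddvd_def by blast
  next
    assume "degree h' = 0"
    then obtain d' where d': "h' = [:d':]" by (metis degree_eq_zeroE)
    define d where "d = e * d'"
    have hd: "h = [:d:]" by (simp add: e(5) d' d_def)
    have d: "d \<in> D" "d \<noteq> 0" using hd hD uv(4) DX_const_iff[OF Ds] by auto
    obtain S where S: "S \<in> DX D" "f * g = P * S" using fg(3) by (auto simp: ddvd_def)
    have "[:d:] * g = u * P * g + v * (f * g)" using hd uv(3) by (metis distrib_right mult.assoc)
    also have "\<dots> = P * (u * g + v * S)" unfolding S(2) by (simp add: algebra_simps)
    finally have "[:d:] * g = P * (u * g + v * S)" .
    moreover have "u * g + v * S \<in> DX D" by (intro subrngD(3)[OF DXs] subrngD(5)[OF DXs] uv fg S)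
    ultimately obtain R' where "R' \<in> DX D" "g = P * R'" using cancel_const[OF D d P(1,2) fg(2)] by metis
    then show ?thesis by (auto simp: ddvd_def)
  qed
qed

theorem PFD_DX:
  fixes D :: "'a::idom set"
  assumes D: "PFD D" shows "PFD (DX D)"
  unfolding PFD_def
proof (intro conjI ballI impI)
  note Ds = PFD_subrng[OF D]
  note DXs = DX_subrng[OF Ds]
  show "subrng (DX D)" by fact
  fix F assume "F \<in> DX D" "F \<noteq> 0"
  then show "\<exists>u\<in>unts (DX D). \<exists>qs. (\<forall>q\<in>set qs. primel (DX D) q) \<and> F = u * prod_list qs"
  proof (induction "degree F" arbitrary: F rule: less_induct)
    case less
    obtain e P where e: "e \<in> D" "e \<noteq> 0" "P \<in> DX D" "primitv D P" "F = [:e:] * P"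
      using content_extract[OF D less.prems] .
    have dP: "degree P = degree F" using e by simp
    obtain u qs where u: "u \<in> unts D" "\<forall>q\<in>set qs. primel D q" "e = u * prod_list qs"
      using PFD_factor[OF D e(1,2)] .
    define qs' where "qs' = map (\<lambda>q. [:q:]) qs"
    have pl: "[:prod_list xs:] = prod_list (map (\<lambda>q. [:q:]) xs)" for xs :: "'a list"
    proof (induction xs)
      case (Cons x xs)
      have "[:prod_list (x # xs):] = [:x:] * [:prod_list xs:]" by simp
      then show ?case unfolding Cons by simp
    qed (simp add: one_pCons)
    have e': "[:e:] = [:u:] * prod_list qs'" "[:u:] \<in> unts (DX D)" "\<forall>q\<in>set qs'. primel (DX D) q"
      using u by (auto simp: unts_DX[OF Ds] qs'_def pl[symmetric] primel_const[OF Ds])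
    have "\<exists>u\<in>unts (DX D). \<exists>qs. (\<forall>q\<in>set qs. primel (DX D) q) \<and> P = u * prod_list qs"
    proof (cases "degree P = 0")
      case True
      then obtain c where c: "P = [:c:]" by (metis degree_eq_zeroE)
      then have cD: "c \<in> D" "c \<noteq> 0" using e less.prems DX_const_iff[OF Ds] by auto
      have "c \<in> unts D"
      proof (rule ccontr)
        assume "c \<notin> unts D"
        then obtain q where "primel D q" "ddvd D q c" using PFD_unit_or_prime[OF D cD] by blast
        moreover from this have "\<forall>i. ddvd D q (coeff P i)" using ddvd_0[OF Ds]
          by (auto simp: c coeff_pCons split: nat.splits)
        ultimately show False using e(4) ddvd_DX_const[OF Ds] by (auto simp: primitv_def)
      qed
      then show ?thesis using c by (intro bexI[of _ P] exI[of _ "[]"]) (auto simp: unts_DX[OF Ds])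
    next
      case False
      show ?thesis
      proof (cases "\<forall>G H. G \<in> DX D \<longrightarrow> H \<in> DX D \<longrightarrow> P = G * H \<longrightarrow> degree G = 0 \<or> degree H = 0")
        case True
        then have "primel (DX D) P" using False by (intro irreducible_imp_primel[OF D e(3,4)]) auto
        then show ?thesis using unts_1[OF DXs] by (intro bexI[of _ 1] exI[of _ "[P]"]) auto
      next
        case False
        then obtain G H where GH: "G \<in> DX D" "H \<in> DX D" "P = G * H" "degree G > 0" "degree H > 0" by auto
        have nz: "G \<noteq> 0" "H \<noteq> 0" using GH by auto
        then have "degree P = degree G + degree H" using GH by (simp add: degree_mult_eq)
        then have dl: "degree G < degree F" "degree H < degree F" using GH dP by auto
        obtain u1 q1 where 1: "u1 \<in> unts (DX D)" "\<forall>q\<in>set q1. primel (DX D) q" "G = u1 * prod_list q1"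
          using less.hyps[OF dl(1) GH(1) nz(1)] by blast
        obtain u2 q2 where 2: "u2 \<in> unts (DX D)" "\<forall>q\<in>set q2. primel (DX D) q" "H = u2 * prod_list q2"
          using less.hyps[OF dl(2) GH(2) nz(2)] by blast
        have "P = (u1 * u2) * prod_list (q1 @ q2)" by (simp add: GH 1 2 mult_ac)
        moreover have "u1 * u2 \<in> unts (DX D)" by (intro unts_mult[OF DXs] 1 2)
        moreover have "\<forall>q\<in>set (q1 @ q2). primel (DX D) q" using 1 2 by auto
        ultimately show ?thesis by blast
      qed
    qed
    then obtain u1 q1 where 1: "u1 \<in> unts (DX D)" "\<forall>q\<in>set q1. primel (DX D) q" "P = u1 * prod_list q1" by blast
    have "F = ([:u:] * u1) * prod_list (qs' @ q1)" unfolding e(5) e'(1) 1(3) by (simp add: mult_ac)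
    moreover have "[:u:] * u1 \<in> unts (DX D)" by (intro unts_mult[OF DXs] 1 e')
    moreover have "\<forall>q\<in>set (qs' @ q1). primel (DX D) q" using 1 e' by auto
    ultimately show ?case by blast
  qed
qed

text \<open>Used for the evaluation of D[X] at the next variable, and for tau as a map from D onto
  itself.\<close>

lemma PFD_transport:
  fixes h :: "'a::idom \<Rightarrow> 'b::idom"
  assumes D: "PFD D" and inj: "inj_on h D"
    and add: "\<And>x y. x \<in> D \<Longrightarrow> y \<in> D \<Longrightarrow> h (x + y) = h x + h y"
    and mult: "\<And>x y. x \<in> D \<Longrightarrow> y \<in> D \<Longrightarrow> h (x * y) = h x * h y" and one: "h 1 = 1"
  shows "PFD (h ` D)" "unts (h ` D) = h ` unts D" "\<And>q. primel D q \<Longrightarrow> primel (h ` D) (h q)"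
    "\<And>x y. x \<in> D \<Longrightarrow> y \<in> D \<Longrightarrow> ddvd (h ` D) (h x) (h y) \<longleftrightarrow> ddvd D x y"
proof -
  note Ds = PFD_subrng[OF D]
  have zero: "h 0 = 0" using add[of 0 0] subrngD(1)[OF Ds] by (metis add_cancel_right_left add_0)
  have minus: "h (x - y) = h x - h y" if "x \<in> D" "y \<in> D" for x y
    using add[of "x - y" y] subrngD(4)[OF Ds that] that by (simp add: algebra_simps)
  have sr: "subrng (h ` D)" unfolding subrng_def
  proof (intro conjI ballI)
    show "0 \<in> h ` D" using subrngD(1)[OF Ds] zero by (metis imageI)
    show "1 \<in> h ` D" using subrngD(2)[OF Ds] one by (metis imageI)
    fix x y assume "x \<in> h ` D" "y \<in> h ` D"
    then obtain a b where "a \<in> D" "b \<in> D" "x = h a" "y = h b" by auto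
    then show "x + y \<in> h ` D" "x - y \<in> h ` D" "x * y \<in> h ` D"
      using subrngD(3-5)[OF Ds, of a b] by (auto simp flip: add minus mult)
  qed
  show u: "unts (h ` D) = h ` unts D"
  proof (intro equalityI subsetI)
    fix x assume "x \<in> unts (h ` D)"
    then obtain a b where ab: "a \<in> D" "b \<in> D" "x = h a" "h (a * b) = h 1" by (auto simp: unts_def mult one)
    then have "a * b = 1" using inj_onD[OF inj] subrngD(2,5)[OF Ds] by blast
    then show "x \<in> h ` unts D" using ab by (auto simp: unts_def)
  next
    fix x assume "x \<in> h ` unts D"
    then obtain a b where ab: "a \<in> D" "b \<in> D" "x = h a" "a * b = 1" by (auto simp: unts_def)
    then have "h a * h b = 1" by (simp flip: mult add: one)
    then show "x \<in> unts (h ` D)" using ab by (auto simp: unts_def)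
  qed
  show dv: "ddvd (h ` D) (h x) (h y) \<longleftrightarrow> ddvd D x y" if "x \<in> D" "y \<in> D" for x y
  proof
    assume "ddvd (h ` D) (h x) (h y)"
    then obtain z where z: "z \<in> D" "h y = h x * h z" by (auto simp: ddvd_def)
    then have "h y = h (x * z)" using that by (simp add: mult)
    then have "y = x * z" using inj_onD[OF inj] that z(1) subrngD(5)[OF Ds] by blast
    then show "ddvd D x y" using z by (auto simp: ddvd_def)
  qed (use that in \<open>auto simp: ddvd_def mult\<close>)
  show pr: "primel (h ` D) (h q)" if q: "primel D q" for q
    unfolding primel_def
  proof (intro conjI ballI impI)
    note qD = primelD[OF q]
    show "h q \<in> h ` D" using qD by simp
    show "h q \<noteq> 0" using qD zero inj_onD[OF inj, of q 0] subrngD(1)[OF Ds] by auto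
    show "h q \<notin> unts (h ` D)"
    proof
      assume "h q \<in> unts (h ` D)"
      then obtain x where x: "x \<in> unts D" "h q = h x" unfolding u by auto
      then have "q = x" using inj_onD[OF inj, of q x] qD(1) by (auto simp: unts_def)
      then show False using x qD(3) by simp
    qed
    fix x y assume "x \<in> h ` D" "y \<in> h ` D" and d: "ddvd (h ` D) (h q) (x * y)"
    then obtain a b where ab: "a \<in> D" "b \<in> D" "x = h a" "y = h b" by auto
    have "ddvd D q (a * b)" using d dv[OF qD(1), of "a * b"] ab subrngD(5)[OF Ds] by (simp add: mult)
    then show "ddvd (h ` D) (h q) x \<or> ddvd (h ` D) (h q) y" using qD(4) ab dv[OF qD(1)] by blast
  qed
  show "PFD (h ` D)" unfolding PFD_def
  proof (intro conjI ballI impI sr)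
    fix x assume "x \<in> h ` D" "x \<noteq> 0"
    then obtain a where a: "a \<in> D" "x = h a" "a \<noteq> 0" using zero by auto
    obtain v qs where v: "v \<in> unts D" "\<forall>q\<in>set qs. primel D q" "a = v * prod_list qs"
      using PFD_factor[OF D a(1,3)] .
    have qsD: "set qs \<subseteq> D" using v(2) by (auto dest: primelD)
    then have "h (prod_list qs) = prod_list (map h qs)"
      by (induction qs) (auto simp: mult one subrng_prod_list[OF Ds])
    moreover have "v \<in> D" using v(1) by (simp add: unts_def)
    ultimately have "x = h v * prod_list (map h qs)" using subrng_prod_list[OF Ds qsD] by (simp add: a v mult)
    then show "\<exists>u\<in>unts (h ` D). \<exists>qs. (\<forall>q\<in>set qs. primel (h ` D) q) \<and> x = u * prod_list qs"
      using v pr u by (intro bexI[of _ "h v"] exI[of _ "map h qs"]) auto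
  qed
qed

lemma subfield_subrng: "is_subfield K \<Longrightarrow> subrng K"
  by (auto simp: is_subfield_def subrng_def)

lemma subfield_unts: "is_subfield K \<Longrightarrow> unts K = K - {0}"
  unfolding is_subfield_def unts_def by auto (metis right_inverse)

lemma PFD_subfield:
  assumes "is_subfield K" shows "PFD K"
  unfolding PFD_def
proof (intro conjI ballI impI subfield_subrng[OF assms])
  fix x assume "x \<in> K" "x \<noteq> 0"
  then show "\<exists>u\<in>unts K. \<exists>qs. (\<forall>q\<in>set qs. primel K q) \<and> x = u * prod_list qs"
    using subfield_unts[OF assms] by (intro bexI[of _ x] exI[of _ "[]"]) auto
qed

lemma PR_0: "subrng K \<Longrightarrow> PR K 0 v = K"
proof (intro equalityI subsetI)
  assume K: "subrng K"
  fix x assume "x \<in> PR K 0 v"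
  then obtain f where f: "f \<in> polyf K 0" "x = f v" by (auto simp: PR_def)
  from f(1) have "f v \<in> K" by induction (use K in \<open>auto simp: subrng_def\<close>)
  then show "x \<in> K" using f by simp
next
  fix x assume "x \<in> K"
  then have "(\<lambda>_. x) \<in> polyf K 0" by (rule polyf.const)
  then show "x \<in> PR K 0 v" by (auto simp: PR_def)
qed

lemma PR_Suc:
  assumes K: "subrng K"
  shows "PR K (Suc N) v = (\<lambda>P. poly P (v N)) ` DX (PR K N v)"
proof (intro equalityI subsetI)
  have PRs: "subrng (PR K N v)" unfolding subrng_def PR_def
  proof (intro conjI ballI)
    show "0 \<in> {f v |f. f \<in> polyf K N}" "1 \<in> {f v |f. f \<in> polyf K N}"
      using polyf.const[OF subrngD(1)[OF K]] polyf.const[OF subrngD(2)[OF K]] by force+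
    fix x y assume "x \<in> {f v |f. f \<in> polyf K N}" "y \<in> {f v |f. f \<in> polyf K N}"
    then obtain f g where fg: "f \<in> polyf K N" "g \<in> polyf K N" "x = f v" "y = g v" by auto
    show "x + y \<in> {f v |f. f \<in> polyf K N}" "x * y \<in> {f v |f. f \<in> polyf K N}"
      using polyf.add[OF fg(1,2)] polyf.mult[OF fg(1,2)] fg by auto
    have "- 1 \<in> K" using subrng_uminus[OF K subrngD(2)[OF K]] .
    from polyf.add[OF fg(1) polyf.mult[OF polyf.const[OF this] fg(2)]]
    show "x - y \<in> {f v |f. f \<in> polyf K N}" unfolding fg mem_Collect_eq by (intro exI conjI) auto
  qed
  {
    fix x assume "x \<in> PR K (Suc N) v"
    then obtain f where f: "f \<in> polyf K (Suc N)" "x = f v" by (auto simp: PR_def)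
    obtain d g where g: "\<forall>l. g l \<in> polyf K N" "\<forall>t x. f (t(N := x)) = (\<Sum>l<d. g l t * x ^ l)"
      using polyf_split[OF f(1) subrngD(1,2)[OF K]] by blast
    define P where "P = (\<Sum>l<d. monom (g l v) l)"
    have "P \<in> DX (PR K N v)" unfolding P_def
      by (intro subrng_sum DX_subrng DX_monom PRs) (use g in \<open>auto simp: PR_def\<close>)
    moreover have "x = poly P (v N)" using g(2)[rule_format, of v "v N"] by (simp add: f P_def poly_sum poly_monom)
    ultimately show "x \<in> (\<lambda>P. poly P (v N)) ` DX (PR K N v)" by blast
  }
  {
    fix x assume "x \<in> (\<lambda>P. poly P (v N)) ` DX (PR K N v)"
    then obtain P where P: "P \<in> DX (PR K N v)" "x = poly P (v N)" by auto
    have "\<forall>i. \<exists>f. f \<in> polyf K N \<and> coeff P i = f v" using P by (auto simp: DX_def PR_def)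
    then obtain f where f: "\<And>i. f i \<in> polyf K N" "\<And>i. coeff P i = f i v" by metis
    have "(\<lambda>t. \<Sum>i\<le>degree P. f i t * t N ^ i) \<in> polyf K (Suc N)"
      by (intro polyf_sum polyf.mult polyf_power subrngD[OF K] polyf.proj polyf_mono[OF f(1)]) auto
    moreover have "x = (\<Sum>i\<le>degree P. f i v * v N ^ i)" by (simp add: P poly_altdef f(2))
    ultimately show "x \<in> PR K (Suc N) v" unfolding PR_def by auto
  }
qed

text \<open>Induction on N: the ring of one more variable is isomorphic to a polynomial ring over
  the previous one, so Gauss's theorem applies, and the constants remain the only units.\<close>

theorem PFD_PR:
  fixes K :: "'b::field_char_0 set"
  assumes K: "is_subfield K" and v: "alg_ind K N v"
  shows "PFD (PR K N v) \<and> unts (PR K N v) = K - {0} \<and> (\<forall>i<N. primel (PR K N v) (v i))"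
  using v
proof (induction N)
  case 0
  then show ?case using PR_0[OF subfield_subrng[OF K], of v] PFD_subfield[OF K] subfield_unts[OF K] by simp
next
  case (Suc N)
  note Ks = subfield_subrng[OF K]
  have IH: "PFD (PR K N v)" "unts (PR K N v) = K - {0}" "\<forall>i<N. primel (PR K N v) (v i)"
    using Suc.IH alg_ind_less[OF Suc.prems] by auto
  note Ds = PFD_subrng[OF IH(1)]
  define h where "h P = poly P (v N)" for P
  have inj: "inj_on h (DX (PR K N v))"
  proof (rule inj_onI)
    fix P Q assume PQ: "P \<in> DX (PR K N v)" "Q \<in> DX (PR K N v)" "h P = h Q"
    have "P - Q \<in> DX (PR K N v)" using subrngD(4)[OF DX_subrng[OF Ds] PQ(1,2)] .
    moreover have "poly (P - Q) (v N) = 0" using PQ(3) by (simp add: h_def)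
    ultimately have "P - Q = 0"
      using DX_coeff by (intro alg_ind_transcendental[OF Suc.prems subrngD(1,2)[OF Ks]])
    then show "P = Q" by simp
  qed
  note T = PFD_transport[OF PFD_DX[OF IH(1)] inj]
  have eq: "PR K (Suc N) v = h ` DX (PR K N v)" unfolding h_def by (rule PR_Suc[OF Ks])
  have hs: "\<And>x y. h (x + y) = h x + h y" "\<And>x y. h (x * y) = h x * h y" "h 1 = 1" by (simp_all add: h_def)
  have "unts (PR K (Suc N) v) = K - {0}"
    unfolding eq T(2)[OF hs] unts_DX[OF Ds] IH(2) by (auto simp: h_def image_image)
  moreover have "primel (PR K (Suc N) v) (v i)" if "i < Suc N" for i
  proof (cases "i = N")
    case True
    have "primel (h ` DX (PR K N v)) (h [:0, 1:])" by (rule T(3)[OF hs primel_X[OF Ds]])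
    then show ?thesis using True by (simp add: eq h_def)
  next
    case False
    then have "primel (PR K N v) (v i)" using IH(3) that by simp
    then have "primel (h ` DX (PR K N v)) (h [:v i:])" by (rule T(3)[OF hs primel_const[OF Ds]])
    then show ?thesis by (simp add: eq h_def)
  qed
  ultimately show ?case using T(1)[OF hs] by (simp add: eq)
qed

section \<open>Localizations and their units\<close>

text \<open>The localization D[1/a], inside the ambient field.\<close>

definition loc :: "'b::field set \<Rightarrow> 'b \<Rightarrow> 'b set" where
  "loc D a = {x. \<exists>i. x * a ^ i \<in> D}"

lemma unts_field:
  fixes D :: "'b::field set"
  shows "x \<in> unts D \<longleftrightarrow> x \<in> D \<and> x \<noteq> 0 \<and> inverse x \<in> D"
proof
  assume "x \<in> unts D"
  then obtain y where y: "x \<in> D" "y \<in> D" "x * y = 1" by (auto simp: unts_def)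
  then have "inverse x = y" by (metis inverse_unique)
  then show "x \<in> D \<and> x \<noteq> 0 \<and> inverse x \<in> D" using y by auto
next
  assume "x \<in> D \<and> x \<noteq> 0 \<and> inverse x \<in> D"
  then show "x \<in> unts D" unfolding unts_def by (auto intro!: bexI[of _ "inverse x"])
qed

lemma unts_inverse: "x \<in> unts D \<Longrightarrow> inverse (x::'b::field) \<in> unts D"
  by (auto simp: unts_field)

lemma unts_divide: "subrng D \<Longrightarrow> x \<in> unts D \<Longrightarrow> y \<in> unts D \<Longrightarrow> x / (y::'b::field) \<in> unts D"
  by (simp add: divide_inverse unts_inverse unts_mult)

lemma unts_power_int: "subrng D \<Longrightarrow> (x::'b::field) \<in> unts D \<Longrightarrow> x powi k \<in> unts D"
proof -
  assume D: "subrng D" and x: "x \<in> unts D"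
  have "y ^ m \<in> unts D" if "y \<in> unts D" for y m
    by (induction m) (auto intro: unts_1[OF D] unts_mult[OF D] that)
  then show ?thesis using x unts_inverse[OF x] by (simp add: power_int_def)
qed

lemma unts_prod: "subrng D \<Longrightarrow> (\<And>i. i \<in> I \<Longrightarrow> f i \<in> unts D) \<Longrightarrow> (\<Prod>i\<in>I. f i) \<in> unts D"
  by (induction I rule: infinite_finite_induct) (auto intro: unts_1 unts_mult)

lemma loc_subset: "D \<subseteq> loc D a"
  unfolding loc_def by (auto intro!: exI[of _ 0])

lemma loc_subrng:
  assumes D: "subrng D" and a: "a \<in> D" shows "subrng (loc D a)"
  unfolding subrng_def
proof (intro conjI ballI)
  show "0 \<in> loc D a" "1 \<in> loc D a" using loc_subset subrngD(1,2)[OF D] by auto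
  fix x y assume "x \<in> loc D a" "y \<in> loc D a"
  then obtain i j where ij: "x * a ^ i \<in> D" "y * a ^ j \<in> D" by (auto simp: loc_def)
  note pw = subrng_power[OF D a]
  have "(x + y) * a ^ (i + j) = x * a ^ i * a ^ j + y * a ^ j * a ^ i"
    "(x - y) * a ^ (i + j) = x * a ^ i * a ^ j - y * a ^ j * a ^ i"
    "(x * y) * a ^ (i + j) = (x * a ^ i) * (y * a ^ j)" by (simp_all add: power_add algebra_simps)
  moreover have "x * a ^ i * a ^ j + y * a ^ j * a ^ i \<in> D" "x * a ^ i * a ^ j - y * a ^ j * a ^ i \<in> D"
     "(x * a ^ i) * (y * a ^ j) \<in> D"
    using ij pw by (auto intro!: subrngD(3-5)[OF D])
  ultimately show "x + y \<in> loc D a" "x - y \<in> loc D a" "x * y \<in> loc D a"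
    unfolding loc_def by (metis (mono_tags, lifting) mem_Collect_eq)+
qed

lemma inverse_in_loc: "subrng D \<Longrightarrow> a \<noteq> 0 \<Longrightarrow> inverse a \<in> loc D a"
  unfolding loc_def by (auto intro!: exI[of _ 1] simp: subrng_def)

lemma power_in_unts_loc:
  assumes "subrng D" "a \<in> D" "a \<noteq> 0" shows "a ^ i \<in> unts (loc D a)"
proof -
  have "a \<in> unts (loc D a)" using assms inverse_in_loc[OF assms(1,3)] loc_subset[of D a] by (auto simp: unts_field)
  then show ?thesis using unts_power_int[OF loc_subrng[OF assms(1,2)], of a "int i"] by simp
qed

lemma primel_ddvd_power:
  assumes "subrng D" "primel D q" "a \<in> D" "ddvd D q (a ^ i)" shows "ddvd D q a \<and> i > 0"
  using assms(4)
proof (induction i)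
  case 0
  then show ?case using not_ddvd_unit[OF assms(1,2) unts_1[OF assms(1)]] by simp
next
  case (Suc i)
  then show ?case using primelD(4)[OF assms(2,3) subrng_power[OF assms(1,3)]] by auto
qed

lemma primel_loc:
  assumes D: "subrng D" and q: "primel D q" and a: "a \<in> D" "a \<noteq> 0" and nd: "\<not> ddvd D q a"
  shows "primel (loc D a) q"
  unfolding primel_def
proof (intro conjI ballI impI)
  note qD = primelD[OF q]
  show "q \<in> loc D a" by (rule subsetD[OF loc_subset qD(1)])
  show "q \<noteq> 0" using qD by simp
  show "q \<notin> unts (loc D a)"
  proof
    assume "q \<in> unts (loc D a)"
    then obtain i where i: "inverse q * a ^ i \<in> D" by (auto simp: unts_field loc_def)
    have "a ^ i = q * (inverse q * a ^ i)" using qD by simp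
    then have "ddvd D q (a ^ i)" using i unfolding ddvd_def by blast
    then show False using primel_ddvd_power[OF D q a(1)] nd by blast
  qed
  fix x y assume x: "x \<in> loc D a" and y: "y \<in> loc D a" and d: "ddvd (loc D a) q (x * y)"
  obtain z where z: "z \<in> loc D a" "x * y = q * z" using d by (auto simp: ddvd_def)
  obtain i j k where ijk: "x * a ^ i \<in> D" "y * a ^ j \<in> D" "z * a ^ k \<in> D" using x y z by (auto simp: loc_def)
  note pw = subrng_power[OF D a(1)]
  have "(x * a ^ i) * (y * a ^ j) * a ^ k = q * (z * a ^ k * a ^ (i + j))"
    using z(2) by (simp add: power_add algebra_simps)
  moreover have "z * a ^ k * a ^ (i + j) \<in> D" by (intro subrngD(5)[OF D] ijk pw)
  ultimately have "ddvd D q ((x * a ^ i) * (y * a ^ j) * a ^ k)" unfolding ddvd_def by blast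
  then have "ddvd D q (x * a ^ i) \<or> ddvd D q (y * a ^ j)"
    using qD(4)[OF subrngD(5)[OF D ijk(1,2)] pw, of k] qD(4)[OF ijk(1,2)] primel_ddvd_power[OF D q a(1)] nd by blast
  moreover have "ddvd (loc D a) q x" if dd: "ddvd D q (x * a ^ i)" for x i
  proof -
    obtain d where d: "d \<in> D" "x * a ^ i = q * d" using dd by (auto simp: ddvd_def)
    have "x = q * (d / a ^ i)" using d a by (simp add: field_simps)
    moreover have "d / a ^ i \<in> loc D a" unfolding loc_def using d a by (auto intro!: exI[of _ i])
    ultimately show ?thesis unfolding ddvd_def by blast
  qed
  ultimately show "ddvd (loc D a) q x \<or> ddvd (loc D a) q y" by blast
qed

lemma ddvd_unts_loc:
  assumes "subrng D" "q \<in> D" "a \<noteq> 0" "ddvd D q a" shows "q \<in> unts (loc D a)"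
proof -
  obtain d where d: "d \<in> D" "a = q * d" using assms(4) by (auto simp: ddvd_def)
  then have "q \<noteq> 0" using assms(3) by auto
  moreover have "inverse q * a ^ 1 \<in> D" using d \<open>q \<noteq> 0\<close> by (simp add: mult.assoc[symmetric])
  then have "inverse q \<in> loc D a" unfolding loc_def by blast
  ultimately show ?thesis using assms(2) loc_subset[of D a] by (auto simp: unts_field)
qed

lemma primel_unts_loc_ddvd:
  assumes "subrng D" "primel D q" "a \<in> D" "a \<noteq> 0" "q \<in> unts (loc D a)" shows "ddvd D q a"
  using primel_loc[OF assms(1-4)] assms(5) by (auto simp: primel_def)

text \<open>Primes of D dividing a become units and all others stay prime, so a factorization over D
  becomes one over D[1/a].\<close>

theorem PFD_loc:
  assumes D: "PFD D" and a: "a \<in> D" "a \<noteq> 0" shows "PFD (loc D a)"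
  unfolding PFD_def
proof (intro conjI ballI impI)
  note Ds = PFD_subrng[OF D]
  show Ls: "subrng (loc D a)" by (rule loc_subrng[OF Ds a(1)])
  fix x assume x: "x \<in> loc D a" "x \<noteq> 0"
  then obtain i where i: "x * a ^ i \<in> D" by (auto simp: loc_def)
  obtain u qs where u: "u \<in> unts D" "\<forall>q\<in>set qs. primel D q" "x * a ^ i = u * prod_list qs"
    using PFD_factor[OF D i] x a by auto
  have "\<exists>v\<in>unts (loc D a). \<exists>rs. (\<forall>q\<in>set rs. primel (loc D a) q) \<and> prod_list qs = v * prod_list rs"
    using u(2)
  proof (induction qs)
    case Nil
    then show ?case using unts_1[OF Ls] by (intro bexI[of _ 1] exI[of _ "[]"]) auto
  next
    case (Cons q qs)
    then obtain v rs where v: "v \<in> unts (loc D a)" "\<forall>q\<in>set rs. primel (loc D a) q" "prod_list qs = v * prod_list rs"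
      by auto
    have q: "primel D q" using Cons by simp
    show ?case
    proof (cases "ddvd D q a")
      case True
      then have "q \<in> unts (loc D a)" using ddvd_unts_loc[OF Ds _ a(2)] primelD[OF q] by blast
      then show ?thesis using v unts_mult[OF Ls, of q v]
        by (intro bexI[of _ "q * v"] exI[of _ rs]) (auto simp: mult.assoc)
    next
      case False
      then have "primel (loc D a) q" using primel_loc[OF Ds q a] by blast
      then show ?thesis using v by (intro bexI[of _ v] exI[of _ "q # rs"]) (auto simp: mult_ac)
    qed
  qed
  then obtain v rs where v: "v \<in> unts (loc D a)" "\<forall>q\<in>set rs. primel (loc D a) q" "prod_list qs = v * prod_list rs" by blast
  have "u \<in> unts (loc D a)" using u(1) loc_subset[of D a] by (auto simp: unts_field)
  then have "u * v / a ^ i \<in> unts (loc D a)"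
    by (intro unts_divide[OF Ls] unts_mult[OF Ls] v power_in_unts_loc[OF Ds a])
  moreover have "x = (u * v / a ^ i) * prod_list rs" using u(3) v(3) a by (simp add: field_simps)
  ultimately show "\<exists>u\<in>unts (loc D a). \<exists>qs. (\<forall>q\<in>set qs. primel (loc D a) q) \<and> x = u * prod_list qs"
    using v by blast
qed

lemma prime_representatives:
  fixes D :: "'b::field set"
  assumes D: "subrng D" and "\<forall>q\<in>set qs. primel D q \<and> P q"
  shows "\<exists>rs. (\<forall>r\<in>set rs. primel D r \<and> P r) \<and> (\<forall>q\<in>set qs. \<exists>r\<in>set rs. ddvd D r q) \<and>
     (\<forall>i<length rs. \<forall>j<length rs. i \<noteq> j \<longrightarrow> \<not> ddvd D (rs ! i) (rs ! j))"
  using assms(2)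
proof (induction qs)
  case Nil
  show ?case by (intro exI[of _ "[]"]) auto
next
  case (Cons q qs)
  then obtain rs where rs: "\<forall>r\<in>set rs. primel D r \<and> P r" "\<forall>q\<in>set qs. \<exists>r\<in>set rs. ddvd D r q"
    "\<forall>i<length rs. \<forall>j<length rs. i \<noteq> j \<longrightarrow> \<not> ddvd D (rs ! i) (rs ! j)" by auto
  show ?case
  proof (cases "\<exists>r\<in>set rs. ddvd D r q")
    case True
    then show ?thesis using rs by (intro exI[of _ rs]) auto
  next
    case False
    have q: "primel D q" "P q" using Cons by auto
    have 1: "\<not> ddvd D (rs ! i) q" "\<not> ddvd D q (rs ! i)" if "i < length rs" for i
    proof -
      show "\<not> ddvd D (rs ! i) q" using False that by auto
      then show "\<not> ddvd D q (rs ! i)" using primel_assoc_sym[OF D q(1), of "rs ! i"] rs(1) that by auto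
    qed
    have "\<forall>i<length (q # rs). \<forall>j<length (q # rs). i \<noteq> j \<longrightarrow> \<not> ddvd D ((q # rs) ! i) ((q # rs) ! j)"
    proof (intro allI impI)
      fix i j assume "i < length (q # rs)" "j < length (q # rs)" "i \<noteq> j"
      then show "\<not> ddvd D ((q # rs) ! i) ((q # rs) ! j)"
        using rs(3) 1 by (cases i; cases j) auto
    qed
    then show ?thesis using rs q ddvd_refl[OF D, of q] by (intro exI[of _ "q # rs"]) auto
  qed
qed

text \<open>U/C is a permutation lattice: e induces an isomorphism of U/C with \<int>^r under which
  tau permutes the coordinates by s.\<close>

definition perm_basis :: "'b::field set \<Rightarrow> 'b set \<Rightarrow> ('b \<Rightarrow> 'b) \<Rightarrow> nat \<Rightarrow> ('b \<Rightarrow> nat \<Rightarrow> int) \<Rightarrow> (nat \<Rightarrow> nat) \<Rightarrow> bool" where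
  "perm_basis U C tau r e s \<longleftrightarrow>
     (\<forall>x\<in>U. \<forall>y\<in>U. \<forall>i<r. e (x * y) i = e x i + e y i) \<and>
     (\<forall>x\<in>U. (\<forall>i<r. e x i = 0) \<longleftrightarrow> x \<in> C) \<and>
     (\<forall>c. \<exists>x\<in>U. \<forall>i<r. e x i = c i) \<and>
     bij_betw s {..<r} {..<r} \<and>
     (\<forall>x\<in>U. \<forall>i<r. e (tau x) (s i) = e x i)"

locale field_aut =
  fixes L :: "'b::field set" and tau :: "'b \<Rightarrow> 'b"
  assumes L: "is_subfield L"
    and tau_add: "x \<in> L \<Longrightarrow> y \<in> L \<Longrightarrow> tau (x + y) = tau x + tau y"
    and tau_mult: "x \<in> L \<Longrightarrow> y \<in> L \<Longrightarrow> tau (x * y) = tau x * tau y"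
    and tau_1: "tau 1 = 1"
    and tau_L: "x \<in> L \<Longrightarrow> tau x \<in> L"
begin

lemma Ls: "subrng L" by (rule subfield_subrng[OF L])

lemma L_inverse: "x \<in> L \<Longrightarrow> inverse x \<in> L" using L by (auto simp: is_subfield_def)

lemma tau_0: "tau 0 = 0"
  using tau_add[of 0 0] subrngD(1)[OF Ls] by (metis add_cancel_right_left add_0)

lemma tau_minus: "x \<in> L \<Longrightarrow> y \<in> L \<Longrightarrow> tau (x - y) = tau x - tau y"
  using tau_add[of "x - y" y] subrngD(4)[OF Ls, of x y] by (simp add: algebra_simps)

lemma tau_nonzero: "x \<in> L \<Longrightarrow> x \<noteq> 0 \<Longrightarrow> tau x \<noteq> 0"
  using tau_mult[of x "inverse x"] L_inverse[of x] tau_1 by auto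

lemma tau_inverse: "x \<in> L \<Longrightarrow> tau (inverse x) = inverse (tau x)"
proof (cases "x = 0")
  case False
  assume x: "x \<in> L"
  have "tau x * tau (inverse x) = 1" using tau_mult[OF x L_inverse[OF x]] False tau_1 by simp
  then show ?thesis by (metis inverse_unique)
qed (simp add: tau_0)

lemma tau_inj: "inj_on tau L"
proof (rule inj_onI)
  fix x y assume xy: "x \<in> L" "y \<in> L" "tau x = tau y"
  then have "tau (x - y) = 0" by (simp add: tau_minus)
  then show "x = y" using tau_nonzero[of "x - y"] subrngD(4)[OF Ls, of x y] xy by auto
qed

lemma tau_power: "x \<in> L \<Longrightarrow> tau (x ^ k) = tau x ^ k"
  by (induction k) (auto simp: tau_1 tau_mult subrng_power[OF Ls])

lemma tau_power_int: "x \<in> L \<Longrightarrow> tau (x powi k) = tau x powi k"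
  by (simp add: power_int_def tau_power tau_inverse L_inverse)

lemma L_power_int: "x \<in> L \<Longrightarrow> x powi k \<in> L"
  by (simp add: power_int_def subrng_power[OF Ls] L_inverse)

lemma tau_prod: "(\<And>i. i \<in> I \<Longrightarrow> f i \<in> L) \<Longrightarrow> tau (\<Prod>i\<in>I. f i) = (\<Prod>i\<in>I. tau (f i))"
  by (induction I rule: infinite_finite_induct) (auto simp: tau_1 tau_mult subrng_prod[OF Ls])

text \<open>The primes dividing a, one from each class of associates, form a basis of the units of
  D[1/a] modulo those of D. Since tau maps D onto itself and preserves the units of D[1/a], it
  permutes these classes.\<close>

theorem unit_perm_basis:
  assumes D: "PFD D" and a: "a \<in> D" "a \<noteq> 0" and DL: "D \<subseteq> L" and tauD: "tau ` D = D"
    and tauU: "\<And>x. x \<in> unts (loc D a) \<Longrightarrow> tau x \<in> unts (loc D a)"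
  shows "\<exists>r e s. perm_basis (unts (loc D a)) (unts D) tau r e s"
proof -
  note Ds = PFD_subrng[OF D]
  define U where "U = unts (loc D a)"
  note locs = loc_subrng[OF Ds a(1)]
  obtain ua as where as: "ua \<in> unts D" "\<forall>q\<in>set as. primel D q" "a = ua * prod_list as"
    using PFD_factor[OF D a] .
  have asD: "set as \<subseteq> D" using as(2) by (auto dest: primelD(1))
  have asa: "\<forall>q\<in>set as. primel D q \<and> ddvd D q a"
  proof
    fix q assume q: "q \<in> set as"
    then have "prod_list as = q * prod_list (remove1 q as)" by (induction as) (auto simp: algebra_simps)
    then have "a = q * (ua * prod_list (remove1 q as))" using as by (simp add: algebra_simps)
    moreover have "ua * prod_list (remove1 q as) \<in> D"
      using as(1) asD set_remove1_subset[of q as]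
      by (intro subrngD(5)[OF Ds] subrng_prod_list[OF Ds]) (auto simp: unts_def)
    ultimately show "primel D q \<and> ddvd D q a" using as q unfolding ddvd_def by blast
  qed
  obtain rs where rs: "\<forall>r\<in>set rs. primel D r \<and> ddvd D r a" "\<forall>q\<in>set as. \<exists>r\<in>set rs. ddvd D r q"
     "\<forall>i<length rs. \<forall>j<length rs. i \<noteq> j \<longrightarrow> \<not> ddvd D (rs ! i) (rs ! j)"
    using prime_representatives[OF Ds asa] by blast
  define r where "r = length rs"
  define pi where "pi i = rs ! i" for i
  have pi: "primel D (pi i)" "ddvd D (pi i) a" if "i < r" for i using that rs(1) by (auto simp: pi_def r_def)
  have piD: "pi i \<in> D" "pi i \<noteq> 0" if "i < r" for i using primelD[OF pi(1)[OF that]] by auto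
  have piU: "pi i \<in> U" if "i < r" for i
    unfolding U_def by (rule ddvd_unts_loc[OF Ds piD(1)[OF that] a(2) pi(2)[OF that]])
  have na: "i = j" if "i < r" "j < r" "ddvd D (pi i) (pi j)" for i j
    using rs(3) that by (auto simp: pi_def r_def)
  have rep: "\<exists>i<r. \<exists>w\<in>unts D. q = pi i * w" if q: "primel D q" "ddvd D q a" for q
  proof -
    have "ddvd D q (ua * prod_list as)" using q as by simp
    moreover have pl: "prod_list as \<in> D" "ua \<in> D" "set as \<subseteq> D"
      using as(1) asD by (auto simp: unts_def intro!: subrng_prod_list[OF Ds])
    ultimately have "ddvd D q (prod_list as)"
      using primelD(4)[OF q(1) pl(2,1)] not_ddvd_unit[OF Ds q(1) as(1)] by blast
    then obtain b where b: "b \<in> set as" "ddvd D q b" using primel_ddvd_prod_list[OF Ds q(1) pl(3)] by blast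
    then obtain c where c: "c \<in> set rs" "ddvd D c b" using rs(2) by blast
    have "ddvd D b q" using primel_assoc_sym[OF Ds q(1)] b as by blast
    then have "ddvd D c q" using ddvd_trans[OF Ds c(2)] by blast
    then obtain w where "w \<in> unts D" "q = c * w" using primel_assoc[OF Ds _ q(1)] c rs(1) by metis
    then show ?thesis using c(1) by (auto simp: pi_def r_def in_set_conv_nth)
  qed
  \<comment> \<open>The group generated by the units of D and the chosen primes; it turns out to be
    all of U.\<close>
  define Z where "Z = {u * (\<Prod>i<r. pi i powi e i) | u e. u \<in> unts D}"
  have Zm: "x * y \<in> Z" if xy: "x \<in> Z" "y \<in> Z" for x y
  proof -
    obtain u e v f where ue: "u \<in> unts D" "x = u * (\<Prod>i<r. pi i powi e i)" "v \<in> unts D" "y = v * (\<Prod>i<r. pi i powi f i)"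
      using xy unfolding Z_def by blast
    have "x * y = (u * v) * (\<Prod>i<r. pi i powi (e i + f i))"
      using piD by (simp add: ue power_int_add prod.distrib mult_ac)
    moreover have "u * v \<in> unts D" by (rule unts_mult[OF Ds ue(1,3)])
    ultimately show ?thesis unfolding Z_def mem_Collect_eq by (intro exI conjI)
  qed
  have Zi: "inverse x \<in> Z" if x: "x \<in> Z" for x
  proof -
    obtain u e where ue: "u \<in> unts D" "x = u * (\<Prod>i<r. pi i powi e i)" using x unfolding Z_def by blast
    have "inverse x = inverse u * (\<Prod>i<r. pi i powi (- e i))"
      by (simp add: ue power_int_minus prod_inversef[symmetric] o_def)
    then show ?thesis unfolding Z_def mem_Collect_eq using unts_inverse[OF ue(1)] by (intro exI conjI)
  qed
  have Zu: "u \<in> Z" if "u \<in> unts D" for u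
    unfolding Z_def mem_Collect_eq using that by (intro exI[of _ u] exI[of _ "\<lambda>_. 0"]) auto
  have Zpi: "pi i \<in> Z" if "i < r" for i
  proof -
    have "(\<Prod>j<r. pi j powi (if j = i then 1 else 0)) = (\<Prod>j<r. if j = i then pi j else 1)" by (intro prod.cong) auto
    also have "\<dots> = pi i" using that by (simp add: prod.delta)
    finally have "pi i = 1 * (\<Prod>j<r. pi j powi (if j = i then 1 else 0))" by simp
    then show ?thesis unfolding Z_def mem_Collect_eq using unts_1[OF Ds] by (intro exI conjI)
  qed
  have Zq: "q \<in> Z" if "primel D q" "ddvd D q a" for q
    using rep[OF that] Zm Zpi Zu by blast
  have Zpl: "prod_list qs \<in> Z" if "\<forall>q\<in>set qs. primel D q \<and> ddvd D q a" for qs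
    using that by (induction qs) (auto intro: Zm Zq Zu unts_1[OF Ds])
  have Zpow: "x ^ k \<in> Z" if "x \<in> Z" for x k
    using that by (induction k) (auto intro: Zm Zu unts_1[OF Ds])
  have ZU: "Z = U"
  proof (intro equalityI subsetI)
    fix x assume "x \<in> Z"
    then obtain u e where ue: "u \<in> unts D" "x = u * (\<Prod>i<r. pi i powi e i)" unfolding Z_def by blast
    have "u \<in> unts (loc D a)" using ue(1) loc_subset[of D a] by (auto simp: unts_field)
    moreover have "(\<Prod>i<r. pi i powi e i) \<in> unts (loc D a)"
      by (intro unts_prod[OF locs] unts_power_int[OF locs]) (use piU in \<open>auto simp: U_def\<close>)
    ultimately show "x \<in> U" unfolding U_def ue by (intro unts_mult[OF locs])
  next
    fix x assume "x \<in> U"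
    then have x: "x \<in> loc D a" "inverse x \<in> loc D a" "x \<noteq> 0" by (auto simp: U_def unts_field)
    then obtain i j where ij: "x * a ^ i \<in> D" "inverse x * a ^ j \<in> D" by (auto simp: loc_def)
    obtain u qs where u: "u \<in> unts D" "\<forall>q\<in>set qs. primel D q" "x * a ^ i = u * prod_list qs"
      using PFD_factor[OF D ij(1)] x a by auto
    have qsD: "set qs \<subseteq> D" using u(2) by (auto dest: primelD(1))
    have "\<forall>q\<in>set qs. primel D q \<and> ddvd D q a"
    proof
      fix q assume q: "q \<in> set qs"
      then have "prod_list qs = q * prod_list (remove1 q qs)" by (induction qs) (auto simp: algebra_simps)
      then have "x * a ^ i = q * (u * prod_list (remove1 q qs))" using u by (simp add: algebra_simps)
      moreover have "u * prod_list (remove1 q qs) \<in> D"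
        using u(1) qsD set_remove1_subset[of q qs]
        by (intro subrngD(5)[OF Ds] subrng_prod_list[OF Ds]) (auto simp: unts_def)
      ultimately have "ddvd D q (x * a ^ i)" unfolding ddvd_def by blast
      then have "ddvd D q ((x * a ^ i) * (inverse x * a ^ j))" by (rule ddvd_mult[OF Ds ij(2)])
      moreover have "(x * a ^ i) * (inverse x * a ^ j) = a ^ (i + j)" using x by (simp add: power_add)
      ultimately have "ddvd D q (a ^ (i + j))" by simp
      then show "primel D q \<and> ddvd D q a" using primel_ddvd_power[OF Ds _ a(1)] u q by blast
    qed
    then have "prod_list qs \<in> Z" by (rule Zpl)
    moreover have "a \<in> Z" unfolding as(3) by (intro Zm Zu as Zpl asa)
    ultimately have "u * prod_list qs * inverse (a ^ i) \<in> Z"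
      using Zm[OF Zm[OF Zu[OF u(1)]] Zi[OF Zpow]] by blast
    moreover have "x = u * prod_list qs * inverse (a ^ i)" using u(3) a by (simp add: field_simps)
    ultimately show "x \<in> Z" by simp
  qed
  \<comment> \<open>If e j > 0, moving the negative exponents to the other side makes pi j divide a
    product of those pi i with e i < 0, none of which is associated to it.\<close>
  have uniq0: "e j \<le> 0" if ue: "u \<in> unts D" "u * (\<Prod>i<r. pi i powi e i) = 1" and j: "j < r" for u e j
  proof (rule ccontr)
    assume "\<not> e j \<le> 0"
    then have ej: "nat (e j) > 0" by simp
    have "pi i powi e i * pi i ^ nat (- e i) = pi i ^ nat (e i)" if "i < r" for i
      using piD(2)[OF that] by (cases "e i \<ge> 0") (auto simp: power_int_def power_mult_distrib[symmetric])
    then have "(\<Prod>i<r. pi i powi e i) * (\<Prod>i<r. pi i ^ nat (- e i)) = (\<Prod>i<r. pi i ^ nat (e i))"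
      unfolding prod.distrib[symmetric] by (intro prod.cong) auto
    then have eq: "u * (\<Prod>i<r. pi i ^ nat (e i)) = (\<Prod>i<r. pi i ^ nat (- e i))"
      using ue(2) by (metis mult.assoc mult_1)
    have "(\<Prod>i<r. pi i ^ nat (e i)) = pi j * (pi j ^ (nat (e j) - 1) * (\<Prod>i\<in>{..<r} - {j}. pi i ^ nat (e i)))"
      using j ej by (subst prod.remove[of _ j]) (auto simp: power_eq_if)
    then have "(\<Prod>i<r. pi i ^ nat (- e i)) = pi j * (u * (pi j ^ (nat (e j) - 1) * (\<Prod>i\<in>{..<r} - {j}. pi i ^ nat (e i))))"
      using eq by (simp add: algebra_simps)
    moreover have "u * (pi j ^ (nat (e j) - 1) * (\<Prod>i\<in>{..<r} - {j}. pi i ^ nat (e i))) \<in> D"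
      using ue(1) piD j by (intro subrngD(5)[OF Ds] subrng_power[OF Ds] subrng_prod[OF Ds]) (auto simp: unts_def)
    ultimately have dd: "ddvd D (pi j) (\<Prod>i<r. pi i ^ nat (- e i))" unfolding ddvd_def by blast
    have "\<exists>i\<in>I. ddvd D (pi j) (pi i ^ nat (- e i))" if "ddvd D (pi j) (\<Prod>i\<in>I. pi i ^ nat (- e i))" "I \<subseteq> {..<r}" for I
      using finite_subset[OF that(2) finite_lessThan] that
    proof (induction I rule: finite_induct)
      case empty
      then show ?case using not_ddvd_unit[OF Ds pi(1)[OF j] unts_1[OF Ds]] by simp
    next
      case (insert i I)
      have "pi i ^ nat (- e i) \<in> D" "(\<Prod>i\<in>I. pi i ^ nat (- e i)) \<in> D"
        using insert piD by (auto intro!: subrng_power[OF Ds] subrng_prod[OF Ds])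
      then show ?case using primelD(4)[OF pi(1)[OF j], of "pi i ^ nat (- e i)" "\<Prod>i\<in>I. pi i ^ nat (- e i)"] insert by auto
    qed
    from this[OF dd] obtain i where i: "i < r" "ddvd D (pi j) (pi i ^ nat (- e i))" by auto
    then have "ddvd D (pi j) (pi i)" "nat (- e i) > 0"
      using primel_ddvd_power[OF Ds pi(1)[OF j] piD(1)[OF i(1)] i(2)] by blast+
    then show False using na[OF j i(1)] ej by auto
  qed
  have uniq: "e j = f j" if ue: "u \<in> unts D" "v \<in> unts D" "u * (\<Prod>i<r. pi i powi e i) = v * (\<Prod>i<r. pi i powi f i)" and j: "j < r" for u e v f j
  proof -
    have le: "e j - f j \<le> 0" if ue: "u \<in> unts D" "v \<in> unts D" "u * (\<Prod>i<r. pi i powi e i) = v * (\<Prod>i<r. pi i powi f i)" for u e v f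
    proof (rule uniq0[of "u / v" "\<lambda>i. e i - f i", OF _ _ j])
      show "u / v \<in> unts D" by (rule unts_divide[OF Ds ue(1,2)])
      have nz: "(\<Prod>i<r. pi i powi f i) \<noteq> 0" "v \<noteq> 0" using piD ue by (auto simp: unts_field)
      have "(\<Prod>i<r. pi i powi (e i - f i)) = (\<Prod>i<r. pi i powi e i) / (\<Prod>i<r. pi i powi f i)"
        using piD by (simp add: power_int_diff prod_dividef)
      then have "u / v * (\<Prod>i<r. pi i powi (e i - f i)) = (u * (\<Prod>i<r. pi i powi e i)) / (v * (\<Prod>i<r. pi i powi f i))"
        by (simp only: times_divide_times_eq)
      also have "\<dots> = 1" unfolding ue(3) by (rule divide_self) (use nz in \<open>simp only: mult_eq_0_iff simp_thms\<close>)
      finally show "u / v * (\<Prod>i<r. pi i powi (e i - f i)) = 1" .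
    qed
    show ?thesis using le[OF ue] le[OF ue(2,1) ue(3)[symmetric]] by simp
  qed
  define e where "e x = (SOME f. \<exists>u\<in>unts D. x = u * (\<Prod>i<r. pi i powi f i))" for x
  have ex: "\<exists>u\<in>unts D. x = u * (\<Prod>i<r. pi i powi e x i)" if "x \<in> U" for x
  proof -
    have "\<exists>f. \<exists>u\<in>unts D. x = u * (\<Prod>i<r. pi i powi f i)" using that unfolding ZU[symmetric] Z_def by blast
    then show ?thesis unfolding e_def by (rule someI_ex)
  qed
  have eI: "e x i = f i" if "u \<in> unts D" "x = u * (\<Prod>i<r. pi i powi f i)" "i < r" for x u f i
  proof -
    have "x \<in> U" unfolding ZU[symmetric] Z_def using that by blast
    then obtain v where "v \<in> unts D" "x = v * (\<Prod>i<r. pi i powi e x i)" using ex by blast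
    then show ?thesis using uniq[of v u "e x" f i] that by simp
  qed
  have DL': "x \<in> D \<Longrightarrow> x \<in> L" for x using DL by blast
  have hom: "\<And>x y. x \<in> D \<Longrightarrow> y \<in> D \<Longrightarrow> tau (x + y) = tau x + tau y"
    "\<And>x y. x \<in> D \<Longrightarrow> y \<in> D \<Longrightarrow> tau (x * y) = tau x * tau y"
    using tau_add tau_mult DL' by blast+
  note injD = inj_on_subset[OF tau_inj DL]
  have T2: "unts D = tau ` unts D"
    using PFD_transport(2)[of D tau] D injD hom tau_1 unfolding tauD by blast
  have T3: "primel D (tau q)" if "primel D q" for q
    using PFD_transport(3)[of D tau q] D injD hom tau_1 that unfolding tauD by blast
  have T4: "ddvd D (tau x) (tau y) \<longleftrightarrow> ddvd D x y" if "x \<in> D" "y \<in> D" for x y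
    using PFD_transport(4)[of D tau x y] D injD hom tau_1 that unfolding tauD by blast
  \<comment> \<open>tau (pi i) is a prime of D and a unit of D[1/a], so it divides a and is
    associated to one of the chosen primes.\<close>
  have "\<forall>i<r. \<exists>j. j < r \<and> (\<exists>w\<in>unts D. tau (pi i) = pi j * w)"
  proof (intro allI impI)
    fix i assume i: "i < r"
    have "primel D (tau (pi i))" by (rule T3[OF pi(1)[OF i]])
    moreover have "tau (pi i) \<in> unts (loc D a)" using tauU piU[OF i] by (simp add: U_def)
    ultimately have "ddvd D (tau (pi i)) a" using primel_unts_loc_ddvd[OF Ds _ a] by blast
    then show "\<exists>j. j < r \<and> (\<exists>w\<in>unts D. tau (pi i) = pi j * w)" using rep[OF \<open>primel D (tau (pi i))\<close>] by blast
  qed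
  then obtain s where s: "\<And>i. i < r \<Longrightarrow> s i < r" "\<And>i. i < r \<Longrightarrow> \<exists>w\<in>unts D. tau (pi i) = pi (s i) * w" by metis
  have "\<forall>i. \<exists>w. i < r \<longrightarrow> w \<in> unts D \<and> tau (pi i) = pi (s i) * w" using s(2) by blast
  then obtain w where w: "\<And>i. i < r \<Longrightarrow> w i \<in> unts D" "\<And>i. i < r \<Longrightarrow> tau (pi i) = pi (s i) * w i" by metis
  have s_inj: "inj_on s {..<r}"
  proof (rule inj_onI)
    fix i j assume ij: "i \<in> {..<r}" "j \<in> {..<r}" "s i = s j"
    then have "tau (pi j) = tau (pi i) * (w j / w i)" using w[of i] w[of j] by (auto simp: unts_field)
    moreover have "w j / w i \<in> D" using unts_divide[OF Ds w(1) w(1), of j i] ij by (auto simp: unts_def)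
    ultimately have "ddvd D (tau (pi i)) (tau (pi j))" unfolding ddvd_def by blast
    then have "ddvd D (pi i) (pi j)" using T4 piD ij by auto
    then show "i = j" using na ij by auto
  qed
  have s_bij: "bij_betw s {..<r} {..<r}"
    using s_inj s(1) by (simp add: bij_betw_def endo_inj_surj image_subset_iff)
  have etau: "e (tau x) (s i) = e x i" if x: "x \<in> U" and i: "i < r" for x i
  proof -
    obtain u where u: "u \<in> unts D" "x = u * (\<Prod>i<r. pi i powi e x i)" using ex[OF x] by blast
    have uL: "u \<in> L" "\<And>i. i < r \<Longrightarrow> pi i \<in> L" using u piD DL by (auto simp: unts_def)
    have pl: "(\<Prod>i<r. pi i powi e x i) \<in> L" by (intro subrng_prod[OF Ls] L_power_int uL) auto
    have "tau x = tau (u * (\<Prod>i<r. pi i powi e x i))" using arg_cong[OF u(2), of tau] .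
    also have "\<dots> = tau u * tau (\<Prod>i<r. pi i powi e x i)" by (rule tau_mult[OF uL(1) pl])
    also have "tau (\<Prod>i<r. pi i powi e x i) = (\<Prod>i<r. tau (pi i powi e x i))"
      by (rule tau_prod) (auto intro: L_power_int uL)
    also have "\<dots> = (\<Prod>i<r. tau (pi i) powi e x i)" by (intro prod.cong) (auto simp: tau_power_int uL)
    also have "(\<Prod>i<r. tau (pi i) powi e x i) = (\<Prod>i<r. pi (s i) powi e x i) * (\<Prod>i<r. w i powi e x i)"
      unfolding prod.distrib[symmetric] by (intro prod.cong) (auto simp: w(2) power_int_mult_distrib)
    also have "(\<Prod>i<r. pi (s i) powi e x i) = (\<Prod>i<r. pi i powi e x (inv_into {..<r} s i))"
    proof -
      have "(\<Prod>i<r. pi (s i) powi e x i) = (\<Prod>i<r. pi (s i) powi e x (inv_into {..<r} s (s i)))"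
        by (intro prod.cong) (auto simp: inv_into_f_f[OF s_inj])
      also have "\<dots> = (\<Prod>i<r. pi i powi e x (inv_into {..<r} s i))"
        by (rule prod.reindex_bij_betw[OF s_bij])
      finally show ?thesis .
    qed
    finally have eq: "tau x = (tau u * (\<Prod>i<r. w i powi e x i)) * (\<Prod>i<r. pi i powi e x (inv_into {..<r} s i))"
      by (simp add: mult_ac)
    have "tau u \<in> unts D" using T2 u(1) by blast
    then have "tau u * (\<Prod>i<r. w i powi e x i) \<in> unts D"
      by (intro unts_mult[OF Ds] unts_prod[OF Ds] unts_power_int[OF Ds]) (auto simp: w(1))
    from eI[OF this eq, of "s i"] show ?thesis using s(1) i inv_into_f_f[OF s_inj] by simp
  qed
  have "perm_basis U (unts D) tau r e s"
    unfolding perm_basis_def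
  proof (intro conjI ballI allI impI)
    fix x y i assume xy: "x \<in> U" "y \<in> U" and i: "i < r"
    obtain u where u: "u \<in> unts D" "x = u * (\<Prod>i<r. pi i powi e x i)" using ex[OF xy(1)] by blast
    obtain v where v: "v \<in> unts D" "y = v * (\<Prod>i<r. pi i powi e y i)" using ex[OF xy(2)] by blast
    have "x * y = (u * v) * (\<Prod>i<r. pi i powi (e x i + e y i))"
      using piD by (subst u(2), subst v(2)) (simp add: power_int_add prod.distrib mult_ac)
    from eI[OF unts_mult[OF Ds u(1) v(1)] this i] show "e (x * y) i = e x i + e y i" .
  next
    fix x assume x: "x \<in> U"
    show "(\<forall>i<r. e x i = 0) \<longleftrightarrow> x \<in> unts D"
    proof
      assume "\<forall>i<r. e x i = 0"
      then show "x \<in> unts D" using ex[OF x] by auto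
    next
      assume "x \<in> unts D"
      then show "\<forall>i<r. e x i = 0" using eI[of x x "\<lambda>_. 0"] by simp
    qed
  next
    fix c :: "nat \<Rightarrow> int"
    have "(\<Prod>i<r. pi i powi c i) = 1 * (\<Prod>i<r. pi i powi c i)" by simp
    then have "\<forall>i<r. e (\<Prod>i<r. pi i powi c i) i = c i" using eI[OF unts_1[OF Ds]] by blast
    moreover have "(\<Prod>i<r. pi i powi c i) \<in> U"
      unfolding U_def by (intro unts_prod[OF locs] unts_power_int[OF locs]) (use piU in \<open>auto simp: U_def\<close>)
    ultimately show "\<exists>x\<in>U. \<forall>i<r. e x i = c i" by blast
  qed (use s_bij etau in auto)
  then show ?thesis unfolding U_def by blast
qed

end

section \<open>Permutation modules\<close>

text \<open>In effect a module over \<int>[X]/(X^n - 1), written multiplicatively, with X acting as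
  tau.\<close>

locale tau_group =
  fixes U :: "'b::field set" and tau :: "'b \<Rightarrow> 'b" and n :: nat
  assumes U_mult: "x \<in> U \<Longrightarrow> y \<in> U \<Longrightarrow> x * y \<in> U"
    and U_inverse: "x \<in> U \<Longrightarrow> inverse x \<in> U"
    and U_1: "1 \<in> U"
    and U_nonzero: "x \<in> U \<Longrightarrow> x \<noteq> 0"
    and U_tau: "x \<in> U \<Longrightarrow> tau x \<in> U"
    and tau_mult: "x \<in> U \<Longrightarrow> y \<in> U \<Longrightarrow> tau (x * y) = tau x * tau y"
    and tau_n: "x \<in> U \<Longrightarrow> (tau ^^ n) x = x"
begin

lemma U_power_int: "x \<in> U \<Longrightarrow> x powi k \<in> U"
proof -
  have "y ^ m \<in> U" if "y \<in> U" for y m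
    by (induction m) (auto intro: U_1 U_mult that)
  then show "x \<in> U \<Longrightarrow> x powi k \<in> U" by (simp add: power_int_def U_inverse)
qed

text \<open>Scalar multiplication by a polynomial in that module, as a Horner scheme;
  \<open>act_altdef\<close> gives the expanded product.\<close>

definition act :: "int poly \<Rightarrow> 'b \<Rightarrow> 'b" where
  "act f x = fold_coeffs (\<lambda>c y. x powi c * tau y) f 1"

lemma act_0 [simp]: "act 0 x = 1" by (simp add: act_def)

lemma tau_1: "tau 1 = 1"
proof -
  have "tau 1 * tau 1 = tau 1 * 1" using tau_mult[OF U_1 U_1] by simp
  then show ?thesis using U_nonzero[OF U_tau[OF U_1]] by (metis mult_left_cancel)
qed

lemma act_pCons [simp]: "act (pCons c f) x = x powi c * tau (act f x)"
  by (cases "c = 0 \<and> f = 0") (auto simp: act_def tau_1)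

lemma act_U: "x \<in> U \<Longrightarrow> act f x \<in> U"
  by (induction f) (auto simp: U_1 intro: U_mult U_power_int U_tau)

end

locale tau_perm = tau_group U tau n for U :: "'b::field set" and tau n +
  fixes C r e s and w :: complex and Phi Psi :: "int poly"
  assumes basis: "perm_basis U C tau r e s" and w: "prt n w" and n1: "n > 1"
    and PP: "Phi * Psi = monom 1 n - 1" and Phiw: "ipoly Phi w = 0"
    and Phi_dvd: "ipoly f w = 0 \<Longrightarrow> Phi dvd f"
begin

lemma e_mult: "x \<in> U \<Longrightarrow> y \<in> U \<Longrightarrow> i < r \<Longrightarrow> e (x * y) i = e x i + e y i"
  using basis by (auto simp: perm_basis_def)

lemma e_C: "x \<in> U \<Longrightarrow> (\<forall>i<r. e x i = 0) \<longleftrightarrow> x \<in> C"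
  using basis by (auto simp: perm_basis_def)

lemma e_surj: "\<exists>x\<in>U. \<forall>i<r. e x i = c i"
  using basis by (auto simp: perm_basis_def)

lemma s_bij: "bij_betw s {..<r} {..<r}" using basis by (auto simp: perm_basis_def)

lemma s_less: "i < r \<Longrightarrow> s i < r" using s_bij by (auto simp: bij_betw_def)

lemma s_pow_less: "i < r \<Longrightarrow> (s ^^ k) i < r" by (induction k) (auto intro: s_less)

lemma s_inj: "i < r \<Longrightarrow> j < r \<Longrightarrow> s i = s j \<Longrightarrow> i = j"
  using s_bij by (auto simp: bij_betw_def inj_on_def)

lemma s_pow_inj: "i < r \<Longrightarrow> j < r \<Longrightarrow> (s ^^ k) i = (s ^^ k) j \<Longrightarrow> i = j"
proof (induction k)
  case (Suc k)
  then have "s ((s ^^ k) i) = s ((s ^^ k) j)" by simp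
  then have "(s ^^ k) i = (s ^^ k) j" using s_inj[OF s_pow_less[OF Suc.prems(1)] s_pow_less[OF Suc.prems(2)]] by simp
  then show ?case by (rule Suc.IH[OF Suc.prems(1,2)])
qed simp

lemma e_tau: "x \<in> U \<Longrightarrow> i < r \<Longrightarrow> e (tau x) (s i) = e x i"
  using basis by (auto simp: perm_basis_def)

lemma U_tau_pow: "x \<in> U \<Longrightarrow> (tau ^^ k) x \<in> U" by (induction k) (auto intro: U_tau)

lemma e_tau_pow: "x \<in> U \<Longrightarrow> i < r \<Longrightarrow> e ((tau ^^ k) x) ((s ^^ k) i) = e x i"
  by (induction k) (auto simp: e_tau U_tau_pow s_pow_less)

lemma s_n: assumes i: "i < r" shows "(s ^^ n) i = i"
proof -
  obtain x where x: "x \<in> U" "\<forall>j<r. e x j = (if j = i then 1 else 0)" using e_surj[of "\<lambda>j. if j = i then 1 else 0"] by blast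
  have "e x ((s ^^ n) i) = e x i" using e_tau_pow[OF x(1) i, of n] tau_n[OF x(1)] by simp
  then show ?thesis using x(2) i s_pow_less[OF i, of n] by (auto split: if_splits)
qed

lemma e_1: "i < r \<Longrightarrow> e 1 i = 0" using e_mult[OF U_1 U_1, of i] by simp

lemma e_inverse: "x \<in> U \<Longrightarrow> i < r \<Longrightarrow> e (inverse x) i = - e x i"
  using e_mult[OF _ U_inverse, of x x i] U_nonzero[of x] e_1[of i] by simp

lemma e_power: "x \<in> U \<Longrightarrow> i < r \<Longrightarrow> e (x ^ k) i = int k * e x i"
proof (induction k)
  case (Suc k)
  have "x ^ k \<in> U" using U_power_int[OF Suc.prems(1), of "int k"] by simp
  then show ?case using Suc by (simp add: e_mult algebra_simps)
qed (simp add: e_1)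

lemma e_power_int: "x \<in> U \<Longrightarrow> i < r \<Longrightarrow> e (x powi k) i = k * e x i"
  by (auto simp: power_int_def e_power e_inverse U_inverse)

text \<open>The exponents of x along the s-orbit of i, read as an element of \<int>[z]. On it tau
  acts as multiplication by z.\<close>

definition EE :: "complex \<Rightarrow> nat \<Rightarrow> 'b \<Rightarrow> complex" where
  "EE z i x = (\<Sum>k<n. of_int (e x ((s ^^ k) i)) * z ^ k)"

lemma EE_mult: "x \<in> U \<Longrightarrow> y \<in> U \<Longrightarrow> i < r \<Longrightarrow> EE z i (x * y) = EE z i x + EE z i y"
  by (simp add: EE_def e_mult s_pow_less sum.distrib algebra_simps)

lemma EE_power_int: "x \<in> U \<Longrightarrow> i < r \<Longrightarrow> EE z i (x powi c) = of_int c * EE z i x"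
  by (simp add: EE_def e_power_int s_pow_less sum_distrib_left mult_ac)

lemma EE_1: "i < r \<Longrightarrow> EE z i 1 = 0"
  by (simp add: EE_def e_1 s_pow_less)

lemma EE_tau:
  assumes x: "x \<in> U" and i: "i < r" and z: "z ^ n = 1"
  shows "EE z i (tau x) = z * EE z i x"
proof -
  let ?f = "\<lambda>k. of_int (e (tau x) ((s ^^ k) i)) * z ^ k"
  have n0: "n > 0" using n1 by simp
  have "?f n = ?f 0" using s_n[OF i] z by simp
  then have "(\<Sum>k<n. ?f k) = (\<Sum>k<n. ?f (Suc k))"
    using sum.lessThan_Suc_shift[of ?f n] sum.lessThan_Suc[of ?f n] by simp
  also have "\<dots> = (\<Sum>k<n. z * (of_int (e x ((s ^^ k) i)) * z ^ k))"
    by (intro sum.cong) (auto simp: e_tau[OF x] s_pow_less[OF i])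
  finally show ?thesis by (simp add: EE_def sum_distrib_left)
qed

lemma EE_shift:
  assumes x: "x \<in> U" and i: "i < r" and z: "z ^ n = 1"
  shows "z * EE z (s i) x = EE z i x"
proof -
  have "z * EE z (s i) x = EE z (s i) (tau x)" using EE_tau[OF x s_less[OF i] z] by simp
  also have "\<dots> = EE z i x" unfolding EE_def
    by (intro sum.cong) (auto simp: e_tau[OF x] s_pow_less[OF i] funpow_swap1[symmetric])
  finally show ?thesis .
qed

lemma EE_shift_pow:
  assumes x: "x \<in> U" and i: "i < r" and z: "z ^ n = 1"
  shows "z ^ k * EE z ((s ^^ k) i) x = EE z i x"
proof (induction k)
  case (Suc k)
  have "z ^ Suc k * EE z ((s ^^ Suc k) i) x = z ^ k * (z * EE z (s ((s ^^ k) i)) x)" by (simp add: mult_ac)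
  also have "\<dots> = EE z i x" using EE_shift[OF x s_pow_less[OF i] z] Suc by simp
  finally show ?case .
qed simp

lemma EE_act:
  assumes x: "x \<in> U" and i: "i < r" and z: "z ^ n = 1"
  shows "EE z i (act f x) = ipoly f z * EE z i x"
proof (induction f)
  case (pCons c f)
  have "EE z i (act (pCons c f) x) = of_int c * EE z i x + z * EE z i (act f x)"
    using EE_mult[OF U_power_int[OF x] U_tau[OF act_U[OF x]] i] EE_power_int[OF x i] EE_tau[OF act_U[OF x] i z] by simp
  then show ?case using pCons by (simp add: algebra_simps)
qed (simp add: EE_1[OF i])

lemma EE_ipoly: "EE z i x = ipoly (\<Sum>k<n. monom (e x ((s ^^ k) i)) k) z"
  by (simp add: EE_def ipoly_sum)

lemma wn: "w ^ n = 1" using w by (simp add: prt_def)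

text \<open>With d = n / gcd i n, Phi divides (X^n - 1) / (X^d - 1), so the cofactor Psi contains
  X^d - 1, which vanishes at w^i.\<close>

lemma Psi_root: assumes "\<not> coprime i n" shows "ipoly Psi (w ^ i) = 0"
proof -
  have n0: "n > 0" using n1 by simp
  define g where "g = gcd i n"
  have g: "g dvd n" "g dvd i" "g > 0" using n0 by (auto simp: g_def)
  have "g \<noteq> 1" using assms unfolding g_def by (metis coprime_iff_gcd_eq_1)
  define d where "d = n div g"
  have nd: "n = d * g" using g by (simp add: d_def)
  have d0: "d > 0" using nd n0 by (intro Nat.gr0I) auto
  have dn: "d < n" using nd d0 \<open>g \<noteq> 1\<close> g(3) by (cases g) auto
  define S :: "int poly" where "S = (\<Sum>k<g. monom 1 (d * k))"
  have S: "(monom 1 d - 1) * S = monom 1 n - 1"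
  proof -
    have "S = (\<Sum>k<g. (monom 1 d) ^ k)" by (simp add: S_def monom_power)
    then have "(monom 1 d - 1) * S = (monom 1 d) ^ g - 1" by (simp add: power_diff_1_eq)
    then show ?thesis by (simp add: monom_power nd)
  qed
  have "(w ^ d - 1) * ipoly S w = 0" using arg_cong[OF S, of "\<lambda>f. ipoly f w"] wn by simp
  moreover have "w ^ d \<noteq> 1" using w d0 dn by (auto simp: prt_def)
  ultimately have "ipoly S w = 0" by simp
  then obtain T where T: "S = Phi * T" using Phi_dvd by (auto simp: dvd_def)
  have "Phi * ((monom 1 d - 1) * T) = Phi * Psi" using S PP T by (simp add: mult_ac)
  moreover have "Phi \<noteq> 0" using PP n0 by (auto simp: monom_eq_1_iff)
  ultimately have "Psi = (monom 1 d - 1) * T" by simp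
  moreover have "(w ^ i) ^ d = 1"
  proof -
    have "n dvd i * d" using g(2) nd by (metis mult.commute mult_dvd_mono dvd_refl)
    then show ?thesis using prt_power_eq_1_iff[OF w, of "i * d"] by (simp add: power_mult)
  qed
  ultimately show ?thesis by simp
qed

text \<open>Otherwise w would be a double root of X^n - 1.\<close>

lemma Psi_w: "ipoly Psi w \<noteq> 0"
proof
  assume 0: "ipoly Psi w = 0"
  have "ipoly (pderiv (Phi * Psi)) w = of_nat n * w ^ (n - 1)" unfolding PP by (rule ipoly_pderiv_xn)
  then have "of_nat n * w ^ (n - 1) = 0" using 0 Phiw by (simp add: pderiv_mult)
  then show False using prt_nonzero[OF w] n1 by simp
qed

text \<open>The exponents of \<open>act Psi x\<close> along an orbit form a polynomial of degree
  below n. It vanishes at primitive n-th roots of unity by conjugation from w and at the others by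
  \<open>Psi_root\<close>, hence is zero. Conversely Psi(w) cancels.\<close>

lemma EE_zero_iff:
  assumes x: "x \<in> U"
  shows "(\<forall>i<r. EE w i x = 0) \<longleftrightarrow> act Psi x \<in> C"
proof
  assume E0: "\<forall>i<r. EE w i x = 0"
  have "e (act Psi x) i = 0" if i: "i < r" for i
  proof -
    define F where "F = (\<Sum>k<n. monom (e (act Psi x) ((s ^^ k) i)) k)"
    have "(monom 1 n - 1) dvd F"
    proof (rule ipoly_eq_0_roots_of_unity[OF w])
      fix j assume "j < n"
      have z: "(w ^ j) ^ n = 1" using wn by (metis mult.commute power_mult power_one)
      have "ipoly F (w ^ j) = ipoly Psi (w ^ j) * EE (w ^ j) i x"
        using EE_act[OF x i z] by (simp add: F_def EE_ipoly[symmetric])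
      also have "\<dots> = 0"
      proof (cases "coprime j n")
        case True
        have "EE (w ^ j) i x = 0" unfolding EE_ipoly
          by (rule conj_root[OF w True]) (use E0 i in \<open>simp add: EE_ipoly[symmetric]\<close>)
        then show ?thesis by simp
      qed (simp add: Psi_root)
      finally show "ipoly F (w ^ j) = 0" .
    qed
    then obtain G where G: "F = (monom 1 n - 1) * G" by (auto simp: dvd_def)
    have "F = 0"
    proof (rule ccontr)
      assume "F \<noteq> 0"
      then have "G \<noteq> 0" using G by auto
      have "degree (monom 1 n - 1 :: int poly) = n"
        using n1 by (intro antisym degree_diff_le le_degree) (auto simp: degree_monom_le)
      moreover have "monom 1 n - 1 \<noteq> (0 :: int poly)" using n1 by (auto simp: monom_eq_1_iff)
      ultimately have "degree F \<ge> n" using G \<open>G \<noteq> 0\<close> by (simp add: degree_mult_eq)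
      moreover have "degree F \<le> n - 1" unfolding F_def
        by (intro degree_sum_le) (auto intro!: order_trans[OF degree_monom_le])
      ultimately show False using n1 by simp
    qed
    then have "coeff F 0 = 0" by simp
    moreover have "coeff F 0 = e (act Psi x) i"
      using n1 by (simp add: F_def coeff_sum sum.delta[of _ 0 "\<lambda>k. e (act Psi x) ((s ^^ k) i)"] if_distrib cong: if_cong)
    ultimately show ?thesis by simp
  qed
  then show "act Psi x \<in> C" using e_C[OF act_U[OF x]] by blast
next
  assume "act Psi x \<in> C"
  then have "\<forall>i<r. e (act Psi x) i = 0" using e_C[OF act_U[OF x]] by blast
  then have "EE w i (act Psi x) = 0" if "i < r" for i using that by (simp add: EE_def s_pow_less)
  then show "\<forall>i<r. EE w i x = 0" using EE_act[OF x _ wn] Psi_w by simp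
qed

text \<open>Least representatives of the orbits of length n. A shorter orbit contributes nothing at
  w, because its evaluation equals itself times some w^d different from 1.\<close>

definition J :: "nat set" where
  "J = {j. j < r \<and> (\<forall>d. 0 < d \<and> d < n \<longrightarrow> (s ^^ d) j \<noteq> j) \<and> (\<forall>k. j \<le> (s ^^ k) j)}"

lemma EE_zero_J:
  assumes x: "x \<in> U" and J0: "\<forall>j\<in>J. EE w j x = 0"
  shows "\<forall>i<r. EE w i x = 0"
proof (intro allI impI)
  fix i assume i: "i < r"
  show "EE w i x = 0"
  proof (cases "\<exists>d. 0 < d \<and> d < n \<and> (s ^^ d) i = i")
    case True
    then obtain d where d: "0 < d" "d < n" "(s ^^ d) i = i" by blast
    then have "w ^ d * EE w i x = EE w i x" using EE_shift_pow[OF x i wn, of d] by simp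
    then have "(w ^ d - 1) * EE w i x = 0" by (simp add: algebra_simps)
    moreover have "w ^ d \<noteq> 1" using w d by (auto simp: prt_def)
    ultimately show ?thesis by simp
  next
    case False
    define j where "j = (LEAST j. \<exists>k. j = (s ^^ k) i)"
    have "\<exists>k. j = (s ^^ k) i" unfolding j_def by (rule LeastI[of _ i]) (auto intro!: exI[of _ 0])
    then obtain k where k: "j = (s ^^ k) i" by blast
    have jr: "j < r" using k s_pow_less[OF i] by simp
    have "j \<le> (s ^^ l) j" for l
    proof -
      have "(s ^^ l) j = (s ^^ (l + k)) i" by (simp add: k funpow_add)
      then show ?thesis unfolding j_def by (intro Least_le) blast
    qed
    moreover have "(s ^^ d) j \<noteq> j" if d: "0 < d" "d < n" for d
    proof
      assume "(s ^^ d) j = j"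
      then have "(s ^^ k) ((s ^^ d) i) = (s ^^ k) i" unfolding k by (metis add.commute comp_apply funpow_add)
      then have "(s ^^ d) i = i" using s_pow_inj[OF s_pow_less[OF i] i] by blast
      then show False using False d by blast
    qed
    ultimately have "j \<in> J" using jr by (auto simp: J_def)
    then have "EE w ((s ^^ k) i) x = 0" using J0 k by simp
    then show ?thesis using EE_shift_pow[OF x i wn, of k] by simp
  qed
qed

lemma J_inj:
  assumes "i \<in> J" "j \<in> J" "k < n" "l < n" "(s ^^ k) i = (s ^^ l) j" shows "i = j \<and> k = l"
proof -
  have ir: "i < r" "j < r" using assms by (auto simp: J_def)
  have n0: "n > 0" using n1 by simp
  have le: "i' \<le> j'" if "i' \<in> J" "j' \<in> J" "k' < n" "l' < n" "(s ^^ k') i' = (s ^^ l') j'" for i' j' k' l'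
  proof -
    have r': "i' < r" "j' < r" using that by (auto simp: J_def)
    have "(s ^^ (n - l' + k')) i' = (s ^^ (n - l')) ((s ^^ l') j')" using that(5) by (simp add: funpow_add)
    also have "\<dots> = (s ^^ (n - l' + l')) j'" by (simp only: funpow_add comp_apply)
    also have "\<dots> = j'" using that s_n[OF r'(2)] by simp
    finally have "j' = (s ^^ (n - l' + k')) i'" ..
    then show ?thesis using that(1) unfolding J_def by blast
  qed
  have ij: "i = j" using le[OF assms] le[OF assms(2,1,4,3) assms(5)[symmetric]] by simp
  have kl: "\<not> k' < l'" if "k' < n" "l' < n" "(s ^^ k') i = (s ^^ l') i" for k' l'
  proof
    assume kl: "k' < l'"
    have "(s ^^ k') ((s ^^ (l' - k')) i) = (s ^^ (k' + (l' - k'))) i" by (simp only: funpow_add comp_apply)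
    also have "\<dots> = (s ^^ k') i" using kl that by simp
    finally have "(s ^^ (l' - k')) i = i" using s_pow_inj[OF s_pow_less[OF ir(1)] ir(1)] by blast
    moreover have "0 < l' - k'" "l' - k' < n" using kl that by auto
    ultimately show False using assms(1) unfolding J_def by blast
  qed
  show ?thesis using ij kl[of k l] kl[of l k] assms by (metis linorder_neqE_nat)
qed

lemma EE_surj: "\<exists>x\<in>U. \<forall>j\<in>J. EE w j x = ipoly (rho j) w"
proof -
  have n0: "n > 0" using n1 by simp
  have "\<forall>j. \<exists>q g. rho j = (monom 1 n - 1) * q + g \<and> (\<forall>i\<ge>n. coeff g i = 0)" using poly_div_xn[OF n0] by blast
  then obtain q g where g: "\<And>j. rho j = (monom 1 n - 1) * q j + g j" "\<And>j i. i \<ge> n \<Longrightarrow> coeff (g j) i = 0" by metis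
  \<comment> \<open>Exponents are prescribed at the positions (s ^^ k) j of the free orbits, which
    are distinct by \<open>J_inj\<close>, and are 0 elsewhere.\<close>
  define c where "c i = (if \<exists>jk. fst jk \<in> J \<and> snd jk < n \<and> i = (s ^^ snd jk) (fst jk)
     then (let jk = SOME jk. fst jk \<in> J \<and> snd jk < n \<and> i = (s ^^ snd jk) (fst jk) in coeff (g (fst jk)) (snd jk)) else 0)" for i
  have c: "c ((s ^^ k) j) = coeff (g j) k" if "j \<in> J" "k < n" for j k
  proof -
    let ?P = "\<lambda>jk. fst jk \<in> J \<and> snd jk < n \<and> (s ^^ k) j = (s ^^ snd jk) (fst jk)"
    have ex: "?P (j, k)" using that by simp
    define jk where "jk = (SOME jk. ?P jk)"
    have P: "?P jk" unfolding jk_def by (rule someI[of ?P, OF ex])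
    have "j = fst jk \<and> k = snd jk" by (rule J_inj) (use that P in auto)
    moreover have "c ((s ^^ k) j) = coeff (g (fst jk)) (snd jk)"
      unfolding c_def jk_def Let_def by (rule if_P) (rule exI[of ?P, OF ex])
    ultimately show ?thesis by simp
  qed
  obtain x where x: "x \<in> U" "\<forall>i<r. e x i = c i" using e_surj[of c] by blast
  have "EE w j x = ipoly (rho j) w" if j: "j \<in> J" for j
  proof -
    have jr: "j < r" using j by (simp add: J_def)
    have "EE w j x = (\<Sum>k<n. of_int (coeff (g j) k) * w ^ k)"
      unfolding EE_def using x(2) s_pow_less[OF jr] c[OF j] by (intro sum.cong) auto
    also have "\<dots> = ipoly (\<Sum>k<n. monom (coeff (g j) k) k) w" by (simp add: ipoly_sum)
    also have "(\<Sum>k<n. monom (coeff (g j) k) k) = g j"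
      using g(2)[of _ j] by (intro poly_eqI) (auto simp: coeff_sum not_less)
    also have "ipoly (g j) w = ipoly (rho j) w" by (simp add: g(1)[of j] wn)
    finally show ?thesis .
  qed
  then show ?thesis using x by blast
qed

text \<open>At X = w the permutation lattice becomes a free \<int>[w]-module whose rank b is the
  number of free orbits; E is its coordinate map on U.\<close>

theorem evaluation_map:
  "\<exists>(b::nat) (E :: 'b \<Rightarrow> nat \<Rightarrow> complex).
     (\<forall>x\<in>U. \<forall>y\<in>U. \<forall>i<b. E (x * y) i = E x i + E y i) \<and>
     (\<forall>x\<in>U. \<forall>i<b. E (tau x) i = w * E x i) \<and>
     (\<forall>x\<in>U. \<forall>i<b. \<exists>f. E x i = ipoly f w) \<and>
     (\<forall>rho. \<exists>x\<in>U. \<forall>i<b. E x i = ipoly (rho i) w) \<and>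
     (\<forall>x\<in>U. (\<forall>i<b. E x i = 0) \<longleftrightarrow> act Psi x \<in> C)"
proof -
  have finJ: "finite J" unfolding J_def by (rule finite_subset[of _ "{..<r}"]) auto
  then obtain h where h: "bij_betw h {..<card J} J" using ex_bij_betw_nat_finite[of J] by (auto simp: atLeast0LessThan)
  have hJ: "h i \<in> J" if "i < card J" for i using h that by (auto simp: bij_betw_def)
  have Jr: "j \<in> J \<Longrightarrow> j < r" for j by (simp add: J_def)
  show ?thesis
  proof (intro exI[of _ "card J"] exI[of _ "\<lambda>x i. EE w (h i) x"] conjI ballI allI impI)
    fix rho :: "nat \<Rightarrow> int poly"
    obtain x where x: "x \<in> U" "\<forall>j\<in>J. EE w j x = ipoly (rho (inv_into {..<card J} h j)) w" using EE_surj[of "\<lambda>j. rho (inv_into {..<card J} h j)"] by blast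
    then have "\<forall>i<card J. EE w (h i) x = ipoly (rho i) w"
      using h hJ by (auto simp: bij_betw_def)
    then show "\<exists>x\<in>U. \<forall>i<card J. EE w (h i) x = ipoly (rho i) w" using x(1) by blast
  next
    fix x assume x: "x \<in> U"
    have "h ` {..<card J} = J" using h by (simp add: bij_betw_def)
    then have "(\<forall>i<card J. EE w (h i) x = 0) \<longleftrightarrow> (\<forall>j\<in>J. EE w j x = 0)"
      by (metis (no_types, lifting) imageE imageI lessThan_iff)
    also have "\<dots> \<longleftrightarrow> (\<forall>i<r. EE w i x = 0)" using EE_zero_J[OF x] Jr by blast
    finally show "(\<forall>i<card J. EE w (h i) x = 0) \<longleftrightarrow> act Psi x \<in> C" using EE_zero_iff[OF x] by simp
  qed (use hJ Jr EE_mult EE_tau wn EE_ipoly in auto)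
qed

end

section \<open>Determinants and the split exact sequence\<close>

lemma det_mult_first_col:
  fixes c :: "'a::comm_ring_1"
  assumes n: "n > 0" and A: "A \<in> carrier_mat n n" and B: "B \<in> carrier_mat n n"
    and eq: "\<And>i. i < n \<Longrightarrow> B $$ (i, 0) = c * A $$ (i, 0)"
    and eq': "\<And>i j. i < n \<Longrightarrow> 0 < j \<Longrightarrow> j < n \<Longrightarrow> B $$ (i, j) = A $$ (i, j)"
  shows "Determinant.det B = c * Determinant.det A"
proof -
  have "mat_delete B i 0 = mat_delete A i 0" if "i < n" for i
    unfolding mat_delete_def by (rule cong_mat) (use A B eq' in auto)
  then have "cofactor B i 0 = cofactor A i 0" if "i < n" for i using that by (simp add: cofactor_def)
  then show ?thesis
    unfolding laplace_expansion_column[OF A n] laplace_expansion_column[OF B n] sum_distrib_left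
    by (intro sum.cong) (auto simp: eq)
qed

lemma det_first_row_dvd:
  fixes A :: "int mat"
  assumes n: "n > 0" and A: "A \<in> carrier_mat n n" and d: "\<And>j. j < n \<Longrightarrow> p dvd A $$ (0, j)"
  shows "p dvd Determinant.det A"
  unfolding laplace_expansion_row[OF A n] by (intro dvd_sum) (use d in auto)

text \<open>A surjection \<open>R\<^sup>b \<rightarrow> R\<^sup>a\<close> whose kernel is isomorphic to the ideal \<open>P\<close>
  forces \<open>b = a + 1\<close> (compare traces), and \<open>P\<close> is generated by a determinant.\<close>
theorem principal_from_splitting:
  fixes F S :: "nat \<Rightarrow> nat \<Rightarrow> int poly" and h :: "nat \<Rightarrow> complex" and m :: "nat \<Rightarrow> int poly"
    and H :: "int poly \<Rightarrow> nat \<Rightarrow> int poly"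
  assumes split: "\<And>i j. i < b \<Longrightarrow> j < b \<Longrightarrow>
       (if i = j then 1 else 0) = h i * ipoly (m j) w + (\<Sum>l<a. ipoly (S i l) w * ipoly (F l j) w)"
    and FS: "\<And>i j. i < a \<Longrightarrow> j < a \<Longrightarrow> (\<Sum>l<b. ipoly (F i l) w * ipoly (S l j) w) = (if i = j then 1 else 0)"
    and Fh: "\<And>i. i < a \<Longrightarrow> (\<Sum>l<b. ipoly (F i l) w * h l) = 0"
    and h: "i0 < b" "h i0 \<noteq> 0"
    and mP: "\<And>j. j < b \<Longrightarrow> int p dvd poly (m j) t"
    and H: "\<And>f i. int p dvd poly f t \<Longrightarrow> i < b \<Longrightarrow> ipoly (H f i) w = ipoly f w * h i"
  shows "\<exists>A. int p dvd poly A t \<and> (\<forall>f. int p dvd poly f t \<longrightarrow> (\<exists>g. ipoly f w = ipoly A w * ipoly g w))"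
proof -
  \<comment> \<open>Apply the matrix identity \<open>split\<close> to the vector h: the part through
    F vanishes by \<open>Fh\<close>, and h i0 cancels.\<close>
  have mh: "(\<Sum>j<b. ipoly (m j) w * h j) = 1"
  proof -
    have "h i0 = (\<Sum>j<b. (if i0 = j then 1 else 0) * h j)" using h(1) by (simp add: if_distrib[of "\<lambda>x. x * _"] sum.delta cong: if_cong)
    also have "\<dots> = (\<Sum>j<b. (h i0 * ipoly (m j) w + (\<Sum>l<a. ipoly (S i0 l) w * ipoly (F l j) w)) * h j)"
      using split[OF h(1)] by (intro sum.cong) auto
    also have "\<dots> = h i0 * (\<Sum>j<b. ipoly (m j) w * h j) + (\<Sum>j<b. \<Sum>l<a. ipoly (S i0 l) w * (ipoly (F l j) w * h j))"
      by (simp add: distrib_right sum.distrib sum_distrib_left sum_distrib_right mult.assoc)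
    also have "(\<Sum>j<b. \<Sum>l<a. ipoly (S i0 l) w * (ipoly (F l j) w * h j)) = (\<Sum>l<a. ipoly (S i0 l) w * (\<Sum>j<b. ipoly (F l j) w * h j))"
      unfolding sum_distrib_left by (rule sum.swap)
    also have "\<dots> = 0" using Fh by simp
    finally show ?thesis using h(2) by simp
  qed
  \<comment> \<open>The trace of the b by b identity: the part h m contributes 1 by
    \<open>mh\<close>, the part S F contributes the trace of F S, which is a.\<close>
  have ba: "b = Suc a"
  proof -
    have "of_nat b = (\<Sum>i<b. (1::complex))" by simp
    also have "\<dots> = (\<Sum>i<b. h i * ipoly (m i) w + (\<Sum>l<a. ipoly (S i l) w * ipoly (F l i) w))"
    proof (intro sum.cong refl)
      fix i assume "i \<in> {..<b}"
      then show "1 = h i * ipoly (m i) w + (\<Sum>l<a. ipoly (S i l) w * ipoly (F l i) w)" using split[of i i] by simp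
    qed
    also have "\<dots> = 1 + (\<Sum>i<b. \<Sum>l<a. ipoly (F l i) w * ipoly (S i l) w)"
      using mh by (simp add: sum.distrib mult.commute)
    also have "(\<Sum>i<b. \<Sum>l<a. ipoly (F l i) w * ipoly (S i l) w) = (\<Sum>l<a. \<Sum>i<b. ipoly (F l i) w * ipoly (S i l) w)"
      by (rule sum.swap)
    also have "\<dots> = of_nat a" using FS by simp
    finally have "of_nat b = (of_nat (Suc a) :: complex)" by simp
    then show ?thesis by (simp only: of_nat_eq_iff)
  qed
  have b0: "b > 0" using ba by simp
  \<comment> \<open>\<open>XM\<close> stacks the row m on F, and \<open>Y\<close> puts the column h
    beside S; \<open>split\<close> says that Y is inverse to XM at w. The determinant of
    \<open>XM\<close> is the generator: its first row is divisible by p at t.\<close>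
  define XM :: "int poly mat" where "XM = mat b b (\<lambda>(i, j). if i = 0 then m j else F (i - 1) j)"
  define Y :: "complex mat" where "Y = mat b b (\<lambda>(i, j). if j = 0 then h i else ipoly (S i (j - 1)) w)"
  interpret hw: comm_ring_hom "\<lambda>f. ipoly f w" by unfold_locales auto
  have ht: "comm_ring_hom (\<lambda>f. poly f t)" by unfold_locales auto
  define Xw where "Xw = map_mat (\<lambda>f. ipoly f w) XM"
  have carX: "XM \<in> carrier_mat b b" "Xw \<in> carrier_mat b b" and carY: "Y \<in> carrier_mat b b" by (auto simp: XM_def Y_def Xw_def)
  have "Y * Xw = 1\<^sub>m b"
  proof (rule eq_matI)
    fix i j assume "i < dim_row (1\<^sub>m b :: complex mat)" "j < dim_col (1\<^sub>m b :: complex mat)"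
    then have ij: "i < b" "j < b" by auto
    have "(Y * Xw) $$ (i, j) = (\<Sum>l<b. Y $$ (i, l) * Xw $$ (l, j))"
      using ij carX carY by (simp add: scalar_prod_def atLeast0LessThan)
    also have "\<dots> = Y $$ (i, 0) * Xw $$ (0, j) + (\<Sum>l<a. Y $$ (i, Suc l) * Xw $$ (Suc l, j))"
      unfolding ba by (rule sum.lessThan_Suc_shift)
    also have "\<dots> = h i * ipoly (m j) w + (\<Sum>l<a. ipoly (S i l) w * ipoly (F l j) w)"
      using ij by (simp add: Y_def Xw_def XM_def ba)
    also have "\<dots> = (if i = j then 1 else 0)" using split[OF ij] by simp
    finally show "(Y * Xw) $$ (i, j) = 1\<^sub>m b $$ (i, j)" using ij by simp
  qed (use carX carY in auto)
  then have "Determinant.det Y * Determinant.det Xw = 1" using det_mult[OF carY carX(2)] by (metis det_one)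
  moreover have "Determinant.det Xw = ipoly (Determinant.det XM) w" unfolding Xw_def by (rule hw.hom_det)
  ultimately have YX: "Determinant.det Y * ipoly (Determinant.det XM) w = 1" by simp
  have "int p dvd poly (Determinant.det XM) t"
  proof -
    have "int p dvd Determinant.det (map_mat (\<lambda>f. poly f t) XM)"
      by (rule det_first_row_dvd[OF b0]) (use mP b0 in \<open>auto simp: XM_def\<close>)
    then show ?thesis by (simp only: comm_ring_hom.hom_det[OF ht])
  qed
  moreover have "\<exists>g. ipoly f w = ipoly (Determinant.det XM) w * ipoly g w" if f: "int p dvd poly f t" for f
  proof -
    \<comment> \<open>h need not lie in \<int>[w], but f(w) h does. So f(w) det Y is an element of
      \<int>[w], and it is the cofactor of the generator in f(w).\<close>
    define Z :: "int poly mat" where "Z = mat b b (\<lambda>(i, j). if j = 0 then H f i else S i (j - 1))"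
    have carZ: "map_mat (\<lambda>f. ipoly f w) Z \<in> carrier_mat b b" by (simp add: Z_def)
    have "Determinant.det (map_mat (\<lambda>f. ipoly f w) Z) = ipoly f w * Determinant.det Y"
      by (rule det_mult_first_col[OF b0 carY carZ]) (auto simp: Z_def Y_def H[OF f])
    then have "ipoly (Determinant.det Z) w = ipoly f w * Determinant.det Y" by (simp only: hw.hom_det)
    then have "ipoly (Determinant.det XM) w * ipoly (Determinant.det Z) w = ipoly f w * (Determinant.det Y * ipoly (Determinant.det XM) w)"
      by (simp add: mult_ac)
    then show ?thesis using YX by (metis mult_1_right)
  qed
  ultimately show ?thesis by blast
qed

context tau_group
begin

lemma tau_inverse: "x \<in> U \<Longrightarrow> tau (inverse x) = inverse (tau x)"
  using tau_mult[OF _ U_inverse, of x x] U_nonzero[of x] tau_1 by (simp add: inverse_unique)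

lemma tau_power_int: "x \<in> U \<Longrightarrow> tau (x powi k) = tau x powi k"
proof -
  have "tau (y ^ m) = tau y ^ m" if y: "y \<in> U" for y m
  proof (induction m)
    case (Suc m)
    have "y ^ m \<in> U" using U_power_int[OF y, of "int m"] by simp
    then show ?case using Suc y by (simp add: tau_mult)
  qed (simp add: tau_1)
  then show "x \<in> U \<Longrightarrow> tau (x powi k) = tau x powi k"
    by (simp add: power_int_def tau_inverse U_inverse)
qed

lemma act_add: "x \<in> U \<Longrightarrow> act (f + g) x = act f x * act g x"
proof (induction f g rule: poly_induct2)
  case (pCons c f d g)
  then show ?case using U_nonzero[of x]
    by (simp add: power_int_add tau_mult act_U mult_ac)
qed simp

lemma act_smult: "x \<in> U \<Longrightarrow> act (smult c f) x = act f x powi c"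
proof (induction f)
  case (pCons d f)
  then show ?case
    by (simp add: power_int_mult_distrib tau_power_int act_U power_int_mult[symmetric] mult.commute)
qed simp

lemma act_mult: "x \<in> U \<Longrightarrow> act (f * g) x = act f (act g x)"
proof (induction f)
  case (pCons c f)
  then show ?case by (simp add: act_add act_smult)
qed simp

lemma act_monom: "x \<in> U \<Longrightarrow> act (monom 1 k) x = (tau ^^ k) x"
proof (induction k)
  case (Suc k)
  then show ?case by (simp add: monom_Suc)
qed (simp add: monom_0 tau_1)

lemma act_xn: assumes "x \<in> U" shows "act (monom 1 n - 1) x = 1"
proof -
  have "act (monom 1 n + smult (- 1) 1) x = (tau ^^ n) x * act 1 x powi (- 1)"
    using assms by (simp only: act_add act_smult act_monom)
  also have "act 1 x = x" by (simp add: one_pCons tau_1)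
  also have "monom 1 n + smult (- 1) 1 = (monom 1 n - 1 :: int poly)" by (simp add: one_pCons)
  finally show ?thesis using tau_n[OF assms] U_nonzero[OF assms] by (simp add: power_int_minus)
qed

lemma act_mult_arg: "x \<in> U \<Longrightarrow> y \<in> U \<Longrightarrow> act f (x * y) = act f x * act f y"
proof (induction f)
  case (pCons c f)
  then show ?case by (simp add: power_int_mult_distrib tau_mult act_U mult_ac)
qed simp

lemma U_prod: "(\<And>i. i \<in> I \<Longrightarrow> f i \<in> U) \<Longrightarrow> (\<Prod>i\<in>I. f i) \<in> U"
  by (induction I rule: infinite_finite_induct) (auto intro: U_1 U_mult)

end

locale tau_eval = tau_group +
  fixes E :: "'a \<Rightarrow> nat \<Rightarrow> complex" and b :: nat and w :: complex
  assumes E_mult: "x \<in> U \<Longrightarrow> y \<in> U \<Longrightarrow> i < b \<Longrightarrow> E (x * y) i = E x i + E y i"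
    and E_tau: "x \<in> U \<Longrightarrow> i < b \<Longrightarrow> E (tau x) i = w * E x i"
begin

lemma E_1: "i < b \<Longrightarrow> E 1 i = 0" using E_mult[OF U_1 U_1, of i] by simp

lemma E_inverse: "x \<in> U \<Longrightarrow> i < b \<Longrightarrow> E (inverse x) i = - E x i"
  using E_mult[OF _ U_inverse, of x x i] U_nonzero[of x] E_1[of i] by (simp add: eq_neg_iff_add_eq_0 add.commute)

lemma E_power_int: "x \<in> U \<Longrightarrow> i < b \<Longrightarrow> E (x powi k) i = of_int k * E x i"
proof -
  have pw: "E (y ^ m) i = of_nat m * E y i" if y: "y \<in> U" and i: "i < b" for y m
  proof (induction m)
    case (Suc m)
    have "y ^ m \<in> U" using U_power_int[OF y, of "int m"] by simp
    then show ?case using Suc y i by (simp add: E_mult algebra_simps)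
  qed (simp add: E_1 i)
  assume "x \<in> U" "i < b"
  then show ?thesis by (auto simp: power_int_def pw E_inverse U_inverse)
qed

lemma E_act: "x \<in> U \<Longrightarrow> i < b \<Longrightarrow> E (act f x) i = ipoly f w * E x i"
proof (induction f)
  case (pCons c f)
  then show ?case by (simp add: E_mult U_power_int U_tau act_U E_power_int E_tau algebra_simps)
qed (simp add: E_1)

lemma E_prod: "finite I \<Longrightarrow> (\<And>j. j \<in> I \<Longrightarrow> f j \<in> U) \<Longrightarrow> i < b \<Longrightarrow> E (\<Prod>j\<in>I. f j) i = (\<Sum>j\<in>I. E (f j) i)"
  by (induction I rule: finite_induct) (auto simp: E_1 E_mult U_prod)

end

text \<open>An equivariant surjection of U onto \<int>[w]^b. The kernel is kept as a predicate Q
  because it is not C itself but the set of x with \<open>act Psi x\<close> in C.\<close>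

definition is_eval :: "'b::times set \<Rightarrow> ('b \<Rightarrow> 'b) \<Rightarrow> complex \<Rightarrow> ('b \<Rightarrow> bool) \<Rightarrow> nat \<Rightarrow> ('b \<Rightarrow> nat \<Rightarrow> complex) \<Rightarrow> bool" where
  "is_eval U tau w Q b E \<longleftrightarrow>
     (\<forall>x\<in>U. \<forall>y\<in>U. \<forall>i<b. E (x * y) i = E x i + E y i) \<and>
     (\<forall>x\<in>U. \<forall>i<b. E (tau x) i = w * E x i) \<and>
     (\<forall>x\<in>U. \<forall>i<b. \<exists>f. E x i = ipoly f w) \<and>
     (\<forall>rho. \<exists>x\<in>U. \<forall>i<b. E x i = ipoly (rho i) w) \<and>
     (\<forall>x\<in>U. (\<forall>i<b. E x i = 0) \<longleftrightarrow> Q x)"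

lemma is_evalD:
  assumes "is_eval U tau w Q b E"
  shows "\<forall>x\<in>U. \<forall>y\<in>U. \<forall>i<b. E (x * y) i = E x i + E y i"
    "\<forall>x\<in>U. \<forall>i<b. E (tau x) i = w * E x i"
    "\<forall>x\<in>U. \<forall>i<b. \<exists>f. E x i = ipoly f w"
    "\<forall>rho. \<exists>x\<in>U. \<forall>i<b. E x i = ipoly (rho i) w"
    "\<forall>x\<in>U. (\<forall>i<b. E x i = 0) \<longleftrightarrow> Q x"
  using assms unfolding is_eval_def by - (elim conjE, assumption)+

text \<open>U/C1 and U/C2 are permutation lattices, and \<open>mon\<close> identifies P modulo X^n -
  1 with C2/C1. Specialized at w, the map from U/C1 onto U/C2 becomes a surjection of free
  \<int>[w]-modules; it splits, and its kernel is found to consist of the multiples g(w) h with g in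
  P.\<close>

theorem principal_from_units:
  fixes U :: "'b::field set" and w :: complex and t :: int and mon :: "int poly \<Rightarrow> 'b"
  assumes tg: "tau_group U tau n" and p: "prime p" and n: "n = p - 1" "n > 2" and w: "prt n w"
    and t: "\<And>d. [t ^ d = 1] (mod int p) \<longleftrightarrow> n dvd d"
    and B1: "perm_basis U C1 tau r1 e1 s1" and B2: "perm_basis U C2 tau r2 e2 s2"
    and C1: "C1 \<subseteq> U" "1 \<in> C1" "\<And>x y. x \<in> C1 \<Longrightarrow> y \<in> C1 \<Longrightarrow> x * y \<in> C1" "\<And>x. x \<in> C1 \<Longrightarrow> inverse x \<in> C1"
       "\<And>x. x \<in> C1 \<Longrightarrow> tau x \<in> C1"
    and mon_U: "\<And>f. int p dvd poly f t \<Longrightarrow> mon f \<in> U"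
    and mon_add: "\<And>f g. mon (f + g) = mon f * mon g"
    and mon_X: "\<And>f. int p dvd poly f t \<Longrightarrow> tau (mon f) = mon (pCons 0 f)"
    and mon_C1: "\<And>f. int p dvd poly f t \<Longrightarrow> mon f \<in> C1 \<Longrightarrow> (monom 1 n - 1) dvd f"
    and C2: "\<And>x. x \<in> U \<Longrightarrow> x \<in> C2 \<longleftrightarrow> (\<exists>c\<in>C1. \<exists>f. int p dvd poly f t \<and> x = c * mon f)"
  shows "\<exists>A. int p dvd poly A t \<and> (\<forall>f. int p dvd poly f t \<longrightarrow> (\<exists>g. ipoly f w = ipoly A w * ipoly g w))"
proof -
  interpret tau_group U tau n by fact
  obtain Phi Psi where PP: "Phi * Psi = monom 1 n - 1" and Phiw: "ipoly Phi w = 0"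
    and Phi_dvd: "\<And>f. ipoly f w = 0 \<Longrightarrow> Phi dvd f" using cyclotomic_factor[OF w] by metis
  interpret T1: tau_perm U tau n C1 r1 e1 s1 w Phi Psi
    by unfold_locales (use B1 w n PP Phiw Phi_dvd in auto)
  interpret T2: tau_perm U tau n C2 r2 e2 s2 w Phi Psi
    by unfold_locales (use B2 w n PP Phiw Phi_dvd in auto)
  have "\<exists>b E. is_eval U tau w (\<lambda>x. act Psi x \<in> C1) b E"
    unfolding is_eval_def by (rule T1.evaluation_map)
  then obtain b E where isE: "is_eval U tau w (\<lambda>x. act Psi x \<in> C1) b E" by blast
  note E = is_evalD[OF isE]
  have "\<exists>a F. is_eval U tau w (\<lambda>x. act Psi x \<in> C2) a F"
    unfolding is_eval_def by (rule T2.evaluation_map)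
  then obtain a F where isF: "is_eval U tau w (\<lambda>x. act Psi x \<in> C2) a F" by blast
  note F = is_evalD[OF isF]
  interpret E: tau_eval U tau n E b w by unfold_locales (use E in auto)
  interpret F: tau_eval U tau n F a w by unfold_locales (use F in auto)
  have p0: "p > 0" using p prime_gt_0_nat by blast
  \<comment> \<open>Modulo p, t is a root of Phi and a simple root of X^n - 1, since n t^(n-1) is
    prime to p.\<close>
  have Psit: "\<not> int p dvd poly Psi t"
  proof
    assume *: "int p dvd poly Psi t"
    have "int p dvd poly Phi t" by (rule ipoly_root_imp_dvd[OF w _ p t Phiw]) (use n in auto)
    then have "int p dvd poly (pderiv (Phi * Psi)) t" using * by (simp add: pderiv_mult)
    then have "int p dvd int n * t ^ (n - 1)" unfolding PP by (simp add: pderiv_diff pderiv_monom poly_monom)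
    then have "int p dvd int n \<or> int p dvd t ^ (n - 1)" using p by (simp add: prime_dvd_mult_iff)
    moreover have "\<not> int p dvd int n" using n p0 by (auto dest!: zdvd_imp_le)
    moreover have "\<not> int p dvd t ^ (n - 1)"
    proof
      assume "int p dvd t ^ (n - 1)"
      then have "int p dvd t ^ n" using n by (metis dvd_mult2 power_minus_mult less_trans zero_less_numeral)
      moreover have "int p dvd t ^ n - 1" using t[of n] by (simp add: cong_iff_dvd_diff)
      ultimately have "int p dvd t ^ n - (t ^ n - 1)" by (rule dvd_diff)
      then have "int p dvd 1" by simp
      then show False using p by (metis not_prime_unit prime_nat_int_transfer)
    qed
    ultimately show False by blast
  qed
  have mon0: "mon 0 = 1"
  proof -
    have "mon 0 * mon 0 = mon 0 * 1" using mon_add[of 0 0] by simp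
    moreover have "mon 0 \<noteq> 0" using mon_U[of 0] U_nonzero by simp
    ultimately show ?thesis by (metis mult_left_cancel)
  qed
  have mon_neg: "mon (- f) = inverse (mon f)" if "int p dvd poly f t" for f
    using mon_add[of f "- f"] mon0 U_nonzero[OF mon_U[OF that]] by (simp add: inverse_unique)
  have mon_smult: "mon (smult c f) = mon f powi c" if f: "int p dvd poly f t" for c f
  proof -
    have nat: "mon (smult (int k) g) = mon g ^ k" if "int p dvd poly g t" for k g
      by (induction k) (auto simp: mon0 mon_add smult_add_left)
    show ?thesis
    proof (cases "c \<ge> 0")
      case True
      then show ?thesis using nat[OF f, of "nat c"] by (simp add: power_int_def)
    next
      case False
      have "mon (smult (int (nat (- c))) (- f)) = mon (- f) ^ nat (- c)" by (rule nat) (use f in simp)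
      then show ?thesis using False mon_neg[OF f] by (simp add: power_int_def)
    qed
  qed
  have mon_act: "act g (mon f) = mon (g * f)" if f: "int p dvd poly f t" for f g
  proof (induction g)
    case (pCons c g)
    have "act (pCons c g) (mon f) = mon (smult c f) * tau (mon (g * f))" using pCons mon_smult[OF f] by simp
    also have "tau (mon (g * f)) = mon (pCons 0 (g * f))" by (rule mon_X) (use f in simp)
    finally show ?case by (simp add: mon_add)
  qed (simp add: mon0)
  have act_C1: "act f c \<in> C1" if "c \<in> C1" for f c
  proof (induction f)
    case (pCons d f)
    have "c powi d \<in> C1"
    proof -
      have "y ^ k \<in> C1" if "y \<in> C1" for y k by (induction k) (auto intro: C1 that)
      then show ?thesis using that C1(4) by (simp add: power_int_def)
    qed
    then show ?case using pCons C1 by simp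
  qed (simp add: C1)
  have C12: "c \<in> C2" if "c \<in> C1" for c
  proof -
    have "\<exists>ca\<in>C1. \<exists>f. int p dvd poly f t \<and> c = ca * mon f"
      using that mon0 by (intro bexI[of _ c] exI[of _ 0]) auto
    then show ?thesis using C2[of c] that C1(1) by blast
  qed
  have K1: "\<forall>i<a. F x i = 0" if x: "x \<in> U" "\<forall>i<b. E x i = 0" for x
    using E(5) F(5) x C12 by blast
  have "\<forall>j. \<exists>x\<in>U. \<forall>i<b. E x i = ipoly (if i = j then 1 else 0) w"
  proof
    fix j show "\<exists>x\<in>U. \<forall>i<b. E x i = ipoly (if i = j then 1 else 0) w"
      using E(4)[rule_format, of "\<lambda>i. if i = j then 1 else 0"] by simp
  qed
  then obtain u where u: "\<And>j. u j \<in> U" "\<And>j i. i < b \<Longrightarrow> E (u j) i = ipoly (if i = j then 1 else 0) w" by metis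
  have "\<forall>j. \<exists>x\<in>U. \<forall>i<a. F x i = ipoly (if i = j then 1 else 0) w"
  proof
    fix j show "\<exists>x\<in>U. \<forall>i<a. F x i = ipoly (if i = j then 1 else 0) w"
      using F(4)[rule_format, of "\<lambda>i. if i = j then 1 else 0"] by simp
  qed
  then obtain v where v: "\<And>j. v j \<in> U" "\<And>j i. i < a \<Longrightarrow> F (v j) i = ipoly (if i = j then 1 else 0) w" by metis
  have "\<forall>x i. \<exists>f. x \<in> U \<longrightarrow> i < b \<longrightarrow> E x i = ipoly f w" using E(3) by blast
  then obtain ep where ep: "\<And>x i. x \<in> U \<Longrightarrow> i < b \<Longrightarrow> E x i = ipoly (ep x i) w" by metis
  have "\<forall>x i. \<exists>f. x \<in> U \<longrightarrow> i < a \<longrightarrow> F x i = ipoly f w" using F(3) by blast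
  then obtain fp where fp: "\<And>x i. x \<in> U \<Longrightarrow> i < a \<Longrightarrow> F x i = ipoly (fp x i) w" by metis
  \<comment> \<open>F factors through E, because by \<open>K1\<close> it vanishes on the kernel of
    E; y has the same E-coordinates as x and is written in terms of the u j.\<close>
  have FE: "F x l = (\<Sum>j<b. E x j * F (u j) l)" if x: "x \<in> U" and l: "l < a" for x l
  proof -
    define y where "y = (\<Prod>j<b. act (ep x j) (u j))"
    have yU: "y \<in> U" unfolding y_def by (intro U_prod act_U u)
    have Ey: "E y i = E x i" if i: "i < b" for i
    proof -
      have "E y i = (\<Sum>j<b. E x j * ipoly (if i = j then 1 else 0) w)"
        unfolding y_def using i by (subst E.E_prod) (auto intro!: act_U u sum.cong simp: E.E_act u ep[OF x])
      also have "\<dots> = (\<Sum>j<b. if i = j then E x j else 0)" by (intro sum.cong) auto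
      also have "\<dots> = E x i" using i by simp
      finally show ?thesis .
    qed
    have xy: "x * inverse y \<in> U" by (intro U_mult U_inverse x yU)
    have "\<forall>i<b. E (x * inverse y) i = 0" using Ey by (simp add: E.E_mult x yU U_inverse E.E_inverse)
    then have "F (x * inverse y) l = 0" using K1[OF xy] l by blast
    then have "F x l = F y l" using l by (simp add: F.E_mult x yU U_inverse F.E_inverse)
    also have "\<dots> = (\<Sum>j<b. E x j * F (u j) l)"
      unfolding y_def using l by (subst F.E_prod) (auto intro!: act_U u sum.cong simp: F.E_act u ep[OF x])
    finally show ?thesis .
  qed
  have Fmon: "F (mon f) l = 0" if f: "int p dvd poly f t" and l: "l < a" for f l
  proof -
    have "\<exists>c\<in>C1. \<exists>f'. int p dvd poly f' t \<and> act Psi (mon f) = c * mon f'"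
      using C1(2) f mon_act[OF f, of Psi] by (intro bexI[of _ 1] exI[of _ "Psi * f"]) auto
    then have "act Psi (mon f) \<in> C2" using C2[OF act_U[OF mon_U[OF f]]] by blast
    then show ?thesis using F(5) mon_U[OF f] l by blast
  qed
  \<comment> \<open>One would like h to be E (mon 1), but 1 is not in P. The constant p is, and
    dividing by p afterwards has the same effect.\<close>
  define cp where "cp = [:int p:]"
  have cp: "int p dvd poly cp t" by (simp add: cp_def)
  define h where "h i = E (mon cp) i / of_nat p" for i
  have Emon: "E (mon f) i = ipoly f w * h i" if f: "int p dvd poly f t" and i: "i < b" for f i
  proof -
    have "of_nat p * E (mon f) i = E (mon f powi int p) i" using E.E_power_int[OF mon_U[OF f] i, of "int p"] by simp
    also have "mon f powi int p = mon (f * cp)" using mon_smult[OF f, of "int p"] by (simp add: cp_def)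
    also have "mon (f * cp) = act f (mon cp)" using mon_act[OF cp] by simp
    also have "E (act f (mon cp)) i = ipoly f w * E (mon cp) i" by (rule E.E_act[OF mon_U[OF cp] i])
    finally show ?thesis using p0 by (simp add: h_def field_simps)
  qed
  have "\<exists>i<b. h i \<noteq> 0"
  proof (rule ccontr)
    assume "\<not> ?thesis"
    then have "\<forall>i<b. E (mon cp) i = 0" using p0 by (auto simp: h_def)
    then have "act Psi (mon cp) \<in> C1" using E(5) mon_U[OF cp] by blast
    then have "mon (Psi * cp) \<in> C1" using mon_act[OF cp] by simp
    then have "(monom 1 n - 1) dvd Psi * cp" by (rule mon_C1[rotated]) (use cp in simp)
    then obtain G where G: "Psi * cp = (monom 1 n - 1) * G" by (auto simp: dvd_def)
    have "ipoly Psi w * ipoly cp w = (w ^ n - 1) * ipoly G w" using arg_cong[OF G, of "\<lambda>f. ipoly f w"] by simp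
    then have "ipoly Psi w * of_nat p = 0" using T1.wn by (simp add: cp_def)
    then show False using T1.Psi_w p0 by simp
  qed
  then obtain i0 where i0: "i0 < b" "h i0 \<noteq> 0" by blast
  define Q where "Q j g \<longleftrightarrow> int p dvd poly g t \<and> (\<forall>i<b. (if i = j then 1 else 0) =
      h i * ipoly g w + (\<Sum>l<a. ipoly (ep (v l) i) w * ipoly (fp (u j) l) w))" for j g
  have "\<exists>g. Q j g" if j: "j < b" for j
  proof -
      \<comment> \<open>x lifts F (u j) through the section given by the v l, so y = u j / x lies in
        the kernel of F.\<close>
      define x where "x = (\<Prod>l<a. act (fp (u j) l) (v l))"
      define y where "y = u j * inverse x"
      have xU: "x \<in> U" unfolding x_def by (intro U_prod act_U v)
      have yU: "y \<in> U" unfolding y_def by (intro U_mult U_inverse u xU)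
      have Fx: "F x i = F (u j) i" if i: "i < a" for i
      proof -
        have "F x i = (\<Sum>l<a. F (u j) l * ipoly (if i = l then 1 else 0) w)"
          unfolding x_def using i by (subst F.E_prod) (auto intro!: act_U v sum.cong simp: F.E_act v fp[OF u(1)])
        also have "\<dots> = (\<Sum>l<a. if i = l then F (u j) l else 0)" by (intro sum.cong) auto
        also have "\<dots> = F (u j) i" using i by simp
        finally show ?thesis .
      qed
      have "\<forall>i<a. F y i = 0" using Fx by (simp add: y_def F.E_mult u xU U_inverse F.E_inverse)
      then have "act Psi y \<in> C2" using F(5) yU by blast
      then obtain c f where c: "c \<in> C1" "int p dvd poly f t" "act Psi y = c * mon f"
        using C2[OF act_U[OF yU]] by blast
      have cU: "c \<in> U" using c C1 by blast
      \<comment> \<open>Phi * Psi = X^n - 1 acts trivially, so mon (Phi * f) lies in C1. Hence X^n -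
        1 divides Phi * f, and Psi divides f.\<close>
      have "1 = act (Phi * Psi) y" unfolding PP using act_xn[OF yU] by simp
      also have "\<dots> = act Phi c * mon (Phi * f)"
        using act_mult[OF yU] c act_mult_arg[OF cU mon_U[OF c(2)]] mon_act[OF c(2)] by simp
      finally have "mon (Phi * f) = inverse (act Phi c)" using U_nonzero[OF act_U[OF cU]]
        by (metis inverse_unique)
      then have "mon (Phi * f) \<in> C1" using C1(4) act_C1[OF c(1)] by simp
      then have "(monom 1 n - 1) dvd Phi * f" by (rule mon_C1[rotated]) (use c in simp)
      then obtain g where "Phi * f = Phi * Psi * g" unfolding PP[symmetric] by (auto simp: dvd_def)
      moreover have "Phi \<noteq> 0" using PP n by (auto simp: monom_eq_1_iff)
      ultimately have fg: "f = Psi * g" by (metis mult.assoc mult_left_cancel)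
      \<comment> \<open>The quotient g stays in P because p does not divide Psi(t).\<close>
      have gt: "int p dvd poly g t" using c(2) Psit p by (simp add: fg prime_dvd_mult_iff)
      have "(if i = j then 1 else 0) = h i * ipoly g w + (\<Sum>l<a. ipoly (ep (v l) i) w * ipoly (fp (u j) l) w)" if i: "i < b" for i
      proof -
        have "act Psi c \<in> C1" by (rule act_C1[OF c(1)])
        then have Ec: "E c i = 0" using E(5) cU i by blast
        have "ipoly Psi w * E y i = E (act Psi y) i" using E.E_act[OF yU i] by simp
        also have "\<dots> = ipoly f w * h i" using c(3) Ec by (simp add: E.E_mult cU mon_U[OF c(2)] i Emon[OF c(2) i])
        also have "\<dots> = ipoly Psi w * (ipoly g w * h i)" by (simp add: fg)
        finally have "E y i = ipoly g w * h i" using T1.Psi_w by simp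
        moreover have "E y i = (if i = j then 1 else 0) - E x i"
          using i by (simp add: y_def E.E_mult u xU U_inverse E.E_inverse)
        moreover have "E x i = (\<Sum>l<a. ipoly (ep (v l) i) w * ipoly (fp (u j) l) w)"
          unfolding x_def using i by (subst E.E_prod) (auto intro!: act_U v sum.cong simp: E.E_act v ep[OF v(1)] mult.commute)
        ultimately show ?thesis by (simp add: algebra_simps)
      qed
      then show ?thesis using gt unfolding Q_def by blast
  qed
  then obtain m where mQ: "\<And>j. j < b \<Longrightarrow> Q j (m j)" by metis
  have m: "\<And>j. j < b \<Longrightarrow> int p dvd poly (m j) t" "\<And>i j. j < b \<Longrightarrow> i < b \<Longrightarrow> (if i = j then 1 else 0) =
      h i * ipoly (m j) w + (\<Sum>l<a. ipoly (ep (v l) i) w * ipoly (fp (u j) l) w)"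
    using mQ unfolding Q_def by blast+
  show ?thesis
  proof (rule principal_from_splitting[where b = b and a = a and h = h and m = m and w = w and ?i0.0 = i0
        and S = "\<lambda>i l. ep (v l) i" and F = "\<lambda>l j. fp (u j) l" and H = "\<lambda>f i. ep (mon f) i"])
    fix i j assume "i < b" "j < b"
    then show "(if i = j then 1 else 0) = h i * ipoly (m j) w + (\<Sum>l<a. ipoly (ep (v l) i) w * ipoly (fp (u j) l) w)"
      using m(2) by blast
  next
    fix i j assume ij: "i < a" "j < a"
    have "(\<Sum>l<b. ipoly (fp (u l) i) w * ipoly (ep (v j) l) w) = (\<Sum>l<b. E (v j) l * F (u l) i)"
      using ij by (intro sum.cong) (auto simp: ep[OF v(1)] fp[OF u(1)])
    also have "\<dots> = F (v j) i" using FE[OF v(1) ij(1)] by simp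
    finally show "(\<Sum>l<b. ipoly (fp (u l) i) w * ipoly (ep (v j) l) w) = (if i = j then 1 else 0)" using v(2)[OF ij(1)] by simp
  next
    fix i assume i: "i < a"
    have "(\<Sum>l<b. ipoly (fp (u l) i) w * h l) = (\<Sum>l<b. E (mon cp) l * F (u l) i) / of_nat p"
      unfolding sum_divide_distrib using i by (intro sum.cong) (auto simp: fp[OF u(1)] h_def)
    also have "(\<Sum>l<b. E (mon cp) l * F (u l) i) = F (mon cp) i" using FE[OF mon_U[OF cp] i] by simp
    finally show "(\<Sum>l<b. ipoly (fp (u l) i) w * h l) = 0" using Fmon[OF cp i] by simp
  next
    fix f i assume "int p dvd poly f t" "i < b"
    then show "ipoly (ep (mon f) i) w = ipoly f w * h i" using ep[OF mon_U] Emon by metis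
  qed (use i0 m in auto)
qed

section \<open>The torus of the invariant field\<close>

definition FR :: "'b::field set \<Rightarrow> nat \<Rightarrow> (nat \<Rightarrow> 'b) \<Rightarrow> 'b set" where
  "FR K N v = {a / b | a b. a \<in> PR K N v \<and> b \<in> PR K N v \<and> b \<noteq> 0}"

lemma PR_subrng: "subrng K \<Longrightarrow> subrng (PR K N v)"
proof -
  assume K: "subrng K"
  show ?thesis unfolding subrng_def PR_def
  proof (intro conjI ballI)
    show "0 \<in> {f v |f. f \<in> polyf K N}" "1 \<in> {f v |f. f \<in> polyf K N}"
      using polyf.const[OF subrngD(1)[OF K]] polyf.const[OF subrngD(2)[OF K]] by force+
    fix x y assume "x \<in> {f v |f. f \<in> polyf K N}" "y \<in> {f v |f. f \<in> polyf K N}"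
    then obtain f g where fg: "f \<in> polyf K N" "g \<in> polyf K N" "x = f v" "y = g v" by auto
    show "x + y \<in> {f v |f. f \<in> polyf K N}" "x * y \<in> {f v |f. f \<in> polyf K N}"
      using polyf.add[OF fg(1,2)] polyf.mult[OF fg(1,2)] fg by auto
    have "- 1 \<in> K" using subrng_uminus[OF K subrngD(2)[OF K]] .
    from polyf.add[OF fg(1) polyf.mult[OF polyf.const[OF this] fg(2)]]
    show "x - y \<in> {f v |f. f \<in> polyf K N}" unfolding fg mem_Collect_eq by (intro exI conjI) auto
  qed
qed

lemma PR_FR: "subrng K \<Longrightarrow> PR K N v \<subseteq> FR K N v"
  unfolding FR_def using subrngD(2)[OF PR_subrng] by (fastforce intro: exI[of _ 1])

lemma FR_subfield:
  assumes K: "subrng K" shows "is_subfield (FR K N v)"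
proof -
  note P = PR_subrng[OF K, of N v]
  note PD = subrngD[OF P]
  show ?thesis unfolding is_subfield_def
  proof (intro conjI ballI)
    show "0 \<in> FR K N v" "1 \<in> FR K N v" using PR_FR[OF K] PD(1,2) by auto
    fix x assume x: "x \<in> FR K N v"
    then obtain a b where ab: "a \<in> PR K N v" "b \<in> PR K N v" "b \<noteq> 0" "x = a / b" by (auto simp: FR_def)
    show "inverse x \<in> FR K N v"
    proof (cases "a = 0")
      case True
      then show ?thesis using x ab by simp
    next
      case False
      have "inverse x = b / a" using ab by simp
      then show ?thesis using ab False unfolding FR_def by blast
    qed
    fix y assume "y \<in> FR K N v"
    then obtain c d where cd: "c \<in> PR K N v" "d \<in> PR K N v" "d \<noteq> 0" "y = c / d" by (auto simp: FR_def)
    have bd: "b * d \<in> PR K N v" "b * d \<noteq> 0" using ab cd PD(5) by auto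
    have "x + y = (a * d + c * b) / (b * d)" "x - y = (a * d - c * b) / (b * d)" "x * y = (a * c) / (b * d)"
      using ab cd by (auto simp: field_simps)
    moreover have "a * d + c * b \<in> PR K N v" "a * d - c * b \<in> PR K N v" "a * c \<in> PR K N v"
      using ab cd by (auto intro!: PD(3-5))
    ultimately show "x + y \<in> FR K N v" "x - y \<in> FR K N v" "x * y \<in> FR K N v"
      using bd unfolding FR_def by blast+
  qed
qed

lemma PR_least:
  assumes "subrng R" "K \<subseteq> R" "\<And>i. i < N \<Longrightarrow> v i \<in> R" shows "PR K N v \<subseteq> R"
proof
  fix x assume "x \<in> PR K N v"
  then obtain f where f: "f \<in> polyf K N" "x = f v" by (auto simp: PR_def)
  from f(1) have "f v \<in> R" by induction (use assms in \<open>auto intro: subrngD(3,5)\<close>)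
  then show "x \<in> R" using f by simp
qed

lemma PR_const: "K \<subseteq> PR K N v"
  unfolding PR_def using polyf.const by force

lemma PR_var: "i < N \<Longrightarrow> v i \<in> PR K N v"
  unfolding PR_def using polyf.proj[of i N K] by force

lemma power_int_sum:
  fixes x :: "'a::field" assumes "x \<noteq> 0" shows "x powi (\<Sum>i\<in>I. f i) = (\<Prod>i\<in>I. x powi f i)"
  by (induction I rule: infinite_finite_induct) (auto simp: power_int_add assms)

lemma (in tau_group) act_altdef:
  "x \<in> U \<Longrightarrow> act f x = (\<Prod>l\<le>degree f. ((tau ^^ l) x) powi coeff f l)"
proof (induction f)
  case (pCons c f)
  have tl: "(tau ^^ l) x \<in> U" for l by (induction l) (auto intro: U_tau pCons.prems)
  have tp: "tau (\<Prod>l\<in>I. g l) = (\<Prod>l\<in>I. tau (g l))" if "finite I" "\<And>l. g l \<in> U" for I :: "nat set" and g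
    using that by (induction I rule: finite_induct) (auto simp: tau_1 tau_mult U_prod)
  have "act (pCons c f) x = x powi c * (\<Prod>l\<le>degree f. ((tau ^^ Suc l) x) powi coeff f l)"
    using pCons by (simp add: tp U_power_int tl tau_power_int)
  also have "\<dots> = (\<Prod>l\<le>Suc (degree f). ((tau ^^ l) x) powi coeff (pCons c f) l)"
    by (subst prod.atMost_Suc_shift) simp
  also have "\<dots> = (\<Prod>l\<le>degree (pCons c f). ((tau ^^ l) x) powi coeff (pCons c f) l)"
    by (rule prod.mono_neutral_right) (auto simp: coeff_eq_0 degree_pCons_eq_if)
  finally show ?case .
qed simp

lemma dvd_iff_cong_of_add_cong:
  assumes "[a + k = i] (mod p)" shows "(p::nat) dvd a \<longleftrightarrow> [k = i] (mod p)"
proof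
  assume "p dvd a"
  then have "[a + k = 0 + k] (mod p)" by (intro cong_add) (auto simp: cong_0_iff)
  then show "[k = i] (mod p)" using assms by (metis add_0 cong_sym cong_trans)
next
  assume "[k = i] (mod p)"
  then have "[a + k = 0 + k] (mod p)" using assms by (metis add_0 cong_sym cong_trans)
  then have "[a = 0] (mod p)" by (simp only: cong_add_rcancel_nat)
  then show "p dvd a" by (simp add: cong_0_iff)
qed

text \<open>The first p entries of v are the indeterminates permuted by the cyclic group, the others
  those added for stable rationality. The ambient field is algebraically closed; it provides z0 and,
  in \<open>indV\<close>, p-th roots.\<close>

locale geo =
  fixes p N g :: nat and v :: "nat \<Rightarrow> 'b::{field_char_0,alg_closed_field}" and z0 :: 'b
  assumes p: "prime p" and pN: "p \<le> N" and p2: "p > 2" and z0: "prt p z0" and v: "alg_ind \<int> N v"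
    and g: "\<And>d. [g ^ d = 1] (mod p) \<longleftrightarrow> (p - 1) dvd d"
begin

abbreviation "n \<equiv> p - 1"
abbreviation "K \<equiv> QF z0"

lemma p1: "p > 1" using p2 by simp

lemma Kf: "is_subfield K" by (rule QF_subfield)
lemma Ks: "subrng K" by (rule subfield_subrng[OF Kf])

lemma indK: "alg_ind K N v" by (rule alg_ind_QF[OF z0 p1 v])

lemma gn: "[g ^ n = 1] (mod p)" using g by simp

lemma gp: "coprime g p"
proof -
  have "[g * g ^ (n - 1) = 1] (mod p)" using gn p2 by (metis power_eq_if diff_is_0_eq not_less zero_less_diff less_diff_conv add.commute One_nat_def p1)
  then show ?thesis by (metis coprime_iff_invertible_nat One_nat_def)
qed

lemma gpow: "coprime (g ^ k) p" using gp by simp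

text \<open>Independence of v over K makes the relation an identity in v, and identities may be
  conjugated. This is what makes tau well defined.\<close>

lemma conj_zero:
  assumes F: "F \<in> polyf \<int> (Suc N)" and ij: "coprime i p" "coprime j p" and 0: "F (v(N := z0 ^ i)) = 0"
  shows "F (v(N := z0 ^ j)) = 0"
proof -
  have "(\<lambda>t. F (t(N := z0 ^ i))) \<in> polyf K N"
    using F Ints_subset_QF[of z0] QF_ipoly[of "monom 1 i" z0] by (intro polyf_fix_last) auto
  then have "F (t(N := z0 ^ i)) = 0" for t using alg_indD[OF indK, of "\<lambda>t. F (t(N := z0 ^ i))"] 0 by blast
  then show ?thesis by (rule polyf_conj_zero[OF z0 F ij(2,1)])
qed

text \<open>K(v), written over \<int> with z0 as the variable of index N, so that tau is a
  substitution in this variable.\<close>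

definition LL :: "'b set" where
  "LL = {F (v(N := z0)) / G (v(N := z0)) | F G. F \<in> polyf \<int> (Suc N) \<and> G \<in> polyf \<int> (Suc N) \<and> G (v(N := z0)) \<noteq> 0}"

text \<open>The automorphism fixing v and sending z0 to z0^g, defined through a chosen
  representation; \<open>tau_eq\<close> proves independence of the choice by conjugating the
  relation F G' = F' G.\<close>

definition tau :: "'b \<Rightarrow> 'b" where
  "tau x = (SOME y. \<exists>F G. F \<in> polyf \<int> (Suc N) \<and> G \<in> polyf \<int> (Suc N) \<and> G (v(N := z0)) \<noteq> 0 \<and>
     x = F (v(N := z0)) / G (v(N := z0)) \<and> y = F (v(N := z0 ^ g)) / G (v(N := z0 ^ g)))"

lemma G_nonzero:
  assumes "G \<in> polyf \<int> (Suc N)" "G (v(N := z0)) \<noteq> 0" "coprime j p" shows "G (v(N := z0 ^ j)) \<noteq> 0"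
  using conj_zero[OF assms(1,3), of 1] assms(2) by auto

lemma tau_eq:
  assumes FG: "F \<in> polyf \<int> (Suc N)" "G \<in> polyf \<int> (Suc N)" "G (v(N := z0)) \<noteq> 0"
  shows "tau (F (v(N := z0)) / G (v(N := z0))) = F (v(N := z0 ^ g)) / G (v(N := z0 ^ g))"
proof -
  let ?x = "F (v(N := z0)) / G (v(N := z0))"
  have "\<exists>y. \<exists>F G. F \<in> polyf \<int> (Suc N) \<and> G \<in> polyf \<int> (Suc N) \<and> G (v(N := z0)) \<noteq> 0 \<and>
     ?x = F (v(N := z0)) / G (v(N := z0)) \<and> y = F (v(N := z0 ^ g)) / G (v(N := z0 ^ g))" using FG by blast
  from someI_ex[OF this, folded tau_def] obtain F' G' where FG': "F' \<in> polyf \<int> (Suc N)" "G' \<in> polyf \<int> (Suc N)"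
    "G' (v(N := z0)) \<noteq> 0" "?x = F' (v(N := z0)) / G' (v(N := z0))" "tau ?x = F' (v(N := z0 ^ g)) / G' (v(N := z0 ^ g))" by blast
  define H where "H t = F t * G' t + (- 1) * (F' t * G t)" for t
  have "H \<in> polyf \<int> (Suc N)" unfolding H_def by (intro polyf.add polyf.mult polyf.const FG FG') auto
  moreover have "H (v(N := z0 ^ 1)) = 0" using FG(3) FG'(3,4) by (simp add: H_def field_simps)
  ultimately have "H (v(N := z0 ^ g)) = 0" using conj_zero[of H 1 g] gp by simp
  then have "F (v(N := z0 ^ g)) * G' (v(N := z0 ^ g)) = F' (v(N := z0 ^ g)) * G (v(N := z0 ^ g))" by (simp add: H_def)
  then show ?thesis unfolding FG'(5) using G_nonzero[of G g, OF FG(2,3) gp] G_nonzero[of G' g, OF FG'(2,3) gp]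
    by (simp add: frac_eq_eq)
qed

lemma one_polyf: "(\<lambda>_. 1) \<in> polyf \<int> M" by (rule polyf.const) simp

lemma LL_PR: "F \<in> polyf \<int> (Suc N) \<Longrightarrow> F (v(N := z0)) \<in> LL"
  unfolding LL_def using one_polyf by (intro CollectI exI[of _ F] exI[of _ "\<lambda>_. 1"]) auto

lemma tau_PR: "F \<in> polyf \<int> (Suc N) \<Longrightarrow> tau (F (v(N := z0))) = F (v(N := z0 ^ g))"
  using tau_eq[OF _ one_polyf, of F] by simp

lemma polyf_conj: "F \<in> polyf \<int> (Suc N) \<Longrightarrow> (\<lambda>t. F (t(N := t N ^ j))) \<in> polyf \<int> (Suc N)"
proof -
  assume F: "F \<in> polyf \<int> (Suc N)"
  have "(\<lambda>t. F (\<lambda>i. (if i = N then (\<lambda>t. t N ^ j) else (\<lambda>t. t i)) t)) \<in> polyf \<int> (Suc N)"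
  proof (rule polyf_subst[OF F])
    fix i assume "i < Suc N"
    then show "(if i = N then (\<lambda>t. t N ^ j) else (\<lambda>t. t i)) \<in> polyf \<int> (Suc N)"
      using polyf_power[OF _ polyf.proj[of N "Suc N" \<int>], of j] by (cases "i = N") (auto intro: polyf.proj)
  qed
  also have "(\<lambda>t. F (\<lambda>i. (if i = N then (\<lambda>t. t N ^ j) else (\<lambda>t. t i)) t)) = (\<lambda>t. F (t(N := t N ^ j)))"
    by (rule ext, rule arg_cong[of _ _ F]) auto
  finally show ?thesis .
qed

lemma tau_conj: "F \<in> polyf \<int> (Suc N) \<Longrightarrow> tau (F (v(N := z0 ^ j))) = F (v(N := z0 ^ (j * g)))"
  using tau_PR[OF polyf_conj[of F j]] by (simp add: power_mult[symmetric] mult.commute)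

lemma LL_subfield: "is_subfield LL"
proof -
  have "LL = {a / b | a b. a \<in> PR \<int> (Suc N) (v(N := z0)) \<and> b \<in> PR \<int> (Suc N) (v(N := z0)) \<and> b \<noteq> 0}"
    unfolding LL_def PR_def by auto
  then have "LL = FR \<int> (Suc N) (v(N := z0))" by (simp add: FR_def)
  moreover have "subrng (\<int> :: 'b set)" by (auto simp: subrng_def)
  ultimately show ?thesis using FR_subfield by metis
qed

lemma LL_repr:
  assumes "x \<in> LL"
  obtains F G where "F \<in> polyf \<int> (Suc N)" "G \<in> polyf \<int> (Suc N)" "G (v(N := z0)) \<noteq> 0"
     "x = F (v(N := z0)) / G (v(N := z0))"
  using assms by (auto simp: LL_def)

sublocale aut: field_aut LL tau
proof
  show "is_subfield LL" by (rule LL_subfield)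
  show "tau 1 = 1" using tau_PR[OF one_polyf] by simp
  fix x assume "x \<in> LL"
  then obtain F G where FG: "F \<in> polyf \<int> (Suc N)" "G \<in> polyf \<int> (Suc N)" "G (v(N := z0)) \<noteq> 0"
     "x = F (v(N := z0)) / G (v(N := z0))" by (rule LL_repr)
  have tx: "tau x = F (v(N := z0 ^ g)) / G (v(N := z0 ^ g))" using tau_eq[of F G, OF FG(1-3)] FG(4) by simp
  have nzG: "G (v(N := z0 ^ g)) \<noteq> 0" by (rule G_nonzero[of G g, OF FG(2,3) gp])
  show "tau x \<in> LL" unfolding LL_def tx
    by (intro CollectI exI[of _ "\<lambda>t. F (t(N := t N ^ g))"] exI[of _ "\<lambda>t. G (t(N := t N ^ g))"] conjI polyf_conj FG)
      (use nzG in auto)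
  fix y assume "y \<in> LL"
  then obtain F' G' where FG': "F' \<in> polyf \<int> (Suc N)" "G' \<in> polyf \<int> (Suc N)" "G' (v(N := z0)) \<noteq> 0"
     "y = F' (v(N := z0)) / G' (v(N := z0))" by (rule LL_repr)
  have ty: "tau y = F' (v(N := z0 ^ g)) / G' (v(N := z0 ^ g))" using tau_eq[of F' G', OF FG'(1-3)] FG'(4) by simp
  have nzG': "G' (v(N := z0 ^ g)) \<noteq> 0" by (rule G_nonzero[of G' g, OF FG'(2,3) gp])
  have GG: "(\<lambda>t. G t * G' t) \<in> polyf \<int> (Suc N)" by (intro polyf.mult FG FG')
  have "x + y = (F (v(N := z0)) * G' (v(N := z0)) + F' (v(N := z0)) * G (v(N := z0))) / (G (v(N := z0)) * G' (v(N := z0)))"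
    unfolding FG(4) FG'(4) using FG(3) FG'(3) by (simp add: add_frac_eq)
  moreover have "(\<lambda>t. F t * G' t + F' t * G t) \<in> polyf \<int> (Suc N)" by (intro polyf.add polyf.mult FG FG')
  ultimately have "tau (x + y) = (F (v(N := z0 ^ g)) * G' (v(N := z0 ^ g)) + F' (v(N := z0 ^ g)) * G (v(N := z0 ^ g))) / (G (v(N := z0 ^ g)) * G' (v(N := z0 ^ g)))"
    using tau_eq[of "\<lambda>t. F t * G' t + F' t * G t", OF _ GG] FG(3) FG'(3) by simp
  then show "tau (x + y) = tau x + tau y" using nzG nzG' by (simp add: tx ty field_simps)
  have "x * y = (F (v(N := z0)) * F' (v(N := z0))) / (G (v(N := z0)) * G' (v(N := z0)))"
    using FG FG' by simp
  moreover have "(\<lambda>t. F t * F' t) \<in> polyf \<int> (Suc N)" by (intro polyf.mult FG FG')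
  ultimately have "tau (x * y) = (F (v(N := z0 ^ g)) * F' (v(N := z0 ^ g))) / (G (v(N := z0 ^ g)) * G' (v(N := z0 ^ g)))"
    using tau_eq[of "\<lambda>t. F t * F' t", OF _ GG] FG(3) FG'(3) by simp
  then show "tau (x * y) = tau x * tau y" by (simp add: tx ty)
qed

lemma tau_funpow_PR: "F \<in> polyf \<int> (Suc N) \<Longrightarrow> (tau ^^ k) (F (v(N := z0))) = F (v(N := z0 ^ (g ^ k)))"
  by (induction k) (auto simp: tau_conj mult.commute)

lemma tau_funpow_LL: "x \<in> LL \<Longrightarrow> (tau ^^ k) x \<in> LL" by (induction k) (auto intro: aut.tau_L)

lemma tau_funpow_divide: "x \<in> LL \<Longrightarrow> y \<in> LL \<Longrightarrow> (tau ^^ k) (x / y) = (tau ^^ k) x / (tau ^^ k) y"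
  by (induction k) (auto simp: divide_inverse aut.tau_mult aut.tau_inverse tau_funpow_LL aut.L_inverse)

lemma tau_n: assumes "x \<in> LL" shows "(tau ^^ n) x = x"
proof -
  obtain F G where FG: "F \<in> polyf \<int> (Suc N)" "G \<in> polyf \<int> (Suc N)" "G (v(N := z0)) \<noteq> 0"
     "x = F (v(N := z0)) / G (v(N := z0))" using assms by (rule LL_repr)
  have "z0 ^ (g ^ n) = z0" using prt_power_cong[OF z0 gn] by simp
  then show ?thesis using FG by (simp add: tau_funpow_divide LL_PR tau_funpow_PR)
qed

lemma tau_image:
  assumes D: "D \<subseteq> LL" "\<And>x. x \<in> D \<Longrightarrow> tau x \<in> D" shows "tau ` D = D"
proof (intro equalityI subsetI)
  fix x assume x: "x \<in> D"
  have "(tau ^^ k) x \<in> D" for k by (induction k) (auto intro: D x)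
  moreover have "tau ((tau ^^ (n - 1)) x) = (tau ^^ n) x" using p2 by (metis funpow.simps(2) comp_apply Suc_diff_1 zero_less_diff p1)
  ultimately show "x \<in> tau ` D" using tau_n D x by (metis imageI subsetD)
qed (use D in auto)

lemma polyf_N: "f \<in> polyf \<int> N \<Longrightarrow> f (v(N := y)) = f v" by (rule polyf_cong) auto

lemma FR_int_LL: "FR \<int> N v \<subseteq> LL"
proof
  fix x assume "x \<in> FR \<int> N v"
  then obtain f h where fh: "f \<in> polyf \<int> N" "h \<in> polyf \<int> N" "h v \<noteq> 0" "x = f v / h v" by (auto simp: FR_def PR_def)
  then show "x \<in> LL" unfolding LL_def
    by (intro CollectI exI[of _ f] exI[of _ h]) (auto simp: polyf_N intro: polyf_mono)
qed

lemma tau_fix: assumes "x \<in> FR \<int> N v" shows "tau x = x"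
proof -
  obtain f h where fh: "f \<in> polyf \<int> N" "h \<in> polyf \<int> N" "h v \<noteq> 0" "x = f v / h v"
    using assms by (auto simp: FR_def PR_def)
  have "f \<in> polyf \<int> (Suc N)" "h \<in> polyf \<int> (Suc N)" using fh by (auto intro: polyf_mono)
  from tau_eq[OF this] show ?thesis using fh by (simp add: polyf_N)
qed

lemma LL_v: "i < N \<Longrightarrow> v i \<in> LL"
  using LL_PR[OF polyf.proj[of i "Suc N"]] by simp

lemma ipoly_polyf: "(\<lambda>t. ipoly r (t N)) \<in> polyf \<int> (Suc N)"
  by (intro polyf_ipoly polyf.proj) simp

lemma K_LL: "K \<subseteq> LL"
proof
  fix x assume "x \<in> K"
  then obtain r s where rs: "x = ipoly r z0 / ipoly s z0" "ipoly s z0 \<noteq> 0" by (auto simp: QF_def)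
  then show "x \<in> LL" unfolding LL_def
    by (intro CollectI exI[of _ "\<lambda>t. ipoly r (t N)"] exI[of _ "\<lambda>t. ipoly s (t N)"]) (auto intro: ipoly_polyf)
qed

lemma tau_K: assumes "x \<in> K" shows "tau x \<in> K"
proof -
  obtain r s where rs: "x = ipoly r z0 / ipoly s z0" "ipoly s z0 \<noteq> 0" using assms by (auto simp: QF_def)
  have "tau x = ipoly r (z0 ^ g) / ipoly s (z0 ^ g)"
    using tau_eq[OF ipoly_polyf ipoly_polyf, of s r] rs by simp
  also have "\<dots> = ipoly (pcompose r (monom 1 g)) z0 * inverse (ipoly (pcompose s (monom 1 g)) z0)"
    by (simp add: ipoly_pcompose divide_inverse)
  also have "\<dots> \<in> K" by (intro QF_mult QF_inverse QF_ipoly)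
  finally show ?thesis .
qed

section \<open>Lagrange resolvents and invariant Laurent monomials\<close>

definition Z :: "nat \<Rightarrow> (nat \<Rightarrow> 'b) \<Rightarrow> 'b" where "Z i t = (\<Sum>j<p. z0 ^ (i * j) * t j)"

definition z :: "nat \<Rightarrow> 'b" where "z i = Z i v"

lemma z_conj: "z i = (\<lambda>t. \<Sum>j<p. t N ^ j * t j) (v(N := z0 ^ i))"
  using pN by (auto simp: z_def Z_def power_mult intro!: sum.cong)

lemma z_polyf: "(\<lambda>t. \<Sum>j<p. t N ^ j * t j) \<in> polyf \<int> (Suc N)"
  using pN by (intro polyf_sum polyf.mult polyf_power polyf.proj) auto

lemma z_mod: "z (i mod p) = z i"
  unfolding z_conj prt_power_mod[OF z0] ..

lemma tau_z: "tau (z i) = z (i * g mod p)"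
proof -
  have "tau (z i) = z (i * g)" unfolding z_conj by (rule tau_conj[OF z_polyf])
  then show ?thesis by (simp add: z_mod)
qed

lemma z_LL: "z i \<in> LL"
  using LL_PR[OF polyf_conj[OF z_polyf, of i]] by (simp add: z_conj)

lemma Z_polyf: "i < p \<Longrightarrow> Z i \<in> polyf K N"
  unfolding Z_def using pN QF_ipoly[of "monom 1 _" z0]
  by (intro polyf_sum polyf.mult polyf.const polyf.proj QF_0) auto

lemma sum_roots: "(\<Sum>j<p. z0 ^ (i * j)) = (if p dvd i then of_nat p else 0)"
proof (cases "p dvd i")
  case True
  then have "z0 ^ (i * j) = 1" for j using prt_power_eq_1_iff[OF z0, of "i * j"] by simp
  then show ?thesis using True by simp
next
  case False
  then have "z0 ^ i \<noteq> 1" using prt_power_eq_1_iff[OF z0] by simp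
  moreover have "(z0 ^ i) ^ p = 1" using prt_power_eq_1_iff[OF z0, of "i * p"] by (simp add: power_mult)
  ultimately show ?thesis using False by (simp add: power_mult geometric_sum)
qed

text \<open>The inverse Fourier transform: exponents of z0 count modulo p, where n = p - 1 is
  -1.\<close>

definition T :: "(nat \<Rightarrow> 'b) \<Rightarrow> nat \<Rightarrow> 'b" where
  "T y j = (\<Sum>i<p. z0 ^ (n * i * j) * y i) / of_nat p"

lemma Z_cong: "(\<And>j. j < p \<Longrightarrow> s j = t j) \<Longrightarrow> Z i s = Z i t" by (simp add: Z_def)

lemma Z_T: assumes "i < p" shows "Z i (T y) = y i"
proof -
  have "Z i (T y) = (\<Sum>j<p. \<Sum>k<p. z0 ^ (i * j) * (z0 ^ (n * k * j) * y k)) / of_nat p"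
    unfolding Z_def T_def by (simp add: sum_distrib_left sum_divide_distrib)
  also have "(\<Sum>j<p. \<Sum>k<p. z0 ^ (i * j) * (z0 ^ (n * k * j) * y k)) = (\<Sum>k<p. y k * (\<Sum>j<p. z0 ^ ((i + n * k) * j)))"
  proof -
    have "z0 ^ (i * j) * (z0 ^ (n * k * j) * y k) = y k * z0 ^ ((i + n * k) * j)" for j k
      unfolding distrib_right power_add by (simp only: mult_ac)
    then have "(\<Sum>j<p. \<Sum>k<p. z0 ^ (i * j) * (z0 ^ (n * k * j) * y k)) = (\<Sum>j<p. \<Sum>k<p. y k * z0 ^ ((i + n * k) * j))"
      by (intro sum.cong refl)
    also have "\<dots> = (\<Sum>k<p. \<Sum>j<p. y k * z0 ^ ((i + n * k) * j))" by (rule sum.swap)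
    finally show ?thesis unfolding sum_distrib_left .
  qed
  also have "\<dots> = (\<Sum>k<p. if k = i then y k * of_nat p else 0)"
  proof (rule sum.cong[OF refl])
    fix k assume k: "k \<in> {..<p}"
    have "p dvd i + n * k \<longleftrightarrow> k = i"
    proof -
      have "Suc n * k = p * k" using p1 by simp
      then have "n * k + k = p * k" by simp
      then have eq: "i + n * k + k = i + p * k" by (simp only: add.assoc)
      have "[i + n * k + k = i] (mod p)" unfolding eq by (simp add: cong_def)
      then have "p dvd i + n * k \<longleftrightarrow> [k = i] (mod p)"
        by (rule dvd_iff_cong_of_add_cong)
      then show ?thesis using k assms by (auto simp: cong_def)
    qed
    then show "y k * (\<Sum>j<p. z0 ^ ((i + n * k) * j)) = (if k = i then y k * of_nat p else 0)" by (simp add: sum_roots)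
  qed
  also have "\<dots> = y i * of_nat p" using assms by simp
  finally show ?thesis using p1 by simp
qed

text \<open>The Fourier transform is invertible, so every y is the transform of \<open>T y\<close>,
  and independence passes from v to z.\<close>

lemma z_ind:
  assumes f: "f \<in> polyf K p" and 0: "f z = 0" shows "f y = 0"
proof -
  have "(\<lambda>t. f (\<lambda>i. Z i t)) \<in> polyf K N" by (rule polyf_subst[OF f Z_polyf])
  moreover have "f (\<lambda>i. Z i v) = 0" using 0 unfolding z_def .
  ultimately have "f (\<lambda>i. Z i (T y)) = 0" using alg_indD[OF indK, of "\<lambda>t. f (\<lambda>i. Z i t)"] by blast
  then show ?thesis using polyf_cong[OF f, of "\<lambda>i. Z i (T y)" y] Z_T by simp
qed

lemma z_nonzero: "i < p \<Longrightarrow> z i \<noteq> 0"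
  using z_ind[OF polyf.proj, of i "\<lambda>_. 1"] by auto

text \<open>Coordinates for the invariants over K. A shift by h multiplies z i by z0^(- i h), so z i
  * z 1 ^ (p - i) is invariant, and V 1 is z 1 ^ p. The entries 1, ..., p - 1 become coordinates of
  the torus, the others of an affine space.\<close>

definition V :: "nat \<Rightarrow> 'b" where
  "V i = (if i = 0 then z 0 else if i < p then z i * z 1 ^ (p - i) else v i)"

text \<open>Any point with nonzero integer coordinates is a value of V: take a p-th root r of its
  coordinate 1 as the value of z 1 and solve for the other resolvents. Such points form an infinite
  grid.\<close>

lemma indV: "alg_ind K N V"
  unfolding alg_ind_def
proof (intro ballI impI allI)
  fix f t assume f: "f \<in> polyf K N" and fV: "f V = 0"
  define phi where "phi i = (if i = 0 then Z 0 else if i < p then (\<lambda>t. Z i t * Z 1 t ^ (p - i)) else (\<lambda>t. t i))" for i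
  have "phi i \<in> polyf K N" if "i < N" for i
    using that p1 Z_polyf QF_1[of z0] by (auto simp: phi_def intro!: polyf.proj polyf.mult polyf_power)
  then have "(\<lambda>t. f (\<lambda>i. phi i t)) \<in> polyf K N" by (rule polyf_subst[OF f])
  moreover have "(\<lambda>i. phi i v) = V" by (auto simp: phi_def V_def z_def)
  ultimately have 0: "f (\<lambda>i. phi i t) = 0" for t using alg_indD[OF indK, of "\<lambda>t. f (\<lambda>i. phi i t)"] fV by metis
  have "infinite (\<int> - {0} :: 'b set)" by (rule infinite_Ints_nonzero)
  then show "f t = 0"
  proof (rule polyf_zero_grid[OF f])
    fix u :: "nat \<Rightarrow> 'b" assume u: "\<And>i. i < N \<Longrightarrow> u i \<in> \<int> - {0}"
    have u1: "u 1 \<noteq> 0" using u[of 1] pN p1 by simp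
    obtain r where r: "r ^ p = u 1" using nth_root_exists[of p "u 1"] p1 by auto
    have r0: "r \<noteq> 0" using r u1 p1 by (auto simp: power_0_left)
    define y where "y i = (if i = 0 then u 0 else u i / r ^ (p - i))" for i
    have y1: "y 1 = r"
    proof -
      have "r ^ p = r * r ^ (p - 1)" using p1 by (metis power_eq_if less_nat_zero_code)
      then show ?thesis using r r0 by (simp add: y_def field_simps)
    qed
    define s where "s i = (if i < p then T y i else u i)" for i
    have Zs: "Z i s = y i" if "i < p" for i using Z_T[OF that, of y] Z_cong[of s "T y" i] by (simp add: s_def)
    have "phi i s = u i" for i
      using p1 r0 Zs[of i] Zs[of 1] y1 by (auto simp: phi_def y_def s_def)
    then have "(\<lambda>i. phi i s) = u" by auto
    then show "f u = 0" using 0[of s] by simp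
  qed
qed

definition monz :: "(nat \<Rightarrow> int) \<Rightarrow> 'b" where "monz m = (\<Prod>i\<in>{1..<p}. z i powi m i)"

definition monV :: "(nat \<Rightarrow> int) \<Rightarrow> 'b" where "monV c = (\<Prod>i\<in>{1..<p}. V i powi c i)"

text \<open>A shift multiplies \<open>monz m\<close> by a power of z0 whose exponent is proportional
  to this sum. So weight 0 modulo p characterizes invariance, and such monomials are exactly the
  monomials in V 1, ..., V (p - 1).\<close>

definition weight :: "(nat \<Rightarrow> int) \<Rightarrow> int" where "weight m = (\<Sum>i\<in>{1..<p}. int i * m i)"

lemma V_z: "i \<in> {1..<p} \<Longrightarrow> V i = z i * z 1 ^ (p - i)" by (simp add: V_def)

lemma monV_eq: "monV c = monz c * z 1 powi (int p * (\<Sum>i\<in>{1..<p}. c i) - weight c)"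
proof -
  have z1: "z 1 \<noteq> 0" using z_nonzero p1 by simp
  have "monV c = (\<Prod>i\<in>{1..<p}. z i powi c i * z 1 powi (int (p - i) * c i))"
    unfolding monV_def by (intro prod.cong refl) (simp add: V_z power_int_mult_distrib power_int_mult del: of_nat_diff)
  also have "\<dots> = monz c * z 1 powi (\<Sum>i\<in>{1..<p}. int (p - i) * c i)"
    by (simp only: prod.distrib monz_def power_int_sum[OF z1])
  also have "(\<Sum>i\<in>{1..<p}. int (p - i) * c i) = (\<Sum>i\<in>{1..<p}. int p * c i - int i * c i)"
    by (intro sum.cong) (auto simp: of_nat_diff algebra_simps)
  also have "\<dots> = int p * (\<Sum>i\<in>{1..<p}. c i) - weight c"
    by (simp add: sum_subtractf weight_def sum_distrib_left)
  finally show ?thesis .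
qed

lemma monz_upd: "monz (\<lambda>i. m i + (if i = 1 then k else 0)) = monz m * z 1 powi k"
proof -
  have "monz (\<lambda>i. m i + (if i = 1 then k else 0)) = (\<Prod>i\<in>{1..<p}. z i powi m i * (if i = 1 then z 1 powi k else 1))"
    unfolding monz_def by (intro prod.cong refl) (auto simp: power_int_add z_nonzero)
  also have "\<dots> = monz m * z 1 powi k" using p1 by (simp add: prod.distrib monz_def prod.delta)
  finally show ?thesis .
qed

lemma weight_upd: "weight (\<lambda>i. m i + (if i = 1 then k else 0)) = weight m + k"
proof -
  have "weight (\<lambda>i. m i + (if i = 1 then k else 0)) = (\<Sum>i\<in>{1..<p}. int i * m i + (if i = 1 then k else 0))"
    unfolding weight_def by (intro sum.cong) (auto simp: distrib_left)
  then show ?thesis using p1 by (simp add: sum.distrib weight_def sum.delta)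
qed

lemma monV_monz: "\<exists>m. monV c = monz m \<and> int p dvd weight m"
proof -
  let ?k = "int p * (\<Sum>i\<in>{1..<p}. c i) - weight c"
  have "monV c = monz (\<lambda>i. c i + (if i = 1 then ?k else 0))" unfolding monz_upd by (rule monV_eq)
  moreover have "int p dvd weight (\<lambda>i. c i + (if i = 1 then ?k else 0))" unfolding weight_upd by simp
  ultimately show ?thesis by blast
qed

lemma monz_monV: assumes "int p dvd weight m" shows "\<exists>c. monz m = monV c"
proof -
  have z1: "z 1 \<noteq> 0" using z_nonzero p1 by simp
  have "int p dvd int p * (\<Sum>i\<in>{1..<p}. m i) - weight m" using assms by simp
  then obtain k where k: "int p * (\<Sum>i\<in>{1..<p}. m i) - weight m = int p * k" by (auto simp: dvd_def)
  \<comment> \<open>For i > 1, V i contains z i exactly once, so c must agree with m there; the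
    entry at 1 is adjusted until the powers of z 1 match.\<close>
  define c where "c i = m i + (if i = 1 then - k else 0)" for i
  have s: "(\<Sum>i\<in>{1..<p}. c i) = (\<Sum>i\<in>{1..<p}. m i) - k" using p1 by (simp add: c_def sum.distrib sum.delta)
  have wc: "weight c = weight m - k" unfolding c_def using weight_upd[of m "- k"] by simp
  have "monz c = monz m * z 1 powi (- k)" unfolding c_def by (rule monz_upd)
  then have "monV c = monz m * z 1 powi (- k) * z 1 powi (int p * (\<Sum>i\<in>{1..<p}. c i) - weight c)"
    by (simp only: monV_eq)
  also have "int p * (\<Sum>i\<in>{1..<p}. c i) - weight c = k"
    unfolding s wc right_diff_distrib using k by linarith
  finally have "monV c = monz m" using z1 by (simp add: power_int_minus)
  then show ?thesis by metis
qed

text \<open>Clearing negative exponents gives a relation among the z i, hence an identity. Its value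
  at the all-ones point gives c = 1; setting one coordinate to 2 then gives m i = 0.\<close>

lemma monz_const:
  assumes "monz m \<in> K" shows "\<forall>i\<in>{1..<p}. m i = 0"
proof -
  define c where "c = monz m"
  define f where "f t = (\<Prod>i\<in>{1..<p}. t i ^ nat (m i)) + (- c) * (\<Prod>i\<in>{1..<p}. t i ^ nat (- m i))" for t :: "nat \<Rightarrow> 'b"
  have f: "f \<in> polyf K p" unfolding f_def
    using assms QF_minus[of c z0] QF_1[of z0] c_def
    by (intro polyf.add polyf.mult polyf.const polyf_prod polyf_power polyf.proj) auto
  have "z i powi m i * z i ^ nat (- m i) = z i ^ nat (m i)" if "i \<in> {1..<p}" for i
    using z_nonzero[of i] that by (cases "m i \<ge> 0") (auto simp: power_int_def power_mult_distrib[symmetric])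
  then have "c * (\<Prod>i\<in>{1..<p}. z i ^ nat (- m i)) = (\<Prod>i\<in>{1..<p}. z i ^ nat (m i))"
    unfolding c_def monz_def prod.distrib[symmetric] by (intro prod.cong) auto
  then have "f z = 0" by (simp add: f_def)
  then have f0: "f y = 0" for y using z_ind[OF f] by blast
  have c1: "c = 1" using f0[of "\<lambda>_. 1"] by (simp add: f_def)
  show ?thesis
  proof
    fix i assume i: "i \<in> {1..<p}"
    have pd: "(\<Prod>j\<in>{1..<p}. ((\<lambda>_. 1)(i := 2)) j ^ k j) = (2::'b) ^ k i" for k :: "nat \<Rightarrow> nat"
    proof -
      have "(\<Prod>j\<in>{1..<p}. ((\<lambda>_. 1)(i := 2)) j ^ k j) = (\<Prod>j\<in>{1..<p}. if j = i then (2::'b) ^ k j else 1)"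
        by (intro prod.cong) auto
      then show ?thesis using i by (simp add: prod.delta)
    qed
    have "(2::'b) ^ nat (m i) = 2 ^ nat (- m i)" using f0[of "(\<lambda>_. 1)(i := 2)"] unfolding f_def pd c1 by simp
    then have "(of_nat (2 ^ nat (m i)) :: 'b) = of_nat (2 ^ nat (- m i))" by simp
    then have "(2::nat) ^ nat (m i) = 2 ^ nat (- m i)" by (simp only: of_nat_eq_iff)
    then have "nat (m i) = nat (- m i)" by (simp add: power_inject_exp)
    then show "m i = 0" by linarith
  qed
qed

end

text \<open>For D = K[V] and the variables V 1, ..., V (p - 1), this says that the units of the
  torus coordinate ring are constants times Laurent monomials.\<close>

lemma unts_loc_primes:
  fixes D :: "'b::field set"
  assumes D: "PFD D" and I: "finite I" "\<And>i. i \<in> I \<Longrightarrow> primel D (V i)" and x: "x \<in> unts (loc D (\<Prod>i\<in>I. V i))"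
  shows "\<exists>u\<in>unts D. \<exists>e. x = u * (\<Prod>i\<in>I. V i powi e i)"
proof -
  note Ds = PFD_subrng[OF D]
  define a where "a = (\<Prod>i\<in>I. V i)"
  have VD: "V i \<in> D" "V i \<noteq> 0" if "i \<in> I" for i using primelD[OF I(2)[OF that]] by auto
  have a: "a \<in> D" "a \<noteq> 0" unfolding a_def using VD I(1) by (auto intro!: subrng_prod[OF Ds])
  define G where "G = {u * (\<Prod>i\<in>I. V i powi e i) | u e. u \<in> unts D}"
  have Gm: "x * y \<in> G" if xy: "x \<in> G" "y \<in> G" for x y
  proof -
    obtain u e v f where ue: "u \<in> unts D" "x = u * (\<Prod>i\<in>I. V i powi e i)" "v \<in> unts D" "y = v * (\<Prod>i\<in>I. V i powi f i)"
      using xy unfolding G_def by blast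
    have "x * y = (u * v) * (\<Prod>i\<in>I. V i powi (e i + f i))"
      using VD by (simp add: ue power_int_add prod.distrib mult_ac)
    moreover have "u * v \<in> unts D" by (rule unts_mult[OF Ds ue(1,3)])
    ultimately show ?thesis unfolding G_def mem_Collect_eq by (intro exI conjI)
  qed
  have Gi: "inverse x \<in> G" if x: "x \<in> G" for x
  proof -
    obtain u e where ue: "u \<in> unts D" "x = u * (\<Prod>i\<in>I. V i powi e i)" using x unfolding G_def by blast
    have "inverse x = inverse u * (\<Prod>i\<in>I. V i powi (- e i))"
      by (simp add: ue power_int_minus prod_inversef[symmetric] o_def)
    then show ?thesis unfolding G_def mem_Collect_eq using unts_inverse[OF ue(1)] by (intro exI conjI)
  qed
  have Gu: "u \<in> G" if "u \<in> unts D" for u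
    unfolding G_def mem_Collect_eq using that by (intro exI[of _ u] exI[of _ "\<lambda>_. 0"]) auto
  have GV: "V i \<in> G" if "i \<in> I" for i
  proof -
    have "(\<Prod>j\<in>I. V j powi (if j = i then 1 else 0)) = (\<Prod>j\<in>I. if j = i then V j else 1)" by (intro prod.cong) auto
    also have "\<dots> = V i" using that I(1) by (simp add: prod.delta)
    finally have "V i = 1 * (\<Prod>j\<in>I. V j powi (if j = i then 1 else 0))" by simp
    then show ?thesis unfolding G_def mem_Collect_eq using unts_1[OF Ds] by (intro exI conjI)
  qed
  have Gq: "q \<in> G" if q: "primel D q" "ddvd D q a" for q
  proof -
    have "\<exists>i\<in>J. ddvd D q (V i)" if "ddvd D q (\<Prod>i\<in>J. V i)" "J \<subseteq> I" for J
      using finite_subset[OF that(2) I(1)] that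
    proof (induction J rule: finite_induct)
      case empty
      then show ?case using not_ddvd_unit[OF Ds q(1) unts_1[OF Ds]] by simp
    next
      case (insert i J)
      have "V i \<in> D" "(\<Prod>i\<in>J. V i) \<in> D" using insert VD by (auto intro!: subrng_prod[OF Ds])
      then show ?case using primelD(4)[OF q(1), of "V i" "\<Prod>i\<in>J. V i"] insert by auto
    qed
    then obtain i where i: "i \<in> I" "ddvd D q (V i)" using q(2) unfolding a_def by blast
    then obtain w where w: "w \<in> unts D" "V i = q * w" using primel_assoc[OF Ds q(1) I(2)[OF i(1)]] by blast
    have "q = V i * inverse w" using w by (auto simp: unts_field)
    then show ?thesis using Gm[OF GV[OF i(1)] Gu[OF unts_inverse[OF w(1)]]] by simp
  qed
  have Gpl: "prod_list qs \<in> G" if "\<forall>q\<in>set qs. primel D q \<and> ddvd D q a" for qs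
    using that by (induction qs) (auto intro: Gm Gq Gu unts_1[OF Ds])
  have "x \<in> loc D a" "inverse x \<in> loc D a" "x \<noteq> 0" using x by (auto simp: a_def unts_field)
  then obtain i j where ij: "x * a ^ i \<in> D" "inverse x * a ^ j \<in> D" by (auto simp: loc_def)
  obtain u qs where u: "u \<in> unts D" "\<forall>q\<in>set qs. primel D q" "x * a ^ i = u * prod_list qs"
    using PFD_factor[OF D ij(1)] \<open>x \<noteq> 0\<close> a by auto
  have qsD: "set qs \<subseteq> D" using u(2) by (auto dest: primelD(1))
  have "\<forall>q\<in>set qs. primel D q \<and> ddvd D q a"
  proof
    fix q assume q: "q \<in> set qs"
    then have "prod_list qs = q * prod_list (remove1 q qs)" by (induction qs) (auto simp: algebra_simps)
    then have "x * a ^ i = q * (u * prod_list (remove1 q qs))" using u by (simp add: algebra_simps)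
    moreover have "u * prod_list (remove1 q qs) \<in> D"
      using u(1) qsD set_remove1_subset[of q qs]
      by (intro subrngD(5)[OF Ds] subrng_prod_list[OF Ds]) (auto simp: unts_def)
    ultimately have "ddvd D q (x * a ^ i)" unfolding ddvd_def by blast
    then have "ddvd D q ((x * a ^ i) * (inverse x * a ^ j))" by (rule ddvd_mult[OF Ds ij(2)])
    moreover have "(x * a ^ i) * (inverse x * a ^ j) = a ^ (i + j)" using \<open>x \<noteq> 0\<close> by (simp add: power_add)
    ultimately have "ddvd D q (a ^ (i + j))" by simp
    then show "primel D q \<and> ddvd D q a" using primel_ddvd_power[OF Ds _ a(1)] u q by blast
  qed
  then have 1: "prod_list qs \<in> G" by (rule Gpl)
  have "(\<Prod>i\<in>J. V i) \<in> G" if "J \<subseteq> I" for J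
    using finite_subset[OF that I(1)] that
  proof (induction J rule: finite_induct)
    case empty
    show ?case using Gu[OF unts_1[OF Ds]] by simp
  next
    case (insert i J)
    then show ?case using Gm[OF GV[of i], of "\<Prod>i\<in>J. V i"] by simp
  qed
  then have "a \<in> G" by (simp add: a_def)
  then have aG: "a ^ k \<in> G" for k
  proof (induction k)
    case 0
    show ?case using Gu[OF unts_1[OF Ds]] by simp
  next
    case (Suc k)
    then show ?case using Gm[of a "a ^ k"] by simp
  qed
  have "u * prod_list qs * inverse (a ^ i) \<in> G" by (rule Gm[OF Gm[OF Gu[OF u(1)] 1] Gi[OF aG]])
  moreover have "x = u * prod_list qs * inverse (a ^ i)" using u(3) a by (simp add: field_simps)
  ultimately show ?thesis unfolding G_def by blast
qed

lemma common_denominator: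
  assumes R: "subrng R" and "finite I" "\<And>y. y \<in> I \<Longrightarrow> \<exists>b\<in>R. b \<noteq> 0 \<and> y * b \<in> (R::'b::field set)"
  shows "\<exists>b\<in>R. b \<noteq> 0 \<and> (\<forall>y\<in>I. y * b \<in> R)"
  using assms(2,3)
proof (induction I rule: finite_induct)
  case empty
  then show ?case using subrngD(2)[OF R] by (intro bexI[of _ 1]) auto
next
  case (insert y I)
  then obtain b where b: "b \<in> R" "b \<noteq> 0" "\<forall>y\<in>I. y * b \<in> R" by auto
  obtain c where c: "c \<in> R" "c \<noteq> 0" "y * c \<in> R" using insert.prems[of y] by auto
  note bc = b c
  have "x * (b * c) \<in> R" if "x \<in> insert y I" for x
  proof (cases "x = y")
    case True
    have "b * (y * c) \<in> R" by (rule subrngD(5)[OF R bc(1,6)])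
    then show ?thesis using True by (simp add: mult_ac)
  next
    case False
    then have "x * b * c \<in> R" using that bc subrngD(5)[OF R, of "x * b" c] by auto
    then show ?thesis by (simp add: mult_ac)
  qed
  moreover have "b * c \<in> R" "b * c \<noteq> 0" using bc subrngD(5)[OF R] by auto
  ultimately show ?case by blast
qed

section \<open>The character lattice and the common localization\<close>

context geo
begin

text \<open>With \<open>PR_least\<close> this lets tau-stability of a generated ring be checked on
  generators.\<close>

lemma tau_preimage_subrng: "subrng D \<Longrightarrow> subrng {x\<in>LL. tau x \<in> D}"
proof -
  assume D: "subrng D"
  note DD = subrngD[OF D] and LL = subrngD[OF aut.Ls]
  show ?thesis unfolding subrng_def
  proof (intro conjI ballI)
    show "0 \<in> {x\<in>LL. tau x \<in> D}" "1 \<in> {x\<in>LL. tau x \<in> D}"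
      using DD(1,2) LL(1,2) aut.tau_0 aut.tau_1 by simp_all
    fix x y assume "x \<in> {x\<in>LL. tau x \<in> D}" "y \<in> {x\<in>LL. tau x \<in> D}"
    then have xy: "x \<in> LL" "y \<in> LL" "tau x \<in> D" "tau y \<in> D" by auto
    show "x + y \<in> {x\<in>LL. tau x \<in> D}" using LL(3)[OF xy(1,2)] DD(3)[OF xy(3,4)] aut.tau_add[OF xy(1,2)] by simp
    show "x - y \<in> {x\<in>LL. tau x \<in> D}" using LL(4)[OF xy(1,2)] DD(4)[OF xy(3,4)] aut.tau_minus[OF xy(1,2)] by simp
    show "x * y \<in> {x\<in>LL. tau x \<in> D}" using LL(5)[OF xy(1,2)] DD(5)[OF xy(3,4)] aut.tau_mult[OF xy(1,2)] by simp
  qed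
qed

lemma totatives_p: "totatives p = {1..<p}"
  unfolding totatives_prime[OF p] One_nat_def atLeastSucLessThan_greaterThanLessThan ..

lemma tau_monz: "\<exists>m'. tau (monz m) = monz m' \<and> [weight m' = int g * weight m] (mod int p)"
proof -
  let ?pi = "\<lambda>i. i * g mod p"
  have b: "bij_betw ?pi {1..<p} {1..<p}" using bij_betw_totatives_mult[OF gp p1] by (simp add: totatives_p)
  then have inj: "inj_on ?pi {1..<p}" by (simp add: bij_betw_def)
  define m' where "m' i = m (inv_into {1..<p} ?pi i)" for i
  have mm: "m' (?pi i) = m i" if "i \<in> {1..<p}" for i using inv_into_f_f[OF inj that] by (simp add: m'_def)
  have "tau (monz m) = (\<Prod>i\<in>{1..<p}. tau (z i powi m i))"
    unfolding monz_def by (rule aut.tau_prod) (auto intro: aut.L_power_int z_LL)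
  also have "\<dots> = (\<Prod>i\<in>{1..<p}. z (?pi i) powi m' (?pi i))"
    by (intro prod.cong refl) (simp only: aut.tau_power_int[OF z_LL] tau_z mm)
  also have "\<dots> = monz m'" unfolding monz_def by (rule prod.reindex_bij_betw[OF b])
  finally have 1: "tau (monz m) = monz m'" .
  have "weight m' = (\<Sum>i\<in>{1..<p}. int (?pi i) * m' (?pi i))"
    unfolding weight_def by (rule sum.reindex_bij_betw[OF b, symmetric])
  also have "\<dots> = (\<Sum>i\<in>{1..<p}. int (?pi i) * m i)" by (intro sum.cong refl) (simp only: mm)
  also have "[\<dots> = (\<Sum>i\<in>{1..<p}. int g * (int i * m i))] (mod int p)"
  proof (rule cong_sum)
    fix i
    have "[int (?pi i) = int (i * g)] (mod int p)" by (simp add: cong_def zmod_int)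
    then have "[int (?pi i) * m i = int (i * g) * m i] (mod int p)" by (rule cong_scalar_right)
    then show "[int (?pi i) * m i = int g * (int i * m i)] (mod int p)" by (simp add: mult_ac)
  qed
  finally have "[weight m' = int g * weight m] (mod int p)" by (simp add: weight_def sum_distrib_left)
  then show ?thesis using 1 by blast
qed

lemma tau_monV: "\<exists>c'. tau (monV c) = monV c'"
proof -
  obtain m where m: "monV c = monz m" "int p dvd weight m" using monV_monz by blast
  obtain m' where m': "tau (monz m) = monz m'" "[weight m' = int g * weight m] (mod int p)" using tau_monz by blast
  have "int p dvd weight m'" using m'(2) m(2) by (simp add: cong_dvd_iff)
  then show ?thesis using monz_monV m m' by metis
qed

sublocale G0: tau_group "LL - {0}" tau n
proof
  fix x y assume xy: "x \<in> LL - {0}" "y \<in> LL - {0}"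
  show "x * y \<in> LL - {0}" using xy subrngD(5)[OF aut.Ls] by auto
  show "tau (x * y) = tau x * tau y" using xy aut.tau_mult by auto
next
  fix x assume x: "x \<in> LL - {0}"
  show "inverse x \<in> LL - {0}" using x aut.L_inverse by auto
  show "tau x \<in> LL - {0}" using x aut.tau_L aut.tau_nonzero by auto
  show "(tau ^^ n) x = x" using x tau_n by auto
  show "x \<noteq> 0" using x by simp
qed (use subrngD(2)[OF aut.Ls] in auto)

text \<open>X^l goes to z (g ^ l mod p). As g is a primitive root, this identifies \<int>[X]/(X^n -
  1) with the Laurent monomials in z 1, ..., z (p - 1), and the weight modulo p becomes
  f(g).\<close>

definition mon :: "int poly \<Rightarrow> 'b" where "mon f = G0.act f (z 1)"

lemma z1: "z 1 \<in> LL - {0}" using z_LL z_nonzero[of 1] p1 by auto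

lemma tau_pow_z1: "(tau ^^ l) (z 1) = z (g ^ l mod p)"
proof (induction l)
  case 0
  then show ?case using p1 by simp
next
  case (Suc l)
  then show ?case by (simp add: tau_z mod_mult_left_eq mod_mult_right_eq mult.commute)
qed

definition mm :: "int poly \<Rightarrow> nat \<Rightarrow> int" where
  "mm f i = (\<Sum>l\<in>{l\<in>{..degree f}. g ^ l mod p = i}. coeff f l)"

lemma g_pow_range: "g ^ l mod p \<in> {1..<p}"
proof -
  have "g ^ l mod p \<noteq> 0" using gpow[of l] p1 by (metis coprime_0_left_iff coprime_mod_left_iff less_numeral_extra(4) nat_dvd_1_iff_1 not_less_zero)
  then show ?thesis using p1 by simp
qed

lemma mon_monz: "mon f = monz (mm f)"
proof -
  have "mon f = (\<Prod>l\<le>degree f. z (g ^ l mod p) powi coeff f l)"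
    unfolding mon_def G0.act_altdef[OF z1] tau_pow_z1 ..
  also have "\<dots> = (\<Prod>i\<in>{1..<p}. \<Prod>l\<in>{l\<in>{..degree f}. g ^ l mod p = i}. z (g ^ l mod p) powi coeff f l)"
    by (rule prod.group[symmetric]) (use g_pow_range in auto)
  also have "\<dots> = monz (mm f)"
    unfolding monz_def
  proof (intro prod.cong refl)
    fix i assume i: "i \<in> {1..<p}"
    have "z i \<noteq> 0" using z_nonzero i by simp
    have "z i powi mm f i = (\<Prod>l\<in>{l\<in>{..degree f}. g ^ l mod p = i}. z i powi coeff f l)"
      unfolding mm_def by (rule power_int_sum[OF \<open>z i \<noteq> 0\<close>])
    also have "\<dots> = (\<Prod>l\<in>{l\<in>{..degree f}. g ^ l mod p = i}. z (g ^ l mod p) powi coeff f l)"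
      by (intro prod.cong) auto
    finally show "(\<Prod>l\<in>{l\<in>{..degree f}. g ^ l mod p = i}. z (g ^ l mod p) powi coeff f l) = z i powi mm f i" ..
  qed
  finally show ?thesis .
qed

lemma weight_mm: "[weight (mm f) = poly f (int g)] (mod int p)"
proof -
  have "weight (mm f) = (\<Sum>i\<in>{1..<p}. \<Sum>l\<in>{l\<in>{..degree f}. g ^ l mod p = i}. int (g ^ l mod p) * coeff f l)"
    unfolding weight_def mm_def sum_distrib_left by (intro sum.cong refl) auto
  also have "\<dots> = (\<Sum>l\<le>degree f. int (g ^ l mod p) * coeff f l)"
    by (rule sum.group) (use g_pow_range in auto)
  also have "[\<dots> = (\<Sum>l\<le>degree f. coeff f l * int g ^ l)] (mod int p)"
  proof (rule cong_sum)
    fix l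
    have "[int (g ^ l mod p) = int (g ^ l)] (mod int p)" by (simp add: cong_def zmod_int)
    then have "[int (g ^ l mod p) * coeff f l = int (g ^ l) * coeff f l] (mod int p)" by (rule cong_scalar_right)
    then show "[int (g ^ l mod p) * coeff f l = coeff f l * int g ^ l] (mod int p)" by (simp add: mult_ac)
  qed
  finally show ?thesis by (simp add: poly_altdef)
qed

lemma g_pow_inj: "k < n \<Longrightarrow> l < n \<Longrightarrow> g ^ k mod p = g ^ l mod p \<Longrightarrow> k = l"
proof -
  have gen: "\<not> k < l" if "k < n" "l < n" "g ^ k mod p = g ^ l mod p" for k l
  proof
    assume kl: "k < l"
    have "g ^ l = g ^ k * g ^ (l - k)" using kl by (simp flip: power_add)
    then have "[g ^ k * g ^ (l - k) = g ^ k * 1] (mod p)" using that(3) by (simp add: cong_def)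
    then have "[g ^ (l - k) = 1] (mod p)" using gpow[of k] by (simp only: cong_mult_lcancel_nat)
    then have "n dvd l - k" using g by blast
    then show False using kl that by (auto dest: dvd_imp_le)
  qed
  show "k < n \<Longrightarrow> l < n \<Longrightarrow> g ^ k mod p = g ^ l mod p \<Longrightarrow> k = l"
    using gen[of k l] gen[of l k] by (metis linorder_neqE_nat)
qed

lemma g_pow_bij: "bij_betw (\<lambda>l. g ^ l mod p) {..<n} {1..<p}"
proof -
  have inj: "inj_on (\<lambda>l. g ^ l mod p) {..<n}" using g_pow_inj by (auto simp: inj_on_def)
  moreover have "(\<lambda>l. g ^ l mod p) ` {..<n} = {1..<p}"
  proof (rule card_subset_eq)
    show "card ((\<lambda>l. g ^ l mod p) ` {..<n}) = card {1..<p}" using card_image[OF inj] by simp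
  qed (use g_pow_range in auto)
  ultimately show ?thesis by (simp add: bij_betw_def)
qed

lemma mm_low: assumes f: "\<And>i. i \<ge> n \<Longrightarrow> coeff f i = 0" and l: "l < n" shows "mm f (g ^ l mod p) = coeff f l"
proof -
  have "mm f (g ^ l mod p) = (\<Sum>k\<in>{k\<in>{..degree f}. g ^ k mod p = g ^ l mod p} \<inter> {..<n}. coeff f k)"
    unfolding mm_def by (rule sum.mono_neutral_right) (use f in \<open>auto simp: not_less\<close>)
  also have "{k\<in>{..degree f}. g ^ k mod p = g ^ l mod p} \<inter> {..<n} = (if l \<le> degree f then {l} else {})"
    using g_pow_inj l by auto
  also have "(\<Sum>k\<in>(if l \<le> degree f then {l} else {}). coeff f k) = coeff f l" by (simp add: coeff_eq_0)
  finally show ?thesis .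
qed

lemma mon_add: "mon (f + h) = mon f * mon h" unfolding mon_def by (rule G0.act_add[OF z1])

lemma mon_X: "tau (mon f) = mon (pCons 0 f)" unfolding mon_def by simp

text \<open>Multiples of X^n - 1 act trivially, so f may be replaced by its remainder, whose
  coefficients are exactly the exponents of the monomial.\<close>

lemma mon_K: assumes "mon f \<in> K" shows "(monom 1 n - 1) dvd f"
proof -
  have n0: "n > 0" using p1 by simp
  obtain q r where f: "f = (monom 1 n - 1) * q + r" and r: "\<forall>i\<ge>n. coeff r i = 0" using poly_div_xn[OF n0] by blast
  have "mon ((monom 1 n - 1) * q) = 1"
    unfolding mon_def G0.act_mult[OF z1] by (rule G0.act_xn[OF G0.act_U[OF z1]])
  then have "mon f = mon r" unfolding f mon_add by simp
  then have "\<forall>i\<in>{1..<p}. mm r i = 0" using assms monz_const[of "mm r"] by (simp add: mon_monz)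
  then have "coeff r l = 0" if "l < n" for l using mm_low[of r l] r that g_pow_range[of l] by simp
  then have "r = 0" using r by (intro poly_eqI) (metis coeff_0 not_le)
  then show ?thesis by (simp add: f)
qed

lemma monz_mon: assumes "int p dvd weight m" shows "\<exists>f. int p dvd poly f (int g) \<and> monz m = mon f"
proof -
  define f where "f = (\<Sum>l<n. monom (m (g ^ l mod p)) l)"
  have cf: "coeff f l = (if l < n then m (g ^ l mod p) else 0)" for l by (auto simp: f_def coeff_sum)
  have mmf: "mm f i = m i" if i: "i \<in> {1..<p}" for i
  proof -
    have "i \<in> (\<lambda>l. g ^ l mod p) ` {..<n}" using g_pow_bij i by (simp only: bij_betw_def)
    then obtain l where l: "l < n" "i = g ^ l mod p" by auto
    then show ?thesis using mm_low[of f l] by (simp add: cf)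
  qed
  have "mon f = monz m" unfolding mon_monz monz_def by (intro prod.cong refl) (simp only: mmf)
  moreover have "weight (mm f) = weight m" unfolding weight_def by (intro sum.cong refl) (simp only: mmf)
  then have "int p dvd poly f (int g)" using weight_mm[of f] assms by (simp add: cong_dvd_iff)
  ultimately show ?thesis by metis
qed

text \<open>A = K[s] has tau-fixed generators, and B is the coordinate ring of the torus times an
  affine space. Inverting a in A and b1 in B gives the same tau-stable ring A'. Its units modulo K -
  {0} and modulo unts B are permutation lattices, and unts B modulo K - {0} is P modulo X^n -
  1.\<close>

theorem geo_principal:
  fixes s :: "nat \<Rightarrow> 'b" and w :: complex
  assumes s: "alg_ind K r s" and sfix: "\<And>i. i < r \<Longrightarrow> s i \<in> FR \<int> N v"
    and sV: "\<And>i. i < r \<Longrightarrow> s i \<in> FR K N V" and Vs: "\<And>i. i < N \<Longrightarrow> V i \<in> FR K r s"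
    and w: "prt n w" and n2: "n > 2"
  shows "\<exists>A. int p dvd poly A (int g) \<and>
    (\<forall>f. int p dvd poly f (int g) \<longrightarrow> (\<exists>h. ipoly f w = ipoly A w * ipoly h w))"
proof -
  define A where "A = PR K r s"
  define B0 where "B0 = PR K N V"
  have PA: "PFD A" "unts A = K - {0}" using PFD_PR[OF Kf s] by (auto simp: A_def)
  have PB0: "PFD B0" "unts B0 = K - {0}" "\<And>i. i < N \<Longrightarrow> primel B0 (V i)" using PFD_PR[OF Kf indV] by (auto simp: B0_def)
  note As = PFD_subrng[OF PA(1)] and B0s = PFD_subrng[OF PB0(1)]
  have V_LL: "V i \<in> LL" if "i < N" for i
    using that z_LL LL_v subrngD(5)[OF aut.Ls] subrng_power[OF aut.Ls] by (auto simp: V_def)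
  have A_LL: "A \<subseteq> LL" unfolding A_def
    by (rule PR_least[OF aut.Ls K_LL]) (use sfix FR_int_LL in auto)
  have B0_LL: "B0 \<subseteq> LL" unfolding B0_def by (rule PR_least[OF aut.Ls K_LL V_LL])
  have KA: "K \<subseteq> A" unfolding A_def by (rule PR_const)
  have KB0: "K \<subseteq> B0" unfolding B0_def by (rule PR_const)
  have tauA: "tau x \<in> A" if "x \<in> A" for x
  proof -
    have "A \<subseteq> {x\<in>LL. tau x \<in> A}" unfolding A_def
    proof (rule PR_least, fold A_def)
      show "subrng {x\<in>LL. tau x \<in> A}" by (rule tau_preimage_subrng[OF As])
      show "K \<subseteq> {x\<in>LL. tau x \<in> A}" using K_LL tau_K KA by blast
      fix i assume i: "i < r"
      have "s i \<in> A" unfolding A_def by (rule PR_var[OF i])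
      then show "s i \<in> {x\<in>LL. tau x \<in> A}" using tau_fix[OF sfix[OF i]] FR_int_LL sfix[OF i] by auto
    qed
    then show ?thesis using that by blast
  qed
  define aV where "aV = (\<Prod>i\<in>{1..<p}. V i)"
  have Vp: "primel B0 (V i)" if "i \<in> {1..<p}" for i using PB0(3)[of i] that pN by simp
  have Vnz: "V i \<in> B0" "V i \<noteq> 0" if "i \<in> {1..<p}" for i using primelD[OF Vp[OF that]] by auto
  have aV: "aV \<in> B0" "aV \<noteq> 0" unfolding aV_def using Vnz by (auto intro!: subrng_prod[OF B0s])
  define B where "B = loc B0 aV"
  have PB: "PFD B" unfolding B_def by (rule PFD_loc[OF PB0(1) aV])
  note Bs = PFD_subrng[OF PB]
  have B0B: "B0 \<subseteq> B" unfolding B_def by (rule loc_subset)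
  have VU: "V i \<in> unts B" if i: "i \<in> {1..<p}" for i
  proof -
    have "aV = V i * (\<Prod>j\<in>{1..<p} - {i}. V j)" unfolding aV_def using i by (simp add: prod.remove)
    moreover have "(\<Prod>j\<in>{1..<p} - {i}. V j) \<in> B0" using Vnz by (intro subrng_prod[OF B0s]) auto
    ultimately have "ddvd B0 (V i) aV" unfolding ddvd_def by blast
    then show ?thesis unfolding B_def by (rule ddvd_unts_loc[OF B0s Vnz(1)[OF i] aV(2)])
  qed
  have monV_U: "monV c \<in> unts B" for c
    unfolding monV_def by (intro unts_prod[OF Bs] unts_power_int[OF Bs] VU)
  have KU: "c \<in> unts B" if "c \<in> K - {0}" for c
    using that KB0 B0B QF_inverse[of c z0] by (auto simp: unts_field)
  have unB: "x \<in> unts B \<longleftrightarrow> (\<exists>c\<in>K - {0}. \<exists>e. x = c * monV e)" for x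
  proof
    assume "x \<in> unts B"
    then show "\<exists>c\<in>K - {0}. \<exists>e. x = c * monV e"
      using unts_loc_primes[where D=B0 and I="{1..<p}" and V=V and x=x, OF PB0(1) _ Vp] unfolding PB0(2) monV_def B_def aV_def by blast
  next
    assume "\<exists>c\<in>K - {0}. \<exists>e. x = c * monV e"
    then show "x \<in> unts B" using unts_mult[OF Bs KU monV_U] by blast
  qed
  have B_LL: "B \<subseteq> LL"
  proof
    fix x assume "x \<in> B"
    then obtain i where "x * aV ^ i \<in> B0" by (auto simp: B_def loc_def)
    then have 1: "x * aV ^ i \<in> LL" using B0_LL by blast
    have "aV ^ i \<in> LL" by (rule subrng_power[OF aut.Ls]) (use aV B0_LL in blast)
    from subrngD(5)[OF aut.Ls 1 aut.L_inverse[OF this]] have "x * aV ^ i * inverse (aV ^ i) \<in> LL" .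
    moreover have "x * aV ^ i * inverse (aV ^ i) = x" using aV(2) by simp
    ultimately show "x \<in> LL" by (simp only:)
  qed
  have V_monV: "V i = monV (\<lambda>j. if j = i then 1 else 0)" if i: "i \<in> {1..<p}" for i
  proof -
    have "monV (\<lambda>j. if j = i then 1 else 0) = (\<Prod>j\<in>{1..<p}. if j = i then V j else 1)"
      unfolding monV_def by (intro prod.cong) auto
    then show ?thesis using i by (simp add: prod.delta)
  qed
  have tau_VU: "tau (V i) \<in> unts B" if i: "i \<in> {1..<p}" for i
    using tau_monV[of "\<lambda>j. if j = i then 1 else 0"] monV_U V_monV[OF i] by metis
  have tauB: "tau x \<in> B" if x: "x \<in> B" for x
  proof -
    have sub: "B0 \<subseteq> {x\<in>LL. tau x \<in> B}" unfolding B0_def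
    proof (rule PR_least)
      show "subrng {x\<in>LL. tau x \<in> B}" by (rule tau_preimage_subrng[OF Bs])
      show "K \<subseteq> {x\<in>LL. tau x \<in> B}" using K_LL tau_K KB0 B0B by blast
      fix i assume i: "i < N"
      have VB: "V i \<in> B" using PR_var[OF i, of V K] B0B unfolding B0_def by blast
      have "tau (V i) \<in> B"
      proof (cases "i \<in> {1..<p}")
        case True
        then show ?thesis using tau_VU[OF True] by (simp add: unts_def)
      next
        case False
        \<comment> \<open>Outside 1, ..., p - 1 every V i is fixed by tau: the index 0 is fixed
          under multiplication by g, and the remaining v i lie in \<rat>(v).\<close>
        then have "V i = z 0 \<or> (V i = v i)" by (auto simp: V_def)
        moreover have "tau (z 0) = z 0" by (simp add: tau_z)
        moreover have "v i \<in> FR \<int> N v" using PR_FR[of \<int> N v] PR_var[OF i, of v \<int>] by (auto simp: subrng_def)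
        ultimately have "tau (V i) = V i" using tau_fix by auto
        then show ?thesis using VB by simp
      qed
      then show "V i \<in> {x\<in>LL. tau x \<in> B}" using V_LL[OF i] by simp
    qed
    obtain i where i: "x * aV ^ i \<in> B0" using x by (auto simp: B_def loc_def)
    have xL: "x \<in> LL" "aV \<in> LL" using x B_LL aV B0_LL by auto
    have tB: "tau x * tau aV ^ i \<in> B"
      using sub i aut.tau_mult[OF xL(1) subrng_power[OF aut.Ls xL(2)]] aut.tau_power[OF xL(2)] by auto
    have VL: "V i \<in> LL" if "i \<in> {1..<p}" for i using V_LL[of i] that pN by simp
    have taV: "tau aV \<in> unts B"
    proof -
      have "tau aV = (\<Prod>i\<in>{1..<p}. tau (V i))" unfolding aV_def by (rule aut.tau_prod) (use VL in auto)
      then show ?thesis using tau_VU by (auto intro!: unts_prod[OF Bs])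
    qed
    then have "inverse (tau aV) ^ i \<in> B" using subrng_power[OF Bs] by (simp add: unts_field)
    then have "tau x * tau aV ^ i * inverse (tau aV) ^ i \<in> B" by (rule subrngD(5)[OF Bs tB])
    moreover have "tau aV \<noteq> 0" using taV by (simp add: unts_field)
    ultimately show ?thesis by (simp add: mult.assoc power_mult_distrib[symmetric])
  qed
  have "\<exists>b\<in>B0. b \<noteq> 0 \<and> (\<forall>y\<in>s ` {..<r}. y * b \<in> B0)"
  proof (rule common_denominator[OF B0s])
    fix y assume "y \<in> s ` {..<r}"
    then have "y \<in> FR K N V" using sV by auto
    then obtain a b where ab: "a \<in> B0" "b \<in> B0" "b \<noteq> 0" "y = a / b" by (auto simp: FR_def B0_def)
    then show "\<exists>b\<in>B0. b \<noteq> 0 \<and> y * b \<in> B0" by (intro bexI[of _ b]) auto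
  qed simp
  then obtain b0 where b0: "b0 \<in> B0" "b0 \<noteq> 0" "\<And>i. i < r \<Longrightarrow> s i * b0 \<in> B0" by auto
  have b0B: "b0 \<in> B" using b0 B0B by blast
  have A_loc: "A \<subseteq> loc B b0" unfolding A_def
  proof (rule PR_least[OF loc_subrng[OF Bs b0B]])
    show "K \<subseteq> loc B b0" using KB0 B0B loc_subset[of B b0] by blast
    fix i assume "i < r"
    then have "s i * b0 ^ 1 \<in> B" using b0(3) B0B by auto
    then show "s i \<in> loc B b0" unfolding loc_def by blast
  qed
  have FRA: "is_subfield (FR K r s)" by (rule FR_subfield[OF Ks])
  have B0_FR: "B0 \<subseteq> FR K r s" unfolding B0_def
    by (rule PR_least[OF subfield_subrng[OF FRA] _ Vs]) (use KA PR_FR[OF Ks, of r s] in \<open>auto simp: A_def\<close>)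
  \<comment> \<open>Once these elements lie in A[1/a], so do B and the inverse of b0.\<close>
  define Y where "Y = V ` {..<N} \<union> {inverse aV, inverse b0}"
  have "\<exists>b\<in>A. b \<noteq> 0 \<and> (\<forall>y\<in>Y. y * b \<in> A)"
  proof (rule common_denominator[OF As])
    fix y assume "y \<in> Y"
    then have "y \<in> FR K r s" using Vs B0_FR aV b0 FRA unfolding Y_def is_subfield_def by auto
    then obtain a b where ab: "a \<in> A" "b \<in> A" "b \<noteq> 0" "y = a / b" by (auto simp: FR_def A_def)
    then show "\<exists>b\<in>A. b \<noteq> 0 \<and> y * b \<in> A" by (intro bexI[of _ b]) auto
  qed (simp add: Y_def)
  then obtain a1 where a1: "a1 \<in> A" "a1 \<noteq> 0" "\<And>y. y \<in> Y \<Longrightarrow> y * a1 \<in> A" by blast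
  have tauA_pow: "(tau ^^ k) x \<in> A" if "x \<in> A" for x k by (induction k) (auto intro: that tauA)
  \<comment> \<open>The norm of a1 under tau: a multiple of a1 in A that tau fixes, so A[1/a] is
    tau-stable.\<close>
  define a where "a = (\<Prod>k<n. (tau ^^ k) a1)"
  have a1L: "a1 \<in> LL" using a1 A_LL by blast
  have aA: "a \<in> A" unfolding a_def using tauA_pow[OF a1(1)] by (intro subrng_prod[OF As]) auto
  have a0: "a \<noteq> 0"
  proof -
    have "(tau ^^ k) a1 \<noteq> 0" for k using a1(2)
      by (induction k) (auto simp: aut.tau_nonzero tau_funpow_LL[OF a1L])
    then show ?thesis by (simp add: a_def)
  qed
  have n0: "n > 0" using n2 by simp
  have tau_a: "tau a = a"
  proof -
    have "tau a = (\<Prod>k<n. (tau ^^ Suc k) a1)"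
      unfolding a_def by (subst aut.tau_prod) (auto simp: tau_funpow_LL[OF a1L])
    also have "\<dots> * (tau ^^ 0) a1 = (\<Prod>k<Suc n. (tau ^^ k) a1)" by (simp add: prod.lessThan_Suc_shift del: prod.lessThan_Suc)
    also have "\<dots> = a * (tau ^^ n) a1" by (simp add: a_def)
    finally show ?thesis using tau_n[OF a1L] a1(2) by simp
  qed
  have a_eq: "a = a1 * (\<Prod>k\<in>{1..<n}. (tau ^^ k) a1)"
  proof -
    have "{..<n} = insert 0 {1..<n}" using n0 by auto
    then show ?thesis unfolding a_def by simp
  qed
  have restA: "(\<Prod>k\<in>{1..<n}. (tau ^^ k) a1) \<in> A" using tauA_pow[OF a1(1)] by (intro subrng_prod[OF As]) auto
  define A' where "A' = loc A a"
  have A's: "subrng A'" unfolding A'_def by (rule loc_subrng[OF As aA])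
  have AA': "A \<subseteq> A'" unfolding A'_def by (rule loc_subset)
  have YA': "y \<in> A'" if "y \<in> Y" for y
  proof -
    have "y * a1 * (\<Prod>k\<in>{1..<n}. (tau ^^ k) a1) \<in> A" by (rule subrngD(5)[OF As a1(3)[OF that] restA])
    then have "y * a ^ 1 \<in> A" by (simp add: a_eq mult.assoc)
    then show ?thesis unfolding A'_def loc_def by blast
  qed
  have B0A': "B0 \<subseteq> A'" unfolding B0_def
    by (rule PR_least[OF A's]) (use KA AA' YA' in \<open>auto simp: Y_def\<close>)
  have BA': "B \<subseteq> A'"
  proof
    fix x assume "x \<in> B"
    then obtain i where i: "x * aV ^ i \<in> B0" by (auto simp: B_def loc_def)
    have "inverse aV \<in> A'" by (rule YA') (simp add: Y_def)
    then have "x * aV ^ i * inverse aV ^ i \<in> A'"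
      by (intro subrngD(5)[OF A's subsetD[OF B0A' i]] subrng_power[OF A's])
    then show "x \<in> A'" using aV by (simp add: mult.assoc power_mult_distrib[symmetric])
  qed
  obtain k where k: "a * b0 ^ k \<in> B" using A_loc aA by (auto simp: loc_def)
  \<comment> \<open>a lies in B[1/b0], so some a * b0 ^ k lies in B; inverting b1 inverts both a and
    b0.\<close>
  define b1 where "b1 = b0 * (a * b0 ^ k)"
  have b1: "b1 \<in> B" "b1 \<noteq> 0" unfolding b1_def using b0B k a0 b0 by (auto intro: subrngD(5)[OF Bs])
  have eqA': "A' = loc B b1"
  proof (intro equalityI subsetI)
    fix x assume "x \<in> A'"
    then obtain i where i: "x * a ^ i \<in> A" by (auto simp: A'_def loc_def)
    then obtain j where j: "x * a ^ i * b0 ^ j \<in> B" using A_loc by (auto simp: loc_def)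
    have "x * b1 ^ (i + j) = (x * a ^ i * b0 ^ j) * ((a * b0 ^ k) ^ j * (b0 ^ i * (b0 ^ k) ^ i))"
      by (simp add: b1_def power_add power_mult_distrib mult_ac)
    also have "\<dots> \<in> B" by (intro subrngD(5)[OF Bs] subrng_power[OF Bs] j k b0B)
    finally show "x \<in> loc B b1" unfolding loc_def by blast
  next
    fix x assume "x \<in> loc B b1"
    then obtain i where i: "x * b1 ^ i \<in> B" by (auto simp: loc_def)
    have ib0: "inverse b0 \<in> A'" by (rule YA') (simp add: Y_def)
    have ia: "inverse a \<in> A'" unfolding A'_def by (rule inverse_in_loc[OF As a0])
    have "inverse b1 = inverse b0 * (inverse a * inverse b0 ^ k)" by (simp add: b1_def power_inverse)
    also have "\<dots> \<in> A'" by (intro subrngD(5)[OF A's] subrng_power[OF A's] ib0 ia)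
    finally have "inverse b1 \<in> A'" .
    then have "x * b1 ^ i * inverse b1 ^ i \<in> A'"
      by (intro subrngD(5)[OF A's subsetD[OF BA' i]] subrng_power[OF A's])
    then show "x \<in> A'" using b1 by (simp add: mult.assoc power_mult_distrib[symmetric])
  qed
  define U where "U = unts A'"
  have A'_LL: "A' \<subseteq> LL"
  proof
    fix x assume "x \<in> A'"
    then obtain i where "x * a ^ i \<in> A" by (auto simp: A'_def loc_def)
    then have 1: "x * a ^ i \<in> LL" using A_LL by blast
    have "a ^ i \<in> LL" by (rule subrng_power[OF aut.Ls]) (use aA A_LL in blast)
    from subrngD(5)[OF aut.Ls 1 aut.L_inverse[OF this]] have "x * a ^ i * inverse (a ^ i) \<in> LL" .
    moreover have "x * a ^ i * inverse (a ^ i) = x" using a0 by simp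
    ultimately show "x \<in> LL" by (simp only:)
  qed
  have tauA': "tau x \<in> A'" if x: "x \<in> A'" for x
  proof -
    obtain i where i: "x * a ^ i \<in> A" using x by (auto simp: A'_def loc_def)
    have aL: "a \<in> LL" using aA A_LL by blast
    have "tau (x * a ^ i) = tau x * a ^ i"
      using aut.tau_mult[OF _ subrng_power[OF aut.Ls aL]] x A'_LL aut.tau_power[OF aL] tau_a by auto
    then show ?thesis using tauA[OF i] unfolding A'_def loc_def by auto
  qed
  have U_LL: "U \<subseteq> LL" using A'_LL by (auto simp: U_def unts_def)
  have tauU: "tau x \<in> U" if "x \<in> U" for x
    using that tauA' aut.tau_inverse U_LL aut.tau_nonzero unfolding U_def unts_field by (metis U_def subsetD unts_field)
  obtain r1 e1 s1 where PB1: "perm_basis U (K - {0}) tau r1 e1 s1"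
    using aut.unit_perm_basis[OF PA(1) aA a0 A_LL tau_image[OF A_LL tauA]] tauU
    unfolding U_def A'_def PA(2) by blast
  obtain r2 e2 s2 where PB2: "perm_basis U (unts B) tau r2 e2 s2"
    using aut.unit_perm_basis[OF PB b1 B_LL tau_image[OF B_LL tauB]] tauU
    unfolding U_def eqA' by blast
  have KU1: "K - {0} \<subseteq> U"
  proof
    fix x assume x: "x \<in> K - {0}"
    then have "x \<in> A'" "inverse x \<in> A'" using KA AA' QF_inverse[of x z0] by blast+
    then show "x \<in> U" using x by (simp add: U_def unts_field)
  qed
  have unBU: "unts B \<subseteq> U" unfolding U_def using BA' by (auto simp: unts_field)
  have mon_unB: "mon f \<in> unts B" if "int p dvd poly f (int g)" for f
  proof -
    have "int p dvd weight (mm f)" using weight_mm[of f] that by (simp add: cong_dvd_iff)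
    then show ?thesis unfolding mon_monz using monz_monV monV_U by metis
  qed
  show ?thesis
  proof (rule principal_from_units[where U = U and tau = tau and n = n and mon = mon and ?C1.0 = "K - {0}" and ?C2.0 = "unts B"])
    show "tau_group U tau n"
    proof
      fix x y assume xy: "x \<in> U" "y \<in> U"
      show "x * y \<in> U" using xy unfolding U_def by (rule unts_mult[OF A's])
      show "tau (x * y) = tau x * tau y" using xy U_LL aut.tau_mult by blast
    next
      fix x assume x: "x \<in> U"
      show "inverse x \<in> U" using x unts_inverse by (auto simp: U_def)
      show "x \<noteq> 0" using x by (auto simp: U_def unts_field)
      show "tau x \<in> U" by (rule tauU[OF x])
      show "(tau ^^ n) x = x" using tau_n x U_LL by blast
    qed (use unts_1[OF A's] in \<open>simp add: U_def\<close>)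
    show "prime p" "n = p - 1" "n > 2" "prt n w" by (use p n2 w in auto)
    show "[int g ^ d = 1] (mod int p) \<longleftrightarrow> n dvd d" for d
      using g[of d] by (metis cong_int_iff of_nat_1 of_nat_power)
    show "perm_basis U (K - {0}) tau r1 e1 s1" by (rule PB1)
    show "perm_basis U (unts B) tau r2 e2 s2" by (rule PB2)
    show "K - {0} \<subseteq> U" by (rule KU1)
    show "1 \<in> K - {0}" using QF_1 by simp
    show "x * y \<in> K - {0}" if "x \<in> K - {0}" "y \<in> K - {0}" for x y using that QF_mult by auto
    show "inverse x \<in> K - {0}" if "x \<in> K - {0}" for x using that QF_inverse by auto
    show "tau x \<in> K - {0}" if "x \<in> K - {0}" for x using that tau_K aut.tau_nonzero K_LL by auto
    show "mon f \<in> U" if "int p dvd poly f (int g)" for f using mon_unB[OF that] unBU by blast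
    show "mon (f + h) = mon f * mon h" for f h by (rule mon_add)
    show "tau (mon f) = mon (pCons 0 f)" for f by (rule mon_X)
    show "(monom 1 n - 1) dvd f" if "mon f \<in> K - {0}" for f using that mon_K by blast
    show "x \<in> unts B \<longleftrightarrow> (\<exists>c\<in>K - {0}. \<exists>f. int p dvd poly f (int g) \<and> x = c * mon f)" for x
    proof
      assume "x \<in> unts B"
      then obtain c e where ce: "c \<in> K - {0}" "x = c * monV e" unfolding unB by blast
      obtain m where "monV e = monz m" "int p dvd weight m" using monV_monz by blast
      then show "\<exists>c\<in>K - {0}. \<exists>f. int p dvd poly f (int g) \<and> x = c * mon f"
        using monz_mon[of m] ce by metis
    next
      assume "\<exists>c\<in>K - {0}. \<exists>f. int p dvd poly f (int g) \<and> x = c * mon f"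
      then show "x \<in> unts B" using unts_mult[OF Bs KU mon_unB] by blast
    qed
  qed
qed

end

section \<open>Invariants of the cyclic shift\<close>

text \<open>Exponents from N on are required to vanish, so that distinct members of M are distinct
  monomials in the first N variables.\<close>

lemma polyf_int_peval:
  fixes f :: "(nat \<Rightarrow> 'b::field_char_0) \<Rightarrow> 'b"
  assumes "f \<in> polyf \<int> N"
  shows "\<exists>M c. finite M \<and> (\<forall>\<alpha>\<in>M. \<forall>i\<ge>N. \<alpha> i = 0) \<and> (\<forall>t. f t = peval M c N t)"
  using assms
proof induction
  case (const c)
  then obtain k where "c = of_int k" by (auto elim: Ints_cases)
  then show ?case by (intro exI[of _ "{\<lambda>_. 0}"] exI[of _ "\<lambda>_. of_int k"]) (auto simp: peval_def)
next
  case (proj i)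
  have "(\<Prod>j<N. t j ^ (if j = i then 1 else 0)) = t i" for t :: "nat \<Rightarrow> 'b"
  proof -
    have "(\<Prod>j<N. t j ^ (if j = i then 1 else 0)) = (\<Prod>j<N. if j = i then t j else 1)" by (intro prod.cong) auto
    then show ?thesis using proj by (simp add: prod.delta)
  qed
  then show ?case using proj
    by (intro exI[of _ "{\<lambda>j. if j = i then 1 else 0}"] exI[of _ "\<lambda>_. 1"]) (auto simp: peval_def)
next
  case (add f g)
  then obtain M c M' c' where M: "finite M" "\<forall>\<alpha>\<in>M. \<forall>i\<ge>N. \<alpha> i = 0" "\<forall>t. f t = peval M c N t"
    "finite M'" "\<forall>\<alpha>\<in>M'. \<forall>i\<ge>N. \<alpha> i = 0" "\<forall>t. g t = peval M' c' N t" by blast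
  have ext: "peval A d N t = (\<Sum>\<alpha>\<in>M \<union> M'. of_rat (if \<alpha> \<in> A then d \<alpha> else 0) * (\<Prod>i<N. t i ^ \<alpha> i))"
    if "A \<subseteq> M \<union> M'" for A d and t :: "nat \<Rightarrow> 'b"
    unfolding peval_def using M(1,4) that by (intro sum.mono_neutral_cong_left) auto
  have "f t + g t = peval (M \<union> M') (\<lambda>\<alpha>. (if \<alpha> \<in> M then c \<alpha> else 0) + (if \<alpha> \<in> M' then c' \<alpha> else 0)) N t" for t
    unfolding M(3)[rule_format] M(6)[rule_format] ext[of M, OF Un_upper1] ext[of M', OF Un_upper2] sum.distrib[symmetric]
    by (subst peval_def) (intro sum.cong refl, simp add: of_rat_add distrib_right)
  then show ?case using M by (intro exI[of _ "M \<union> M'"] exI conjI) auto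
next
  case (mult f g)
  then obtain M c M' c' where M: "finite M" "\<forall>\<alpha>\<in>M. \<forall>i\<ge>N. \<alpha> i = 0" "\<forall>t. f t = peval M c N t"
    "finite M'" "\<forall>\<alpha>\<in>M'. \<forall>i\<ge>N. \<alpha> i = 0" "\<forall>t. g t = peval M' c' N t" by blast
  define h where "h ab = (\<lambda>i. fst ab i + snd ab i)" for ab :: "(nat \<Rightarrow> nat) \<times> (nat \<Rightarrow> nat)"
  \<comment> \<open>Different pairs of exponent vectors may have the same sum, so their coefficients
    are collected.\<close>
  define e where "e \<gamma> = (\<Sum>ab\<in>{ab. ab \<in> M \<times> M' \<and> h ab = \<gamma>}. c (fst ab) * c' (snd ab))" for \<gamma>
  have "f t * g t = peval (h ` (M \<times> M')) e N t" for t
  proof -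
    have "f t * g t = (\<Sum>ab\<in>M \<times> M'. of_rat (c (fst ab) * c' (snd ab)) * (\<Prod>i<N. t i ^ h ab i))"
      unfolding M(3)[rule_format] M(6)[rule_format] peval_def sum_product sum.cartesian_product
      by (intro sum.cong refl) (auto simp: h_def of_rat_mult power_add prod.distrib mult_ac)
    also have "\<dots> = (\<Sum>\<gamma>\<in>h ` (M \<times> M'). \<Sum>ab\<in>{ab. ab \<in> M \<times> M' \<and> h ab = \<gamma>}. of_rat (c (fst ab) * c' (snd ab)) * (\<Prod>i<N. t i ^ h ab i))"
      using M by (intro sum.image_gen) auto
    also have "\<dots> = peval (h ` (M \<times> M')) e N t"
      unfolding peval_def e_def of_rat_sum sum_distrib_right by (intro sum.cong refl) auto
    finally show ?thesis .
  qed
  moreover have "\<forall>\<alpha>\<in>h ` (M \<times> M'). \<forall>i\<ge>N. \<alpha> i = 0" using M by (auto simp: h_def)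
  ultimately show ?case using M by (intro exI[of _ "h ` (M \<times> M')"] exI[of _ e] conjI) auto
qed

lemma to_ac_of_rat: "to_ac (of_rat q :: 'a::field_char_0) = of_rat q"
  by (cases q) (simp add: of_rat_rat)

lemma to_ac_peval: "to_ac (peval M c N t) = peval M c N (\<lambda>i. to_ac (t i))" for t :: "nat \<Rightarrow> 'a::field_char_0"
  by (simp add: peval_def to_ac_sum to_ac_prod to_ac_of_rat)

lemma alg_indep_Q_imp_alg_ind:
  fixes v :: "nat \<Rightarrow> 'a::field_char_0"
  assumes ind: "alg_indep_Q (v ` {..<N})" and inj: "inj_on v {..<N}"
  shows "alg_ind \<int> N (\<lambda>i. to_ac (v i))"
  unfolding alg_ind_def
proof (intro ballI impI allI)
  fix f :: "(nat \<Rightarrow> 'a alg_closure) \<Rightarrow> 'a alg_closure" and t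
  assume f: "f \<in> polyf \<int> N" and 0: "f (\<lambda>i. to_ac (v i)) = 0"
  obtain M c where M: "finite M" "\<And>\<alpha> i. \<alpha> \<in> M \<Longrightarrow> i \<ge> N \<Longrightarrow> \<alpha> i = 0" "\<And>t. f t = peval M c N t"
    using polyf_int_peval[OF f] by blast
  have "to_ac (peval M c N v) = 0" using 0 unfolding M(3) to_ac_peval .
  then have pv: "peval M c N v = 0" by simp
  define F where "F = v ` {..<N}"
  \<comment> \<open>e moves exponents from the indices to the elements v i, as
    \<open>alg_indep_Q\<close> expects; d moves them back, so no two monomials are merged.\<close>
  define e where "e \<alpha> s = (if s \<in> F then \<alpha> (inv_into {..<N} v s) else 0)" for \<alpha> :: "nat \<Rightarrow> nat" and s
  define d where "d \<beta> = (\<lambda>i. if i < N then \<beta> (v i) else 0)" for \<beta> :: "'a \<Rightarrow> nat"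
  have ev: "e \<alpha> (v i) = \<alpha> i" if "i < N" for \<alpha> i using that inj by (simp add: e_def F_def)
  have de: "d (e \<alpha>) = \<alpha>" if "\<alpha> \<in> M" for \<alpha>
  proof
    fix i show "d (e \<alpha>) i = \<alpha> i" using M(2)[OF that, of i] ev[of i \<alpha>] by (simp add: d_def)
  qed
  have "(\<Sum>\<beta>\<in>e ` M. of_rat (c (d \<beta>)) * (\<Prod>s\<in>F. s ^ \<beta> s)) = (\<Sum>\<alpha>\<in>M. of_rat (c (d (e \<alpha>))) * (\<Prod>s\<in>F. s ^ e \<alpha> s))"
    by (rule sum.reindex_cong[of e]) (auto intro!: inj_on_inverseI[of _ d] de)
  also have "\<dots> = peval M c N v"
    unfolding peval_def F_def prod.reindex[OF inj] by (intro sum.cong prod.cong refl arg_cong2[of _ _ _ _ "(*)"]) (auto simp: de ev)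
  finally have 1: "(\<Sum>\<beta>\<in>e ` M. of_rat (c (d \<beta>)) * (\<Prod>s\<in>F. s ^ \<beta> s)) = 0" using pv by simp
  have "\<forall>\<beta>\<in>e ` M. c (d \<beta>) = 0"
    by (rule ind[unfolded alg_indep_Q_def, rule_format, of F "e ` M" "\<lambda>\<beta>. c (d \<beta>)", THEN ballI])
      (use M(1) 1 in \<open>auto simp: F_def e_def\<close>)
  then have "\<forall>\<alpha>\<in>M. c \<alpha> = 0" using de by simp
  then show "f t = 0" by (simp add: M(3) peval_def)
qed

lemma subfield_of_rat:
  fixes R :: "'b::field_char_0 set" assumes R: "is_subfield R" shows "of_rat q \<in> R"
proof -
  note Rs = subfield_subrng[OF R]
  have nat: "of_nat k \<in> R" for k using subrngD(1-3)[OF Rs] by (induction k) auto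
  have int: "of_int k \<in> R" for k
    using nat[of "nat k"] subrng_uminus[OF Rs nat[of "nat (- k)"]] by (cases "k \<ge> 0") auto
  obtain a b where ab: "quotient_of q = (a, b)" by fastforce
  have "of_rat q = of_int a * inverse (of_int b :: 'b)"
    using quotient_of_div[OF ab] by (simp add: of_rat_mult of_rat_inverse divide_inverse)
  moreover have "inverse (of_int b :: 'b) \<in> R" using R int by (auto simp: is_subfield_def)
  ultimately show ?thesis using subrngD(5)[OF Rs int] by metis
qed

lemma subfield_peval:
  fixes R :: "'b::field_char_0 set"
  assumes R: "is_subfield R" "\<And>i. i < N \<Longrightarrow> t i \<in> R" shows "peval M c N t \<in> R"
proof -
  note Rs = subfield_subrng[OF R(1)]
  show ?thesis unfolding peval_def
    by (intro subrng_sum[OF Rs] subrngD(5)[OF Rs] subfield_of_rat[OF R(1)] subrng_prod[OF Rs] subrng_power[OF Rs] R(2)) simp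
qed

lemma subfield_divide: "is_subfield R \<Longrightarrow> a \<in> R \<Longrightarrow> b \<in> R \<Longrightarrow> a / b \<in> R"
  by (simp add: is_subfield_def divide_inverse)

lemma polyf_peval:
  fixes K :: "'b::field_char_0 set"
  assumes K: "is_subfield K" shows "peval M c N \<in> polyf K N"
proof -
  have "0 \<in> K" "1 \<in> K" using K by (auto simp: is_subfield_def)
  then have "(\<lambda>t. \<Sum>\<alpha>\<in>M. of_rat (c \<alpha>) * (\<Prod>i<N. t i ^ \<alpha> i)) \<in> polyf K N"
    by (intro polyf_sum polyf.mult polyf.const polyf_prod polyf_power polyf.proj subfield_of_rat[OF K]) auto
  moreover have "peval M c N = (\<lambda>t :: nat \<Rightarrow> 'b. \<Sum>\<alpha>\<in>M. of_rat (c \<alpha>) * (\<Prod>i<N. t i ^ \<alpha> i))" by (rule ext) (rule peval_def)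
  ultimately show ?thesis by simp
qed

lemma gen_field_subfield: "is_subfield (gen_field S)"
  unfolding gen_field_def is_subfield_def by auto

lemma gen_field_superset: "S \<subseteq> gen_field S"
  by (auto simp: gen_field_def)

lemma gen_field_least: "is_subfield R \<Longrightarrow> S \<subseteq> R \<Longrightarrow> gen_field S \<subseteq> R"
  by (auto simp: gen_field_def)

lemma gen_field_mono: "S \<subseteq> T \<Longrightarrow> gen_field S \<subseteq> gen_field T"
  by (meson gen_field_least gen_field_subfield gen_field_superset order_trans)

lemma gen_field_finitary:
  assumes "x \<in> gen_field S" shows "\<exists>S0\<subseteq>S. finite S0 \<and> x \<in> gen_field S0"
proof -
  define R where "R = {x. \<exists>S0\<subseteq>S. finite S0 \<and> x \<in> gen_field S0}"
  have two: "\<exists>S0\<subseteq>S. finite S0 \<and> x \<in> gen_field S0 \<and> y \<in> gen_field S0" if xy: "x \<in> R" "y \<in> R" for x y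
  proof -
    obtain A B where AB: "A \<subseteq> S" "finite A" "x \<in> gen_field A" "B \<subseteq> S" "finite B" "y \<in> gen_field B"
      using xy unfolding R_def by blast
    have "gen_field A \<subseteq> gen_field (A \<union> B)" "gen_field B \<subseteq> gen_field (A \<union> B)" by (auto intro!: gen_field_mono)
    then show ?thesis using AB by (intro exI[of _ "A \<union> B"]) auto
  qed
  note gf = gen_field_subfield[unfolded is_subfield_def]
  have "is_subfield R" unfolding is_subfield_def
  proof (intro conjI ballI)
    show "0 \<in> R" "1 \<in> R" unfolding R_def using gf[of "{}"] by auto
    fix x assume x: "x \<in> R"
    then show "inverse x \<in> R" unfolding R_def using gf by blast
    fix y assume y: "y \<in> R"
    obtain A where "A \<subseteq> S" "finite A" "x \<in> gen_field A" "y \<in> gen_field A" using two[OF x y] by blast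
    then show "x + y \<in> R" "x - y \<in> R" "x * y \<in> R" unfolding R_def using gf[of A] by blast+
  qed
  moreover have "S \<subseteq> R"
  proof
    fix s assume "s \<in> S"
    then show "s \<in> R" unfolding R_def using gen_field_superset[of "{s}"] by (intro CollectI exI[of _ "{s}"]) auto
  qed
  ultimately have "gen_field S \<subseteq> R" by (rule gen_field_least)
  then show ?thesis using assms by (auto simp: R_def)
qed

lemma gen_field_finitary_set:
  assumes "finite T" "T \<subseteq> gen_field S" shows "\<exists>S0\<subseteq>S. finite S0 \<and> T \<subseteq> gen_field S0"
  using assms
proof (induction T rule: finite_induct)
  case empty
  then show ?case by auto
next
  case (insert x T)
  obtain A where A: "A \<subseteq> S" "finite A" "T \<subseteq> gen_field A" using insert by auto
  obtain B where B: "B \<subseteq> S" "finite B" "x \<in> gen_field B" using gen_field_finitary[of x S] insert by auto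
  have "gen_field A \<subseteq> gen_field (A \<union> B)" "gen_field B \<subseteq> gen_field (A \<union> B)" by (auto intro!: gen_field_mono)
  then show ?case using A B by (intro exI[of _ "A \<union> B"]) auto
qed

lemma to_ac_vimage_subfield: "is_subfield R \<Longrightarrow> is_subfield (to_ac -` R)"
  by (auto simp: is_subfield_def)

context geo
begin

text \<open>The resolvents are eigenvectors of the shift; n * i * h is the exponent - i h modulo
  p.\<close>

lemma Z_shift: "Z i (\<lambda>j. t ((h + j) mod p)) = z0 ^ (n * i * h) * Z i t"
proof -
  have p0: "p > 0" using p1 by simp
  have bij: "bij_betw (\<lambda>j. (h + j) mod p) {..<p} {..<p}"
  proof (rule bij_betw_byWitness[where f' = "\<lambda>j. (j + n * h) mod p"])
    have e: "h + n * h = p * h" using p0 by (metis Suc_diff_1 mult_Suc)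
    have "(((h + j) mod p) + n * h) mod p = j" if "j < p" for j
    proof -
      have "(((h + j) mod p) + n * h) mod p = (j + (h + n * h)) mod p" by (simp add: mod_add_left_eq ac_simps)
      then show ?thesis using that unfolding e by simp
    qed
    then show "\<forall>j\<in>{..<p}. ((h + j) mod p + n * h) mod p = j" by simp
    have "(h + (j + n * h) mod p) mod p = j" if "j < p" for j
    proof -
      have "(h + (j + n * h) mod p) mod p = (j + (h + n * h)) mod p" by (simp add: mod_add_right_eq ac_simps)
      then show ?thesis using that unfolding e by simp
    qed
    then show "\<forall>j\<in>{..<p}. (h + (j + n * h) mod p) mod p = j" by simp
  qed (use p0 in auto)
  have "z0 ^ (n * i * h) * Z i t = z0 ^ (n * i * h) * (\<Sum>j<p. z0 ^ (i * ((h + j) mod p)) * t ((h + j) mod p))"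
    unfolding Z_def by (simp only: sum.reindex_bij_betw[OF bij, of "\<lambda>j. z0 ^ (i * j) * t j"])
  also have "\<dots> = (\<Sum>j<p. z0 ^ (i * j) * t ((h + j) mod p))"
    unfolding sum_distrib_left
  proof (rule sum.cong[OF refl])
    fix j
    have "[n * i * h + i * ((h + j) mod p) = n * i * h + i * (h + j)] (mod p)"
      by (intro cong_add cong_mult) (auto simp: cong_def)
    also have "n * i * h + i * (h + j) = p * (i * h) + i * j"
    proof -
      have "p * (i * h) = Suc n * (i * h)" using p0 by simp
      then show ?thesis by (simp add: algebra_simps)
    qed
    also have "[p * (i * h) + i * j = i * j] (mod p)" by (simp add: cong_def)
    finally have "z0 ^ (n * i * h + i * ((h + j) mod p)) = z0 ^ (i * j)" by (rule prt_power_cong[OF z0])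
    then show "z0 ^ (n * i * h) * (z0 ^ (i * ((h + j) mod p)) * t ((h + j) mod p)) = z0 ^ (i * j) * t ((h + j) mod p)"
      by (simp add: power_add mult.assoc[symmetric])
  qed
  finally show ?thesis by (simp add: Z_def)
qed

lemma T_Z: assumes j: "j < p" shows "T (\<lambda>i. Z i t) j = t j"
proof -
  have "(\<Sum>i<p. z0 ^ (n * i * j) * Z i t) = (\<Sum>i<p. \<Sum>k<p. t k * z0 ^ ((n * j + k) * i))"
    unfolding Z_def sum_distrib_left by (intro sum.cong refl) (simp only: distrib_right distrib_left power_add mult_ac)
  also have "\<dots> = (\<Sum>k<p. t k * (\<Sum>i<p. z0 ^ ((n * j + k) * i)))"
    unfolding sum_distrib_left by (rule sum.swap)
  also have "\<dots> = (\<Sum>k<p. if k = j then t k * of_nat p else 0)"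
  proof (rule sum.cong[OF refl])
    fix k assume k: "k \<in> {..<p}"
    have "p dvd k + n * j \<longleftrightarrow> [j = k] (mod p)"
    proof (rule dvd_iff_cong_of_add_cong)
      have "p * j = Suc n * j" using p1 by simp
      then have e: "k + n * j + j = k + p * j" by simp
      show "[k + n * j + j = k] (mod p)" unfolding e by (simp add: cong_def)
    qed
    then have "p dvd n * j + k \<longleftrightarrow> k = j" using k j by (auto simp: cong_def add.commute)
    then show "t k * (\<Sum>i<p. z0 ^ ((n * j + k) * i)) = (if k = j then t k * of_nat p else 0)" by (simp add: sum_roots)
  qed
  also have "\<dots> = t j * of_nat p" using j by simp
  finally show ?thesis using p1 by (simp add: T_def)
qed

lemma V_Z: "i < p \<Longrightarrow> V i = z i * z 1 ^ ((p - i) mod p)"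
  by (cases "i = 0") (auto simp: V_def)

lemma z1_pow_p: "z 1 ^ p = V 1"
proof -
  have "z 1 ^ p = z 1 * z 1 ^ (p - 1)" using p1 by (metis power_eq_if less_nat_zero_code)
  then show ?thesis using p1 by (simp add: V_def)
qed

lemma FR_V: "i < N \<Longrightarrow> V i \<in> FR K N V"
  using PR_var PR_FR[OF Ks] by blast

lemma FR_K: "K \<subseteq> FR K N V"
  using PR_const PR_FR[OF Ks] by blast

lemma z_quot: assumes "i < p" shows "z i / z 1 ^ i \<in> FR K N V"
proof (cases "i = 0")
  case True
  then have "z i / z 1 ^ i = V 0" by (simp add: V_def)
  then show ?thesis using FR_V pN p1 by simp
next
  case False
  have z1: "z 1 \<noteq> 0" using z_nonzero p1 by simp
  \<comment> \<open>V 1 is z 1 ^ p, written with exponent i + (p - i) so that z 1 ^ (p - i)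
    cancels.\<close>
  have "V i / V 1 = (z i * z 1 ^ (p - i)) / z 1 ^ (i + (p - i))"
    using False assms z1_pow_p by (simp add: V_def)
  also have "\<dots> = z i / z 1 ^ i" using z1 by (simp add: power_add)
  finally have "z i / z 1 ^ i = V i / V 1" by simp
  then show ?thesis using subfield_divide[OF FR_subfield[OF Ks] FR_V FR_V, of i 1] assms pN p1 by simp
qed

text \<open>A shift of the variables multiplies \<open>z i\<close> by \<open>z0 ^ (- i h)\<close>; since \<open>z i / z 1 ^ i\<close> is
  invariant, the values of a polynomial on the shifts of \<open>v\<close> are those of a polynomial over the invariants
  at \<open>z0 ^ (- h) * z 1\<close>.\<close>

lemma shift_poly:
  assumes "F \<in> polyf K p"
  shows "\<exists>P. (\<forall>k. coeff P k \<in> FR K N V) \<and> (\<forall>h. F (\<lambda>j. v ((h + j) mod p)) = poly P (z0 ^ (n * h) * z 1))"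
  using assms
proof induction
  note Fs = subfield_subrng[OF FR_subfield[OF Ks, of N V]]
  {
    case (const c)
    then show ?case using FR_K subrngD(1)[OF Fs] by (intro exI[of _ "[:c:]"]) (auto simp: coeff_pCons split: nat.split)
  next
    case (proj j)
    define P where "P = (\<Sum>i<p. monom (z0 ^ (n * i * j) / of_nat p * (z i / z 1 ^ i)) i)"
    have z1: "z 1 \<noteq> 0" using z_nonzero p1 by simp
    have "coeff P k \<in> FR K N V" for k
    proof -
      have "z0 ^ (n * i * j) / of_nat p \<in> K" for i
        using subfield_divide[OF Kf QF_ipoly[of "monom 1 (n * i * j)" z0] QF_of_int[of "int p" z0]] by simp
      then have "z0 ^ (n * i * j) / of_nat p * (z i / z 1 ^ i) \<in> FR K N V" if "i < p" for i
        using subrngD(5)[OF Fs _ z_quot[OF that]] FR_K by blast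
      then show ?thesis unfolding P_def coeff_sum using subrngD(1)[OF Fs]
        by (intro subrng_sum[OF Fs]) auto
    qed
    moreover have "v ((h + j) mod p) = poly P (z0 ^ (n * h) * z 1)" for h
    proof -
      have "v ((h + j) mod p) = T (\<lambda>i. Z i (\<lambda>j. v ((h + j) mod p))) j" using T_Z[OF proj] by simp
      also have "\<dots> = (\<Sum>i<p. z0 ^ (n * i * j) * (z0 ^ (n * i * h) * z i)) / of_nat p"
        unfolding T_def Z_shift z_def ..
      also have "\<dots> = (\<Sum>i<p. z0 ^ (n * i * j) / of_nat p * (z i / z 1 ^ i) * (z0 ^ (n * h) * z 1) ^ i)"
        unfolding sum_divide_distrib using z1
        by (intro sum.cong refl) (simp add: power_mult_distrib power_mult[symmetric] mult_ac)
      also have "\<dots> = poly P (z0 ^ (n * h) * z 1)"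
        by (simp add: P_def poly_sum poly_monom)
      finally show ?thesis .
    qed
    ultimately show ?case by blast
  next
    case (add f g)
    then obtain P Q where PQ: "\<forall>k. coeff P k \<in> FR K N V" "\<forall>h. f (\<lambda>j. v ((h + j) mod p)) = poly P (z0 ^ (n * h) * z 1)"
      "\<forall>k. coeff Q k \<in> FR K N V" "\<forall>h. g (\<lambda>j. v ((h + j) mod p)) = poly Q (z0 ^ (n * h) * z 1)" by blast
    then show ?case using subrngD(3)[OF Fs] by (intro exI[of _ "P + Q"]) simp
  next
    case (mult f g)
    then obtain P Q where PQ: "\<forall>k. coeff P k \<in> FR K N V" "\<forall>h. f (\<lambda>j. v ((h + j) mod p)) = poly P (z0 ^ (n * h) * z 1)"
      "\<forall>k. coeff Q k \<in> FR K N V" "\<forall>h. g (\<lambda>j. v ((h + j) mod p)) = poly Q (z0 ^ (n * h) * z 1)" by blast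
    then have "coeff (P * Q) k \<in> FR K N V" for k unfolding coeff_mult by (intro subrng_sum[OF Fs] subrngD(5)[OF Fs]) auto
    then show ?case using PQ by (intro exI[of _ "P * Q"]) simp
  }
qed

lemma sum_roots_conj: "(\<Sum>h<p. z0 ^ (n * h * k)) = (if p dvd k then of_nat p else 0)"
proof -
  have "p dvd n * k \<longleftrightarrow> p dvd k"
  proof -
    have "\<not> p dvd n" using p1 by (auto dest: dvd_imp_le)
    then show ?thesis using prime_dvd_mult_iff[OF p, of n k] by blast
  qed
  moreover have "(\<Sum>h<p. z0 ^ (n * h * k)) = (\<Sum>h<p. z0 ^ ((n * k) * h))" by (simp add: mult_ac)
  ultimately show ?thesis by (simp only: sum_roots)
qed

text \<open>Summing over the shifts keeps only the powers z 1 ^ k with p dividing k, and z 1 ^ p is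
  V 1.\<close>

lemma poly_shift_sum:
  assumes P: "\<And>k. coeff P k \<in> FR K N V"
  shows "(\<Sum>h<p. poly P (z0 ^ (n * h) * z 1)) \<in> FR K N V"
proof -
  note Fs = subfield_subrng[OF FR_subfield[OF Ks, of N V]]
  have V_div: "z 1 ^ k = V 1 ^ (k div p)" if "p dvd k" for k
    using that unfolding z1_pow_p[symmetric] power_mult[symmetric] by simp
  have "(\<Sum>h<p. poly P (z0 ^ (n * h) * z 1)) = (\<Sum>h<p. \<Sum>k\<le>degree P. coeff P k * z 1 ^ k * z0 ^ (n * h * k))"
    unfolding poly_altdef by (intro sum.cong refl) (simp only: power_mult_distrib power_mult[symmetric] mult_ac)
  also have "\<dots> = (\<Sum>k\<le>degree P. coeff P k * z 1 ^ k * (\<Sum>h<p. z0 ^ (n * h * k)))"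
    unfolding sum_distrib_left by (rule sum.swap)
  also have "\<dots> = (\<Sum>k\<le>degree P. if p dvd k then coeff P k * V 1 ^ (k div p) * of_nat p else 0)"
    unfolding sum_roots_conj by (intro sum.cong refl) (auto simp: V_div simp del: One_nat_def)
  also have "\<dots> \<in> FR K N V"
  proof (rule subrng_sum[OF Fs])
    fix k
    have "of_nat p \<in> FR K N V" using FR_K QF_of_int[of "int p" z0] by auto
    then show "(if p dvd k then coeff P k * V 1 ^ (k div p) * of_nat p else 0) \<in> FR K N V"
      using P FR_V[of 1] pN p1 subrngD(1)[OF Fs] by (auto intro!: subrngD(5)[OF Fs] subrng_power[OF Fs])
  qed
  finally show ?thesis .
qed

text \<open>Numerator and denominator need not be invariant separately. Multiplying \<Phi>(y_h) = Q
  \<Delta>(y_h) by y_h^k and summing over h gives two elements of K(V) with ratio Q. For some k < p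
  the second is nonzero: otherwise Fourier inversion gives \<Delta>(y_0) = 0.\<close>

lemma invariant_in_FR_V:
  assumes P: "P \<in> polyf K p" and D: "D \<in> polyf K p"
    and Q: "\<And>h. h < p \<Longrightarrow> P (\<lambda>j. v ((h + j) mod p)) / D (\<lambda>j. v ((h + j) mod p)) = Q"
  shows "Q \<in> FR K N V"
proof (cases "Q = 0")
  case True
  then show ?thesis using FR_subfield[OF Ks, of N V] by (simp add: is_subfield_def)
next
  case False
  note Ff = FR_subfield[OF Ks, of N V] and Fs = subfield_subrng[OF FR_subfield[OF Ks, of N V]]
  define y where "y h = z0 ^ (n * h) * z 1" for h
  obtain \<Phi> where \<Phi>: "\<And>k. coeff \<Phi> k \<in> FR K N V" "\<And>h. P (\<lambda>j. v ((h + j) mod p)) = poly \<Phi> (y h)"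
    using shift_poly[OF P] unfolding y_def by blast
  obtain \<Delta> where \<Delta>: "\<And>k. coeff \<Delta> k \<in> FR K N V" "\<And>h. D (\<lambda>j. v ((h + j) mod p)) = poly \<Delta> (y h)"
    using shift_poly[OF D] unfolding y_def by blast
  have \<Delta>0: "poly \<Delta> (y h) \<noteq> 0" if "h < p" for h using Q[OF that] False unfolding \<Delta>(2) by auto
  have eq: "poly \<Phi> (y h) = Q * poly \<Delta> (y h)" if "h < p" for h
    using Q[OF that] \<Delta>0[OF that] unfolding \<Phi>(2) \<Delta>(2) by (auto simp: field_simps)
  have mem: "(\<Sum>h<p. y h ^ k * poly F (y h)) \<in> FR K N V" if "\<And>k. coeff F k \<in> FR K N V" for F k
  proof -
    have "coeff (monom 1 k * F) i \<in> FR K N V" for i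
      using that subrngD(1)[OF Fs] by (auto simp: coeff_monom_mult)
    from poly_shift_sum[OF this] show ?thesis by (simp add: y_def poly_monom)
  qed
  have z1: "z 1 \<noteq> 0" using z_nonzero p1 by simp
  have "\<exists>k<p. (\<Sum>h<p. y h ^ k * poly \<Delta> (y h)) \<noteq> 0"
  proof (rule ccontr)
    assume "\<not> ?thesis"
    then have 0: "(\<Sum>h<p. y h ^ k * poly \<Delta> (y h)) = 0" if "k < p" for k using that by blast
    have "0 = (\<Sum>k<p. inverse (z 1) ^ k * (\<Sum>h<p. y h ^ k * poly \<Delta> (y h)))" using 0 by simp
    also have "\<dots> = (\<Sum>k<p. \<Sum>h<p. z0 ^ (n * k * h) * poly \<Delta> (y h))"
      unfolding sum_distrib_left using z1
      by (intro sum.cong refl) (simp add: y_def power_mult_distrib power_inverse power_mult[symmetric] mult_ac)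
    also have "\<dots> = (\<Sum>h<p. (\<Sum>k<p. z0 ^ (n * k * h)) * poly \<Delta> (y h))"
      unfolding sum_distrib_right by (rule sum.swap)
    also have "\<dots> = (\<Sum>h<p. if h = 0 then of_nat p * poly \<Delta> (y h) else 0)"
      unfolding sum_roots_conj by (intro sum.cong refl) (auto dest: dvd_imp_le)
    also have "\<dots> = of_nat p * poly \<Delta> (y 0)" using p1 by simp
    finally show False using \<Delta>0[of 0] p1 by simp
  qed
  then obtain k where k: "(\<Sum>h<p. y h ^ k * poly \<Delta> (y h)) \<noteq> 0" by blast
  have "(\<Sum>h<p. y h ^ k * poly \<Phi> (y h)) = Q * (\<Sum>h<p. y h ^ k * poly \<Delta> (y h))"
    unfolding sum_distrib_left by (intro sum.cong refl) (simp add: eq mult_ac)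
  then have "Q = (\<Sum>h<p. y h ^ k * poly \<Phi> (y h)) / (\<Sum>h<p. y h ^ k * poly \<Delta> (y h))" using k by (simp add: field_simps)
  then show ?thesis using subfield_divide[OF Ff mem mem, OF \<Phi>(1) \<Delta>(1)] by simp
qed

text \<open>V i has coefficients in K, so it is not yet in the given invariant field. The traces c j
  of z0^j V i have integer coefficients and are invariant under shifts, and V i is a K-linear
  combination of them.\<close>

lemma V_from_invariants:
  assumes i: "i < p"
  shows "\<exists>C. finite C \<and> C \<subseteq> polyf \<int> p \<and> (\<forall>f\<in>C. \<forall>t h. f (\<lambda>j. t ((h + j) mod p)) = f t) \<and>
    (\<forall>R. is_subfield R \<longrightarrow> K \<subseteq> R \<longrightarrow> (\<forall>f\<in>C. f v \<in> R) \<longrightarrow> V i \<in> R)"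
proof -
  \<comment> \<open>The reduction modulo p gives e = 0 at i = 0, where V 0 is z 0 without a power of
    z 1.\<close>
  define e where "e = (p - i) mod p"
  have pe: "p dvd i + e" using i by (cases "i = 0") (auto simp: e_def)
  define G where "G k t = Z (i * k) t * Z k t ^ e" for k t
  define c where "c j t = (\<Sum>k\<in>totatives p. z0 ^ (k * j) * G k t)" for j t
  have "c j \<in> polyf \<int> p" for j
  proof -
    let ?F = "\<lambda>t. t p ^ j * ((\<Sum>l<p. t p ^ (i * l) * t l) * (\<Sum>l<p. t p ^ l * t l) ^ e)"
    have F: "?F \<in> polyf \<int> (Suc p)"
      by (intro polyf.mult polyf_power polyf_sum polyf.proj) auto
    have "(\<lambda>t. \<Sum>k\<in>totatives p. ?F (t(p := z0 ^ k))) = c j"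
      unfolding c_def G_def Z_def by (intro ext sum.cong refl) (simp add: power_mult[symmetric] mult_ac)
    then show ?thesis using polyf_trace[OF z0 F] by simp
  qed
  moreover have "c j (\<lambda>l. t ((h + l) mod p)) = c j t" for j h t
  proof -
    have "G k (\<lambda>l. t ((h + l) mod p)) = G k t" for k
    proof -
      have "z0 ^ (n * (i * k) * h) * (z0 ^ (n * k * h)) ^ e = z0 ^ (n * k * h * (i + e))"
        by (simp only: power_mult[symmetric] power_add[symmetric] distrib_left mult_ac add.commute)
      also have "\<dots> = 1" using pe prt_power_eq_1_iff[OF z0] by simp
      finally have "z0 ^ (n * (i * k) * h) * (z0 ^ (n * k * h)) ^ e = 1" .
      moreover have "G k (\<lambda>l. t ((h + l) mod p)) = (z0 ^ (n * (i * k) * h) * (z0 ^ (n * k * h)) ^ e) * G k t"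
        unfolding G_def Z_shift power_mult_distrib by (simp only: mult_ac)
      ultimately show ?thesis by simp
    qed
    then show ?thesis by (simp add: c_def)
  qed
  moreover have "V i \<in> R" if R: "is_subfield R" "K \<subseteq> R" "\<forall>f\<in>c ` {..<p}. f v \<in> R" for R
  proof -
    note Rs = subfield_subrng[OF R(1)]
    \<comment> \<open>Orthogonality against z0^(- j): among the conjugates G k only G 1, which is V
      i, survives.\<close>
    have "(\<Sum>j<p. z0 ^ (n * j) * c j v) = (\<Sum>j<p. \<Sum>k\<in>totatives p. G k v * z0 ^ ((n + k) * j))"
      unfolding c_def sum_distrib_left by (intro sum.cong refl) (simp only: distrib_right distrib_left power_add mult_ac)
    also have "\<dots> = (\<Sum>k\<in>totatives p. G k v * (\<Sum>j<p. z0 ^ ((n + k) * j)))"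
      unfolding sum_distrib_left by (rule sum.swap)
    also have "\<dots> = (\<Sum>k\<in>totatives p. if k = 1 then G k v * of_nat p else 0)"
    proof (rule sum.cong[OF refl])
      fix k assume "k \<in> totatives p"
      then have k: "0 < k" "k \<le> p" by (auto simp: totatives_def)
      have "p dvd n + k \<longleftrightarrow> k = 1"
      proof
        assume "p dvd n + k"
        then have "p dvd n + k - p" by simp
        moreover have "n + k - p < p" "n + k - p = k - 1" using k p1 by auto
        ultimately show "k = 1" using k by (auto dest: dvd_imp_le)
      qed (use p1 in simp)
      then show "G k v * (\<Sum>j<p. z0 ^ ((n + k) * j)) = (if k = 1 then G k v * of_nat p else 0)" unfolding sum_roots by simp
    qed
    also have "\<dots> = G 1 v * of_nat p" using p1 by (simp add: totatives_def)
    also have "G 1 v = V i" using V_Z[OF i] by (simp add: G_def e_def z_def)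
    finally have "V i = (\<Sum>j<p. z0 ^ (n * j) * c j v) / of_nat p" using p1 by (simp add: field_simps)
    moreover have "(\<Sum>j<p. z0 ^ (n * j) * c j v) \<in> R"
    proof (intro subrng_sum[OF Rs] subrngD(5)[OF Rs])
      fix j assume "j \<in> {..<p}"
      then show "c j v \<in> R" using R(3) by simp
      show "z0 ^ (n * j) \<in> R" using R(2) QF_ipoly[of "monom 1 (n * j)" z0] by auto
    qed
    moreover have "of_nat p \<in> R" using R(2) QF_of_int[of "int p" z0] by auto
    ultimately show ?thesis using subfield_divide[OF R(1)] by simp
  qed
  ultimately show ?thesis by (intro exI[of _ "c ` {..<p}"]) auto
qed

end

section \<open>Stable rationality\<close>

text \<open>A root of 1 + X + ... + X^(p-1) is not 1 in characteristic 0, and its order divides the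
  prime p.\<close>

lemma primitive_root_of_unity_exists:
  assumes "prime p" shows "\<exists>z::'b::{field_char_0,alg_closed_field}. prt p z"
proof -
  have p1: "p > 1" using assms by (rule prime_gt_1_nat)
  define f :: "'b poly" where "f = (\<Sum>i<p. monom 1 i)"
  have "coeff f 1 = 1" using p1 by (simp add: f_def coeff_sum)
  then have "degree f > 0" using le_degree[of f 1] by simp
  then obtain z where z: "poly f z = 0" using alg_closed_imp_poly_has_root by blast
  then have s: "(\<Sum>i<p. z ^ i) = 0" by (simp add: f_def poly_sum poly_monom)
  have z1: "z \<noteq> 1" using s p1 by auto
  have zp: "z ^ p = 1" using s power_diff_1_eq[of z p] by simp
  have "z ^ d \<noteq> 1" if d: "0 < d" "d < p" for d
  proof
    assume zd: "z ^ d = 1"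
    have "coprime d p" using assms d by (metis coprime_commute nat_dvd_not_less prime_imp_coprime)
    then obtain k where "[d * k = 1] (mod p)" using cong_solve_coprime_nat by auto
    then have "(d * k) mod p = 1" using p1 by (simp add: cong_def)
    then have "d * k = p * (d * k div p) + 1" by (metis mult_div_mod_eq)
    then have "z ^ (d * k) = z" using zp by (metis power_add power_mult power_one power_one_right mult_1)
    then show False using zd z1 by (simp add: power_mult)
  qed
  then show ?thesis using zp p1 unfolding prt_def by (intro exI[of _ z]) auto
qed

lemma prt_cis: assumes "n > 0" shows "prt n (cis (2 * pi / real n))"
proof -
  have "cis (2 * pi / real n) ^ d \<noteq> 1" if d: "0 < d" "d < n" for d
  proof
    assume "cis (2 * pi / real n) ^ d = 1"
    then have "cis (real d * (2 * pi / real n)) = 1" by (simp only: Complex.DeMoivre)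
    then have "cos (real d * (2 * pi / real n)) = 1" by (metis cis.sel(1) one_complex.sel(1))
    then obtain k :: int where "real d * (2 * pi / real n) = of_int k * 2 * pi" by (auto simp: cos_one_2pi_int)
    then have k: "real d = of_int k * real n" using assms by (simp add: field_simps)
    then have "int d = k * int n" by (metis of_int_eq_iff of_int_mult of_int_of_nat_eq)
    then have "int n dvd int d" by simp
    then show False using d by (auto dest: dvd_imp_le)
  qed
  moreover have "cis (2 * pi / real n) ^ n = 1" using assms by (simp add: Complex.DeMoivre)
  ultimately show ?thesis using assms by (simp add: prt_def)
qed

lemma invariant_polyf_fixed_field:
  fixes x :: "nat \<Rightarrow> 'a::field_char_0"
  assumes f: "f \<in> polyf \<int> p" and inv: "\<And>t h. f (\<lambda>j. t ((h + j) mod p)) = f t"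
  shows "\<exists>u\<in>fixed_field_Cp p x. f (\<lambda>i. to_ac (x i)) = to_ac u"
proof -
  obtain M c where M: "finite M" "\<And>t. f t = peval M c p t" using polyf_int_peval[OF f] by blast
  have 1: "peval {\<lambda>_. 0} (\<lambda>_. 1) p t = 1" for t :: "nat \<Rightarrow> 'a" by (simp add: peval_def)
  have "peval M c p (\<lambda>g. x ((h + g) mod p)) = peval M c p x" for h
  proof -
    have "to_ac (peval M c p (\<lambda>g. x ((h + g) mod p))) = to_ac (peval M c p x)"
      unfolding to_ac_peval M(2)[symmetric] by (rule inv)
    then show ?thesis by simp
  qed
  then have "peval M c p x \<in> fixed_field_Cp p x"
    unfolding fixed_field_Cp_def using M(1)
    by (intro CollectI exI[of _ M] exI[of _ c] exI[of _ "{\<lambda>_. 0}"] exI[of _ "\<lambda>_. 1"]) (simp add: 1)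
  then show ?thesis unfolding M(2) to_ac_peval[symmetric] by blast
qed

lemma alg_indep_Q_subset: "alg_indep_Q S \<Longrightarrow> T \<subseteq> S \<Longrightarrow> alg_indep_Q T"
  unfolding alg_indep_Q_def by (meson order_trans)

text \<open>The image of the rational field E lies in \<rat>(v) by \<open>E1\<close>, hence is fixed
  by tau, and in K(V) by \<open>E2\<close>; over K it generates every V i. So a finite part of the
  generating set S meets the hypotheses of \<open>geo_principal\<close>.\<close>

theorem stably_rational_imp_principal:
  assumes sr: "QCp_stably_rational_in TYPE('a::field_char_0) p" and pp: "prime p" "p > 3"
    and g: "\<And>d. [g ^ d = 1] (mod p) \<longleftrightarrow> (p - 1) dvd d" and w: "prt (p - 1) (w::complex)"
  shows "\<exists>A. int p dvd poly A (int g) \<and>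
    (\<forall>f. int p dvd poly f (int g) \<longrightarrow> (\<exists>h. ipoly f w = ipoly A w * ipoly h w))"
proof -
  obtain m and x y :: "nat \<Rightarrow> 'a" where inj: "inj_on x {..<p}" "inj_on y {..<m}" and dis: "x ` {..<p} \<inter> y ` {..<m} = {}"
    and ind: "alg_indep_Q (x ` {..<p} \<union> y ` {..<m})"
    and rat: "rational_over_Q (gen_field (fixed_field_Cp p x \<union> y ` {..<m}))"
    using sr unfolding QCp_stably_rational_in_def by blast
  define E where "E = gen_field (fixed_field_Cp p x \<union> y ` {..<m})"
  obtain S where S: "alg_indep_Q S" "gen_field S = E" using rat unfolding rational_over_Q_def E_def by blast
  define N where "N = p + m"
  define u where "u i = (if i < p then x i else y (i - p))" for i
  define v where "v i = to_ac (u i)" for i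
  have img: "u ` {..<N} = x ` {..<p} \<union> y ` {..<m}"
  proof (intro equalityI subsetI)
    fix b assume "b \<in> x ` {..<p} \<union> y ` {..<m}"
    then consider i where "i < p" "b = x i" | i where "i < m" "b = y i" by auto
    then show "b \<in> u ` {..<N}"
    proof cases
      case 1
      then show ?thesis by (intro image_eqI[of _ _ i]) (auto simp: u_def N_def)
    next
      case 2
      then show ?thesis by (intro image_eqI[of _ _ "p + i"]) (auto simp: u_def N_def)
    qed
  qed (auto simp: u_def N_def)
  have "inj_on u {..<N}"
  proof (rule inj_onI)
    fix i j assume ij: "i \<in> {..<N}" "j \<in> {..<N}" "u i = u j"
    show "i = j"
    proof (cases "i < p"; cases "j < p")
      assume "i < p" "j < p"
      then show ?thesis using ij inj(1) by (auto simp: u_def inj_on_def)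
    next
      assume "i < p" "\<not> j < p"
      then show ?thesis using ij dis by (auto simp: u_def N_def)
    next
      assume "\<not> i < p" "j < p"
      then show ?thesis using ij dis by (auto simp: u_def N_def) (metis disjoint_iff imageI lessThan_iff less_diff_conv2 linorder_not_le add.commute)
    next
      assume a: "\<not> i < p" "\<not> j < p"
      then have "i - p = j - p" using ij inj(2) unfolding u_def inj_on_def N_def by simp
      then show ?thesis using a by simp
    qed
  qed
  then have indv: "alg_ind \<int> N v" unfolding v_def using alg_indep_Q_imp_alg_ind[of u N] ind img by simp
  obtain z0 :: "'a alg_closure" where z0: "prt p z0" using primitive_root_of_unity_exists[OF pp(1)] by blast
  interpret geo p N g v z0
    by unfold_locales (use pp z0 indv g in \<open>auto simp: N_def\<close>)
  have vx: "v i = to_ac (x i)" if "i < p" for i using that by (simp add: v_def u_def)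
  have vy: "v (p + i) = to_ac (y i)" for i by (simp add: v_def u_def)
  have E_least: "to_ac ` E \<subseteq> R" if "is_subfield R" "\<And>e. e \<in> fixed_field_Cp p x \<Longrightarrow> to_ac e \<in> R" "\<And>i. i < m \<Longrightarrow> to_ac (y i) \<in> R" for R
  proof -
    have "E \<subseteq> to_ac -` R" unfolding E_def
      by (rule gen_field_least[OF to_ac_vimage_subfield[OF that(1)]]) (use that in auto)
    then show ?thesis by auto
  qed
  have Zs: "subrng (\<int> :: 'a alg_closure set)" by (auto simp: subrng_def)
  have FRv: "v i \<in> FR \<int> N v" if "i < N" for i using PR_var[OF that] PR_FR[OF Zs] by blast
  have E1: "to_ac ` E \<subseteq> FR \<int> N v"
  proof (rule E_least)
    show sf: "is_subfield (FR \<int> N v)" by (rule FR_subfield[OF Zs])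
    show "to_ac (y i) \<in> FR \<int> N v" if "i < m" for i using FRv[of "p + i"] that vy by (simp add: N_def)
    fix e assume "e \<in> fixed_field_Cp p x"
    then obtain M c M' c' where "e = peval M c p x / peval M' c' p x" unfolding fixed_field_Cp_def by blast
    then have e: "to_ac e = peval M c p (\<lambda>i. to_ac (x i)) / peval M' c' p (\<lambda>i. to_ac (x i))" by (simp add: to_ac_peval)
    have "to_ac (x i) \<in> FR \<int> N v" if "i < p" for i using FRv[of i] vx[OF that] that by (simp add: N_def)
    then show "to_ac e \<in> FR \<int> N v" unfolding e by (intro subfield_divide[OF sf] subfield_peval[OF sf])
  qed
  have E2: "to_ac ` E \<subseteq> FR K N V"
  proof (rule E_least)
    show sf: "is_subfield (FR K N V)" by (rule FR_subfield[OF Ks])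
    show "to_ac (y i) \<in> FR K N V" if "i < m" for i
    proof -
      have "V (p + i) = to_ac (y i)" using p1 vy by (simp add: V_def)
      then show ?thesis using FR_V[of "p + i"] that by (simp add: N_def)
    qed
    fix e assume "e \<in> fixed_field_Cp p x"
    then obtain M c M' c' where e: "\<And>h. h < p \<Longrightarrow> peval M c p (\<lambda>g. x ((h + g) mod p)) / peval M' c' p (\<lambda>g. x ((h + g) mod p)) = e"
      unfolding fixed_field_Cp_def by blast
    show "to_ac e \<in> FR K N V"
    proof (rule invariant_in_FR_V[of "peval M c p" "peval M' c' p", OF polyf_peval[OF Kf] polyf_peval[OF Kf]])
      fix h assume h: "h < p"
      have "v ((h + j) mod p) = to_ac (x ((h + j) mod p))" for j using vx[of "(h + j) mod p"] p1 by simp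
      then show "peval M c p (\<lambda>j. v ((h + j) mod p)) / peval M' c' p (\<lambda>j. v ((h + j) mod p)) = to_ac e"
        using arg_cong[OF e[OF h], of to_ac] by (simp add: to_ac_peval)
    qed
  qed
  \<comment> \<open>Over K each V i is generated by finitely many elements of E: the invariants from
    \<open>V_from_invariants\<close> for i < p, a single y otherwise.\<close>
  have "\<exists>T\<subseteq>E. finite T \<and> (\<forall>R. is_subfield R \<longrightarrow> K \<subseteq> R \<longrightarrow> to_ac ` T \<subseteq> R \<longrightarrow> V i \<in> R)" if i: "i < N" for i
  proof (cases "i < p")
    case True
    obtain C where C: "finite C" "C \<subseteq> polyf \<int> p" "\<And>f t h. f \<in> C \<Longrightarrow> f (\<lambda>j. t ((h + j) mod p)) = f t"
      "\<And>R. is_subfield R \<Longrightarrow> K \<subseteq> R \<Longrightarrow> (\<forall>f\<in>C. f v \<in> R) \<Longrightarrow> V i \<in> R"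
      using V_from_invariants[OF True] by blast
    have "\<exists>u\<in>fixed_field_Cp p x. f v = to_ac u" if f: "f \<in> C" for f
    proof -
      have fp: "f \<in> polyf \<int> p" using C(2) f by blast
      have "f v = f (\<lambda>i. to_ac (x i))" by (rule polyf_cong[OF fp vx])
      then show ?thesis using invariant_polyf_fixed_field[OF fp C(3)[OF f], of x] by simp
    qed
    then obtain b where b: "\<And>f. f \<in> C \<Longrightarrow> b f \<in> fixed_field_Cp p x \<and> f v = to_ac (b f)" by metis
    have "b ` C \<subseteq> E" unfolding E_def using b gen_field_superset[of "fixed_field_Cp p x \<union> y ` {..<m}"] by blast
    moreover have "V i \<in> R" if "is_subfield R" "K \<subseteq> R" "to_ac ` b ` C \<subseteq> R" for R
      by (rule C(4)[OF that(1,2)]) (use b that(3) in auto)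
    ultimately show ?thesis using C(1) by (intro exI[of _ "b ` C"]) auto
  next
    case False
    have "V i = to_ac (y (i - p))" using False p1 vy[of "i - p"] by (simp add: V_def)
    moreover have "y (i - p) \<in> E" unfolding E_def
      using False i gen_field_superset[of "fixed_field_Cp p x \<union> y ` {..<m}"] by (auto simp: N_def)
    ultimately show ?thesis by (intro exI[of _ "{y (i - p)}"]) auto
  qed
  then obtain T where T: "\<And>i. i < N \<Longrightarrow> T i \<subseteq> E" "\<And>i. i < N \<Longrightarrow> finite (T i)"
    "\<And>i R. i < N \<Longrightarrow> is_subfield R \<Longrightarrow> K \<subseteq> R \<Longrightarrow> to_ac ` T i \<subseteq> R \<Longrightarrow> V i \<in> R" by metis
  have Tf: "finite (\<Union>i<N. T i)" "(\<Union>i<N. T i) \<subseteq> gen_field S" using T(1,2) S(2) by auto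
  \<comment> \<open>S may be infinite, but the finitely many elements of the T i involve only
    finitely many of its members.\<close>
  obtain S0 where S0: "S0 \<subseteq> S" "finite S0" "(\<Union>i<N. T i) \<subseteq> gen_field S0"
    using gen_field_finitary_set[OF Tf] by (elim exE conjE)
  obtain s where s: "bij_betw s {..<card S0} S0"
    using ex_bij_betw_nat_finite[OF S0(2)] by (auto simp: atLeast0LessThan)
  let ?r = "card S0" and ?s = "\<lambda>i. to_ac (s i)"
  have "alg_ind \<int> ?r ?s"
    using alg_indep_Q_imp_alg_ind[of s ?r] alg_indep_Q_subset[OF S(1) S0(1)] s by (simp add: bij_betw_def)
  then have sK: "alg_ind K ?r ?s" by (rule alg_ind_QF[OF z0 p1])
  have sE: "s i \<in> E" if "i < ?r" for i
    using that s S0(1) S(2) gen_field_superset[of S] by (auto simp: bij_betw_def)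
  show ?thesis
  proof (rule geo_principal[OF sK _ _ _ w])
    show "?s i \<in> FR \<int> N v" "?s i \<in> FR K N V" if "i < ?r" for i using sE[OF that] E1 E2 by auto
    show "n > 2" using pp(2) by simp
    fix i assume i: "i < N"
    show "V i \<in> FR K ?r ?s"
    proof (rule T(3)[OF i])
      show sf: "is_subfield (FR K ?r ?s)" by (rule FR_subfield[OF Ks])
      show "K \<subseteq> FR K ?r ?s" using PR_const PR_FR[OF Ks] by blast
      have "S0 \<subseteq> to_ac -` FR K ?r ?s"
      proof
        fix a assume "a \<in> S0"
        then obtain i where i: "i < ?r" "a = s i" using s by (auto simp: bij_betw_def)
        then show "a \<in> to_ac -` FR K ?r ?s" using PR_var[of i ?r ?s K] PR_FR[OF Ks, of ?r ?s] by auto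
      qed
      then have "gen_field S0 \<subseteq> to_ac -` FR K ?r ?s" by (rule gen_field_least[OF to_ac_vimage_subfield[OF sf]])
      then show "to_ac ` T i \<subseteq> FR K ?r ?s" using S0(3) i by auto
    qed
  qed
qed

theorem theorem1p1:
  fixes p :: nat
  assumes "prime p" and "p < 20000"
    and "p \<notin> R_set \<union> U_set \<union> X_set \<or> (GRH \<and> p \<notin> R_set \<union> U_set)"
  shows "\<not> QCp_stably_rational_in TYPE('a::field_char_0) p"
proof
  assume sr: "QCp_stably_rational_in TYPE('a) p"
  have R: "p \<notin> R_set" using assms(3) by auto
  have "p \<noteq> 0" "p \<noteq> 1" using assms(1) by auto
  moreover have "p \<noteq> 2" "p \<noteq> 3" using R unfolding R_set_def by auto
  \<comment> \<open>This gives n = p - 1 > 2, so that n - 1, the exponent of complex conjugation,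
    differs from 1 modulo n.\<close>
  ultimately have p3: "p > 3" by linarith
  obtain g where g: "residue_primroot p g" using prime_primitive_root_exists[OF prime_gt_1_nat[OF assms(1)] assms(1)] by blast
  have og: "[g ^ d = 1] (mod p) \<longleftrightarrow> (p - 1) dvd d" for d
    using g ord_divides[of g d p] assms(1) by (simp add: residue_primroot_def totient_prime)
  define w where "w = cis (2 * pi / real (p - 1))"
  have w: "prt (p - 1) w" unfolding w_def by (rule prt_cis) (use p3 in simp)
  obtain A where A: "int p dvd poly A (int g)"
    "\<And>f. int p dvd poly f (int g) \<Longrightarrow> \<exists>h. ipoly f w = ipoly A w * ipoly h w"
    using stably_rational_imp_principal[OF sr assms(1) p3 og w] by blast
  \<comment> \<open>p and X - g lie in P and generate the prime ideal at w; dividing them by A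
    yields the cofactors b and c of \<open>principal_prime\<close>.\<close>
  obtain b where b: "ipoly [:int p:] w = ipoly A w * ipoly b w" using A(2)[of "[:int p:]"] by auto
  obtain c where c: "ipoly [:- int g, 1:] w = ipoly A w * ipoly c w" using A(2)[of "[:- int g, 1:]"] by auto
  have "principal_prime p (p - 1) w (int g) A b c"
  proof
    show "[int g ^ d = 1] (mod int p) \<longleftrightarrow> p - 1 dvd d" for d
      using og[of d] by (metis cong_int_iff of_nat_1 of_nat_power)
  qed (use assms(1) p3 w A(1) b c in auto)
  from principal_prime.principal_prime_cases[OF this assms(2)] show False using R by (simp add: R_set_def)
qed

end
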